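(* The Acyclic Matching problem remains NP-hard when the input graph is restricted to planar line graphs with maximum degree $4$.
   Context: All graphs are finite and simple. A graph $G$ is a line graph if $G=L(H)$ for some graph $H$, where $L(H)$ has the edges of $H$ as vertices, two adjacent iff they share an endpoint in $H$. A matching $M$ (set of pairwise nonadjacent edges) is acyclic if the subgraph induced on the endpoints of the edges of $M$ is acyclic. The Acyclic Matching problem: given a graph $G$ and a positive integer $k$, decide whether $G$ has an acyclic matching of size $k$. *)

theory Defs
  imports "HOL-Analysis.Analysis" "HOL-Computational_Algebra.Polynomial"
begin

section \<open>Finite simple graphs\<close>

record 'a ugraph =
  verts :: "'a set"
  edges :: "'a set set"

definition simple_graph :: "'a ugraph \<Rightarrow> bool" where
  "simple_graph G \<longleftrightarrow>
     finite (verts G) \<and> (\<forall>e \<in> edges G. e \<subseteq> verts G \<and> card e = 2)"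

definition degree_of :: "'a ugraph \<Rightarrow> 'a \<Rightarrow> nat" where
  "degree_of G v = card {e \<in> edges G. v \<in> e}"

text \<open>The maximum degree of the graph without vertices is taken to be 0.\<close>

definition max_degree :: "'a ugraph \<Rightarrow> nat" where
  "max_degree G = Max (insert 0 (degree_of G ` verts G))"

definition graph_iso :: "'a ugraph \<Rightarrow> 'b ugraph \<Rightarrow> bool" where
  "graph_iso G H \<longleftrightarrow>
     (\<exists>f. bij_betw f (verts G) (verts H) \<and>
          (\<forall>u \<in> verts G. \<forall>v \<in> verts G. {u, v} \<in> edges G \<longleftrightarrow> {f u, f v} \<in> edges H))"

definition line_graph :: "'a ugraph \<Rightarrow> 'a set ugraph" where
  "line_graph H =
     \<lparr>verts = edges H,
      edges = {{e, f} | e f. e \<in> edges H \<and> f \<in> edges H \<and> e \<noteq> f \<and> e \<inter> f \<noteq> {}}\<rparr>"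

text \<open>Every finite graph has an isomorphic copy with vertices in \<^typ>\<open>nat\<close>, so it is no
  restriction to take the root graph over \<^typ>\<open>nat\<close>.\<close>

definition is_line_graph :: "'a ugraph \<Rightarrow> bool" where
  "is_line_graph G \<longleftrightarrow> (\<exists>H :: nat ugraph. simple_graph H \<and> graph_iso G (line_graph H))"

text \<open>A planar drawing places the vertices at distinct points \<open>pos v\<close> and draws every edge
  \<open>e\<close> as a simple arc \<open>\<gamma> e\<close> joining its two endpoints. Arcs pass through no other vertex
  and meet each other only in vertices.\<close>

definition planar :: "'a ugraph \<Rightarrow> bool" where
  "planar G \<longleftrightarrow>
     (\<exists>(pos :: 'a \<Rightarrow> complex) (\<gamma> :: 'a set \<Rightarrow> real \<Rightarrow> complex).
        inj_on pos (verts G) \<and>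
        (\<forall>e \<in> edges G. arc (\<gamma> e) \<and>
           {pathstart (\<gamma> e), pathfinish (\<gamma> e)} = pos ` e \<and>
           path_image (\<gamma> e) \<inter> pos ` verts G = pos ` e) \<and>
        (\<forall>e \<in> edges G. \<forall>f \<in> edges G. e \<noteq> f \<longrightarrow>
           path_image (\<gamma> e) \<inter> path_image (\<gamma> f) \<subseteq> pos ` verts G))"

definition is_cycle :: "'a ugraph \<Rightarrow> 'a list \<Rightarrow> bool" where
  "is_cycle G vs \<longleftrightarrow>
     length vs \<ge> 3 \<and> distinct vs \<and> set vs \<subseteq> verts G \<and>
     (\<forall>i < length vs. {vs ! i, vs ! (Suc i mod length vs)} \<in> edges G)"

definition acyclic_graph :: "'a ugraph \<Rightarrow> bool" where
  "acyclic_graph G \<longleftrightarrow> (\<nexists>vs. is_cycle G vs)"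

definition induced_subgraph :: "'a ugraph \<Rightarrow> 'a set \<Rightarrow> 'a ugraph" where
  "induced_subgraph G S = \<lparr>verts = verts G \<inter> S, edges = {e \<in> edges G. e \<subseteq> S}\<rparr>"

definition matching :: "'a ugraph \<Rightarrow> 'a set set \<Rightarrow> bool" where
  "matching G M \<longleftrightarrow> M \<subseteq> edges G \<and> (\<forall>e \<in> M. \<forall>f \<in> M. e \<noteq> f \<longrightarrow> e \<inter> f = {})"

definition acyclic_matching :: "'a ugraph \<Rightarrow> 'a set set \<Rightarrow> bool" where
  "acyclic_matching G M \<longleftrightarrow> matching G M \<and> acyclic_graph (induced_subgraph G (\<Union>M))"


section \<open>Turing machines\<close>

text \<open>Nondeterministic multi-tape machines with two-way infinite tapes. States and symbols are
  initial segments of \<^typ>\<open>nat\<close>; state 0 is initial and state 1 is accepting; symbol 0 is the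
  blank, symbols 1 and 2 stand for the input bits \<^const>\<open>False\<close> and \<^const>\<open>True\<close>. A transition
  \<open>(q, rs, q', as)\<close> applies in state \<open>q\<close> when the heads read \<open>rs\<close>; it changes to state \<open>q'\<close>
  and, on each tape, writes a symbol and moves the head by -1, 0 or 1. A machine halts when no
  transition applies.\<close>

record tm =
  num_tapes :: nat
  num_symbols :: nat
  num_states :: nat
  transitions :: "(nat \<times> nat list \<times> nat \<times> (nat \<times> int) list) set"

definition wf_tm :: "tm \<Rightarrow> bool" where
  "wf_tm M \<longleftrightarrow>
     num_tapes M \<ge> 1 \<and> num_symbols M \<ge> 3 \<and> num_states M \<ge> 2 \<and>
     (\<forall>(q, rs, q', as) \<in> transitions M.
        q < num_states M \<and> q' < num_states M \<and>
        length rs = num_tapes M \<and> (\<forall>s \<in> set rs. s < num_symbols M) \<and>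
        length as = num_tapes M \<and>
        (\<forall>(s, d) \<in> set as. s < num_symbols M \<and> d \<in> {-1, 0, 1}))"

definition deterministic :: "tm \<Rightarrow> bool" where
  "deterministic M \<longleftrightarrow>
     (\<forall>q rs q1 as1 q2 as2.
        (q, rs, q1, as1) \<in> transitions M \<longrightarrow> (q, rs, q2, as2) \<in> transitions M \<longrightarrow>
        q1 = q2 \<and> as1 = as2)"

text \<open>A tape consists of its contents and the position of its head.\<close>

type_synonym tape = "(int \<Rightarrow> nat) \<times> int"
type_synonym config = "nat \<times> tape list"

definition read_tape :: "tape \<Rightarrow> nat" where
  "read_tape t = fst t (snd t)"

definition act_tape :: "nat \<times> int \<Rightarrow> tape \<Rightarrow> tape" where
  "act_tape a t = ((fst t)(snd t := fst a), snd t + snd a)"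

definition tm_step :: "tm \<Rightarrow> config \<Rightarrow> config \<Rightarrow> bool" where
  "tm_step M c c' \<longleftrightarrow>
     (\<exists>as. (fst c, map read_tape (snd c), fst c', as) \<in> transitions M \<and>
           snd c' = map2 act_tape as (snd c))"

definition halted :: "tm \<Rightarrow> config \<Rightarrow> bool" where
  "halted M c \<longleftrightarrow> (\<nexists>c'. tm_step M c c')"

definition word_contents :: "bool list \<Rightarrow> int \<Rightarrow> nat" where
  "word_contents w i =
     (if 0 \<le> i \<and> i < int (length w) then (if w ! nat i then 2 else 1) else 0)"

definition init_config :: "tm \<Rightarrow> bool list \<Rightarrow> config" where
  "init_config M w =
     (0, (word_contents w, 0) # replicate (num_tapes M - 1) (word_contents [], 0))"


section \<open>NP-hardness\<close>

definition NP :: "bool list set set" where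
  "NP = {L. \<exists>M (p :: nat poly). wf_tm M \<and>
          (\<forall>w t c. (tm_step M ^^ t) (init_config M w) c \<longrightarrow> t \<le> poly p (length w)) \<and>
          (\<forall>w. w \<in> L \<longleftrightarrow>
             (\<exists>t c. (tm_step M ^^ t) (init_config M w) c \<and> halted M c \<and> fst c = 1))}"

text \<open>The input is given on the first tape, the output is left on the last one.\<close>

definition polytime_computable :: "(bool list \<Rightarrow> bool list) \<Rightarrow> bool" where
  "polytime_computable f \<longleftrightarrow>
     (\<exists>M (p :: nat poly). wf_tm M \<and> deterministic M \<and>
        (\<forall>w. \<exists>t c. t \<le> poly p (length w) \<and> (tm_step M ^^ t) (init_config M w) c \<and>
               halted M c \<and> fst (last (snd c)) = word_contents (f w)))"

text \<open>A decision problem has a set \<open>I\<close> of admissible instances, a predicate \<open>yes\<close> and an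
  encoding \<open>enc\<close> of instances as words. A many-one reduction to it must produce an admissible
  instance on every input, so a restriction of the instances is a restriction on reductions.\<close>

definition NP_hard :: "('i \<Rightarrow> bool list) \<Rightarrow> 'i set \<Rightarrow> ('i \<Rightarrow> bool) \<Rightarrow> bool" where
  "NP_hard enc I yes \<longleftrightarrow>
     (\<forall>L \<in> NP. \<exists>f. polytime_computable f \<and>
        (\<forall>w. \<exists>i \<in> I. f w = enc i \<and> (w \<in> L \<longleftrightarrow> yes i)))"


section \<open>The Acyclic Matching problem\<close>

definition acyclic_matching_instances :: "(nat ugraph \<times> nat) set" where
  "acyclic_matching_instances =
     {(G, k). simple_graph G \<and> (\<exists>n. verts G = {..<n}) \<and> k > 0}"

definition has_acyclic_matching :: "nat ugraph \<times> nat \<Rightarrow> bool" where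
  "has_acyclic_matching = (\<lambda>(G, k). \<exists>M. acyclic_matching G M \<and> card M = k)"

text \<open>Binary digits, least significant first.\<close>

fun binary :: "nat \<Rightarrow> bool list" where
  "binary k = (if k = 0 then [] else odd k # binary (k div 2))"

declare binary.simps [simp del]

text \<open>The number of vertices in unary, a separator, the adjacency matrix row by row, and \<open>k\<close>
  in binary.\<close>

definition encode_instance :: "nat ugraph \<times> nat \<Rightarrow> bool list" where
  "encode_instance = (\<lambda>(G, k). let n = card (verts G) in
     replicate n True @ [False] @
     concat (map (\<lambda>i. map (\<lambda>j. {i, j} \<in> edges G) [0..<n]) [0..<n]) @
     binary k)"

lemma binary_inj: "binary k = binary l \<Longrightarrow> k = l"
proof (induction k arbitrary: l rule: less_induct)
  case (less k)
  show ?case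
  proof (cases "k = 0 \<or> l = 0")
    case True
    then show ?thesis using less.prems by (auto simp: binary.simps split: if_splits)
  next
    case False
    have "odd k = odd l" "binary (k div 2) = binary (l div 2)"
      using less.prems False binary.simps[of k] binary.simps[of l] by simp_all
    moreover have "k div 2 < k" using False by simp
    ultimately have "k div 2 = l div 2" "odd k = odd l" using less.IH by blast+
    then show ?thesis by presburger
  qed
qed

lemma concat_map_eq:
  assumes "concat (map (\<lambda>i. map (f i) ys) xs) = concat (map (\<lambda>i. map (g i) ys) xs)"
    and "i \<in> set xs" and "j \<in> set ys"
  shows "f i j = g i j"
  using assms by (induction xs) auto

lemma inj_on_encode_instance: "inj_on encode_instance acyclic_matching_instances"
proof (rule inj_onI, clarify)
  fix G H :: "nat ugraph" and k l
  assume G: "(G, k) \<in> acyclic_matching_instances" and H: "(H, l) \<in> acyclic_matching_instances"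
    and eq: "encode_instance (G, k) = encode_instance (H, l)"
  obtain n m where n: "verts G = {..<n}" and m: "verts H = {..<m}"
    using G H by (auto simp: acyclic_matching_instances_def)
  have tw: "takeWhile id (replicate a True @ [False] @ xs) = replicate a True" for a xs
    by (induction a) auto
  have "takeWhile id (encode_instance (G, k)) = replicate n True"
    unfolding encode_instance_def by (simp only: Let_def case_prod_conv n card_lessThan tw)
  moreover have "takeWhile id (encode_instance (H, l)) = replicate m True"
    unfolding encode_instance_def by (simp only: Let_def case_prod_conv m card_lessThan tw)
  ultimately have nm: "n = m" using eq by (metis length_replicate)
  define A where "A G = concat (map (\<lambda>i. map (\<lambda>j. {i, j} \<in> edges G) [0..<n]) [0..<n])"
    for G :: "nat ugraph"
  have len: "length (A G) = length (A H)"
    unfolding A_def by (simp add: length_concat comp_def)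
  have "A G @ binary k = A H @ binary l"
    using eq unfolding encode_instance_def A_def by (simp add: n m nm)
  then have "A G = A H" and "binary k = binary l" using len by auto
  have adj: "{i, j} \<in> edges G \<longleftrightarrow> {i, j} \<in> edges H" if "i < n" "j < n" for i j
    using concat_map_eq[OF \<open>A G = A H\<close>[unfolded A_def], of i j] that by simp
  have e: "\<exists>i j. e = {i, j} \<and> i < n \<and> j < n" if "e \<in> edges G \<or> e \<in> edges H" for e
  proof -
    have "card e = 2" "e \<subseteq> {..<n}"
      using that G H n m nm by (auto simp: acyclic_matching_instances_def simple_graph_def)
    then show ?thesis by (auto simp: card_2_iff)
  qed
  have "edges G = edges H" using adj e by blast
  then show "G = H \<and> k = l" using n m nm binary_inj[OF \<open>binary k = binary l\<close>] by simp
qed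

end

theory Submission imports Defs "HOL-Combinatorics.Transposition" begin

text \<open>The graphs of the reduction are line graphs of subcubic subgraphs of the square lattice. An
  acyclic matching of largest conceivable size in such a graph consists of paths of the lattice
  graph that pass through every point of degree at least two and end in every point of degree one,
  and the pairs of edges that are matched along a path are all centred at points of the same
  colour of the lattice. So every path carries a bit. With two gadgets, found by computer search,
  these bits are combined to a crossbar of row and column wires that solves an exact cover
  problem, and the tableau of a nondeterministic machine is an exact cover problem in which every
  constraint concerns only neighbouring tiles.\<close>

section \<open>Runs as exact covers\<close>

text \<open>The size bound comes from degrees: three matched lattice edges at a point would form a
  triangle in the line graph, so the matched edges have degree at most 2 everywhere, and counting
  gives that 4 times the size of the matching is at most the sum of \<open>min 2 (degree)\<close>.
  Demanding equality turns an optimisation problem into rules that are local to a lattice point.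
  Degree at most 3 serves twice: it bounds the degree of the line graph by 4, and it excludes the
  two crossing diagonals that four edges at one point would produce in the drawing. A wire that ends
  in a point of degree one has its bit forced by the colour of that point. A column can therefore
  carry a free bit only if such an end is avoided, which is why columns come in pairs that are
  joined at both ends. Local rules do not see cycles; the direction from solutions to matchings
  therefore carries a potential that decreases along the paths. Finally, a Turing machine has to
  write the graph: the tile data enter its program as finite tables, and whatever depends on the
  input is reached by comparing a few arithmetic expressions.\<close>

type_synonym transition = "nat \<times> nat list \<times> nat \<times> (nat \<times> int) list"

text \<open>A halted machine in the accepting state may idle, so that acceptance becomes the existence of a
  long run.\<close>

definition idling :: "tm \<Rightarrow> transition set" where
  "idling M = {(1, rs, 1, map (\<lambda>s. (s, 0)) rs) | rs. length rs = num_tapes M \<and>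
     (\<forall>s\<in>set rs. s < num_symbols M) \<and> (\<forall>q' as. (1, rs, q', as) \<notin> transitions M)}"

definition patient :: "tm \<Rightarrow> tm" where
  "patient M = M\<lparr>transitions := transitions M \<union> idling M\<rparr>"

definition wf_config :: "tm \<Rightarrow> config \<Rightarrow> bool" where
  "wf_config M c \<longleftrightarrow> length (snd c) = num_tapes M \<and> (\<forall>t\<in>set (snd c). \<forall>i. fst t i < num_symbols M)"

lemma patient_simps [simp]: "num_tapes (patient M) = num_tapes M" "num_symbols (patient M) = num_symbols M"
  "num_states (patient M) = num_states M" "transitions (patient M) = transitions M \<union> idling M"
  by (simp_all add: patient_def)

lemma wf_patient: "wf_tm M \<Longrightarrow> wf_tm (patient M)"
  by (auto simp: wf_tm_def idling_def)

lemma wf_tmD: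
  assumes "wf_tm M" "(q, rs, q', as) \<in> transitions M"
  shows "q < num_states M" "q' < num_states M" "length rs = num_tapes M" "\<forall>s\<in>set rs. s < num_symbols M"
    "length as = num_tapes M" "\<forall>a\<in>set as. fst a < num_symbols M \<and> snd a \<in> {-1, 0, 1}"
  using assms unfolding wf_tm_def case_prod_unfold by fastforce+

lemma wf_config_init: "wf_tm M \<Longrightarrow> wf_config M (init_config M w)"
  by (auto simp: wf_config_def init_config_def word_contents_def wf_tm_def)

lemma wf_config_step:
  assumes M: "wf_tm M" and c: "wf_config M c" and st: "tm_step M c c'"
  shows "wf_config M c'" "\<And>j. j < num_tapes M \<Longrightarrow> \<bar>snd (snd c' ! j) - snd (snd c ! j)\<bar> \<le> 1"
proof -
  obtain as where as: "(fst c, map read_tape (snd c), fst c', as) \<in> transitions M"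
    and c': "snd c' = map2 act_tape as (snd c)" using st by (auto simp: tm_step_def)
  note w = wf_tmD[OF M as]
  have len: "length (snd c) = num_tapes M" using c by (simp add: wf_config_def)
  have nth: "snd c' ! j = act_tape (as ! j) (snd c ! j)" if "j < num_tapes M" for j
    using that len w(5) by (simp add: c')
  have "fst (snd c' ! j) i < num_symbols M" if "j < num_tapes M" for j i
  proof -
    have "as ! j \<in> set as" "snd c ! j \<in> set (snd c)" using that w(5) len by simp_all
    then show ?thesis using w(6) c unfolding nth[OF that] wf_config_def act_tape_def by auto
  qed
  then show "wf_config M c'" unfolding wf_config_def all_set_conv_all_nth using len w(5) by (simp add: c')
  fix j assume j: "j < num_tapes M"
  have "as ! j \<in> set as" using j w(5) by simp
  then have "snd (as ! j) \<in> {-1, 0, 1}" using w(6) by blast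
  then show "\<bar>snd (snd c' ! j) - snd (snd c ! j)\<bar> \<le> 1" unfolding nth[OF j] act_tape_def by auto
qed

lemma run_invariant:
  assumes M: "wf_tm M" and st: "(tm_step M ^^ t) (init_config M w) c"
  shows "wf_config M c \<and> (\<forall>j<num_tapes M. \<bar>snd (snd c ! j)\<bar> \<le> int t)"
  using st
proof (induction t arbitrary: c)
  case 0
  then have c: "c = init_config M w" by simp
  have "snd (snd c ! j) = 0" if "j < num_tapes M" for j
    using that M unfolding c init_config_def by (cases j) (auto simp: wf_tm_def)
  then show ?case using wf_config_init[OF M] c by simp
next
  case (Suc t)
  then obtain d where d: "(tm_step M ^^ t) (init_config M w) d" "tm_step M d c" by auto
  have i: "wf_config M d" "\<And>j. j < num_tapes M \<Longrightarrow> \<bar>snd (snd d ! j)\<bar> \<le> int t" using Suc.IH[OF d(1)] by blast+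
  have "\<bar>snd (snd c ! j)\<bar> \<le> int (Suc t)" if "j < num_tapes M" for j
    using i(2)[OF that] wf_config_step(2)[OF M i(1) d(2) that] by linarith
  then show ?case using wf_config_step(1)[OF M i(1) d(2)] by blast
qed

lemma step_patient: "tm_step M c c' \<Longrightarrow> tm_step (patient M) c c'"
  by (auto simp: tm_step_def)

lemma step_patientD:
  assumes "tm_step (patient M) c c'" "\<not> tm_step M c c'"
  shows "halted M c \<and> fst c = 1"
proof -
  obtain as where as: "(fst c, map read_tape (snd c), fst c', as) \<in> transitions M \<union> idling M"
    "snd c' = map2 act_tape as (snd c)" using assms(1) by (auto simp: tm_step_def)
  then have "(fst c, map read_tape (snd c), fst c', as) \<in> idling M" using assms(2) by (auto simp: tm_step_def)
  then show ?thesis by (auto simp: idling_def halted_def tm_step_def)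
qed

lemma idle_step:
  assumes "wf_config M c" "halted M c" "fst c = 1"
  shows "tm_step (patient M) c c"
proof -
  let ?rs = "map read_tape (snd c)"
  have len: "length ?rs = num_tapes M" using assms(1) by (simp add: wf_config_def)
  have "\<forall>s\<in>set ?rs. s < num_symbols M" using assms(1) by (auto simp: wf_config_def read_tape_def)
  moreover have "(1, ?rs, q', as) \<notin> transitions M" for q' as
  proof
    assume "(1, ?rs, q', as) \<in> transitions M"
    then have "tm_step M c (q', map2 act_tape as (snd c))" using assms(3) by (auto simp: tm_step_def)
    then show False using assms(2) by (auto simp: halted_def)
  qed
  ultimately have "(1, ?rs, 1, map (\<lambda>s. (s, 0)) ?rs) \<in> idling M" using len unfolding idling_def by blast
  moreover have "map2 act_tape (map (\<lambda>s. (s, 0)) ?rs) (snd c) = snd c"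
    by (rule nth_equalityI) (auto simp: act_tape_def read_tape_def)
  ultimately show ?thesis unfolding tm_step_def using assms(3) by (intro exI[of _ "map (\<lambda>s. (s, 0)) ?rs"]) simp
qed

text \<open>All runs of \<open>M\<close> stop before time \<open>U\<close>, so a run of length
  \<open>U\<close> of the patient machine contains an idle step, and the first such step starts in a
  halted accepting configuration. The second claim continues the run forever, because the tableau
  will have more than \<open>U\<close> rows; idling moves no head, so the heads stay within distance
  \<open>U\<close>.\<close>

lemma accepts_iff_long_run:
  assumes M: "wf_tm M" and bound: "\<And>t c. (tm_step M ^^ t) (init_config M w) c \<Longrightarrow> t < U"
  shows "(\<exists>t c. (tm_step M ^^ t) (init_config M w) c \<and> halted M c \<and> fst c = 1) \<longleftrightarrow>
    (\<exists>c. (tm_step (patient M) ^^ U) (init_config M w) c)" (is "?acc \<longleftrightarrow> ?run")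
    and "(\<exists>t c. (tm_step M ^^ t) (init_config M w) c \<and> halted M c \<and> fst c = 1) \<Longrightarrow>
      \<exists>f. f 0 = init_config M w \<and> (\<forall>i. tm_step (patient M) (f i) (f (Suc i))) \<and>
        (\<forall>i. wf_config M (f i)) \<and> (\<forall>i. \<forall>j<num_tapes M. \<bar>snd (snd (f i) ! j)\<bar> \<le> int U)"
proof -
  show inf: "\<exists>f. f 0 = init_config M w \<and> (\<forall>i. tm_step (patient M) (f i) (f (Suc i))) \<and>
        (\<forall>i. wf_config M (f i)) \<and> (\<forall>i. \<forall>j<num_tapes M. \<bar>snd (snd (f i) ! j)\<bar> \<le> int U)" if acc: ?acc
  proof -
    from acc obtain t c where c: "(tm_step M ^^ t) (init_config M w) c" "halted M c" "fst c = 1" by blast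
    obtain g where g: "g 0 = init_config M w" "g t = c" "\<And>i. i < t \<Longrightarrow> tm_step M (g i) (g (Suc i))"
      using c(1) unfolding relpowp_fun_conv by blast
    define f where "f i = (if i \<le> t then g i else c)" for i
    have steps: "(tm_step M ^^ i) (init_config M w) (g i)" if "i \<le> t" for i
      unfolding relpowp_fun_conv using g that by (intro exI[of _ g]) simp
    have inv: "wf_config M (f i) \<and> (\<forall>j<num_tapes M. \<bar>snd (snd (f i) ! j)\<bar> \<le> int t)" for i
    proof (cases "i \<le> t")
      case True
      then show ?thesis using run_invariant[OF M steps[OF True]] by (fastforce simp: f_def)
    next
      case False
      then show ?thesis using run_invariant[OF M c(1)] by (simp add: f_def)
    qed
    have cw: "wf_config M c" using run_invariant[OF M c(1)] by blast
    have "tm_step (patient M) (f i) (f (Suc i))" for i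
    proof (cases "i < t")
      case True
      then show ?thesis using g(3)[OF True] by (simp add: f_def step_patient)
    next
      case False
      then have "f i = c" "f (Suc i) = c" using g(2) by (auto simp: f_def)
      then show ?thesis using idle_step[OF cw c(2,3)] by simp
    qed
    moreover have "t < U" using bound[OF c(1)] .
    then have "\<bar>snd (snd (f i) ! j)\<bar> \<le> int U" if "j < num_tapes M" for i j
      using inv[of i] that by fastforce
    moreover have "f 0 = init_config M w" using g by (simp add: f_def)
    ultimately show ?thesis using inv by blast
  qed
  show "?acc \<longleftrightarrow> ?run"
  proof
    assume ?acc
    from inf[OF this] obtain f where f: "f 0 = init_config M w" "\<And>i. tm_step (patient M) (f i) (f (Suc i))" by blast
    have "(tm_step (patient M) ^^ U) (init_config M w) (f U)"
      unfolding relpowp_fun_conv using f by (intro exI[of _ f]) simp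
    then show ?run by blast
  next
    assume ?run
    then obtain f where f: "f 0 = init_config M w" "\<And>i. i < U \<Longrightarrow> tm_step (patient M) (f i) (f (Suc i))"
      unfolding relpowp_fun_conv by blast
    have "\<exists>i<U. \<not> tm_step M (f i) (f (Suc i))"
    proof (rule ccontr)
      assume "\<not> ?thesis"
      then have "(tm_step M ^^ U) (init_config M w) (f U)"
        unfolding relpowp_fun_conv using f by (intro exI[of _ f]) blast
      then show False using bound by blast
    qed
    define i where "i = (LEAST i. i < U \<and> \<not> tm_step M (f i) (f (Suc i)))"
    have i: "i < U" "\<not> tm_step M (f i) (f (Suc i))" and
      least: "\<And>j. j < i \<Longrightarrow> j < U \<Longrightarrow> tm_step M (f j) (f (Suc j))"
      using LeastI_ex[OF \<open>\<exists>i<U. \<not> tm_step M (f i) (f (Suc i))\<close>] not_less_Least unfolding i_def by blast+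
    have "(tm_step M ^^ i) (init_config M w) (f i)"
      unfolding relpowp_fun_conv using f(1) least i(1) by (intro exI[of _ f]) auto
    then show ?acc using step_patientD[OF f(2)[OF i(1)] i(2)] by blast
  qed
qed

text \<open>A tile describes a cell of a configuration (the symbol and the presence of the head, for all
  tapes), the transition applied to the configuration, the heads in the cells to the left and to the
  right, and whether the cell is the first or the last one.\<close>

type_synonym tile = "transition \<times> (nat \<times> bool) list \<times> bool list \<times> bool list \<times> bool \<times> bool"

text \<open>The colour \<open>None\<close> at both ends makes the last cell of any row fit the first
  cell of any other row. The cells can then be numbered consecutively through all rows, with a
  uniform constraint between number \<open>b\<close> and number \<open>b + 1\<close>.\<close>

fun left_colour :: "tile \<Rightarrow> (transition \<times> bool list \<times> bool list) option" where
  "left_colour (\<tau>, cs, lh, rh, b, e) = (if b then None else Some (\<tau>, lh, map snd cs))"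
fun right_colour :: "tile \<Rightarrow> (transition \<times> bool list \<times> bool list) option" where
  "right_colour (\<tau>, cs, lh, rh, b, e) = (if e then None else Some (\<tau>, map snd cs, rh))"
fun top_colour :: "tile \<Rightarrow> nat \<times> (nat \<times> bool) list \<times> bool \<times> bool" where
  "top_colour ((q, rs, q', as), cs, lh, rh, b, e) = (q, cs, b, e)"
fun bottom_colour :: "tile \<Rightarrow> nat \<times> (nat \<times> bool) list \<times> bool \<times> bool" where
  "bottom_colour ((q, rs, q', as), cs, lh, rh, b, e) = (q', map (\<lambda>j.
     (if snd (cs ! j) then fst (as ! j) else fst (cs ! j),
      snd (cs ! j) \<and> snd (as ! j) = 0 \<or> lh ! j \<and> snd (as ! j) = 1 \<or> rh ! j \<and> snd (as ! j) = -1))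
     [0..<length cs], b, e)"

text \<open>The symbols read are checked only where a head is present. As the horizontal colours
  spread one transition over the whole row and every head stands in some column, this amounts to
  applicability of the transition.\<close>

definition tiles :: "tm \<Rightarrow> tile set" where
  "tiles M = {((q, rs, q', as), cs, lh, rh, b, e) | q rs q' as cs lh rh b e.
     (q, rs, q', as) \<in> transitions (patient M) \<and> length cs = num_tapes M \<and> length lh = num_tapes M \<and>
     length rh = num_tapes M \<and> (\<forall>c\<in>set cs. fst c < num_symbols M) \<and>
     (\<forall>j<num_tapes M. snd (cs ! j) \<longrightarrow> fst (cs ! j) = rs ! j) \<and>
     (b \<longrightarrow> lh = replicate (num_tapes M) False) \<and> (e \<longrightarrow> rh = replicate (num_tapes M) False)}"

lemma finite_transitions: "wf_tm M \<Longrightarrow> finite (transitions M)"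
proof -
  assume M: "wf_tm M"
  let ?A = "{as. set as \<subseteq> {..<num_symbols M} \<times> {-1, 0, 1 :: int} \<and> length as = num_tapes M}"
  let ?R = "{rs. set rs \<subseteq> {..<num_symbols M} \<and> length rs = num_tapes M}"
  have "transitions M \<subseteq> {..<num_states M} \<times> ?R \<times> {..<num_states M} \<times> ?A"
  proof (clarify, intro conjI SigmaI)
    fix q rs q' as assume t: "(q, rs, q', as) \<in> transitions M"
    note w = wf_tmD[OF M t]
    show "q \<in> {..<num_states M}" "q' \<in> {..<num_states M}" using w by auto
    show "rs \<in> ?R" using w by auto
    show "as \<in> ?A" using w(5,6) by fastforce
  qed
  moreover have "finite ?A" "finite ?R" by (simp_all add: finite_lists_length_eq)
  ultimately show ?thesis by (meson finite_SigmaI finite_lessThan finite_subset)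
qed

lemma finite_tiles: "wf_tm M \<Longrightarrow> finite (tiles M)"
proof -
  assume M: "wf_tm M"
  let ?C = "{cs. set cs \<subseteq> {..<num_symbols M} \<times> (UNIV :: bool set) \<and> length cs = num_tapes M}"
  let ?B = "{bs. set bs \<subseteq> (UNIV :: bool set) \<and> length bs = num_tapes M}"
  have "tiles M \<subseteq> transitions (patient M) \<times> ?C \<times> ?B \<times> ?B \<times> UNIV \<times> UNIV"
    by (auto simp: tiles_def)
  moreover have "finite ?C" by (rule finite_lists_length_eq) simp
  moreover have "finite ?B" by (rule finite_lists_length_eq) simp
  moreover have "finite (transitions (patient M))" by (rule finite_transitions[OF wf_patient[OF M]])
  ultimately show ?thesis by (meson finite_SigmaI finite finite_subset)
qed

text \<open>The configuration \<open>c\<close> as a row of cells, where column \<open>s\<close> shows position \<open>s - U\<close>.\<close>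

definition cell_of :: "tm \<Rightarrow> nat \<Rightarrow> config \<Rightarrow> nat \<Rightarrow> (nat \<times> bool) list" where
  "cell_of M U c s = map (\<lambda>j. (fst (snd c ! j) (int s - int U), snd (snd c ! j) = int s - int U)) [0..<num_tapes M]"

definition top_of :: "tm \<Rightarrow> nat \<Rightarrow> config \<Rightarrow> nat \<Rightarrow> nat \<times> (nat \<times> bool) list \<times> bool \<times> bool" where
  "top_of M U c s = (fst c, cell_of M U c s, s = 0, s = 2 * U)"

lemma init_config_patient [simp]: "init_config (patient M) w = init_config M w"
  by (simp add: init_config_def)

lemma wf_config_patient [simp]: "wf_config (patient M) c = wf_config M c"
  by (simp add: wf_config_def)

text \<open>One computation of the successor configuration for both directions of the correspondence
  between runs and tilings. A head that moves out of the strip shows up in no column, on both sides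
  of the equation.\<close>

lemma bottom_cell:
  assumes M: "wf_tm M" and tr: "(q, rs, q', as) \<in> transitions (patient M)" and c: "wf_config M c"
    and bd: "\<And>j. j < num_tapes M \<Longrightarrow> \<bar>snd (snd c ! j)\<bar> \<le> int U" and s: "s \<le> 2 * U"
    and lh: "\<And>j. j < num_tapes M \<Longrightarrow> lh ! j \<longleftrightarrow> s \<noteq> 0 \<and> snd (snd c ! j) = int s - 1 - int U"
    and rh: "\<And>j. j < num_tapes M \<Longrightarrow> rh ! j \<longleftrightarrow> s \<noteq> 2 * U \<and> snd (snd c ! j) = int s + 1 - int U"
  shows "bottom_colour ((q, rs, q', as), cell_of M U c s, lh, rh, b, e) =
    (q', cell_of M U (q', map2 act_tape as (snd c)) s, b, e)"
proof -
  note w = wf_tmD[OF wf_patient[OF M] tr]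
  have len: "length (snd c) = num_tapes M" "length as = num_tapes M"
    using c w(5) by (simp_all add: wf_config_def)
  have cell: "cell_of M U c s ! j = (fst (snd c ! j) (int s - int U), snd (snd c ! j) = int s - int U)"
    if "j < num_tapes M" for j using that by (simp add: cell_of_def)
  have eq: "(if snd (cell_of M U c s ! j) then fst (as ! j) else fst (cell_of M U c s ! j),
      snd (cell_of M U c s ! j) \<and> snd (as ! j) = 0 \<or> lh ! j \<and> snd (as ! j) = 1 \<or> rh ! j \<and> snd (as ! j) = -1) =
      cell_of M U (q', map2 act_tape as (snd c)) s ! j" if j: "j < num_tapes M" for j
  proof -
    have "as ! j \<in> set as" using j len by simp
    then have d: "snd (as ! j) = -1 \<or> snd (as ! j) = 0 \<or> snd (as ! j) = 1" using w(6) by blast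
    have nth: "cell_of M U (q', map2 act_tape as (snd c)) s ! j =
        (((fst (snd c ! j))(snd (snd c ! j) := fst (as ! j))) (int s - int U),
         snd (snd c ! j) + snd (as ! j) = int s - int U)"
      using j len by (simp add: cell_of_def act_tape_def)
    have h: "(snd (snd c ! j) = int s - int U \<and> snd (as ! j) = 0 \<or> lh ! j \<and> snd (as ! j) = 1 \<or>
        rh ! j \<and> snd (as ! j) = -1) \<longleftrightarrow> snd (snd c ! j) + snd (as ! j) = int s - int U"
      unfolding lh[OF j] rh[OF j] using d bd[OF j] s by auto
    show ?thesis unfolding nth cell[OF j] fst_conv snd_conv h by simp
  qed
  have lc: "length (cell_of M U c s) = num_tapes M" "length (cell_of M U (q', map2 act_tape as (snd c)) s) = num_tapes M"
    by (simp_all add: cell_of_def)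
  have "map (\<lambda>j. (if snd (cell_of M U c s ! j) then fst (as ! j) else fst (cell_of M U c s ! j),
      snd (cell_of M U c s ! j) \<and> snd (as ! j) = 0 \<or> lh ! j \<and> snd (as ! j) = 1 \<or> rh ! j \<and> snd (as ! j) = -1))
      [0..<length (cell_of M U c s)] = cell_of M U (q', map2 act_tape as (snd c)) s"
    by (rule nth_equalityI) (simp_all only: lc length_map length_upt diff_zero nth_map nth_upt add_0 eq)
  then show ?thesis unfolding bottom_colour.simps by simp
qed

section \<open>Correspondence between tilings and runs\<close>

lemma run_of_tiling:
  assumes M: "wf_tm M"
    and tile: "\<And>t s. t \<le> U \<Longrightarrow> s \<le> 2 * U \<Longrightarrow> g t s \<in> tiles M"
    and init: "\<And>s. s \<le> 2 * U \<Longrightarrow> top_colour (g 0 s) = top_of M U (init_config M w) s"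
    and horiz: "\<And>t s. t \<le> U \<Longrightarrow> s < 2 * U \<Longrightarrow> right_colour (g t s) = left_colour (g t (Suc s))"
    and vert: "\<And>t s. t < U \<Longrightarrow> s \<le> 2 * U \<Longrightarrow> top_colour (g (Suc t) s) = bottom_colour (g t s)"
  shows "\<exists>c. (tm_step (patient M) ^^ U) (init_config M w) c"
proof -
  have "\<exists>c. (tm_step (patient M) ^^ t) (init_config M w) c \<and> (\<forall>s\<le>2 * U. top_colour (g t s) = top_of M U c s)"
    if "t \<le> U" for t
    using that
  proof (induction t)
    case 0
    then show ?case using init by auto
  next
    case (Suc t)
    then obtain c where c: "(tm_step (patient M) ^^ t) (init_config M w) c"
      and top: "\<And>s. s \<le> 2 * U \<Longrightarrow> top_colour (g t s) = top_of M U c s" by auto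
    have t: "t < U" using Suc.prems by simp
    have inv: "wf_config M c" "\<And>j. j < num_tapes M \<Longrightarrow> \<bar>snd (snd c ! j)\<bar> \<le> int t"
      using run_invariant[OF wf_patient[OF M], of t w c] c by auto
    have bd: "\<bar>snd (snd c ! j)\<bar> \<le> int U" if "j < num_tapes M" for j using inv(2)[OF that] t by linarith
    define \<tau> lh rh where "\<tau> s = fst (g t s)" and "lh s = fst (snd (snd (g t s)))"
      and "rh s = fst (snd (snd (snd (g t s))))" for s
    have dec: "g t s = (\<tau> s, cell_of M U c s, lh s, rh s, s = 0, s = 2 * U)" if s: "s \<le> 2 * U" for s
    proof -
      obtain q rs q' as cs l r b e where g: "g t s = ((q, rs, q', as), cs, l, r, b, e)"
        by (metis prod.exhaust)
      then show ?thesis using top[OF s] by (simp add: \<tau>_def lh_def rh_def top_of_def)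
    qed
    have hz: "\<tau> (Suc s) = \<tau> s" "lh (Suc s) = map snd (cell_of M U c s)" "rh s = map snd (cell_of M U c (Suc s))"
      if "s < 2 * U" for s
      using horiz[OF _ that, of t] t that dec[of s] dec[of "Suc s"] by auto
    \<comment> \<open>The horizontal colours contain the transition, so a row uses a single
      one.\<close>
    have tau: "\<tau> s = \<tau> 0" if "s \<le> 2 * U" for s
      using that
    proof (induction s)
      case (Suc s)
      then show ?case using hz(1)[of s] by simp
    qed simp
    obtain q rs q' as where tau0: "\<tau> 0 = (q, rs, q', as)" by (metis prod.exhaust)
    have dec': "g t s = ((q, rs, q', as), cell_of M U c s, lh s, rh s, s = 0, s = 2 * U)" if "s \<le> 2 * U" for s
      using dec[OF that] tau[OF that] tau0 by simp
    have valid: "(q, rs, q', as) \<in> transitions (patient M)"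
        "\<And>j. j < num_tapes M \<Longrightarrow> snd (cell_of M U c s ! j) \<Longrightarrow> fst (cell_of M U c s ! j) = rs ! j"
        "s = 0 \<Longrightarrow> lh s = replicate (num_tapes M) False" "s = 2 * U \<Longrightarrow> rh s = replicate (num_tapes M) False"
      if "s \<le> 2 * U" for s
      using tile[of t s] t that unfolding dec'[OF that] tiles_def by auto
    have tr: "(q, rs, q', as) \<in> transitions (patient M)" using valid(1)[of 0] by simp
    note wr = wf_tmD[OF wf_patient[OF M] tr]
    have lenc: "length (snd c) = num_tapes M" using inv(1) by (simp add: wf_config_def)
    have "rs = map read_tape (snd c)"
    proof (rule nth_equalityI)
      show "length rs = length (map read_tape (snd c))" using wr(3) lenc by simp
      fix j assume "j < length rs"
      then have j: "j < num_tapes M" using wr(3) by simp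
      \<comment> \<open>The column in which the head of tape \<open>j\<close> is visible; it exists
        since the head has moved at most \<open>t\<close> steps and \<open>t < U\<close>.\<close>
      define s where "s = nat (snd (snd c ! j) + int U)"
      have s: "s \<le> 2 * U" "int s - int U = snd (snd c ! j)" using bd[OF j] by (auto simp: s_def)
      have "fst (cell_of M U c s ! j) = rs ! j"
        using valid(2)[OF s(1) j] j s(2) by (simp add: cell_of_def)
      then show "rs ! j = map read_tape (snd c) ! j" using j lenc s(2) by (simp add: cell_of_def read_tape_def)
    qed
    moreover have "fst c = q" using top[of 0] unfolding dec'[of 0, simplified] by (simp add: top_of_def)
    ultimately have step: "tm_step (patient M) c (q', map2 act_tape as (snd c))"
      using tr by (auto simp: tm_step_def)
    have "top_colour (g (Suc t) s) = top_of M U (q', map2 act_tape as (snd c)) s" if s: "s \<le> 2 * U" for s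
    proof -
      have lh': "lh s ! j \<longleftrightarrow> s \<noteq> 0 \<and> snd (snd c ! j) = int s - 1 - int U" if j: "j < num_tapes M" for j
      proof (cases s)
        case 0
        then show ?thesis using valid(3)[OF s] j by simp
      next
        case (Suc s')
        then show ?thesis using hz(2)[of s'] s j by (simp add: cell_of_def)
      qed
      have rh': "rh s ! j \<longleftrightarrow> s \<noteq> 2 * U \<and> snd (snd c ! j) = int s + 1 - int U" if j: "j < num_tapes M" for j
      proof (cases "s = 2 * U")
        case True
        then show ?thesis using valid(4)[OF s] j by simp
      next
        case False
        then have "s < 2 * U" using s by simp
        then show ?thesis using hz(3)[of s] j False by (simp add: cell_of_def algebra_simps)
      qed
      show ?thesis unfolding vert[OF t s] dec'[OF s] top_of_def
        using bottom_cell[OF M tr inv(1) bd s lh' rh'] by simp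
    qed
    then show ?case using relpowp_Suc_I[OF c step] by blast
  qed
  then show ?thesis by blast
qed

text \<open>Tiles are given for all times \<open>t\<close>, not only for \<open>t \<le> U\<close>:
  the exact cover problem constrains a square of \<open>2 * U + 1\<close> rows and mentions one
  further row below it. The last conjunct is the match between the end of one row and the start of
  another.\<close>

lemma tiling_of_run:
  assumes M: "wf_tm M" and steps: "\<And>i. tm_step (patient M) (f i) (f (Suc i))"
    and wf: "\<And>i. wf_config M (f i)" and bd: "\<And>i j. j < num_tapes M \<Longrightarrow> \<bar>snd (snd (f i) ! j)\<bar> \<le> int U"
  shows "\<exists>g. (\<forall>t. \<forall>s\<le>2 * U. g t s \<in> tiles M \<and> top_colour (g t s) = top_of M U (f t) s \<and>
      bottom_colour (g t s) = top_of M U (f (Suc t)) s) \<and>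
    (\<forall>t s. s < 2 * U \<longrightarrow> right_colour (g t s) = left_colour (g t (Suc s))) \<and>
    (\<forall>t t'. right_colour (g t (2 * U)) = left_colour (g t' 0))"
proof -
  have "\<forall>i. \<exists>as. (fst (f i), map read_tape (snd (f i)), fst (f (Suc i)), as) \<in> transitions (patient M) \<and>
      snd (f (Suc i)) = map2 act_tape as (snd (f i))" using steps unfolding tm_step_def by blast
  then obtain as where as: "\<And>i. (fst (f i), map read_tape (snd (f i)), fst (f (Suc i)), as i) \<in> transitions (patient M)"
    "\<And>i. snd (f (Suc i)) = map2 act_tape (as i) (snd (f i))" by metis
  define lh where "lh t s = map (\<lambda>j. s \<noteq> 0 \<and> snd (snd (f t) ! j) = int s - 1 - int U) [0..<num_tapes M]" for t s
  define rh where "rh t s = map (\<lambda>j. s \<noteq> 2 * U \<and> snd (snd (f t) ! j) = int s + 1 - int U) [0..<num_tapes M]" for t s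
  define g where "g t s = ((fst (f t), map read_tape (snd (f t)), fst (f (Suc t)), as t), cell_of M U (f t) s,
    lh t s, rh t s, s = 0, s = 2 * U)" for t s
  have "g t s \<in> tiles M" if "s \<le> 2 * U" for t s
  proof -
    have len: "length (snd (f t)) = num_tapes M" using wf by (simp add: wf_config_def)
    have "\<forall>c\<in>set (cell_of M U (f t) s). fst c < num_symbols M"
      using wf[of t] len by (auto simp: cell_of_def wf_config_def)
    moreover have "snd (cell_of M U (f t) s ! j) \<longrightarrow> fst (cell_of M U (f t) s ! j) = map read_tape (snd (f t)) ! j"
      if "j < num_tapes M" for j
      using that len by (simp add: cell_of_def read_tape_def)
    moreover have "lh t 0 = replicate (num_tapes M) False" "rh t (2 * U) = replicate (num_tapes M) False"
      by (simp_all add: lh_def rh_def map_replicate_const)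
    ultimately show ?thesis unfolding g_def tiles_def using as(1)[of t]
      by (auto simp: lh_def rh_def cell_of_def)
  qed
  moreover have "top_colour (g t s) = top_of M U (f t) s" for t s by (simp add: g_def top_of_def)
  moreover have "bottom_colour (g t s) = top_of M U (f (Suc t)) s" if s: "s \<le> 2 * U" for t s
  proof -
    have "bottom_colour (g t s) = (fst (f (Suc t)), cell_of M U (fst (f (Suc t)), map2 act_tape (as t) (snd (f t))) s, s = 0, s = 2 * U)"
      unfolding g_def
      by (rule bottom_cell[OF M as(1) wf bd s]) (simp_all add: lh_def rh_def)
    then show ?thesis by (simp add: top_of_def as(2)[symmetric])
  qed
  moreover have "right_colour (g t s) = left_colour (g t (Suc s))" if "s < 2 * U" for t s
    using that by (auto simp: g_def lh_def rh_def cell_of_def algebra_simps)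
  moreover have "right_colour (g t (2 * U)) = left_colour (g t' 0)" for t t' by (simp add: g_def)
  ultimately show ?thesis by (intro exI[of _ g]) blast
qed

section \<open>The exact cover problem of a tableau\<close>

definition count :: "nat \<Rightarrow> (nat \<Rightarrow> bool) \<Rightarrow> nat" where "count K P = (\<Sum>a<K. if P a then 1 else 0)"

lemma count_card: "count K P = card {a. a < K \<and> P a}"
proof -
  have "count K P = card ({..<K} \<inter> {a. P a})" unfolding count_def by (simp add: sum.If_cases)
  also have "{..<K} \<inter> {a. P a} = {a. a < K \<and> P a}" by auto
  finally show ?thesis .
qed

lemma count_unique:
  assumes "\<And>a. a < K \<Longrightarrow> Q a \<longleftrightarrow> a = a0" "a0 < K"
  shows "count K (\<lambda>a. Q a \<and> P a) = (if P a0 then 1 else 0)"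
proof -
  have "{a. a < K \<and> Q a \<and> P a} = (if P a0 then {a0} else {})" using assms by auto
  then show ?thesis by (simp add: count_card)
qed

lemma count_one: "count K Q = 1 \<Longrightarrow> \<exists>a0<K. \<forall>a<K. Q a \<longleftrightarrow> a = a0"
proof -
  assume "count K Q = 1"
  then obtain a0 where "{a. a < K \<and> Q a} = {a0}" unfolding count_card by (auto simp: card_1_singleton_iff)
  then show ?thesis by blast
qed

text \<open>All that a constraint may know about the input at block \<open>b\<close>. It ranges over
  a finite set, so the constraint tables depend on the language only. Blocks count from 1, hence the
  tape position 0 of the first row is block \<open>U + 1\<close>.\<close>

definition input_class :: "bool list \<Rightarrow> nat \<Rightarrow> nat \<Rightarrow> nat \<times> bool \<times> bool \<times> bool \<times> bool" where
  "input_class w U b = (word_contents w (int b - int (U + 1)), b = U + 1, b = 1, b = 2 * U + 1, b \<le> 2 * U + 1)"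

text \<open>It holds trivially outside the first row of the tableau, so that the same constraint can
  be imposed on every block.\<close>

definition init_ok :: "tm \<Rightarrow> nat \<times> bool \<times> bool \<times> bool \<times> bool \<Rightarrow> tile \<Rightarrow> bool" where
  "init_ok M ic a \<longleftrightarrow> (case ic of (s, h, b, e, i) \<Rightarrow>
     i \<longrightarrow> top_colour a = (0, (s, h) # replicate (num_tapes M - 1) (0, h), b, e))"

lemma init_ok_iff:
  assumes "wf_tm M" "s \<le> 2 * U"
  shows "init_ok M (input_class w U (Suc s)) a \<longleftrightarrow> top_colour a = top_of M U (init_config M w) s"
proof -
  have T: "1 \<le> num_tapes M" using assms by (simp add: wf_tm_def)
  have "cell_of M U (init_config M w) s = (word_contents w (int s - int U), s = U) # replicate (num_tapes M - 1) (0, s = U)"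
  proof (rule nth_equalityI)
    fix j assume "j < length (cell_of M U (init_config M w) s)"
    then have "j < num_tapes M" by (simp add: cell_of_def)
    then show "cell_of M U (init_config M w) s ! j =
        ((word_contents w (int s - int U), s = U) # replicate (num_tapes M - 1) (0, s = U)) ! j"
      by (cases j) (auto simp: cell_of_def init_config_def word_contents_def)
  qed (use T in \<open>simp add: cell_of_def\<close>)
  then show ?thesis using assms(2)
    by (simp add: init_ok_def input_class_def top_of_def init_config_def)
qed

text \<open>With \<open>S = 2 * U + 1\<close>, block \<open>b\<close> is the cell in row
  \<open>(b - 1) div S\<close> and column \<open>(b - 1) mod S\<close> of the tableau, and
  \<open>x b a\<close> says that it holds tile number \<open>a\<close>. Each constraint concerns a
  block, its right neighbour \<open>b + 1\<close> and its lower neighbour \<open>b + S\<close>. The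
  numbers \<open>K\<close>, \<open>C\<close> and the tables depend on \<open>L\<close> alone; the
  word enters through \<open>input_class\<close> and \<open>U\<close>.\<close>

lemma cook_levin:
  assumes "L \<in> NP"
  shows "\<exists>(K::nat) (C::nat) A0 A1 A2 (p :: nat poly). 1 \<le> K \<and> 1 \<le> C \<and> (\<forall>n. 1 \<le> poly p n) \<and> (\<forall>w. w \<in> L \<longleftrightarrow>
    (let U = poly p (length w) in \<exists>x. \<forall>b t. 1 \<le> b \<longrightarrow> b \<le> (2 * U + 1) * (2 * U + 1) \<longrightarrow> t < C \<longrightarrow>
       count K (\<lambda>a. x b a \<and> A0 (input_class w U b) t a) + count K (\<lambda>a. x (b + 1) a \<and> A1 t a) +
       count K (\<lambda>a. x (b + (2 * U + 1)) a \<and> A2 t a) = 1))"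
proof -
  obtain M p0 where M: "wf_tm M"
    and bound: "\<And>w t c. (tm_step M ^^ t) (init_config M w) c \<Longrightarrow> t \<le> poly p0 (length w)"
    and acc: "\<And>w. w \<in> L \<longleftrightarrow> (\<exists>t c. (tm_step M ^^ t) (init_config M w) c \<and> halted M c \<and> fst c = 1)"
    using assms unfolding NP_def by blast
  define p where "p = p0 + 1"
  obtain ts where ts: "set ts = tiles M" "distinct ts" using finite_distinct_list[OF finite_tiles[OF M]] by blast
  have "finite (right_colour ` tiles M)" "finite (bottom_colour ` tiles M)"
    using finite_tiles[OF M] by simp_all
  then obtain hc vc where hc: "set hc = right_colour ` tiles M" and vc: "set vc = bottom_colour ` tiles M"
    by (meson finite_list)
  \<comment> \<open>The surplus index keeps \<open>K\<close> positive even for an empty tile set;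
    the tables reject it.\<close>
  define K where "K = Suc (length ts)"
  \<comment> \<open>Exactly one tile per block, then the initial row, then one constraint per colour
    \<open>c\<close>. Equality of colours becomes a sum: the indicator of \<open>c\<close> being
    sent plus the indicator of the neighbour not expecting \<open>c\<close> is 1 iff both sides
    agree about \<open>c\<close>.\<close>
  define rows where "rows = [(\<lambda>ic a. True, \<lambda>a. False, \<lambda>a. False), (\<lambda>ic a. init_ok M ic a, \<lambda>a. False, \<lambda>a. False)] @
    map (\<lambda>c. (\<lambda>ic a. right_colour a = c, \<lambda>a. left_colour a \<noteq> c, \<lambda>a. False)) hc @
    map (\<lambda>c. (\<lambda>ic a. bottom_colour a = c, \<lambda>a. False, \<lambda>a. top_colour a \<noteq> c)) vc"
  define A0 where "A0 ic t a \<longleftrightarrow> a < length ts \<and> fst (rows ! t) ic (ts ! a)" for ic t a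
  define A1 where "A1 t a \<longleftrightarrow> a < length ts \<and> fst (snd (rows ! t)) (ts ! a)" for t a
  define A2 where "A2 t a \<longleftrightarrow> a < length ts \<and> snd (snd (rows ! t)) (ts ! a)" for t a
  define N where "N = length ts"
  have all_rows: "(\<forall>t<length rows. Q (fst (rows ! t)) (fst (snd (rows ! t))) (snd (snd (rows ! t)))) \<longleftrightarrow>
      Q (\<lambda>ic a. True) (\<lambda>a. False) (\<lambda>a. False) \<and> Q (\<lambda>ic a. init_ok M ic a) (\<lambda>a. False) (\<lambda>a. False) \<and>
      (\<forall>c\<in>set hc. Q (\<lambda>ic a. right_colour a = c) (\<lambda>a. left_colour a \<noteq> c) (\<lambda>a. False)) \<and>
      (\<forall>c\<in>set vc. Q (\<lambda>ic a. bottom_colour a = c) (\<lambda>a. False) (\<lambda>a. top_colour a \<noteq> c))" for Q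
  proof -
    have "(\<forall>t<length rows. Q (fst (rows ! t)) (fst (snd (rows ! t))) (snd (snd (rows ! t)))) \<longleftrightarrow>
        (\<forall>r\<in>set rows. Q (fst r) (fst (snd r)) (snd (snd r)))" by (simp add: all_set_conv_all_nth)
    also have "\<dots> \<longleftrightarrow> Q (\<lambda>ic a. True) (\<lambda>a. False) (\<lambda>a. False) \<and> Q (\<lambda>ic a. init_ok M ic a) (\<lambda>a. False) (\<lambda>a. False) \<and>
        (\<forall>c\<in>set hc. Q (\<lambda>ic a. right_colour a = c) (\<lambda>a. left_colour a \<noteq> c) (\<lambda>a. False)) \<and>
        (\<forall>c\<in>set vc. Q (\<lambda>ic a. bottom_colour a = c) (\<lambda>a. False) (\<lambda>a. top_colour a \<noteq> c))"
      by (simp add: rows_def ball_Un)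
    finally show ?thesis .
  qed
  have main: "w \<in> L \<longleftrightarrow> (\<exists>x. \<forall>b t. 1 \<le> b \<longrightarrow> b \<le> (2 * U + 1) * (2 * U + 1) \<longrightarrow> t < length rows \<longrightarrow>
       count K (\<lambda>a. x b a \<and> A0 (input_class w U b) t a) + count K (\<lambda>a. x (b + 1) a \<and> A1 t a) +
       count K (\<lambda>a. x (b + (2 * U + 1)) a \<and> A2 t a) = 1)" (is "_ \<longleftrightarrow> (\<exists>x. ?cover x)")
    if U: "U = poly p (length w)" for w U
  proof -
    define S where "S = 2 * U + 1"
    have bd: "t < U" if "(tm_step M ^^ t) (init_config M w) c" for t c
      using bound[OF that] by (simp add: U p_def)
    have run: "w \<in> L \<longleftrightarrow> (\<exists>c. (tm_step (patient M) ^^ U) (init_config M w) c)"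
      unfolding acc by (rule accepts_iff_long_run(1)[OF M bd])
    show ?thesis
    proof
      assume "w \<in> L"
      then have accw: "\<exists>t c. (tm_step M ^^ t) (init_config M w) c \<and> halted M c \<and> fst c = 1"
        unfolding acc .
      have "\<exists>f. f 0 = init_config M w \<and> (\<forall>i. tm_step (patient M) (f i) (f (Suc i))) \<and>
        (\<forall>i. wf_config M (f i)) \<and> (\<forall>i. \<forall>j<num_tapes M. \<bar>snd (snd (f i) ! j)\<bar> \<le> int U)"
        by (rule accepts_iff_long_run(2)[OF M _ accw]) (rule bd)
      then obtain f where
        f: "f 0 = init_config M w" "\<And>i. tm_step (patient M) (f i) (f (Suc i))" "\<And>i. wf_config M (f i)"
        "\<And>i j. j < num_tapes M \<Longrightarrow> \<bar>snd (snd (f i) ! j)\<bar> \<le> int U" by blast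
      from tiling_of_run[where f = f, OF M f(2,3,4)] obtain g where
        g: "\<And>t s. s \<le> 2 * U \<Longrightarrow> g t s \<in> tiles M" "\<And>t s. s \<le> 2 * U \<Longrightarrow> top_colour (g t s) = top_of M U (f t) s"
          "\<And>t s. s \<le> 2 * U \<Longrightarrow> bottom_colour (g t s) = top_of M U (f (Suc t)) s"
        and gh: "\<And>t s. s < 2 * U \<Longrightarrow> right_colour (g t s) = left_colour (g t (Suc s))"
          "\<And>t t'. right_colour (g t (2 * U)) = left_colour (g t' 0)" by auto
      \<comment> \<open>As \<open>g\<close> is defined for all times, the blocks beyond the
        constrained square receive tiles as well.\<close>
      define T where "T b = g ((b - 1) div S) ((b - 1) mod S)" for b
      have mS: "m mod S \<le> 2 * U" for m using mod_less_divisor[of S m] by (simp add: S_def)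
      have TT: "T b \<in> set ts" for b using g(1)[OF mS] ts by (simp add: T_def)
      then have "\<forall>b. \<exists>i. i < N \<and> ts ! i = T b" unfolding N_def by (metis in_set_conv_nth)
      then obtain ix where ix: "\<And>b. ix b < N" "\<And>b. ts ! ix b = T b" by metis
      define x where "x b a \<longleftrightarrow> a = ix b" for b a
      have cnt: "count K (\<lambda>a. x b a \<and> a < length ts \<and> P (ts ! a)) = (if P (T b) then 1 else 0)" for b P
        using count_unique[of K "x b" "ix b" "\<lambda>a. a < length ts \<and> P (ts ! a)"] ix[of b]
        by (simp add: x_def K_def N_def)
      have hz: "right_colour (T b) = left_colour (T (b + 1))" if "1 \<le> b" for b
      proof (cases "(b - 1) mod S = 2 * U")
        case True
        then have "(b - 1 + 1) mod S = 0" by (simp add: mod_Suc S_def)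
        then show ?thesis using True gh(2) that by (simp add: T_def)
      next
        case False
        then have "(b - 1) mod S < 2 * U" using mS[of "b - 1"] by linarith
        then have "Suc ((b - 1) mod S) \<noteq> S" using S_def by linarith
        then have "b mod S = Suc ((b - 1) mod S)" "b div S = (b - 1) div S"
          using that mod_Suc[of "b - 1" S] div_Suc[of "b - 1" S] by simp_all
        then show ?thesis using gh(1)[of "(b - 1) mod S"] mS[of "b - 1"] False by (simp add: T_def)
      qed
      have vt: "bottom_colour (T b) = top_colour (T (b + S))" if "1 \<le> b" for b
      proof -
        have e: "b + S - 1 = (b - 1) + S" using that by simp
        have "S > 0" by (simp add: S_def)
        then have "(b + S - 1) div S = Suc ((b - 1) div S)" "(b + S - 1) mod S = (b - 1) mod S"
          unfolding e by simp_all
        then show ?thesis unfolding T_def using g(2,3)[OF mS] by simp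
      qed
      have "?cover x"
      proof (intro allI impI)
        fix b t assume b: "1 \<le> b" "b \<le> (2 * U + 1) * (2 * U + 1)" and t: "t < length rows"
        have ini: "init_ok M (input_class w U b) (T b)"
        proof (cases "b \<le> S")
          case True
          then have "(b - 1) div S = 0" "(b - 1) mod S = b - 1" "b - 1 \<le> 2 * U" using b by (simp_all add: S_def)
          then show ?thesis using init_ok_iff[OF M, of "b - 1" U w "T b"] g(2)[of "b - 1" 0] f(1) b(1)
            by (simp add: T_def)
        next
          case False
          then show ?thesis by (simp add: init_ok_def input_class_def S_def)
        qed
        have "\<forall>t<length rows. (if fst (rows ! t) (input_class w U b) (T b) then 1 else 0) +
            (if fst (snd (rows ! t)) (T (b + 1)) then 1 else 0) +
            (if snd (snd (rows ! t)) (T (b + S)) then 1 else (0::nat)) = 1"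
          unfolding all_rows[of "\<lambda>P0 P1 P2. (if P0 (input_class w U b) (T b) then 1 else 0) +
            (if P1 (T (b + 1)) then 1 else 0) + (if P2 (T (b + S)) then 1 else (0::nat)) = 1"]
          using ini hz[OF b(1)] vt[OF b(1)] by auto
        then show "count K (\<lambda>a. x b a \<and> A0 (input_class w U b) t a) + count K (\<lambda>a. x (b + 1) a \<and> A1 t a) +
            count K (\<lambda>a. x (b + (2 * U + 1)) a \<and> A2 t a) = 1"
          unfolding A0_def A1_def A2_def cnt S_def[symmetric] using t by blast
      qed
      then show "\<exists>x. ?cover x" by blast
    next
      assume "\<exists>x. ?cover x"
      then obtain x where x: "?cover x" by blast
      define ok where "ok b \<longleftrightarrow> 1 \<le> b \<and> b \<le> S * S" for b
      have eqs: "\<forall>t<length rows. count K (\<lambda>a. x b a \<and> a < length ts \<and> fst (rows ! t) (input_class w U b) (ts ! a)) +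
          count K (\<lambda>a. x (b + 1) a \<and> a < length ts \<and> fst (snd (rows ! t)) (ts ! a)) +
          count K (\<lambda>a. x (b + S) a \<and> a < length ts \<and> snd (snd (rows ! t)) (ts ! a)) = 1" if "ok b" for b
        using x that unfolding ok_def A0_def A1_def A2_def S_def by blast
      note eqs' = eqs[unfolded all_rows[of "\<lambda>P0 P1 P2. count K (\<lambda>a. x b a \<and> a < length ts \<and> P0 (input_class w U b) (ts ! a)) +
          count K (\<lambda>a. x (b + 1) a \<and> a < length ts \<and> P1 (ts ! a)) +
          count K (\<lambda>a. x (b + S) a \<and> a < length ts \<and> P2 (ts ! a)) = 1" for b]]
      have c0: "count K (\<lambda>a. False) = 0" by (simp add: count_def)
      have "\<exists>a0. a0 < length ts \<and> (\<forall>a<K. x b a \<and> a < length ts \<longleftrightarrow> a = a0)" if "ok b" for b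
      proof -
        have "count K (\<lambda>a. x b a \<and> a < length ts) = 1" using eqs'[OF that] by (simp add: c0)
        from count_one[OF this] obtain a0 where a0: "a0 < K" "\<forall>a<K. (x b a \<and> a < length ts) \<longleftrightarrow> a = a0" by blast
        then have "x b a0 \<and> a0 < length ts" by blast
        then show ?thesis using a0 by blast
      qed
      then obtain ix where ix: "\<And>b. ok b \<Longrightarrow> ix b < length ts"
        "\<And>b a. ok b \<Longrightarrow> a < K \<Longrightarrow> (x b a \<and> a < length ts) \<longleftrightarrow> a = ix b" by metis
      define T where "T b = ts ! ix b" for b
      have cnt: "count K (\<lambda>a. x b a \<and> a < length ts \<and> P (ts ! a)) = (if P (T b) then 1 else 0)" if "ok b" for b P
        using count_unique[of K "\<lambda>a. x b a \<and> a < length ts" "ix b" "\<lambda>a. P (ts ! a)"] ix[OF that]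
        by (simp add: K_def T_def conj_assoc)
      have inT: "T b \<in> tiles M" if "ok b" for b using ix(1)[OF that] ts(1) nth_mem[of "ix b" ts] by (simp add: T_def)
      have ini: "init_ok M (input_class w U b) (T b)" if "ok b" for b
      proof -
        have "count K (\<lambda>a. x b a \<and> a < length ts \<and> init_ok M (input_class w U b) (ts ! a)) = 1"
          using eqs'[OF that] by (simp add: c0)
        then show ?thesis unfolding cnt[OF that, of "init_ok M (input_class w U b)"] by (simp split: if_splits)
      qed
      have hz: "right_colour (T b) = left_colour (T (b + 1))" if "ok b" "ok (b + 1)" for b
      proof -
        have "right_colour (T b) \<in> set hc" using hc inT[OF that(1)] by simp
        then have "count K (\<lambda>a. x b a \<and> a < length ts \<and> right_colour (ts ! a) = right_colour (T b)) +
            count K (\<lambda>a. x (b + 1) a \<and> a < length ts \<and> left_colour (ts ! a) \<noteq> right_colour (T b)) = 1"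
          using eqs'[OF that(1)] by (simp add: c0)
        then show ?thesis
          unfolding cnt[OF that(1), of "\<lambda>a. right_colour a = right_colour (T b)"]
            cnt[OF that(2), of "\<lambda>a. left_colour a \<noteq> right_colour (T b)"] by (simp split: if_splits)
      qed
      have vt: "top_colour (T (b + S)) = bottom_colour (T b)" if "ok b" "ok (b + S)" for b
      proof -
        have "bottom_colour (T b) \<in> set vc" using vc inT[OF that(1)] by simp
        then have "count K (\<lambda>a. x b a \<and> a < length ts \<and> bottom_colour (ts ! a) = bottom_colour (T b)) +
            count K (\<lambda>a. x (b + S) a \<and> a < length ts \<and> top_colour (ts ! a) \<noteq> bottom_colour (T b)) = 1"
          using eqs'[OF that(1)] by (simp add: c0)
        then show ?thesis
          unfolding cnt[OF that(1), of "\<lambda>a. bottom_colour a = bottom_colour (T b)"]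
            cnt[OF that(2), of "\<lambda>a. top_colour a \<noteq> bottom_colour (T b)"] by (simp split: if_splits)
      qed
      define g where "g t s = T (1 + t * S + s)" for t s
      \<comment> \<open>The run is read off from the rows up to \<open>U\<close>, all of whose
        blocks are constrained because \<open>U + 1 \<le> S\<close>.\<close>
      have ok: "ok (1 + t * S + s)" if "t \<le> U" "s \<le> 2 * U" for t s
      proof -
        have "1 + t * S + s \<le> (t + 1) * S" using that by (simp add: S_def)
        also have "\<dots> \<le> S * S" using that by (intro mult_le_mono1) (simp add: S_def)
        finally show ?thesis by (simp add: ok_def)
      qed
      have "\<exists>c. (tm_step (patient M) ^^ U) (init_config M w) c"
      proof (rule run_of_tiling[OF M, where g = g])
        fix t s assume ts: "t \<le> U" "s \<le> 2 * U"
        show "g t s \<in> tiles M" unfolding g_def by (rule inT[OF ok[OF ts]])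
      next
        fix s assume s: "s \<le> 2 * U"
        show "top_colour (g 0 s) = top_of M U (init_config M w) s"
          using init_ok_iff[OF M s, of w "g 0 s"] ini[OF ok[of 0 s]] s by (simp add: g_def)
      next
        fix t s assume ts: "t \<le> U" "s < 2 * U"
        have "1 + t * S + s + 1 = 1 + t * S + Suc s" by simp
        then show "right_colour (g t s) = left_colour (g t (Suc s))"
          using hz[of "1 + t * S + s"] ok[of t s] ok[of t "Suc s"] ts unfolding g_def by simp
      next
        fix t s assume ts: "t < U" "s \<le> 2 * U"
        have e: "1 + t * S + s + S = 1 + Suc t * S + s" by simp
        have "ok (1 + t * S + s)" "ok (1 + t * S + s + S)"
          unfolding e using ok[of t s] ok[of "Suc t" s] ts by simp_all
        from vt[OF this] show "top_colour (g (Suc t) s) = bottom_colour (g t s)"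
          unfolding g_def e .
      qed
      then show "w \<in> L" unfolding run .
    qed
  qed
  have "1 \<le> K" "1 \<le> length rows" "\<forall>n. 1 \<le> poly p n" by (simp_all add: K_def rows_def p_def)
  moreover have "\<forall>w. w \<in> L \<longleftrightarrow> (let U = poly p (length w) in \<exists>x. \<forall>b t. 1 \<le> b \<longrightarrow> b \<le> (2 * U + 1) * (2 * U + 1) \<longrightarrow>
      t < length rows \<longrightarrow> count K (\<lambda>a. x b a \<and> A0 (input_class w U b) t a) + count K (\<lambda>a. x (b + 1) a \<and> A1 t a) +
       count K (\<lambda>a. x (b + (2 * U + 1)) a \<and> A2 t a) = 1)"
    unfolding Let_def using main[OF refl] by blast
  ultimately show ?thesis by blast
qed

section \<open>Structured multi-tape programs\<close>

datatype com =
    Act nat "nat \<Rightarrow> nat \<times> int"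
  | Seq com com
  | While nat nat com
  | Cond nat nat com com

text \<open>The cost model is that of the machine below: taking a sequence apart and testing a
  condition are one step each, so times agree exactly with numbers of machine steps.\<close>

inductive exec :: "com \<Rightarrow> tape list \<Rightarrow> nat \<Rightarrow> tape list \<Rightarrow> bool" where
  exec_Act: "i < length ts \<Longrightarrow>
     exec (Act i g) ts 1 (ts[i := act_tape (g (read_tape (ts ! i))) (ts ! i)])"
| exec_Seq: "exec c ts a us \<Longrightarrow> exec d us b vs \<Longrightarrow> exec (Seq c d) ts (Suc (a + b)) vs"
| exec_While_stop: "i < length ts \<Longrightarrow> read_tape (ts ! i) = s \<Longrightarrow> exec (While i s c) ts 1 ts"
| exec_While_loop: "i < length ts \<Longrightarrow> read_tape (ts ! i) \<noteq> s \<Longrightarrow> exec c ts a us \<Longrightarrow>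
     exec (While i s c) us b vs \<Longrightarrow> exec (While i s c) ts (Suc (a + b)) vs"
| exec_Cond: "i < length ts \<Longrightarrow> exec (if read_tape (ts ! i) = s then c else d) ts a us \<Longrightarrow>
     exec (Cond i s c d) ts (Suc a) us"

text \<open>The control states of the machine that runs a program are continuations, i.e. lists of
  programs still to be executed; only finitely many of them are reachable.\<close>

fun next_state :: "nat \<Rightarrow> com list \<Rightarrow> nat list \<Rightarrow> (com list \<times> (nat \<times> int) list) option" where
  "next_state n [] rs = None"
| "next_state n (Act i g # k) rs =
     Some (k, map (\<lambda>j. if j = i then g (rs ! j) else (rs ! j, 0)) [0..<n])"
| "next_state n (Seq c d # k) rs = Some (c # d # k, map (\<lambda>j. (rs ! j, 0)) [0..<n])"
| "next_state n (While i s c # k) rs =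
     Some (if rs ! i = s then k else c # While i s c # k, map (\<lambda>j. (rs ! j, 0)) [0..<n])"
| "next_state n (Cond i s c d # k) rs =
     Some ((if rs ! i = s then c else d) # k, map (\<lambda>j. (rs ! j, 0)) [0..<n])"

fun continuations :: "com \<Rightarrow> com list \<Rightarrow> com list set" where
  "continuations (Act i g) k = {Act i g # k}"
| "continuations (Seq c d) k =
     {Seq c d # k} \<union> continuations c (d # k) \<union> continuations d k"
| "continuations (While i s c) k =
     {While i s c # k} \<union> continuations c (While i s c # k)"
| "continuations (Cond i s c d) k =
     {Cond i s c d # k} \<union> continuations c k \<union> continuations d k"

lemma finite_continuations: "finite (continuations c k)"
  by (induction c arbitrary: k) auto

lemma Cons_in_continuations: "c # k \<in> continuations c k"
  by (cases c) auto

lemma continuations_closed: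
  "q \<in> continuations c k \<Longrightarrow> next_state n q rs = Some (q', as) \<Longrightarrow>
     q' \<in> insert k (continuations c k)"
proof (induction c arbitrary: k q)
  case (Seq c d)
  from Seq.prems(1) consider "q = Seq c d # k" | "q \<in> continuations c (d # k)"
    | "q \<in> continuations d k" by auto
  then show ?case
  proof cases
    case 1
    then show ?thesis using Seq.prems Cons_in_continuations[of c "d # k"] by auto
  next
    case 2
    then show ?thesis using Seq.IH(1)[OF 2 Seq.prems(2)] Cons_in_continuations[of d k] by auto
  next
    case 3
    then show ?thesis using Seq.IH(2)[OF 3 Seq.prems(2)] by auto
  qed
next
  case (While i s c)
  from While.prems(1) consider "q = While i s c # k" | "q \<in> continuations c (While i s c # k)"
    by auto
  then show ?case
  proof cases
    case 1
    then show ?thesis using While.prems Cons_in_continuations[of c "While i s c # k"]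
      by (auto split: if_splits)
  next
    case 2
    then show ?thesis using While.IH[OF 2 While.prems(2)] by auto
  qed
next
  case (Cond i s c d)
  from Cond.prems(1) consider "q = Cond i s c d # k" | "q \<in> continuations c k"
    | "q \<in> continuations d k" by auto
  then show ?case
  proof cases
    case 1
    then show ?thesis
      using Cond.prems Cons_in_continuations[of c k] Cons_in_continuations[of d k]
      by (auto split: if_splits)
  next
    case 2
    then show ?thesis using Cond.IH(1)[OF 2 Cond.prems(2)] by auto
  next
    case 3
    then show ?thesis using Cond.IH(2)[OF 3 Cond.prems(2)] by auto
  qed
qed auto

primrec wf_com :: "com \<Rightarrow> bool" where
  "wf_com (Act i g) \<longleftrightarrow> (\<forall>s<3. fst (g s) < 3 \<and> snd (g s) \<in> {-1, 0, 1})"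
| "wf_com (Seq c d) \<longleftrightarrow> wf_com c \<and> wf_com d"
| "wf_com (While i s c) \<longleftrightarrow> wf_com c"
| "wf_com (Cond i s c d) \<longleftrightarrow> wf_com c \<and> wf_com d"

lemma continuations_wf:
  "q \<in> continuations c k \<Longrightarrow> wf_com c \<Longrightarrow> \<forall>d\<in>set k. wf_com d \<Longrightarrow> \<forall>d\<in>set q. wf_com d"
proof (induction c arbitrary: k)
  case (Seq c d)
  have dk: "\<forall>e\<in>set (d # k). wf_com e" using Seq.prems by simp
  from Seq.prems(1) consider "q = Seq c d # k" | "q \<in> continuations c (d # k)"
    | "q \<in> continuations d k" by auto
  then show ?case
    using Seq.prems(2,3) Seq.IH(1)[OF _ _ dk] Seq.IH(2)[OF _ _ Seq.prems(3)] by cases simp_all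
next
  case (While i s c)
  have wk: "\<forall>e\<in>set (While i s c # k). wf_com e" using While.prems by simp
  from While.prems(1) consider "q = While i s c # k" | "q \<in> continuations c (While i s c # k)"
    by auto
  then show ?case using While.prems(2,3) While.IH[OF _ _ wk] by cases simp_all
next
  case (Cond i s c d)
  from Cond.prems(1) consider "q = Cond i s c d # k" | "q \<in> continuations c k"
    | "q \<in> continuations d k" by auto
  then show ?case
    using Cond.prems(2,3) Cond.IH(1)[OF _ _ Cond.prems(3)] Cond.IH(2)[OF _ _ Cond.prems(3)]
    by cases simp_all
qed auto

definition ternary :: "nat \<Rightarrow> tape list \<Rightarrow> bool" where
  "ternary n ts \<longleftrightarrow> length ts = n \<and> (\<forall>t\<in>set ts. \<forall>p. fst t p < 3)"

lemma read_tape_ternary: "ternary n ts \<Longrightarrow> i < n \<Longrightarrow> read_tape (ts ! i) < 3"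
  by (auto simp: ternary_def read_tape_def)

definition com_step :: "nat \<Rightarrow> com list \<times> tape list \<Rightarrow> com list \<times> tape list \<Rightarrow> bool" where
  "com_step n c c' \<longleftrightarrow> (\<exists>as. next_state n (fst c) (map read_tape (snd c)) = Some (fst c', as) \<and>
     snd c' = map2 act_tape as (snd c))"

lemma map2_act_tape_read:
  "length ts = n \<Longrightarrow> map2 act_tape (map (\<lambda>j. (map read_tape ts ! j, 0)) [0..<n]) ts = ts"
  by (rule nth_equalityI) (auto simp: act_tape_def read_tape_def)

lemma map2_act_tape_Act:
  "length ts = n \<Longrightarrow> i < n \<Longrightarrow>
   map2 act_tape (map (\<lambda>j. if j = i then g (map read_tape ts ! j) else (map read_tape ts ! j, 0))
     [0..<n]) ts = ts[i := act_tape (g (read_tape (ts ! i))) (ts ! i)]"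
  by (rule nth_equalityI) (auto simp: act_tape_def read_tape_def nth_list_update)

lemma exec_length: "exec c ts t us \<Longrightarrow> length us = length ts"
  by (induction rule: exec.induct) auto

lemma exec_com_step:
  "exec c ts t us \<Longrightarrow> length ts = n \<Longrightarrow> (com_step n ^^ t) (c # k, ts) (k, us)"
proof (induction arbitrary: k rule: exec.induct)
  case (exec_Act i ts g)
  then show ?case by (auto simp: com_step_def map2_act_tape_Act)
next
  case (exec_Seq c ts a us d b vs)
  have 1: "com_step n (Seq c d # k, ts) (c # d # k, ts)"
    using exec_Seq.prems by (auto simp: com_step_def map2_act_tape_read)
  have 2: "(com_step n ^^ (a + b)) (c # d # k, ts) (k, vs)"
    using exec_Seq.IH exec_Seq.prems exec_length[OF exec_Seq.hyps(1)]
    by (auto simp: relpowp_add)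
  show ?case using relpowp_Suc_I2[OF 1 2] .
next
  case (exec_While_stop i ts s c)
  then show ?case by (auto simp: com_step_def map2_act_tape_read)
next
  case (exec_While_loop i ts s c a us b vs)
  have 1: "com_step n (While i s c # k, ts) (c # While i s c # k, ts)"
    using exec_While_loop.prems exec_While_loop.hyps
    by (auto simp: com_step_def map2_act_tape_read)
  have 2: "(com_step n ^^ (a + b)) (c # While i s c # k, ts) (k, vs)"
    using exec_While_loop.IH exec_While_loop.prems exec_length[OF exec_While_loop.hyps(3)]
    by (auto simp: relpowp_add)
  show ?case using relpowp_Suc_I2[OF 1 2] .
next
  case (exec_Cond i ts s c d a us)
  have 1: "com_step n (Cond i s c d # k, ts) ((if read_tape (ts ! i) = s then c else d) # k, ts)"
    using exec_Cond.prems exec_Cond.hyps by (auto simp: com_step_def map2_act_tape_read)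
  show ?case using relpowp_Suc_I2[OF 1 exec_Cond.IH[OF exec_Cond.prems]] .
qed

lemma ternary_com_step:
  assumes "com_step n (q, ts) (q', ts')" "\<forall>d\<in>set q. wf_com d" "ternary n ts"
  shows "ternary n ts'"
proof -
  obtain as where as: "next_state n q (map read_tape ts) = Some (q', as)"
    and ts': "ts' = map2 act_tape as ts" using assms(1) by (auto simp: com_step_def)
  have n: "length ts = n" using assms(3) by (simp add: ternary_def)
  have len: "length as = n" using as by (cases "(n, q, map read_tape ts)" rule: next_state.cases) auto
  have "fst (as ! j) < 3" if "j < n" for j
    using as assms(2) that read_tape_ternary[OF assms(3), of j] n
    by (cases "(n, q, map read_tape ts)" rule: next_state.cases) auto
  moreover have "fst (ts ! j) p < 3" if "j < n" for j p
    using assms(3) that by (auto simp: ternary_def)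
  ultimately have "fst (ts' ! j) p < 3" if "j < n" for j p
    using that len n by (simp add: ts' act_tape_def)
  moreover have "length ts' = n" using len n by (simp add: ts')
  ultimately show ?thesis unfolding ternary_def all_set_conv_all_nth by blast
qed

section \<open>The Turing machine of a program\<close>

lemma tm_of_com:
  fixes c :: com
  assumes wf: "wf_com c" and n: "1 \<le> n"
  shows "\<exists>M. wf_tm M \<and> deterministic M \<and> num_tapes M = n \<and>
     (\<forall>ts t us. ternary n ts \<longrightarrow> exec c ts t us \<longrightarrow>
        (\<exists>d. (tm_step M ^^ t) (0, ts) d \<and> halted M d \<and> snd d = us))"
proof -
  define Q where "Q = insert [] (continuations c [])"
  have finQ: "finite Q" by (simp add: Q_def finite_continuations)
  have c0: "[c] \<in> Q" using Cons_in_continuations[of c "[]"] by (simp add: Q_def)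
  obtain h0 where h0: "bij_betw h0 Q {0..<card Q}" using ex_bij_betw_finite_nat[OF finQ] ..
  \<comment> \<open>Any numbering of the continuations is corrected by a transposition so that the
    whole program gets the initial state 0. The empty continuation has no successor and serves as
    the halting state.\<close>
  define h where "h = Transposition.transpose 0 (h0 [c]) \<circ> h0"
  have in0: "h0 [c] < card Q" using h0 c0 by (auto simp: bij_betw_def)
  have injh: "inj_on h Q"
    unfolding h_def
    by (intro comp_inj_on bij_betw_imp_inj_on[OF h0] inj_onI)
      (metis Transposition.transpose_involutory)
  have hlt: "h q < card Q" if "q \<in> Q" for q
  proof -
    have "h0 q < card Q" using h0 that by (auto simp: bij_betw_def)
    then show ?thesis unfolding h_def o_def using in0 by (auto simp: Transposition.transpose_def)
  qed
  have hc: "h [c] = 0" by (simp add: h_def)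
  have closed: "q' \<in> Q" if "q \<in> Q" "next_state n q rs = Some (q', as)" for q rs q' as
    using that continuations_closed[of q c "[]"] by (auto simp: Q_def)
  have wfQ: "\<forall>d\<in>set q. wf_com d" if "q \<in> Q" for q
    using that continuations_wf[of q c "[]"] wf by (auto simp: Q_def)
  have card2: "2 \<le> card Q"
    using card_mono[of Q "{[], [c]}"] finQ c0 by (simp add: Q_def)
  define M where "M = \<lparr>num_tapes = n, num_symbols = 3, num_states = card Q,
    transitions = {(h q, rs, h q', as) | q rs q' as. q \<in> Q \<and> length rs = n \<and> (\<forall>s\<in>set rs. s < 3) \<and>
      next_state n q rs = Some (q', as)}\<rparr>"
  have act_ok: "length as = n \<and> (\<forall>a\<in>set as. fst a < 3 \<and> snd a \<in> {-1, 0, 1})"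
    if "q \<in> Q" "length rs = n" "\<forall>s\<in>set rs. s < 3" "next_state n q rs = Some (q', as)"
    for q rs q' as
  proof -
    have rs: "rs ! j < 3" if "j < n" for j using \<open>length rs = n\<close> \<open>\<forall>s\<in>set rs. s < 3\<close> that by auto
    have len: "length as = n"
      using that(4) by (cases "(n, q, rs)" rule: next_state.cases) auto
    have "fst (as ! j) < 3 \<and> snd (as ! j) \<in> {-1, 0, 1}" if "j < n" for j
      using \<open>next_state n q rs = _\<close> wfQ[OF \<open>q \<in> Q\<close>] rs[OF that] that
      by (cases "(n, q, rs)" rule: next_state.cases) (auto dest!: spec[of _ "rs ! j"])
    then have "\<forall>a\<in>set as. fst a < 3 \<and> snd a \<in> {-1, 0, 1}"
      unfolding all_set_conv_all_nth len by blast
    then show ?thesis using len by blast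
  qed
  have trans_ok: "h q < card Q \<and> h q' < card Q \<and> length rs = n \<and> (\<forall>s\<in>set rs. s < 3) \<and>
     length as = n \<and> (\<forall>a\<in>set as. fst a < 3 \<and> snd a \<in> {-1, 0, 1})"
    if "q \<in> Q" "length rs = n" "\<forall>s\<in>set rs. s < 3" "next_state n q rs = Some (q', as)"
    for q rs q' as
    using that(2,3) hlt[OF that(1)] hlt[OF closed[OF that(1,4)]] act_ok[OF that] by simp
  have "\<forall>z \<in> transitions M. fst z < card Q \<and> fst (snd (snd z)) < card Q \<and>
      length (fst (snd z)) = n \<and> (\<forall>s\<in>set (fst (snd z)). s < 3) \<and>
      length (snd (snd (snd z))) = n \<and> (\<forall>a\<in>set (snd (snd (snd z))). fst a < 3 \<and> snd a \<in> {-1, 0, 1})"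
    (is "\<forall>z\<in>_. ?W z")
  proof (intro ballI)
    fix z assume "z \<in> transitions M"
    then obtain q rs q' as where z: "z = (h q, rs, h q', as)" and t: "q \<in> Q" "length rs = n"
      "\<forall>s\<in>set rs. s < 3" "next_state n q rs = Some (q', as)" by (auto simp: M_def)
    show "?W z" unfolding z fst_conv snd_conv by (rule trans_ok[OF t])
  qed
  moreover have "num_tapes M = n" "num_symbols M = 3" "num_states M = card Q"
    by (simp_all add: M_def)
  ultimately have "wf_tm M"
    unfolding wf_tm_def case_prod_unfold using n card2 by simp
  moreover have "deterministic M"
  proof -
    have "q1 = q2 \<and> as1 = as2" if t1: "(s, rs, q1, as1) \<in> transitions M"
      and t2: "(s, rs, q2, as2) \<in> transitions M" for s rs q1 q2 as1 as2
    proof -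
      obtain p1 p1' where p1: "s = h p1" "p1 \<in> Q" "q1 = h p1'"
        "next_state n p1 rs = Some (p1', as1)" using t1 by (auto simp: M_def)
      obtain p2 p2' where p2: "s = h p2" "p2 \<in> Q" "q2 = h p2'"
        "next_state n p2 rs = Some (p2', as2)" using t2 by (auto simp: M_def)
      have "p1 = p2" using injh p1 p2 by (auto dest: inj_onD)
      then show ?thesis using p1 p2 by simp
    qed
    then show ?thesis unfolding deterministic_def by blast
  qed
  moreover have "\<exists>d. (tm_step M ^^ t) (0, ts) d \<and> halted M d \<and> snd d = us"
    if ts: "ternary n ts" and ex: "exec c ts t us" for ts t us
  proof -
    have step: "q' \<in> Q \<and> ternary n ts' \<and> tm_step M (h q, ts) (h q', ts')"
      if cs: "com_step n (q, ts) (q', ts')" and qQ: "q \<in> Q" and te: "ternary n ts" for q q' ts ts'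
    proof -
      have rd: "length (map read_tape ts) = n" "\<forall>s\<in>set (map read_tape ts). s < 3"
        using te by (auto simp: ternary_def read_tape_def)
      obtain as where as: "next_state n q (map read_tape ts) = Some (q', as)"
        and ts': "ts' = map2 act_tape as ts" using cs by (auto simp: com_step_def)
      have "(h q, map read_tape ts, h q', as) \<in> transitions M"
        unfolding M_def tm.select_convs mem_Collect_eq using qQ rd as by blast
      then show ?thesis
        using ternary_com_step[OF cs wfQ[OF qQ] te] closed[OF qQ as] ts'
        unfolding tm_step_def by auto
    qed
    have steps: "(com_step n ^^ t) (q, ts) (q', ts') \<Longrightarrow> q \<in> Q \<Longrightarrow> ternary n ts \<Longrightarrow>
        q' \<in> Q \<and> ternary n ts' \<and> (tm_step M ^^ t) (h q, ts) (h q', ts')" for t q ts q' ts'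
    proof (induction t arbitrary: q' ts')
      case (Suc t)
      then obtain q'' ts'' where "(com_step n ^^ t) (q, ts) (q'', ts'')"
        "com_step n (q'', ts'') (q', ts')" by auto
      then show ?case using Suc.IH[of q'' ts''] Suc.prems step[of q'' ts'' q' ts']
        by (auto intro: relpowp_Suc_I)
    qed auto
    have "(com_step n ^^ t) ([c], ts) ([], us)"
      using exec_com_step[OF ex] ts by (simp add: ternary_def)
    then have "(tm_step M ^^ t) (0, ts) (h [], us)" using steps c0 ts hc by metis
    moreover have "halted M (h [], us)"
    proof -
      have "\<not> tm_step M (h [], us) d" for d
      proof
        assume "tm_step M (h [], us) d"
        then obtain q rs q' as where q: "h [] = h q" "q \<in> Q" "next_state n q rs = Some (q', as)"
          by (auto simp: tm_step_def M_def)
        then have "q = []" using injh by (auto simp: Q_def inj_on_def)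
        then show False using q by simp
      qed
      then show ?thesis by (simp add: halted_def)
    qed
    ultimately show ?thesis by auto
  qed
  moreover have "num_tapes M = n" by (simp add: M_def)
  ultimately show ?thesis by (intro exI[of _ M] conjI allI impI)
qed

section \<open>Counter programs\<close>

text \<open>A counter is a tape with a mark at position 0; its value is the position of the head.\<close>

definition counter_tape :: "nat \<Rightarrow> tape" where
  "counter_tape v = ((\<lambda>p. if p = 0 then 1 else 0), int v)"

type_synonym cstate = "(nat \<Rightarrow> nat) \<times> int \<times> bool list"

text \<open>The first tape holds the input, the last one the output, the \<open>m\<close> tapes between them are
  counters.\<close>

definition conf :: "bool list \<Rightarrow> nat \<Rightarrow> cstate \<Rightarrow> tape list" where
  "conf w m s = (case s of (\<rho>, h, out) \<Rightarrow>
     (word_contents w, h) # map (\<lambda>r. counter_tape (\<rho> r)) [0..<m] @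
     [(word_contents out, int (length out))])"

lemma length_conf [simp]: "length (conf w m s) = m + 2"
  by (simp add: conf_def split: prod.split)

lemma conf_nth_counter: "r < m \<Longrightarrow> conf w m (\<rho>, h, out) ! Suc r = counter_tape (\<rho> r)"
  by (simp add: conf_def nth_append)

lemma conf_update_counter:
  "r < m \<Longrightarrow> (conf w m (\<rho>, h, out))[Suc r := counter_tape v] = conf w m (\<rho>(r := v), h, out)"
  by (rule nth_equalityI)
    (auto simp: conf_def nth_append nth_list_update nth_Cons' split: if_splits)

lemma read_counter [simp]: "read_tape (counter_tape v) = (if v = 0 then 1 else 0)"
  by (simp add: read_tape_def counter_tape_def)

definition inc :: "nat \<Rightarrow> com" where "inc r = Act (Suc r) (\<lambda>s. (s, 1))"
definition dec :: "nat \<Rightarrow> com" where "dec r = Act (Suc r) (\<lambda>s. (s, if s = 1 then 0 else -1))"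
definition move :: "int \<Rightarrow> com" where "move d = Act 0 (\<lambda>s. (s, d))"
definition emit :: "nat \<Rightarrow> bool \<Rightarrow> com" where
  "emit m b = Act (Suc m) (\<lambda>s. (if b then 2 else 1, 1))"
definition loop :: "nat \<Rightarrow> com \<Rightarrow> com" where "loop r c = While (Suc r) 1 c"
definition ifzero :: "nat \<Rightarrow> com \<Rightarrow> com \<Rightarrow> com" where "ifzero r c d = Cond (Suc r) 1 c d"

text \<open>A bound instead of the exact time, so that the costs of composite programs may be
  rounded up.\<close>

definition runs :: "bool list \<Rightarrow> nat \<Rightarrow> com \<Rightarrow> cstate \<Rightarrow> nat \<Rightarrow> cstate \<Rightarrow> bool" where
  "runs w m c s B s' \<longleftrightarrow> (\<exists>t\<le>B. exec c (conf w m s) t (conf w m s'))"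

lemma runs_cong: "runs w m c s B s' \<Longrightarrow> s' = t \<Longrightarrow> B \<le> B' \<Longrightarrow> runs w m c s B' t"
  using order_trans by (auto simp: runs_def)

lemma runs_inc: "r < m \<Longrightarrow> runs w m (inc r) (\<rho>, h, out) 1 (\<rho>(r := Suc (\<rho> r)), h, out)"
proof -
  assume r: "r < m"
  have "act_tape (read_tape (counter_tape (\<rho> r)), 1) (counter_tape (\<rho> r)) = counter_tape (Suc (\<rho> r))"
    by (auto simp: act_tape_def counter_tape_def read_tape_def)
  then have "exec (inc r) (conf w m (\<rho>, h, out)) 1 (conf w m (\<rho>(r := Suc (\<rho> r)), h, out))"
    using exec_Act[of "Suc r" "conf w m (\<rho>, h, out)" "\<lambda>s. (s, 1)"] r
    by (simp add: inc_def conf_nth_counter conf_update_counter del: read_counter)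
  then show ?thesis unfolding runs_def by blast
qed

lemma runs_dec: "r < m \<Longrightarrow> runs w m (dec r) (\<rho>, h, out) 1 (\<rho>(r := \<rho> r - 1), h, out)"
proof -
  assume r: "r < m"
  have "act_tape (read_tape (counter_tape (\<rho> r)), if read_tape (counter_tape (\<rho> r)) = 1 then 0 else -1)
      (counter_tape (\<rho> r)) = counter_tape (\<rho> r - 1)"
    by (auto simp: act_tape_def counter_tape_def read_tape_def)
  then have "exec (dec r) (conf w m (\<rho>, h, out)) 1 (conf w m (\<rho>(r := \<rho> r - 1), h, out))"
    using exec_Act[of "Suc r" "conf w m (\<rho>, h, out)" "\<lambda>s. (s, if s = 1 then 0 else -1)"] r
    by (simp add: dec_def conf_nth_counter conf_update_counter del: read_counter)
  then show ?thesis unfolding runs_def by blast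
qed

lemma runs_move: "runs w m (move d) (\<rho>, h, out) 1 (\<rho>, h + d, out)"
proof -
  have "(conf w m (\<rho>, h, out))[0 := act_tape (read_tape (conf w m (\<rho>, h, out) ! 0), d)
      (conf w m (\<rho>, h, out) ! 0)] = conf w m (\<rho>, h + d, out)"
    by (simp add: conf_def act_tape_def read_tape_def)
  then show ?thesis using exec_Act[of 0 "conf w m (\<rho>, h, out)" "\<lambda>s. (s, d)"]
    unfolding runs_def move_def by (intro exI[of _ 1]) simp
qed

lemma word_contents_snoc:
  "(word_contents out)(int (length out) := if b then 2 else 1) = word_contents (out @ [b])"
  by (rule ext) (auto simp: word_contents_def nth_append)

lemma runs_emit: "runs w m (emit m b) (\<rho>, h, out) 1 (\<rho>, h, out @ [b])"
proof -
  have "(conf w m (\<rho>, h, out))[Suc m := act_tape (if b then 2 else 1, 1)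
      (conf w m (\<rho>, h, out) ! Suc m)] = conf w m (\<rho>, h, out @ [b])"
    using word_contents_snoc[of out b]
    by (simp add: conf_def act_tape_def nth_append list_update_append)
  then show ?thesis
    using exec_Act[of "Suc m" "conf w m (\<rho>, h, out)" "\<lambda>s. (if b then 2 else 1, 1)"]
    unfolding runs_def emit_def by (intro exI[of _ 1]) simp
qed

lemma runs_Seq:
  "runs w m c s A s' \<Longrightarrow> runs w m d s' B s'' \<Longrightarrow> runs w m (Seq c d) s (A + B + 1) s''"
proof -
  assume "runs w m c s A s'" "runs w m d s' B s''"
  then obtain a b where "a \<le> A" "exec c (conf w m s) a (conf w m s')"
    "b \<le> B" "exec d (conf w m s') b (conf w m s'')" unfolding runs_def by blast
  then show ?thesis unfolding runs_def by (intro exI[of _ "Suc (a + b)"]) (auto intro: exec_Seq)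
qed

lemma runs_While_stop:
  "i < m + 2 \<Longrightarrow> read_tape (conf w m s ! i) = a \<Longrightarrow> runs w m (While i a c) s 1 s"
  unfolding runs_def by (auto intro!: exI[of _ 1] exec_While_stop)

lemma runs_While_loop:
  "i < m + 2 \<Longrightarrow> read_tape (conf w m s ! i) \<noteq> a \<Longrightarrow> runs w m c s A s' \<Longrightarrow>
   runs w m (While i a c) s' B s'' \<Longrightarrow> runs w m (While i a c) s (A + B + 1) s''"
proof -
  assume i: "i < m + 2" "read_tape (conf w m s ! i) \<noteq> a"
    and "runs w m c s A s'" "runs w m (While i a c) s' B s''"
  then obtain t u where "t \<le> A" "exec c (conf w m s) t (conf w m s')"
    "u \<le> B" "exec (While i a c) (conf w m s') u (conf w m s'')" unfolding runs_def by blast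
  then show ?thesis using i unfolding runs_def
    by (intro exI[of _ "Suc (t + u)"]) (auto intro: exec_While_loop)
qed

lemma runs_While:
  assumes "i < m + 2" "\<And>j. j < k \<Longrightarrow> runs w m c (\<sigma> j) B (\<sigma> (Suc j))"
    "\<And>j. j < k \<Longrightarrow> read_tape (conf w m (\<sigma> j) ! i) \<noteq> a" "read_tape (conf w m (\<sigma> k) ! i) = a"
  shows "runs w m (While i a c) (\<sigma> 0) (k * (B + 1) + 1) (\<sigma> k)"
proof -
  have "runs w m (While i a c) (\<sigma> (k - j)) (j * (B + 1) + 1) (\<sigma> k)" if "j \<le> k" for j
    using that
  proof (induction j)
    case 0
    then show ?case using runs_While_stop[of i m w "\<sigma> k" a c] assms by simp
  next
    case (Suc j)
    then have lt: "k - Suc j < k" and eq: "k - j = Suc (k - Suc j)" by simp_all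
    have "runs w m (While i a c) (\<sigma> (Suc (k - Suc j))) (j * (B + 1) + 1) (\<sigma> k)"
      using Suc eq by simp
    from runs_While_loop[OF assms(1) assms(3)[OF lt] assms(2)[OF lt] this]
    show ?case by (rule runs_cong) simp_all
  qed
  from this[of k] show ?thesis by simp
qed

lemma read_conf: "r < m \<Longrightarrow> read_tape (conf w m s ! Suc r) = (if fst s r = 0 then 1 else 0)"
  by (cases s) (simp add: conf_nth_counter)

lemma runs_loop:
  assumes "r < m" "\<And>j. j < k \<Longrightarrow> runs w m c (\<sigma> j) B (\<sigma> (Suc j))"
    "\<And>j. j < k \<Longrightarrow> fst (\<sigma> j) r \<noteq> 0" "fst (\<sigma> k) r = 0"
  shows "runs w m (loop r c) (\<sigma> 0) (k * (B + 1) + 1) (\<sigma> k)"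
  unfolding loop_def by (rule runs_While) (use assms in \<open>simp_all add: read_conf\<close>)

lemma runs_loop_stop: "r < m \<Longrightarrow> fst s r = 0 \<Longrightarrow> runs w m (loop r c) s 1 s"
  using runs_loop[of r m 0 w c "\<lambda>_. s" 0] by simp

lemma runs_loop_step:
  "r < m \<Longrightarrow> fst s r \<noteq> 0 \<Longrightarrow> runs w m c s A s' \<Longrightarrow> runs w m (loop r c) s' B s'' \<Longrightarrow>
   runs w m (loop r c) s (A + B + 1) s''"
  using runs_While_loop[of "Suc r" m w s 1 c A s' B s''] by (simp add: loop_def read_conf)

lemma runs_Cond:
  "i < m + 2 \<Longrightarrow> runs w m (if read_tape (conf w m s ! i) = a then c else d) s B s' \<Longrightarrow>
   runs w m (Cond i a c d) s (B + 1) s'"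
proof -
  assume i: "i < m + 2" and "runs w m (if read_tape (conf w m s ! i) = a then c else d) s B s'"
  then obtain t where "t \<le> B"
    "exec (if read_tape (conf w m s ! i) = a then c else d) (conf w m s) t (conf w m s')"
    unfolding runs_def by blast
  then show ?thesis using i unfolding runs_def
    by (intro exI[of _ "Suc t"]) (auto intro!: exec_Cond)
qed

lemma runs_ifzero:
  "r < m \<Longrightarrow> runs w m (if fst s r = 0 then c else d) s B s' \<Longrightarrow>
   runs w m (ifzero r c d) s (B + 1) s'"
  using runs_Cond[of "Suc r" m w s 1 c d B s']
  by (cases "fst s r = 0") (simp_all add: ifzero_def read_conf)

text \<open>Reading a counter destroys it. The value is therefore sent to the target and to a
  scratch counter \<open>f\<close> at once, and \<open>runs_restore\<close> rebuilds the source from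
  \<open>f\<close>.\<close>

lemma runs_transfer:
  assumes "r < m" "z < m" "f < m" "r \<noteq> z" "r \<noteq> f" "z \<noteq> f"
  shows "runs w m (loop r (Seq (dec r) (Seq (inc z) (inc f)))) (\<rho>, h, out) (\<rho> r * 6 + 1)
     (\<rho>(r := 0, z := \<rho> z + \<rho> r, f := \<rho> f + \<rho> r), h, out)"
proof -
  define \<sigma> where "\<sigma> j = (\<rho>(r := \<rho> r - j, z := \<rho> z + j, f := \<rho> f + j), h, out)" for j
  have "runs w m (loop r (Seq (dec r) (Seq (inc z) (inc f)))) (\<sigma> 0) (\<rho> r * (5 + 1) + 1) (\<sigma> (\<rho> r))"
  proof (rule runs_loop[OF assms(1)])
    fix j assume "j < \<rho> r"
    then show "runs w m (Seq (dec r) (Seq (inc z) (inc f))) (\<sigma> j) 5 (\<sigma> (Suc j))"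
      unfolding \<sigma>_def
      by (rule_tac runs_cong[OF runs_Seq[OF runs_dec runs_Seq[OF runs_inc runs_inc]]])
        (use assms in \<open>auto simp: fun_eq_iff\<close>)
  qed (use assms in \<open>simp_all add: \<sigma>_def\<close>)
  then show ?thesis by (simp add: \<sigma>_def)
qed

lemma runs_restore:
  assumes "r < m" "f < m" "r \<noteq> f"
  shows "runs w m (loop f (Seq (dec f) (inc r))) (\<rho>, h, out) (\<rho> f * 4 + 1)
     (\<rho>(f := 0, r := \<rho> r + \<rho> f), h, out)"
proof -
  define \<sigma> where "\<sigma> j = (\<rho>(f := \<rho> f - j, r := \<rho> r + j), h, out)" for j
  have "runs w m (loop f (Seq (dec f) (inc r))) (\<sigma> 0) (\<rho> f * (3 + 1) + 1) (\<sigma> (\<rho> f))"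
  proof (rule runs_loop[OF assms(2)])
    fix j assume "j < \<rho> f"
    then show "runs w m (Seq (dec f) (inc r)) (\<sigma> j) 3 (\<sigma> (Suc j))"
      unfolding \<sigma>_def
      by (rule_tac runs_cong[OF runs_Seq[OF runs_dec runs_inc]])
        (use assms in \<open>auto simp: fun_eq_iff\<close>)
  qed (use assms in \<open>simp_all add: \<sigma>_def\<close>)
  then show ?thesis by (simp add: \<sigma>_def)
qed

lemma runs_shift:
  assumes "f < m"
  shows "runs w m (loop f (Seq (dec f) (move d))) (\<rho>, h, out) (\<rho> f * 4 + 1)
     (\<rho>(f := 0), h + int (\<rho> f) * d, out)"
proof -
  define \<sigma> where "\<sigma> j = (\<rho>(f := \<rho> f - j), h + int j * d, out)" for j
  have "runs w m (loop f (Seq (dec f) (move d))) (\<sigma> 0) (\<rho> f * (3 + 1) + 1) (\<sigma> (\<rho> f))"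
  proof (rule runs_loop[OF assms])
    fix j assume "j < \<rho> f"
    then show "runs w m (Seq (dec f) (move d)) (\<sigma> j) 3 (\<sigma> (Suc j))"
      unfolding \<sigma>_def
      by (rule_tac runs_cong[OF runs_Seq[OF runs_dec runs_move]])
        (use assms in \<open>auto simp: fun_eq_iff algebra_simps\<close>)
  qed (use assms in \<open>simp_all add: \<sigma>_def\<close>)
  then show ?thesis by (simp add: \<sigma>_def)
qed

lemma runs_clear:
  assumes "f < m"
  shows "runs w m (loop f (dec f)) (\<rho>, h, out) (\<rho> f * 2 + 1) (\<rho>(f := 0), h, out)"
proof -
  define \<sigma> where "\<sigma> j = (\<rho>(f := \<rho> f - j), h, out)" for j
  have "runs w m (loop f (dec f)) (\<sigma> 0) (\<rho> f * (1 + 1) + 1) (\<sigma> (\<rho> f))"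
  proof (rule runs_loop[OF assms])
    fix j assume "j < \<rho> f"
    then show "runs w m (dec f) (\<sigma> j) 1 (\<sigma> (Suc j))"
      unfolding \<sigma>_def
      by (rule_tac runs_cong[OF runs_dec]) (use assms in \<open>auto simp: fun_eq_iff\<close>)
  qed (use assms in \<open>simp_all add: \<sigma>_def\<close>)
  then show ?thesis by (simp add: \<sigma>_def mult_2_right)
qed

subsection \<open>Polynomially bounded functions\<close>

text \<open>A single power as bound, from 2 on: a sum is absorbed by one more factor because
  \<open>2 * N ^ k \<le> N ^ (k + 1)\<close>, and a constant \<open>c\<close> because
  \<open>c \<le> 2 ^ c\<close>.\<close>

definition poly_bounded :: "(nat \<Rightarrow> nat) \<Rightarrow> bool" where
  "poly_bounded g \<longleftrightarrow> (\<exists>k. \<forall>N\<ge>2. g N \<le> N ^ k)"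

lemma less_two_power: "(k::nat) \<le> 2 ^ k"
  by (simp add: less_imp_le)

lemma poly_bounded_const: "poly_bounded (\<lambda>_. c)"
  unfolding poly_bounded_def
  by (intro exI[of _ c] allI impI) (meson le_trans less_two_power power_mono zero_le)

lemma poly_bounded_id: "poly_bounded (\<lambda>N. N)"
  unfolding poly_bounded_def by (intro exI[of _ 1]) simp

lemma poly_bounded_mult:
  assumes "poly_bounded g" "poly_bounded h" shows "poly_bounded (\<lambda>N. g N * h N)"
proof -
  obtain j k where "\<forall>N\<ge>2. g N \<le> N ^ j" "\<forall>N\<ge>2. h N \<le> N ^ k"
    using assms by (auto simp: poly_bounded_def)
  then have "\<forall>N\<ge>2. g N * h N \<le> N ^ (j + k)" by (simp add: power_add mult_mono)
  then show ?thesis unfolding poly_bounded_def by blast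
qed

lemma poly_bounded_add:
  assumes "poly_bounded g" "poly_bounded h" shows "poly_bounded (\<lambda>N. g N + h N)"
proof -
  obtain j k where j: "\<forall>N\<ge>2. g N \<le> N ^ j" and k: "\<forall>N\<ge>2. h N \<le> N ^ k"
    using assms by (auto simp: poly_bounded_def)
  have "g N + h N \<le> N ^ (j + k + 1)" if N: "N \<ge> 2" for N
  proof -
    have "N ^ j \<le> N ^ (j + k)" "N ^ k \<le> N ^ (j + k)" using N by (simp_all add: power_increasing)
    then have "g N + h N \<le> 2 * N ^ (j + k)"
      using j k N by (metis add_mono le_trans mult_2)
    also have "\<dots> \<le> N * N ^ (j + k)" using N by (intro mult_right_mono) auto
    finally show ?thesis by simp
  qed
  then show ?thesis unfolding poly_bounded_def by blast
qed

text \<open>For loops, whose bodies run in an environment with a larger bound.\<close>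

lemma poly_bounded_comp:
  assumes "poly_bounded g" "poly_bounded h" "\<And>N. 2 \<le> N \<Longrightarrow> 2 \<le> h N"
  shows "poly_bounded (\<lambda>N. g (h N))"
proof -
  obtain j k where j: "\<forall>N\<ge>2. g N \<le> N ^ j" and k: "\<forall>N\<ge>2. h N \<le> N ^ k"
    using assms by (auto simp: poly_bounded_def)
  have "g (h N) \<le> N ^ (k * j)" if N: "N \<ge> 2" for N
  proof -
    have "g (h N) \<le> h N ^ j" using j assms(3)[OF N] by simp
    also have "\<dots> \<le> (N ^ k) ^ j" using k N by (intro power_mono) auto
    finally show ?thesis by (simp add: power_mult)
  qed
  then show ?thesis unfolding poly_bounded_def by blast
qed

lemmas poly_bounded_intros =
  poly_bounded_const poly_bounded_id poly_bounded_mult poly_bounded_add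

subsection \<open>Arithmetic expressions\<close>

text \<open>\<open>Sym a b\<close> is the input symbol at position \<open>a - b\<close>.\<close>

datatype expr = Var nat | Num nat | Len | Plus expr expr | Times expr expr | Minus expr expr
  | Sym expr expr

primrec val :: "bool list \<Rightarrow> (nat \<Rightarrow> nat) \<Rightarrow> expr \<Rightarrow> nat" where
  "val w \<rho> (Var r) = \<rho> r"
| "val w \<rho> (Num c) = c"
| "val w \<rho> Len = length w"
| "val w \<rho> (Plus a b) = val w \<rho> a + val w \<rho> b"
| "val w \<rho> (Times a b) = val w \<rho> a * val w \<rho> b"
| "val w \<rho> (Minus a b) = val w \<rho> a - val w \<rho> b"
| "val w \<rho> (Sym a b) = word_contents w (int (val w \<rho> a) - int (val w \<rho> b))"

primrec var_bound :: "expr \<Rightarrow> nat" where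
  "var_bound (Var r) = Suc r"
| "var_bound (Num c) = 0"
| "var_bound Len = 0"
| "var_bound (Plus a b) = max (var_bound a) (var_bound b)"
| "var_bound (Times a b) = max (var_bound a) (var_bound b)"
| "var_bound (Minus a b) = max (var_bound a) (var_bound b)"
| "var_bound (Sym a b) = max (var_bound a) (var_bound b)"

primrec temps :: "expr \<Rightarrow> nat" where
  "temps (Var r) = 1"
| "temps (Num c) = 0"
| "temps Len = 1"
| "temps (Plus a b) = max (temps a) (temps b)"
| "temps (Times a b) = 1 + max (temps a) (temps b)"
| "temps (Minus a b) = 2 + max (temps a) (temps b)"
| "temps (Sym a b) = 4 + max (temps a) (temps b)"

text \<open>Adds the value of an expression to the counter \<open>z\<close>; counters from \<open>f\<close> on are free.\<close>

primrec add_expr :: "expr \<Rightarrow> nat \<Rightarrow> nat \<Rightarrow> com" where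
  "add_expr (Var r) z f =
     Seq (loop r (Seq (dec r) (Seq (inc z) (inc f)))) (loop f (Seq (dec f) (inc r)))"
| "add_expr (Num c) z f = (Seq (inc z) ^^ c) (move 0)"
| "add_expr Len z f =
     Seq (While 0 0 (Seq (inc z) (Seq (inc f) (move 1)))) (loop f (Seq (dec f) (move (-1))))"
| "add_expr (Plus a b) z f = Seq (add_expr a z f) (add_expr b z f)"
| "add_expr (Times a b) z f =
     Seq (add_expr a f (f + 1)) (loop f (Seq (dec f) (add_expr b z (f + 1))))"
| "add_expr (Minus a b) z f =
     Seq (add_expr a f (f + 2)) (Seq (add_expr b (f + 1) (f + 2))
       (Seq (loop (f + 1) (Seq (dec (f + 1)) (dec f))) (loop f (Seq (dec f) (inc z)))))"
| "add_expr (Sym a b) z f =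
     Seq (add_expr a f (f + 4)) (Seq (add_expr b (f + 1) (f + 4))
     (Seq (add_expr a (f + 2) (f + 4)) (Seq (add_expr b (f + 3) (f + 4))
     (Seq (loop f (Seq (dec f) (move 1))) (Seq (loop (f + 1) (Seq (dec (f + 1)) (move (-1))))
     (Seq (Cond 0 0 (move 0) (Cond 0 1 (inc z) (Seq (inc z) (inc z))))
     (Seq (loop (f + 3) (Seq (dec (f + 3)) (move 1)))
       (loop (f + 2) (Seq (dec (f + 2)) (move (-1)))))))))))"

definition env_bounded :: "bool list \<Rightarrow> (nat \<Rightarrow> nat) \<Rightarrow> nat \<Rightarrow> nat \<Rightarrow> bool" where
  "env_bounded w \<rho> k N \<longleftrightarrow> 2 \<le> N \<and> length w \<le> N \<and> (\<forall>r<k. \<rho> r \<le> N)"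

lemma env_bounded_max:
  "env_bounded w \<rho> (max j k) N \<longleftrightarrow> env_bounded w \<rho> j N \<and> env_bounded w \<rho> k N"
  by (auto simp: env_bounded_def less_max_iff_disj)

lemma val_bounded:
  "\<exists>g. poly_bounded g \<and> (\<forall>w \<rho> N. env_bounded w \<rho> (var_bound e) N \<longrightarrow> val w \<rho> e \<le> g N)"
proof (induction e)
  case (Var r)
  show ?case by (intro exI[of _ "\<lambda>N. N"]) (auto simp: env_bounded_def poly_bounded_intros)
next
  case (Num c)
  show ?case by (intro exI[of _ "\<lambda>_. c"]) (auto simp: poly_bounded_intros)
next
  case Len
  show ?case by (intro exI[of _ "\<lambda>N. N"]) (auto simp: env_bounded_def poly_bounded_intros)
next
  case (Plus a b)
  then obtain g h where "poly_bounded g" "\<forall>w \<rho> N. env_bounded w \<rho> (var_bound a) N \<longrightarrow> val w \<rho> a \<le> g N"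
    "poly_bounded h" "\<forall>w \<rho> N. env_bounded w \<rho> (var_bound b) N \<longrightarrow> val w \<rho> b \<le> h N" by blast
  then show ?case
    by (intro exI[of _ "\<lambda>N. g N + h N"] conjI allI impI poly_bounded_intros)
      (simp_all add: env_bounded_max add_mono)
next
  case (Times a b)
  then obtain g h where "poly_bounded g" "\<forall>w \<rho> N. env_bounded w \<rho> (var_bound a) N \<longrightarrow> val w \<rho> a \<le> g N"
    "poly_bounded h" "\<forall>w \<rho> N. env_bounded w \<rho> (var_bound b) N \<longrightarrow> val w \<rho> b \<le> h N" by blast
  then show ?case
    by (intro exI[of _ "\<lambda>N. g N * h N"] conjI allI impI poly_bounded_intros)
      (simp_all add: env_bounded_max mult_le_mono)
next
  case (Minus a b)
  then obtain g where "poly_bounded g" "\<forall>w \<rho> N. env_bounded w \<rho> (var_bound a) N \<longrightarrow> val w \<rho> a \<le> g N"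
    by blast
  then show ?case
    by (intro exI[of _ g] conjI allI impI)
      (simp_all add: env_bounded_max le_trans[OF diff_le_self])
next
  case (Sym a b)
  show ?case by (intro exI[of _ "\<lambda>_. 2"]) (auto simp: word_contents_def poly_bounded_intros)
qed

lemma val_upd [simp]: "var_bound e \<le> r \<Longrightarrow> val w (\<rho>(r := v)) e = val w \<rho> e"
  by (induction e) auto

lemma env_bounded_upd [simp]: "k \<le> r \<Longrightarrow> env_bounded w (\<rho>(r := v)) k N = env_bounded w \<rho> k N"
  by (auto simp: env_bounded_def)

text \<open>The contract of \<open>add_expr\<close>. The target lies above the variables of the
  expression, the counters from \<open>f\<close> on are zero before and after, the input head starts
  and ends at the origin, and the time depends on the bound \<open>N\<close> of the environment
  only.\<close>

definition adds :: "expr \<Rightarrow> (nat \<Rightarrow> nat) \<Rightarrow> bool" where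
  "adds e g \<longleftrightarrow> (\<forall>w m \<rho> z f N prog_out. var_bound e \<le> z \<longrightarrow> z < f \<longrightarrow> f + temps e \<le> m \<longrightarrow>
     (\<forall>r\<ge>f. \<rho> r = 0) \<longrightarrow> env_bounded w \<rho> (var_bound e) N \<longrightarrow>
     runs w m (add_expr e z f) (\<rho>, 0, prog_out) (g N) (\<rho>(z := \<rho> z + val w \<rho> e), 0, prog_out))"

lemma addsD:
  assumes "adds e g" "var_bound e \<le> z" "z < f" "f + temps e \<le> m" "\<forall>r\<ge>f. \<rho> r = 0"
    "env_bounded w \<rho> (var_bound e) N"
  shows "runs w m (add_expr e z f) (\<rho>, 0, prog_out) (g N) (\<rho>(z := \<rho> z + val w \<rho> e), 0, prog_out)"
  using assms unfolding adds_def by blast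

lemma adds_Var: "adds (Var r) (\<lambda>N. N * 10 + 3)"
  unfolding adds_def
proof (intro allI impI)
  fix w m \<rho> z f N and prog_out :: "bool list"
  assume a: "var_bound (Var r) \<le> z" "z < f" "f + temps (Var r) \<le> m" "\<forall>r\<ge>f. \<rho> r = 0"
    "env_bounded w \<rho> (var_bound (Var r)) N"
  have lt: "r < m" "z < m" "f < m" "r \<noteq> z" "r \<noteq> f" "z \<noteq> f" and f0: "\<rho> f = 0" using a by auto
  have "\<rho> r \<le> N" using a by (auto simp: env_bounded_def)
  then show "runs w m (add_expr (Var r) z f) (\<rho>, 0, prog_out) (N * 10 + 3)
      (\<rho>(z := \<rho> z + val w \<rho> (Var r)), 0, prog_out)"
    unfolding add_expr.simps
    by (intro runs_cong[OF runs_Seq[OF runs_transfer[OF lt] runs_restore[OF lt(1,3,5)]]])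
      (use lt f0 in \<open>auto simp: fun_eq_iff\<close>)
qed

lemma adds_Num: "adds (Num c) (\<lambda>N. 2 * c + 1)"
  unfolding adds_def
proof (intro allI impI)
  fix w m \<rho> z f N and prog_out :: "bool list"
  assume a: "z < f" "f + temps (Num c) \<le> m"
  have "runs w m ((Seq (inc z) ^^ c) (move 0)) (\<rho>, 0, prog_out) (2 * c + 1) (\<rho>(z := \<rho> z + c), 0, prog_out)"
    for \<rho>
  proof (induction c arbitrary: \<rho>)
    case 0
    then show ?case using runs_move[of w m 0 \<rho> 0 prog_out] by simp
  next
    case (Suc c)
    show ?case unfolding funpow.simps o_def
      by (rule runs_cong[OF runs_Seq[OF runs_inc Suc]]) (use a in auto)
  qed
  then show "runs w m (add_expr (Num c) z f) (\<rho>, 0, prog_out) (2 * c + 1)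
      (\<rho>(z := \<rho> z + val w \<rho> (Num c)), 0, prog_out)" by simp
qed

lemma adds_Len: "adds Len (\<lambda>N. N * 10 + 3)"
  unfolding adds_def
proof (intro allI impI)
  fix w m \<rho> z f N and prog_out :: "bool list"
  assume a: "z < f" "f + temps Len \<le> m" "\<forall>r\<ge>f. \<rho> r = 0" "env_bounded w \<rho> (var_bound Len) N"
  then have lt: "f < m" "z < m" and f0: "\<rho> f = 0" and N: "length w \<le> N"
    by (auto simp: env_bounded_def)
  define \<sigma> where "\<sigma> j = (\<rho>(z := \<rho> z + j, f := j), int j, prog_out)" for j
  have 1: "runs w m (While 0 0 (Seq (inc z) (Seq (inc f) (move 1)))) (\<sigma> 0)
      (length w * (5 + 1) + 1) (\<sigma> (length w))"
  proof (rule runs_While)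
    fix j
    show "runs w m (Seq (inc z) (Seq (inc f) (move 1))) (\<sigma> j) 5 (\<sigma> (Suc j))"
      unfolding \<sigma>_def
      by (rule runs_cong[OF runs_Seq[OF runs_inc runs_Seq[OF runs_inc runs_move]]])
        (use lt a in \<open>auto simp: fun_eq_iff\<close>)
  qed (auto simp: \<sigma>_def conf_def read_tape_def word_contents_def)
  have s0: "\<sigma> 0 = (\<rho>, 0, prog_out)" using f0 by (auto simp: \<sigma>_def fun_eq_iff)
  show "runs w m (add_expr Len z f) (\<rho>, 0, prog_out) (N * 10 + 3)
      (\<rho>(z := \<rho> z + val w \<rho> Len), 0, prog_out)"
    unfolding add_expr.simps s0[symmetric]
    by (rule runs_cong[OF runs_Seq[OF 1[unfolded \<sigma>_def[of "length w"]] runs_shift[OF lt(1)]]])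
      (use a f0 N in \<open>auto simp: fun_eq_iff\<close>)
qed

lemma adds_Plus:
  assumes "adds a g" "adds b h" shows "adds (Plus a b) (\<lambda>N. g N + h N + 1)"
  unfolding adds_def
proof (intro allI impI)
  fix w m \<rho> z f N and prog_out :: "bool list"
  assume a: "var_bound (Plus a b) \<le> z" "z < f" "f + temps (Plus a b) \<le> m" "\<forall>r\<ge>f. \<rho> r = 0"
    "env_bounded w \<rho> (var_bound (Plus a b)) N"
  show "runs w m (add_expr (Plus a b) z f) (\<rho>, 0, prog_out) (g N + h N + 1)
      (\<rho>(z := \<rho> z + val w \<rho> (Plus a b)), 0, prog_out)"
    unfolding add_expr.simps
    by (rule runs_cong[OF runs_Seq[OF addsD[OF assms(1)] addsD[OF assms(2)]]])
      (use a in \<open>auto simp: env_bounded_max\<close>)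
qed

text \<open>Repeated addition of \<open>b\<close>; the bound \<open>va\<close> on the value of
  \<open>a\<close> limits the number of rounds.\<close>

lemma adds_Times:
  assumes "adds a g" "adds b h"
    and v: "\<And>w \<rho> N. env_bounded w \<rho> (var_bound a) N \<Longrightarrow> val w \<rho> a \<le> va N"
  shows "adds (Times a b) (\<lambda>N. g N + (va N * (h N + 3) + 1) + 1)"
  unfolding adds_def
proof (intro allI impI)
  fix w m \<rho> z f N and prog_out :: "bool list"
  assume a: "var_bound (Times a b) \<le> z" "z < f" "f + temps (Times a b) \<le> m" "\<forall>r\<ge>f. \<rho> r = 0"
    "env_bounded w \<rho> (var_bound (Times a b)) N"
  define \<sigma> where "\<sigma> j = (\<rho>(f := val w \<rho> a - j, z := \<rho> z + j * val w \<rho> b), 0::int, prog_out)" for j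
  have 1: "runs w m (add_expr a f (f + 1)) (\<rho>, 0, prog_out) (g N) (\<sigma> 0)"
    unfolding \<sigma>_def
    by (rule runs_cong[OF addsD[OF assms(1)]]) (use a in \<open>auto simp: env_bounded_max fun_eq_iff\<close>)
  have 2: "runs w m (loop f (Seq (dec f) (add_expr b z (f + 1)))) (\<sigma> 0)
      (val w \<rho> a * (h N + 2 + 1) + 1) (\<sigma> (val w \<rho> a))"
  proof (rule runs_loop)
    fix j assume "j < val w \<rho> a"
    then show "runs w m (Seq (dec f) (add_expr b z (f + 1))) (\<sigma> j) (h N + 2) (\<sigma> (Suc j))"
      unfolding \<sigma>_def
      by (rule_tac runs_cong[OF runs_Seq[OF runs_dec addsD[OF assms(2)]]])
        (use a in \<open>auto simp: env_bounded_max fun_eq_iff\<close>)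
  qed (use a in \<open>auto simp: \<sigma>_def\<close>)
  have "val w \<rho> a \<le> va N" using v a by (simp add: env_bounded_max)
  then have le: "val w \<rho> a * (h N + 2 + 1) \<le> va N * (h N + 3)" by (rule mult_le_mono) simp
  have eq: "\<sigma> (val w \<rho> a) = (\<rho>(z := \<rho> z + val w \<rho> (Times a b)), 0, prog_out)"
    using a by (auto simp: \<sigma>_def fun_eq_iff)
  show "runs w m (add_expr (Times a b) z f) (\<rho>, 0, prog_out) (g N + (va N * (h N + 3) + 1) + 1)
      (\<rho>(z := \<rho> z + val w \<rho> (Times a b)), 0, prog_out)"
    unfolding add_expr.simps
    by (rule runs_cong[OF runs_Seq[OF 1 2] eq]) (use le in linarith)
qed

lemma adds_Minus:
  assumes "adds a g" "adds b h"
    and va: "\<And>w \<rho> N. env_bounded w \<rho> (var_bound a) N \<Longrightarrow> val w \<rho> a \<le> va N"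
    and vb: "\<And>w \<rho> N. env_bounded w \<rho> (var_bound b) N \<Longrightarrow> val w \<rho> b \<le> vb N"
  shows "adds (Minus a b) (\<lambda>N. g N + (h N + ((vb N * 4 + 1) + (va N * 4 + 1) + 1) + 1) + 1)"
  unfolding adds_def
proof (intro allI impI)
  fix w m \<rho> z f N and prog_out :: "bool list"
  assume a: "var_bound (Minus a b) \<le> z" "z < f" "f + temps (Minus a b) \<le> m" "\<forall>r\<ge>f. \<rho> r = 0"
    "env_bounded w \<rho> (var_bound (Minus a b)) N"
  define \<sigma> where "\<sigma> j = (\<rho>(f := val w \<rho> a - j, f + 1 := val w \<rho> b - j), 0::int, prog_out)" for j
  have 1: "runs w m (add_expr a f (f + 2)) (\<rho>, 0, prog_out) (g N) (\<rho>(f := val w \<rho> a), 0, prog_out)"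
    by (rule runs_cong[OF addsD[OF assms(1)]]) (use a in \<open>auto simp: env_bounded_max\<close>)
  have 2: "runs w m (add_expr b (f + 1) (f + 2)) (\<rho>(f := val w \<rho> a), 0, prog_out) (h N) (\<sigma> 0)"
    unfolding \<sigma>_def
    by (rule runs_cong[OF addsD[OF assms(2)]]) (use a in \<open>auto simp: env_bounded_max fun_eq_iff\<close>)
  have 3: "runs w m (loop (f + 1) (Seq (dec (f + 1)) (dec f))) (\<sigma> 0)
      (val w \<rho> b * (3 + 1) + 1) (\<sigma> (val w \<rho> b))"
  proof (rule runs_loop)
    fix j assume "j < val w \<rho> b"
    then show "runs w m (Seq (dec (f + 1)) (dec f)) (\<sigma> j) 3 (\<sigma> (Suc j))"
      unfolding \<sigma>_def
      by (rule_tac runs_cong[OF runs_Seq[OF runs_dec runs_dec]]) (use a in \<open>auto simp: fun_eq_iff\<close>)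
  qed (use a in \<open>auto simp: \<sigma>_def\<close>)
  have 4: "runs w m (loop f (Seq (dec f) (inc z))) (\<sigma> (val w \<rho> b))
      ((val w \<rho> a - val w \<rho> b) * 4 + 1) (\<rho>(z := \<rho> z + val w \<rho> (Minus a b)), 0, prog_out)"
    unfolding \<sigma>_def
    by (rule runs_cong[OF runs_restore]) (use a in \<open>auto simp: fun_eq_iff\<close>)
  have "val w \<rho> a \<le> va N" "val w \<rho> b \<le> vb N" using va vb a by (simp_all add: env_bounded_max)
  then show "runs w m (add_expr (Minus a b) z f) (\<rho>, 0, prog_out)
      (g N + (h N + ((vb N * 4 + 1) + (va N * 4 + 1) + 1) + 1) + 1)
      (\<rho>(z := \<rho> z + val w \<rho> (Minus a b)), 0, prog_out)"
    unfolding add_expr.simps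
    by (intro runs_cong[OF runs_Seq[OF 1 runs_Seq[OF 2 runs_Seq[OF 3 4]]] refl]) simp
qed

text \<open>The input head walks \<open>a\<close> cells to the right and \<open>b\<close> to the
  left, adds the symbol found to \<open>z\<close>, and walks back. Walking consumes counters, so
  both operands are evaluated twice; this is the reason for four scratch counters.\<close>

lemma adds_Sym:
  assumes "adds a g" "adds b h"
    and va: "\<And>w \<rho> N. env_bounded w \<rho> (var_bound a) N \<Longrightarrow> val w \<rho> a \<le> va N"
    and vb: "\<And>w \<rho> N. env_bounded w \<rho> (var_bound b) N \<Longrightarrow> val w \<rho> b \<le> vb N"
  shows "adds (Sym a b) (\<lambda>N. 2 * g N + 2 * h N + 8 * va N + 8 * vb N + 20)"
  unfolding adds_def
proof (intro allI impI)
  fix w m \<rho> z f N and prog_out :: "bool list"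
  assume a: "var_bound (Sym a b) \<le> z" "z < f" "f + temps (Sym a b) \<le> m" "\<forall>r\<ge>f. \<rho> r = 0"
    "env_bounded w \<rho> (var_bound (Sym a b)) N"
  define x y v where "x = val w \<rho> a" and "y = val w \<rho> b"
    and "v = word_contents w (int x - int y)"
  have r1: "runs w m (add_expr a f (f + 4)) (\<rho>, 0, prog_out) (g N) (\<rho>(f := x), 0, prog_out)"
    by (rule runs_cong[OF addsD[OF assms(1)]]) (use a in \<open>auto simp: env_bounded_max x_def\<close>)
  have r2: "runs w m (add_expr b (f + 1) (f + 4)) (\<rho>(f := x), 0, prog_out) (h N)
      (\<rho>(f := x, f + 1 := y), 0, prog_out)"
    by (rule runs_cong[OF addsD[OF assms(2)]]) (use a in \<open>auto simp: env_bounded_max y_def\<close>)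
  have r3: "runs w m (add_expr a (f + 2) (f + 4)) (\<rho>(f := x, f + 1 := y), 0, prog_out) (g N)
      (\<rho>(f := x, f + 1 := y, f + 2 := x), 0, prog_out)"
    by (rule runs_cong[OF addsD[OF assms(1)]]) (use a in \<open>auto simp: env_bounded_max x_def\<close>)
  have r4: "runs w m (add_expr b (f + 3) (f + 4)) (\<rho>(f := x, f + 1 := y, f + 2 := x), 0, prog_out) (h N)
      (\<rho>(f := x, f + 1 := y, f + 2 := x, f + 3 := y), 0, prog_out)"
    by (rule runs_cong[OF addsD[OF assms(2)]]) (use a in \<open>auto simp: env_bounded_max y_def\<close>)
  have r5: "runs w m (loop f (Seq (dec f) (move 1)))
      (\<rho>(f := x, f + 1 := y, f + 2 := x, f + 3 := y), 0, prog_out) (x * 4 + 1)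
      (\<rho>(f + 1 := y, f + 2 := x, f + 3 := y), int x, prog_out)"
    by (rule runs_cong[OF runs_shift]) (use a in \<open>auto simp: fun_eq_iff\<close>)
  have r6: "runs w m (loop (f + 1) (Seq (dec (f + 1)) (move (- 1))))
      (\<rho>(f + 1 := y, f + 2 := x, f + 3 := y), int x, prog_out) (y * 4 + 1)
      (\<rho>(f + 2 := x, f + 3 := y), int x - int y, prog_out)"
    by (rule runs_cong[OF runs_shift]) (use a in \<open>auto simp: fun_eq_iff\<close>)
  have r7: "runs w m (Cond 0 0 (move 0) (Cond 0 1 (inc z) (Seq (inc z) (inc z))))
      (\<rho>(f + 2 := x, f + 3 := y), int x - int y, prog_out) 5
      (\<rho>(f + 2 := x, f + 3 := y, z := \<rho> z + v), int x - int y, prog_out)" (is "runs w m _ ?s 5 ?t")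
  proof -
    have rd: "read_tape (conf w m ?s ! 0) = v" by (simp add: conf_def read_tape_def v_def)
    have "v = 0 \<or> v = 1 \<or> v = 2" by (auto simp: v_def word_contents_def)
    then consider "v = 0" | "v = 1" | "v = 2" by blast
    then show ?thesis
    proof cases
      case 1
      have "runs w m (move 0) ?s 1 ?t"
        by (rule runs_cong[OF runs_move]) (use a 1 in \<open>auto simp: fun_eq_iff\<close>)
      then have "runs w m (Cond 0 0 (move 0) (Cond 0 1 (inc z) (Seq (inc z) (inc z)))) ?s (1 + 1) ?t"
        by (intro runs_Cond) (use rd 1 in simp_all)
      then show ?thesis by (rule runs_cong) simp_all
    next
      case 2
      have "runs w m (inc z) ?s 1 ?t"
        by (rule runs_cong[OF runs_inc]) (use a 2 in \<open>auto simp: fun_eq_iff\<close>)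
      then have i: "runs w m (Cond 0 1 (inc z) (Seq (inc z) (inc z))) ?s (1 + 1) ?t"
        by (intro runs_Cond) (use rd 2 in simp_all)
      have "runs w m (Cond 0 0 (move 0) (Cond 0 1 (inc z) (Seq (inc z) (inc z)))) ?s (1 + 1 + 1) ?t"
        by (rule runs_Cond) (use rd 2 i in simp_all)
      then show ?thesis by (rule runs_cong) simp_all
    next
      case 3
      have "runs w m (Seq (inc z) (inc z)) ?s 3 ?t"
        by (rule runs_cong[OF runs_Seq[OF runs_inc runs_inc]]) (use a 3 in \<open>auto simp: fun_eq_iff\<close>)
      then have i: "runs w m (Cond 0 1 (inc z) (Seq (inc z) (inc z))) ?s (3 + 1) ?t"
        by (intro runs_Cond) (use rd 3 in simp_all)
      have "runs w m (Cond 0 0 (move 0) (Cond 0 1 (inc z) (Seq (inc z) (inc z)))) ?s (3 + 1 + 1) ?t"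
        by (rule runs_Cond) (use rd 3 i in simp_all)
      then show ?thesis by (rule runs_cong) simp_all
    qed
  qed
  have r8: "runs w m (loop (f + 3) (Seq (dec (f + 3)) (move 1)))
      (\<rho>(f + 2 := x, f + 3 := y, z := \<rho> z + v), int x - int y, prog_out) (y * 4 + 1)
      (\<rho>(f + 2 := x, z := \<rho> z + v), int x, prog_out)"
    by (rule runs_cong[OF runs_shift]) (use a in \<open>auto simp: fun_eq_iff\<close>)
  have r9: "runs w m (loop (f + 2) (Seq (dec (f + 2)) (move (- 1))))
      (\<rho>(f + 2 := x, z := \<rho> z + v), int x, prog_out) (x * 4 + 1) (\<rho>(z := \<rho> z + v), 0, prog_out)"
    by (rule runs_cong[OF runs_shift]) (use a in \<open>auto simp: fun_eq_iff\<close>)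
  have eq: "(\<rho>(z := \<rho> z + v), 0, prog_out) = (\<rho>(z := \<rho> z + val w \<rho> (Sym a b)), 0::int, prog_out)"
    by (simp add: v_def x_def y_def)
  have "x \<le> va N" "y \<le> vb N" using va vb a by (simp_all add: env_bounded_max x_def y_def)
  then show "runs w m (add_expr (Sym a b) z f) (\<rho>, 0, prog_out)
      (2 * g N + 2 * h N + 8 * va N + 8 * vb N + 20) (\<rho>(z := \<rho> z + val w \<rho> (Sym a b)), 0, prog_out)"
    unfolding add_expr.simps
    by (intro runs_cong[OF runs_Seq[OF r1 runs_Seq[OF r2 runs_Seq[OF r3 runs_Seq[OF r4
      runs_Seq[OF r5 runs_Seq[OF r6 runs_Seq[OF r7 runs_Seq[OF r8 r9]]]]]]]] eq]) linarith
qed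

lemma adds_exists: "\<exists>g. poly_bounded g \<and> adds e g"
proof (induction e)
  case (Var r)
  show ?case by (intro exI[of _ "\<lambda>N. N * 10 + 3"] conjI adds_Var poly_bounded_intros)
next
  case (Num c)
  show ?case by (intro exI[of _ "\<lambda>N. 2 * c + 1"] conjI adds_Num poly_bounded_intros)
next
  case Len
  show ?case by (intro exI[of _ "\<lambda>N. N * 10 + 3"] conjI adds_Len poly_bounded_intros)
next
  case (Plus a b)
  then obtain g h where gh: "poly_bounded g" "adds a g" "poly_bounded h" "adds b h" by blast
  have "poly_bounded (\<lambda>N. g N + h N + 1)" by (intro poly_bounded_intros gh)
  then show ?case using adds_Plus[OF gh(2,4)] by blast
next
  case (Times a b)
  then obtain g h where gh: "poly_bounded g" "adds a g" "poly_bounded h" "adds b h" by blast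
  obtain va where va: "poly_bounded va"
    "\<And>w \<rho> N. env_bounded w \<rho> (var_bound a) N \<Longrightarrow> val w \<rho> a \<le> va N" using val_bounded[of a] by blast
  have "poly_bounded (\<lambda>N. g N + (va N * (h N + 3) + 1) + 1)"
    by (intro poly_bounded_intros gh va)
  then show ?case using adds_Times[where va = va, OF gh(2,4) va(2)] by blast
next
  case (Minus a b)
  then obtain g h where gh: "poly_bounded g" "adds a g" "poly_bounded h" "adds b h" by blast
  obtain va where va: "poly_bounded va"
    "\<And>w \<rho> N. env_bounded w \<rho> (var_bound a) N \<Longrightarrow> val w \<rho> a \<le> va N" using val_bounded[of a] by blast
  obtain vb where vb: "poly_bounded vb"
    "\<And>w \<rho> N. env_bounded w \<rho> (var_bound b) N \<Longrightarrow> val w \<rho> b \<le> vb N" using val_bounded[of b] by blast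
  have "poly_bounded (\<lambda>N. g N + (h N + ((vb N * 4 + 1) + (va N * 4 + 1) + 1) + 1) + 1)"
    by (intro poly_bounded_intros gh va vb)
  then show ?case using adds_Minus[where va = va and vb = vb, OF gh(2,4) va(2) vb(2)] by blast
next
  case (Sym a b)
  then obtain g h where gh: "poly_bounded g" "adds a g" "poly_bounded h" "adds b h" by blast
  obtain va where va: "poly_bounded va"
    "\<And>w \<rho> N. env_bounded w \<rho> (var_bound a) N \<Longrightarrow> val w \<rho> a \<le> va N" using val_bounded[of a] by blast
  obtain vb where vb: "poly_bounded vb"
    "\<And>w \<rho> N. env_bounded w \<rho> (var_bound b) N \<Longrightarrow> val w \<rho> b \<le> vb N" using val_bounded[of b] by blast
  have "poly_bounded (\<lambda>N. 2 * g N + 2 * h N + 8 * va N + 8 * vb N + 20)"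
    by (intro poly_bounded_intros gh va vb)
  then show ?case using adds_Sym[where va = va and vb = vb, OF gh(2,4) va(2) vb(2)] by blast
qed

subsection \<open>A language for emitting words\<close>

datatype stm = Emit bool | Nop | Then stm stm | IfZ expr stm stm | For expr stm | EmitBin expr

text \<open>At level \<open>f\<close>, a loop keeps its index in counter \<open>f\<close> and the number of remaining rounds in
  counter \<open>f + 1\<close>.\<close>

primrec prog_out :: "bool list \<Rightarrow> stm \<Rightarrow> nat \<Rightarrow> (nat \<Rightarrow> nat) \<Rightarrow> bool list" where
  "prog_out w (Emit b) f \<rho> = [b]"
| "prog_out w Nop f \<rho> = []"
| "prog_out w (Then s t) f \<rho> = prog_out w s f \<rho> @ prog_out w t f \<rho>"
| "prog_out w (IfZ e s t) f \<rho> = (if val w \<rho> e = 0 then prog_out w s f \<rho> else prog_out w t f \<rho>)"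
| "prog_out w (For e s) f \<rho> =
     concat (map (\<lambda>i. prog_out w s (f + 2) (\<rho>(f := i, f + 1 := val w \<rho> e - i))) [0..<val w \<rho> e])"
| "prog_out w (EmitBin e) f \<rho> = binary (val w \<rho> e)"

primrec wf_stm :: "stm \<Rightarrow> nat \<Rightarrow> bool" where
  "wf_stm (Emit b) f = True"
| "wf_stm Nop f = True"
| "wf_stm (Then s t) f = (wf_stm s f \<and> wf_stm t f)"
| "wf_stm (IfZ e s t) f = (var_bound e \<le> f \<and> wf_stm s f \<and> wf_stm t f)"
| "wf_stm (For e s) f = (var_bound e \<le> f \<and> wf_stm s (f + 2))"
| "wf_stm (EmitBin e) f = (var_bound e \<le> f)"

primrec counters :: "stm \<Rightarrow> nat \<Rightarrow> nat" where
  "counters (Emit b) f = f"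
| "counters Nop f = f"
| "counters (Then s t) f = max (counters s f) (counters t f)"
| "counters (IfZ e s t) f = max (f + 1 + temps e) (max (counters s f) (counters t f))"
| "counters (For e s) f = max (f + 2 + temps e) (counters s (f + 2))"
| "counters (EmitBin e) f = f + 3 + temps e"

text \<open>Each round takes two units from \<open>f\<close> and puts one into \<open>f + 1\<close>.
  If \<open>f\<close> runs empty in the middle of a round, the value was odd and the unit goes into
  \<open>f + 2\<close>.\<close>

definition halve :: "nat \<Rightarrow> com" where
  "halve f = loop f (Seq (dec f) (ifzero f (inc (f + 2)) (Seq (dec f) (inc (f + 1)))))"

definition emit_digit :: "nat \<Rightarrow> nat \<Rightarrow> com" where
  "emit_digit m f = Seq (halve f) (Seq (ifzero (f + 2) (emit m False) (Seq (dec (f + 2)) (emit m True)))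
     (loop (f + 1) (Seq (dec (f + 1)) (inc f))))"

primrec compile :: "nat \<Rightarrow> stm \<Rightarrow> nat \<Rightarrow> com" where
  "compile m (Emit b) f = emit m b"
| "compile m Nop f = move 0"
| "compile m (Then s t) f = Seq (compile m s f) (compile m t f)"
| "compile m (IfZ e s t) f = Seq (add_expr e f (f + 1))
     (ifzero f (compile m s f) (Seq (loop f (dec f)) (compile m t f)))"
| "compile m (For e s) f = Seq (add_expr e (f + 1) (f + 2))
     (Seq (loop (f + 1) (Seq (compile m s (f + 2)) (Seq (inc f) (dec (f + 1))))) (loop f (dec f)))"
| "compile m (EmitBin e) f = Seq (add_expr e f (f + 1)) (loop f (emit_digit m f))"

lemma runs_halve:
  assumes "f + 2 < m"
  shows "runs w m (halve f) (\<rho>(f := a, f + 1 := b, f + 2 := 0), h, ys) (8 * a + 1)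
     (\<rho>(f := 0, f + 1 := b + a div 2, f + 2 := a mod 2), h, ys)"
proof (induction a arbitrary: b rule: less_induct)
  case (less a)
  consider "a = 0" | "a = 1" | "a \<ge> 2" by linarith
  then show ?case
  proof cases
    case 1
    show ?thesis unfolding halve_def
      by (rule runs_cong[OF runs_loop_stop]) (use 1 assms in auto)
  next
    case 2
    let ?s = "(\<rho>(f := 0, f + 1 := b, f + 2 := 0), h, ys)"
    have 1: "runs w m (inc (f + 2)) ?s 1 (\<rho>(f := 0, f + 1 := b, f + 2 := 1), h, ys)"
      by (rule runs_cong[OF runs_inc]) (use assms in auto)
    have 2: "runs w m (ifzero f (inc (f + 2)) (Seq (dec f) (inc (f + 1)))) ?s (1 + 1)
        (\<rho>(f := 0, f + 1 := b, f + 2 := 1), h, ys)"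
      by (rule runs_ifzero) (use assms 1 in auto)
    have 3: "runs w m (dec f) (\<rho>(f := a, f + 1 := b, f + 2 := 0), h, ys) 1 ?s"
      by (rule runs_cong[OF runs_dec]) (use assms \<open>a = 1\<close> in \<open>auto simp: fun_eq_iff\<close>)
    have 4: "runs w m (halve f) (\<rho>(f := 0, f + 1 := b, f + 2 := 1), h, ys) 1
        (\<rho>(f := 0, f + 1 := b, f + 2 := 1), h, ys)"
      unfolding halve_def by (rule runs_loop_stop) (use assms in auto)
    show ?thesis unfolding halve_def
      by (rule runs_cong[OF runs_loop_step[OF _ _ runs_Seq[OF 3 2] 4[unfolded halve_def]]])
        (use assms \<open>a = 1\<close> in auto)
  next
    case 3
    let ?s = "(\<rho>(f := a - 1, f + 1 := b, f + 2 := 0), h, ys)"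
    let ?t = "(\<rho>(f := a - 2, f + 1 := b + 1, f + 2 := 0), h, ys)"
    have 1: "runs w m (Seq (dec f) (inc (f + 1))) ?s 3 ?t"
      by (rule runs_cong[OF runs_Seq[OF runs_dec runs_inc]]) (use assms 3 in \<open>auto simp: fun_eq_iff\<close>)
    have 2: "runs w m (ifzero f (inc (f + 2)) (Seq (dec f) (inc (f + 1)))) ?s (3 + 1) ?t"
      by (rule runs_ifzero) (use assms 1 3 in auto)
    have 4: "runs w m (dec f) (\<rho>(f := a, f + 1 := b, f + 2 := 0), h, ys) 1 ?s"
      by (rule runs_cong[OF runs_dec]) (use assms in \<open>auto simp: fun_eq_iff\<close>)
    have 5: "runs w m (halve f) ?t (8 * (a - 2) + 1)
        (\<rho>(f := 0, f + 1 := b + 1 + (a - 2) div 2, f + 2 := (a - 2) mod 2), h, ys)"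
      by (rule less) (use 3 in simp)
    obtain c where c: "a = c + 2" using le_Suc_ex[OF 3] by (auto simp: add.commute)
    have eq: "b + 1 + (a - 2) div 2 = b + a div 2" "(a - 2) mod 2 = a mod 2" unfolding c by simp_all
    show ?thesis unfolding halve_def
      by (rule runs_cong[OF runs_loop_step[OF _ _ runs_Seq[OF 4 2] 5[unfolded halve_def eq]]])
        (use assms 3 in auto)
  qed
qed

lemma runs_emit_digit:
  assumes "f + 2 < m" "\<rho> (f + 1) = 0" "\<rho> (f + 2) = 0"
  shows "runs w m (emit_digit m f) (\<rho>(f := a), h, ys) (16 * a + 10) (\<rho>(f := a div 2), h, ys @ [odd a])"
proof -
  have s: "\<rho>(f := a) = \<rho>(f := a, f + 1 := 0, f + 2 := 0)" using assms by (auto simp: fun_eq_iff)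
  let ?s = "(\<rho>(f := 0, f + 1 := 0 + a div 2, f + 2 := a mod 2), h, ys)"
  let ?t = "(\<rho>(f := 0, f + 1 := a div 2, f + 2 := 0), h, ys @ [odd a])"
  have 1: "runs w m (if fst ?s (f + 2) = 0 then emit m False else Seq (dec (f + 2)) (emit m True)) ?s 3 ?t"
  proof (cases "even a")
    case True
    have "runs w m (emit m False) ?s 3 ?t"
      by (rule runs_cong[OF runs_emit]) (use True in \<open>auto simp: fun_eq_iff\<close>)
    then show ?thesis using True by simp
  next
    case False
    have "runs w m (Seq (dec (f + 2)) (emit m True)) ?s 3 ?t"
      by (rule runs_cong[OF runs_Seq[OF runs_dec runs_emit]])
        (use False assms in \<open>auto simp: fun_eq_iff odd_iff_mod_2_eq_one\<close>)
    then show ?thesis using False by (simp add: odd_iff_mod_2_eq_one)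
  qed
  have 2: "runs w m (ifzero (f + 2) (emit m False) (Seq (dec (f + 2)) (emit m True))) ?s (3 + 1) ?t"
    by (rule runs_ifzero[OF _ 1]) (use assms in simp)
  have 3: "runs w m (loop (f + 1) (Seq (dec (f + 1)) (inc f))) ?t (a div 2 * 4 + 1)
      (\<rho>(f := a div 2), h, ys @ [odd a])"
    by (rule runs_cong[OF runs_restore]) (use assms in \<open>auto simp: fun_eq_iff\<close>)
  show ?thesis unfolding emit_digit_def
    by (subst s, rule runs_cong[OF runs_Seq[OF runs_halve[OF assms(1)] runs_Seq[OF 2 3]] refl]) simp
qed

text \<open>The number \<open>k\<close> is a bound fixed for the whole induction, so every digit is
  charged the same amount.\<close>

lemma runs_emit_binary:
  assumes "f + 2 < m" "\<rho> (f + 1) = 0" "\<rho> (f + 2) = 0" "a \<le> k"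
  shows "runs w m (loop f (emit_digit m f)) (\<rho>(f := a), h, ys) (a * (16 * k + 11) + 1)
     (\<rho>(f := 0), h, ys @ binary a)"
  using assms(4)
proof (induction a arbitrary: ys rule: less_induct)
  case (less a)
  show ?case
  proof (cases "a = 0")
    case True
    show ?thesis
      by (rule runs_cong[OF runs_loop_stop]) (use True assms in \<open>auto simp: binary.simps\<close>)
  next
    case False
    have 1: "runs w m (loop f (emit_digit m f)) (\<rho>(f := a div 2), h, ys @ [odd a])
        (a div 2 * (16 * k + 11) + 1) (\<rho>(f := 0), h, (ys @ [odd a]) @ binary (a div 2))"
      by (rule less.IH) (use False less.prems in auto)
    \<comment> \<open>Going from \<open>a\<close> to \<open>a div 2\<close> frees at least one share
      of the time bound, which pays for the current digit.\<close>
    have "a div 2 + 1 \<le> a" using False by linarith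
    define X where "X = 16 * k + 11"
    have "(a div 2 + 1) * X \<le> a * X" using \<open>a div 2 + 1 \<le> a\<close> by (rule mult_le_mono1)
    moreover have "16 * a + 11 \<le> X" using less.prems by (simp add: X_def)
    ultimately have "16 * a + 10 + (a div 2 * X + 1) + 1 \<le> a * X + 1"
      unfolding add_mult_distrib by linarith
    then have "16 * a + 10 + (a div 2 * (16 * k + 11) + 1) + 1 \<le> a * (16 * k + 11) + 1"
      unfolding X_def .
    then show ?thesis
      by (rule runs_cong[OF runs_loop_step[OF _ _ runs_emit_digit[OF assms(1-3)] 1], rotated 3])
        (use False assms binary.simps[of a] in auto)
  qed
qed

text \<open>The time bound depends on the program and its level but not on the word. In the loop
  case the bound of the body is evaluated at \<open>N + v N\<close>, since the index and the number
  of remaining rounds may exceed \<open>N\<close>.\<close>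

lemma stm_runs:
  "wf_stm s f \<Longrightarrow> \<exists>g. poly_bounded g \<and> (\<forall>w m \<rho> N ys. counters s f \<le> m \<longrightarrow> (\<forall>r\<ge>f. \<rho> r = 0) \<longrightarrow>
     env_bounded w \<rho> f N \<longrightarrow> runs w m (compile m s f) (\<rho>, 0, ys) (g N) (\<rho>, 0, ys @ prog_out w s f \<rho>))"
proof (induction s arbitrary: f)
  case (Emit b)
  show ?case
    by (intro exI[of _ "\<lambda>_. 1"]) (auto simp: poly_bounded_const intro!: runs_cong[OF runs_emit])
next
  case Nop
  show ?case
    by (intro exI[of _ "\<lambda>_. 1"]) (auto simp: poly_bounded_const intro!: runs_cong[OF runs_move])
next
  case (Then s t)
  obtain g where g: "poly_bounded g" "\<And>w m \<rho> N ys. counters s f \<le> m \<Longrightarrow> \<forall>r\<ge>f. \<rho> r = 0 \<Longrightarrow>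
     env_bounded w \<rho> f N \<Longrightarrow> runs w m (compile m s f) (\<rho>, 0, ys) (g N) (\<rho>, 0, ys @ prog_out w s f \<rho>)"
    using Then.IH(1)[of f] Then.prems by auto
  obtain h where h: "poly_bounded h" "\<And>w m \<rho> N ys. counters t f \<le> m \<Longrightarrow> \<forall>r\<ge>f. \<rho> r = 0 \<Longrightarrow>
     env_bounded w \<rho> f N \<Longrightarrow> runs w m (compile m t f) (\<rho>, 0, ys) (h N) (\<rho>, 0, ys @ prog_out w t f \<rho>)"
    using Then.IH(2)[of f] Then.prems by auto
  have "runs w m (compile m (Then s t) f) (\<rho>, 0, ys) (g N + h N + 1) (\<rho>, 0, ys @ prog_out w (Then s t) f \<rho>)"
    if "counters (Then s t) f \<le> m" "\<forall>r\<ge>f. \<rho> r = 0" "env_bounded w \<rho> f N" for w m \<rho> N ys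
    unfolding compile.simps
    by (rule runs_cong[OF runs_Seq[OF g(2) h(2)]]) (use that in auto)
  moreover have "poly_bounded (\<lambda>N. g N + h N + 1)" by (intro poly_bounded_intros g h)
  ultimately show ?case by blast
next
  case (IfZ e s t)
  obtain g where g: "poly_bounded g" "\<And>w m \<rho> N ys. counters s f \<le> m \<Longrightarrow> \<forall>r\<ge>f. \<rho> r = 0 \<Longrightarrow>
     env_bounded w \<rho> f N \<Longrightarrow> runs w m (compile m s f) (\<rho>, 0, ys) (g N) (\<rho>, 0, ys @ prog_out w s f \<rho>)"
    using IfZ.IH(1)[of f] IfZ.prems by auto
  obtain h where h: "poly_bounded h" "\<And>w m \<rho> N ys. counters t f \<le> m \<Longrightarrow> \<forall>r\<ge>f. \<rho> r = 0 \<Longrightarrow>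
     env_bounded w \<rho> f N \<Longrightarrow> runs w m (compile m t f) (\<rho>, 0, ys) (h N) (\<rho>, 0, ys @ prog_out w t f \<rho>)"
    using IfZ.IH(2)[of f] IfZ.prems by auto
  obtain k where k: "poly_bounded k" "adds e k" using adds_exists by blast
  obtain v where v: "poly_bounded v"
    "\<And>w \<rho> N. env_bounded w \<rho> (var_bound e) N \<Longrightarrow> val w \<rho> e \<le> v N" using val_bounded[of e] by blast
  have "runs w m (compile m (IfZ e s t) f) (\<rho>, 0, ys) (k N + (g N + (2 * v N + 1 + h N + 1) + 1) + 1)
      (\<rho>, 0, ys @ prog_out w (IfZ e s t) f \<rho>)"
    if a: "counters (IfZ e s t) f \<le> m" "\<forall>r\<ge>f. \<rho> r = 0" "env_bounded w \<rho> f N" for w m \<rho> N ys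
  proof -
    have eb: "env_bounded w \<rho> (var_bound e) N" using a IfZ.prems by (auto simp: env_bounded_def)
    let ?s = "(\<rho>(f := val w \<rho> e), 0, ys)"
    have 1: "runs w m (add_expr e f (f + 1)) (\<rho>, 0, ys) (k N) ?s"
      by (rule runs_cong[OF addsD[OF k(2)]]) (use a eb IfZ.prems in auto)
    have z: "\<rho>(f := 0) = \<rho>" using a by auto
    have "runs w m (if fst ?s f = 0 then compile m s f else Seq (loop f (dec f)) (compile m t f)) ?s
        (g N + (2 * v N + 1 + h N + 1)) (\<rho>, 0, ys @ prog_out w (IfZ e s t) f \<rho>)"
    proof (cases "val w \<rho> e = 0")
      case True
      have "runs w m (compile m s f) (\<rho>, 0, ys) (g N + (2 * v N + 1 + h N + 1)) (\<rho>, 0, ys @ prog_out w s f \<rho>)"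
        by (rule runs_cong[OF g(2)]) (use a in auto)
      then show ?thesis using True z a(2)[rule_format, of f] by simp
    next
      case False
      have 2: "runs w m (loop f (dec f)) ?s (2 * v N + 1) (\<rho>, 0, ys)"
        by (rule runs_cong[OF runs_clear]) (use a z v(2)[OF eb] in auto)
      have "runs w m (Seq (loop f (dec f)) (compile m t f)) ?s (g N + (2 * v N + 1 + h N + 1))
          (\<rho>, 0, ys @ prog_out w t f \<rho>)"
        by (rule runs_cong[OF runs_Seq[OF 2 h(2)]]) (use a in auto)
      then show ?thesis using False by simp
    qed
    then have 3: "runs w m (ifzero f (compile m s f) (Seq (loop f (dec f)) (compile m t f))) ?s
        (g N + (2 * v N + 1 + h N + 1) + 1) (\<rho>, 0, ys @ prog_out w (IfZ e s t) f \<rho>)"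
      by (rule runs_ifzero[rotated]) (use a in auto)
    show ?thesis unfolding compile.simps by (rule runs_Seq[OF 1 3])
  qed
  moreover have "poly_bounded (\<lambda>N. k N + (g N + (2 * v N + 1 + h N + 1) + 1) + 1)"
    by (intro poly_bounded_intros g h k v)
  ultimately show ?case by blast
next
  case (For e s)
  obtain g where g: "poly_bounded g" "\<And>w m \<rho> N ys. counters s (f + 2) \<le> m \<Longrightarrow> \<forall>r\<ge>f + 2. \<rho> r = 0 \<Longrightarrow>
     env_bounded w \<rho> (f + 2) N \<Longrightarrow>
     runs w m (compile m s (f + 2)) (\<rho>, 0, ys) (g N) (\<rho>, 0, ys @ prog_out w s (f + 2) \<rho>)"
    using For.IH[of "f + 2"] For.prems by auto
  obtain k where k: "poly_bounded k" "adds e k" using adds_exists by blast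
  obtain v where v: "poly_bounded v"
    "\<And>w \<rho> N. env_bounded w \<rho> (var_bound e) N \<Longrightarrow> val w \<rho> e \<le> v N" using val_bounded[of e] by blast
  have "runs w m (compile m (For e s) f) (\<rho>, 0, ys)
      (k N + ((v N * (g (N + v N) + 5) + 1) + (2 * v N + 1) + 1) + 1)
      (\<rho>, 0, ys @ prog_out w (For e s) f \<rho>)"
    if a: "counters (For e s) f \<le> m" "\<forall>r\<ge>f. \<rho> r = 0" "env_bounded w \<rho> f N" for w m \<rho> N ys
  proof -
    have eb: "env_bounded w \<rho> (var_bound e) N" using a For.prems by (auto simp: env_bounded_def)
    define n where "n = val w \<rho> e"
    have n: "n \<le> v N" using v(2)[OF eb] by (simp add: n_def)
    define \<sigma> where "\<sigma> j = (\<rho>(f := j, f + 1 := n - j), 0::int,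
      ys @ concat (map (\<lambda>i. prog_out w s (f + 2) (\<rho>(f := i, f + 1 := n - i))) [0..<j]))" for j
    have 1: "runs w m (add_expr e (f + 1) (f + 2)) (\<rho>, 0, ys) (k N) (\<sigma> 0)"
      unfolding \<sigma>_def
      by (rule runs_cong[OF addsD[OF k(2)]]) (use a eb For.prems in \<open>auto simp: fun_eq_iff n_def\<close>)
    have 2: "runs w m (loop (f + 1) (Seq (compile m s (f + 2)) (Seq (inc f) (dec (f + 1))))) (\<sigma> 0)
        (n * (g (N + v N) + 4 + 1) + 1) (\<sigma> n)"
    proof (rule runs_loop)
      fix j assume j: "j < n"
      have eb2: "env_bounded w (\<rho>(f := j, f + 1 := n - j)) (f + 2) (N + v N)"
        using a(3) j n by (auto simp: env_bounded_def less_Suc_eq trans_le_add1)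
      show "runs w m (Seq (compile m s (f + 2)) (Seq (inc f) (dec (f + 1)))) (\<sigma> j)
          (g (N + v N) + 4) (\<sigma> (Suc j))"
        unfolding \<sigma>_def
        by (rule runs_cong[OF runs_Seq[OF g(2)[OF _ _ eb2] runs_Seq[OF runs_inc runs_dec]]])
          (use a j in \<open>auto simp: fun_eq_iff\<close>)
    qed (use a in \<open>auto simp: \<sigma>_def\<close>)
    have 3: "runs w m (loop f (dec f)) (\<sigma> n) (2 * v N + 1) (\<rho>, 0, ys @ prog_out w (For e s) f \<rho>)"
      unfolding \<sigma>_def
      by (rule runs_cong[OF runs_clear]) (use a n in \<open>auto simp: fun_eq_iff n_def\<close>)
    have "n * (g (N + v N) + 4 + 1) \<le> v N * (g (N + v N) + 5)" using n by (rule mult_le_mono) simp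
    then show ?thesis unfolding compile.simps
      by (intro runs_cong[OF runs_Seq[OF 1 runs_Seq[OF 2 3]] refl]) linarith
  qed
  moreover have "poly_bounded (\<lambda>N. k N + ((v N * (g (N + v N) + 5) + 1) + (2 * v N + 1) + 1) + 1)"
    by (intro poly_bounded_intros k v poly_bounded_comp[OF g(1)]) auto
  ultimately show ?case by blast
next
  case (EmitBin e)
  obtain k where k: "poly_bounded k" "adds e k" using adds_exists by blast
  obtain v where v: "poly_bounded v"
    "\<And>w \<rho> N. env_bounded w \<rho> (var_bound e) N \<Longrightarrow> val w \<rho> e \<le> v N" using val_bounded[of e] by blast
  have "runs w m (compile m (EmitBin e) f) (\<rho>, 0, ys) (k N + (v N * (16 * v N + 11) + 1) + 1)
      (\<rho>, 0, ys @ prog_out w (EmitBin e) f \<rho>)"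
    if a: "counters (EmitBin e) f \<le> m" "\<forall>r\<ge>f. \<rho> r = 0" "env_bounded w \<rho> f N" for w m \<rho> N ys
  proof -
    have eb: "env_bounded w \<rho> (var_bound e) N" using a EmitBin.prems by (auto simp: env_bounded_def)
    have 1: "runs w m (add_expr e f (f + 1)) (\<rho>, 0, ys) (k N) (\<rho>(f := val w \<rho> e), 0, ys)"
      by (rule runs_cong[OF addsD[OF k(2)]]) (use a eb EmitBin.prems in auto)
    have 2: "runs w m (loop f (emit_digit m f)) (\<rho>(f := val w \<rho> e), 0, ys)
        (val w \<rho> e * (16 * v N + 11) + 1) (\<rho>(f := 0), 0, ys @ binary (val w \<rho> e))"
      by (rule runs_emit_binary) (use a v(2)[OF eb] in auto)
    have "val w \<rho> e * (16 * v N + 11) \<le> v N * (16 * v N + 11)" using v(2)[OF eb] by (rule mult_le_mono1)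
    then have le: "k N + (val w \<rho> e * (16 * v N + 11) + 1) + 1 \<le> k N + (v N * (16 * v N + 11) + 1) + 1"
      by linarith
    show ?thesis unfolding compile.simps
      by (rule runs_cong[OF runs_Seq[OF 1 2] _ le]) (use a in \<open>auto simp: fun_eq_iff\<close>)
  qed
  moreover have "poly_bounded (\<lambda>N. k N + (v N * (16 * v N + 11) + 1) + 1)"
    by (intro poly_bounded_intros k v)
  ultimately show ?case by blast
qed

section \<open>Polynomial time computability of emitted words\<close>

lemma wf_com_add_expr: "wf_com (add_expr e z f)"
proof (induction e arbitrary: z f)
  case (Num c)
  show ?case by (induction c) (auto simp: inc_def move_def)
qed (auto simp: inc_def dec_def move_def loop_def)

lemma wf_com_compile: "wf_com (compile m s f)"
  by (induction s arbitrary: f) (auto simp: inc_def dec_def move_def loop_def emit_def ifzero_def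
    halve_def emit_digit_def wf_com_add_expr)

text \<open>Writing the mark under the heads turns the blank work tapes of the initial configuration
  into counters with value 0.\<close>

primrec mark :: "nat \<Rightarrow> com" where
  "mark 0 = move 0"
| "mark (Suc r) = Seq (mark r) (Act (Suc r) (\<lambda>s. (1, 0)))"

lemma exec_mark:
  "r \<le> m \<Longrightarrow> \<exists>t\<le>2 * r + 1. exec (mark r) ((word_contents w, 0) # replicate (m + 1) (word_contents [], 0)) t
     ((word_contents w, 0) # replicate r (counter_tape 0) @ replicate (m + 1 - r) (word_contents [], 0))"
proof (induction r)
  case 0
  show ?case
    using exec_Act[of 0 "(word_contents w, 0) # replicate (m + 1) (word_contents [], 0)" "\<lambda>s. (s, 0)"]
    by (intro exI[of _ 1]) (auto simp: move_def act_tape_def read_tape_def)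
next
  case (Suc r)
  let ?ts = "(word_contents w, 0) # replicate r (counter_tape 0) @ replicate (m + 1 - r) (word_contents [], 0)"
  obtain t where t: "t \<le> 2 * r + 1"
    "exec (mark r) ((word_contents w, 0) # replicate (m + 1) (word_contents [], 0)) t ?ts"
    using Suc by auto
  have c0: "act_tape (1, 0) (word_contents [], 0) = counter_tape 0"
    by (auto simp: act_tape_def counter_tape_def word_contents_def fun_eq_iff)
  have nth: "?ts ! Suc r = (word_contents [], 0)" using Suc.prems by (simp add: nth_append)
  define B :: "tape list" where "B = replicate (m - r) (word_contents [], 0)"
  have ts: "?ts = (word_contents w, 0) # replicate r (counter_tape 0) @ (word_contents [], 0) # B"
    using Suc.prems by (simp add: B_def Suc_diff_le)
  have upd: "?ts[Suc r := counter_tape 0] = (word_contents w, 0) # replicate (Suc r) (counter_tape 0) @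
      replicate (m + 1 - Suc r) (word_contents [], 0)"
    unfolding ts by (simp add: list_update_append B_def replicate_app_Cons_same)
  have "exec (Act (Suc r) (\<lambda>s. (1, 0))) ?ts 1 (?ts[Suc r := act_tape (1, 0) (?ts ! Suc r)])"
    using exec_Act[of "Suc r" ?ts "\<lambda>s. (1, 0)"] Suc.prems by simp
  then have "exec (Act (Suc r) (\<lambda>s. (1, 0))) ?ts 1 ((word_contents w, 0) # replicate (Suc r) (counter_tape 0) @
      replicate (m + 1 - Suc r) (word_contents [], 0))"
    unfolding nth c0 upd .
  from exec_Seq[OF t(2) this] show ?case using t(1)
    by (intro exI[of _ "Suc (t + 1)"]) (simp del: replicate.simps)
qed

theorem polytime_out:
  assumes "wf_stm s 0"
  shows "polytime_computable (\<lambda>w. prog_out w s 0 (\<lambda>_. 0))"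
proof -
  obtain g where g: "poly_bounded g" "\<And>w m \<rho> N ys. counters s 0 \<le> m \<Longrightarrow> \<forall>r\<ge>0. \<rho> r = 0 \<Longrightarrow>
     env_bounded w \<rho> 0 N \<Longrightarrow> runs w m (compile m s 0) (\<rho>, 0, ys) (g N) (\<rho>, 0, ys @ prog_out w s 0 \<rho>)"
    using stm_runs[OF assms] by auto
  obtain k where k: "\<And>N. N \<ge> 2 \<Longrightarrow> g N \<le> N ^ k" using g(1) by (auto simp: poly_bounded_def)
  define m where "m = counters s 0"
  define c where "c = Seq (mark m) (compile m s 0)"
  have wfm: "wf_com (mark r)" for r by (induction r) (auto simp: move_def)
  have "wf_com c" by (simp add: c_def wfm wf_com_compile)
  from tm_of_com[OF this, of "m + 2"] obtain M where M: "wf_tm M" "deterministic M"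
    "num_tapes M = m + 2" and run: "\<And>ts t us. ternary (m + 2) ts \<Longrightarrow> exec c ts t us \<Longrightarrow>
        \<exists>d. (tm_step M ^^ t) (0, ts) d \<and> halted M d \<and> snd d = us" by auto
  \<comment> \<open>The environment bound is \<open>length w + 2\<close>, which gives the power;
    marking takes at most \<open>2 * m + 1\<close> steps and the sequencing one more.\<close>
  define p :: "nat poly" where "p = [:2, 1:] ^ k + [:2 * m + 2:]"
  have "\<exists>t d. t \<le> poly p (length w) \<and> (tm_step M ^^ t) (init_config M w) d \<and>
      halted M d \<and> fst (last (snd d)) = word_contents (prog_out w s 0 (\<lambda>_. 0))" for w
  proof -
    let ?ts = "(word_contents w, 0) # replicate (m + 1) (word_contents [], 0)"
    have init: "init_config M w = (0, ?ts)" by (simp add: init_config_def M)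
    have conf0: "(word_contents w, 0) # replicate m (counter_tape 0) @ replicate (m + 1 - m) (word_contents [], 0)
        = conf w m (\<lambda>_. 0, 0, [])"
      by (simp add: conf_def map_replicate_const)
    obtain t1 where t1: "t1 \<le> 2 * m + 1" "exec (mark m) ?ts t1 (conf w m (\<lambda>_. 0, 0, []))"
      using exec_mark[of m m w] unfolding conf0 by auto
    have "env_bounded w (\<lambda>_. 0) 0 (length w + 2)" by (simp add: env_bounded_def)
    from g(2)[of m "\<lambda>_. 0" w "length w + 2" "[]"] this obtain t2 where t2: "t2 \<le> g (length w + 2)"
      "exec (compile m s 0) (conf w m (\<lambda>_. 0, 0, [])) t2 (conf w m (\<lambda>_. 0, 0, prog_out w s 0 (\<lambda>_. 0)))"
      unfolding runs_def m_def by auto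
    have ex: "exec c ?ts (Suc (t1 + t2)) (conf w m (\<lambda>_. 0, 0, prog_out w s 0 (\<lambda>_. 0)))"
      unfolding c_def by (rule exec_Seq[OF t1(2) t2(2)])
    have ter: "ternary (m + 2) ?ts" by (auto simp: ternary_def word_contents_def)
    obtain d where d: "(tm_step M ^^ Suc (t1 + t2)) (0, ?ts) d" "halted M d"
      "snd d = conf w m (\<lambda>_. 0, 0, prog_out w s 0 (\<lambda>_. 0))" using run[OF ter ex] by blast
    have "g (length w + 2) \<le> (length w + 2) ^ k" by (rule k) simp
    then have "Suc (t1 + t2) \<le> poly p (length w)"
      using t1(1) t2(1) by (simp add: p_def poly_power add.commute)
    moreover have "fst (last (snd d)) = word_contents (prog_out w s 0 (\<lambda>_. 0))"
      by (simp add: d(3) conf_def)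
    ultimately show ?thesis using d init by (metis)
  qed
  then show ?thesis unfolding polytime_computable_def using M by blast
qed

section \<open>Subgraphs of the square lattice\<close>

type_synonym point = "nat \<times> nat"

text \<open>The edge \<open>(x, y, d)\<close> leads from \<open>(x, y)\<close> to the right or, if \<open>d\<close> holds, downwards.\<close>

type_synonym ledge = "nat \<times> nat \<times> bool"

definition near :: "ledge \<Rightarrow> point" where "near e = (fst e, fst (snd e))"
definition far :: "ledge \<Rightarrow> point" where
  "far e = (if snd (snd e) then (fst e, Suc (fst (snd e))) else (Suc (fst e), fst (snd e)))"
definition ends :: "ledge \<Rightarrow> point set" where "ends e = {near e, far e}"
definition lat_colour :: "point \<Rightarrow> nat" where "lat_colour p = (fst p + snd p) mod 2"

lemma near_neq_far: "near e \<noteq> far e"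
  by (simp add: near_def far_def)

lemma card_ends: "card (ends e) = 2"
  using near_neq_far by (simp add: ends_def)

lemma finite_ends [simp]: "finite (ends e)"
  by (simp add: ends_def)

lemma colour_cases: "lat_colour p = 0 \<or> lat_colour p = 1"
  by (auto simp: lat_colour_def)

lemma colour_le: "lat_colour p \<le> 1"
  using colour_cases[of p] by auto

lemma colour_other: "p \<in> ends e \<Longrightarrow> q \<in> ends e \<Longrightarrow> p \<noteq> q \<Longrightarrow> lat_colour q = 1 - lat_colour p"
  by (auto simp: ends_def near_def far_def lat_colour_def split: if_splits) presburger+

lemma ends_colour: "c \<le> 1 \<Longrightarrow> \<exists>p\<in>ends e. lat_colour p = c"
  using colour_other[of "near e" e "far e"] near_neq_far[of e] colour_cases[of "near e"]
  by (force simp: ends_def le_Suc_eq)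

lemma ends_inject: "ends e = ends f \<Longrightarrow> e = f"
  by (cases e; cases f) (auto simp: ends_def near_def far_def doubleton_eq_iff split: if_splits)

lemma share_unique:
  assumes "e \<noteq> f" "p \<in> ends e" "p \<in> ends f" "q \<in> ends e" "q \<in> ends f" shows "p = q"
proof (rule ccontr)
  assume "p \<noteq> q"
  then have "{p, q} = ends e" "{p, q} = ends f"
    using assms by (auto simp: ends_def)
  then show False using ends_inject assms(1) by metis
qed

definition incident :: "ledge set \<Rightarrow> point \<Rightarrow> ledge set" where "incident E p = {e \<in> E. p \<in> ends e}"

lemma sum_degrees:
  assumes "finite F" "finite P" "\<And>e. e \<in> F \<Longrightarrow> ends e \<subseteq> P"
  shows "(\<Sum>p\<in>P. card (incident F p)) = 2 * card F"
proof -
  have "(\<Sum>p\<in>P. card (incident F p)) = (\<Sum>p\<in>P. \<Sum>e\<in>F. if p \<in> ends e then 1 else 0)"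
    using assms(1) by (intro sum.cong refl) (simp add: incident_def sum.If_cases Int_def)
  also have "\<dots> = (\<Sum>e\<in>F. \<Sum>p\<in>P. if p \<in> ends e then 1 else 0)" by (rule sum.swap)
  also have "\<dots> = (\<Sum>e\<in>F. 2)"
  proof (intro sum.cong refl)
    fix e assume "e \<in> F"
    then have "P \<inter> {p. p \<in> ends e} = ends e" using assms(3) by blast
    then show "(\<Sum>p\<in>P. if p \<in> ends e then 1 else 0) = (2::nat)"
      using assms(2) card_ends[of e] by (simp add: sum.If_cases)
  qed
  finally show ?thesis by simp
qed

text \<open>The line graph of \<open>E\<close>, padded by an isolated vertex for each number whose
  lattice edge is absent. The numbering of the vertices then does not depend on \<open>E\<close>,
  and a program can compute it.\<close>

definition lattice_graph :: "nat \<Rightarrow> (nat \<Rightarrow> ledge) \<Rightarrow> ledge set \<Rightarrow> nat ugraph" where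
  "lattice_graph n \<epsilon> E = \<lparr>verts = {..<n},
     edges = {{u, v} | u v. u < n \<and> v < n \<and> u \<noteq> v \<and> \<epsilon> u \<in> E \<and> \<epsilon> v \<in> E \<and>
       ends (\<epsilon> u) \<inter> ends (\<epsilon> v) \<noteq> {}}\<rparr>"

locale lattice =
  fixes n :: nat and \<epsilon> :: "nat \<Rightarrow> ledge" and E :: "ledge set"
  assumes inj: "inj_on \<epsilon> {..<n}" and sub: "E \<subseteq> \<epsilon> ` {..<n}" and deg3: "card (incident E p) \<le> 3"
begin

abbreviation "G \<equiv> lattice_graph n \<epsilon> E"

lemma finite_E: "finite E"
  using finite_subset[OF sub] by simp

lemma finite_inc [simp]: "finite (incident E p)"
  using finite_E by (simp add: incident_def)

lemma eps_eq: "u < n \<Longrightarrow> v < n \<Longrightarrow> \<epsilon> u = \<epsilon> v \<longleftrightarrow> u = v"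
  using inj by (auto simp: inj_on_def)

lemma G_edge: "{u, v} \<in> edges G \<longleftrightarrow> u < n \<and> v < n \<and> u \<noteq> v \<and> \<epsilon> u \<in> E \<and> \<epsilon> v \<in> E \<and>
    ends (\<epsilon> u) \<inter> ends (\<epsilon> v) \<noteq> {}"
  unfolding lattice_graph_def by (auto simp: doubleton_eq_iff)

lemma G_edgeE:
  assumes "a \<in> edges G"
  obtains u v where "a = {u, v}" "{u, v} \<in> edges G"
proof -
  obtain u v where "a = {u, v}" using assms unfolding lattice_graph_def by auto
  then show ?thesis using assms that by metis
qed

lemma verts_G [simp]: "verts G = {..<n}"
  by (simp add: lattice_graph_def)

lemma simple_graph_G: "simple_graph G"
  unfolding simple_graph_def
proof (intro conjI ballI)
  fix a assume "a \<in> edges G"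
  then obtain u v where "a = {u, v}" "{u, v} \<in> edges G" by (rule G_edgeE)
  then show "a \<subseteq> verts G" "card a = 2" unfolding G_edge by auto
qed simp

lemma is_line_graph_G: "is_line_graph G"
proof -
  \<comment> \<open>In the root graph, the isolated vertices become edges with two private
    endpoints. Finally \<open>to_nat\<close> moves everything into the natural numbers.\<close>
  define \<psi> :: "nat \<Rightarrow> (point + nat \<times> bool) set" where
    "\<psi> u = (if \<epsilon> u \<in> E then Inl ` ends (\<epsilon> u) else {Inr (u, False), Inr (u, True)})" for u
  define \<phi> :: "nat \<Rightarrow> nat set" where "\<phi> u = to_nat ` \<psi> u" for u
  define H :: "nat ugraph" where "H = \<lparr>verts = \<Union> (\<phi> ` {..<n}), edges = \<phi> ` {..<n}\<rparr>"
  have fin: "finite (\<psi> u)" for u by (simp add: \<psi>_def)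
  have "card (\<psi> u) = 2" for u by (simp add: \<psi>_def card_image card_ends)
  then have card: "card (\<phi> u) = 2" for u unfolding \<phi>_def by (simp add: card_image)
  have int: "\<phi> u \<inter> \<phi> v = to_nat ` (\<psi> u \<inter> \<psi> v)" for u v
    unfolding \<phi>_def by (rule image_Int[symmetric]) simp
  have "simple_graph H" unfolding simple_graph_def H_def using card by (auto simp: \<phi>_def fin)
  moreover have psi_inj: "u = v" if "\<psi> u = \<psi> v" "u < n" "v < n" for u v
  proof (cases "\<epsilon> u \<in> E")
    case True
    have "\<epsilon> v \<in> E"
    proof (rule ccontr)
      assume "\<epsilon> v \<notin> E"
      then have "Inr (v, False) \<in> \<psi> v" by (simp add: \<psi>_def)
      then have "Inr (v, False) \<in> \<psi> u" unfolding that(1) .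
      then show False using True by (auto simp: \<psi>_def)
    qed
    then have "ends (\<epsilon> u) = ends (\<epsilon> v)" using that(1) True by (simp add: \<psi>_def inj_image_eq_iff)
    from ends_inject[OF this] show ?thesis using eps_eq[OF that(2,3)] by simp
  next
    case False
    then have "Inr (u, False) \<in> \<psi> u" by (simp add: \<psi>_def)
    then have "Inr (u, False) \<in> \<psi> v" unfolding that(1) .
    then show ?thesis by (auto simp: \<psi>_def split: if_splits)
  qed
  have phi_inj: "\<phi> u = \<phi> v \<longleftrightarrow> u = v" if "u < n" "v < n" for u v
    using psi_inj[of u v] that unfolding \<phi>_def by (auto simp: inj_image_eq_iff)
  have psi_int: "\<psi> u \<inter> \<psi> v \<noteq> {} \<longleftrightarrow> \<epsilon> u \<in> E \<and> \<epsilon> v \<in> E \<and> ends (\<epsilon> u) \<inter> ends (\<epsilon> v) \<noteq> {}"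
    if "u \<noteq> v" for u v
    using that by (auto simp: \<psi>_def)
  have "graph_iso G (line_graph H)"
    unfolding graph_iso_def
  proof (intro exI[of _ \<phi>] conjI ballI)
    show "bij_betw \<phi> (verts G) (verts (line_graph H))"
      using phi_inj by (auto simp: bij_betw_def inj_on_def line_graph_def H_def)
    fix u v assume "u \<in> verts G" "v \<in> verts G"
    then have uv: "u < n" "v < n" by simp_all
    have "{\<phi> u, \<phi> v} \<in> edges (line_graph H) \<longleftrightarrow> \<phi> u \<noteq> \<phi> v \<and> \<phi> u \<inter> \<phi> v \<noteq> {}"
      using uv unfolding line_graph_def H_def by (auto simp: doubleton_eq_iff)
    also have "\<dots> \<longleftrightarrow> u \<noteq> v \<and> \<psi> u \<inter> \<psi> v \<noteq> {}" using phi_inj uv by (simp add: int)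
    finally show "{u, v} \<in> edges G \<longleftrightarrow> {\<phi> u, \<phi> v} \<in> edges (line_graph H)"
      using psi_int[of u v] uv unfolding G_edge by auto
  qed
  then show ?thesis using \<open>simple_graph H\<close> unfolding is_line_graph_def by blast
qed

subsection \<open>Degrees\<close>

lemma degree_G:
  assumes "u < n"
  shows "degree_of G u = card {v. {u, v} \<in> edges G}"
proof -
  have "{a \<in> edges G. u \<in> a} = (\<lambda>v. {u, v}) ` {v. {u, v} \<in> edges G}"
  proof (intro equalityI subsetI)
    fix a assume "a \<in> {a \<in> edges G. u \<in> a}"
    then have a: "a \<in> edges G" "u \<in> a" by simp_all
    obtain x y where "a = {x, y}" "{x, y} \<in> edges G" using G_edgeE[OF a(1)] by blast
    then have "a = {x, y}" "{x, y} \<in> edges G" "u = x \<or> u = y" using a(2) by auto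
    then show "a \<in> (\<lambda>v. {u, v}) ` {v. {u, v} \<in> edges G}"
      by (auto simp: insert_commute)
  qed auto
  then show ?thesis unfolding degree_of_def
    by (simp add: card_image inj_on_def doubleton_eq_iff)
qed

lemma neighbours_G:
  assumes "u < n" "\<epsilon> u \<in> E"
  shows "card {v. {u, v} \<in> edges G} =
    card ((incident E (near (\<epsilon> u)) - {\<epsilon> u}) \<union> (incident E (far (\<epsilon> u)) - {\<epsilon> u}))"
proof -
  have "\<epsilon> ` {v. {u, v} \<in> edges G} = (incident E (near (\<epsilon> u)) - {\<epsilon> u}) \<union> (incident E (far (\<epsilon> u)) - {\<epsilon> u})"
  proof (intro equalityI subsetI)
    fix e assume "e \<in> \<epsilon> ` {v. {u, v} \<in> edges G}"
    then show "e \<in> (incident E (near (\<epsilon> u)) - {\<epsilon> u}) \<union> (incident E (far (\<epsilon> u)) - {\<epsilon> u})"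
      using eps_eq unfolding G_edge incident_def ends_def by auto
  next
    fix e assume e: "e \<in> (incident E (near (\<epsilon> u)) - {\<epsilon> u}) \<union> (incident E (far (\<epsilon> u)) - {\<epsilon> u})"
    then have "e \<in> E" by (auto simp: incident_def)
    then obtain v where "v < n" "e = \<epsilon> v" using sub by auto
    then have "{u, v} \<in> edges G"
      using e assms unfolding G_edge incident_def ends_def by auto
    then show "e \<in> \<epsilon> ` {v. {u, v} \<in> edges G}" using \<open>e = \<epsilon> v\<close> by auto
  qed
  moreover have "inj_on \<epsilon> {v. {u, v} \<in> edges G}"
    using eps_eq unfolding G_edge by (auto simp: inj_on_def)
  ultimately show ?thesis by (metis card_image)
qed

text \<open>The neighbours of an edge are the other edges at its two ends, hence at most 2 + 2.
  Distinct edges share at most one point, so at an edge between two points of degree 3 there are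
  four different ones.\<close>

lemma max_degree_G:
  assumes e: "e \<in> E" "card (incident E (near e)) = 3" "card (incident E (far e)) = 3"
  shows "max_degree G = 4"
proof -
  have eq: "card (incident E (near e) - {e}) = card (incident E (near e)) - 1"
      "card (incident E (far e) - {e}) = card (incident E (far e)) - 1" if "e \<in> E" for e
    using that by (simp_all add: incident_def ends_def finite_E)
  have le: "degree_of G u \<le> 4" if "u < n" for u
  proof (cases "\<epsilon> u \<in> E")
    case True
    have "card ((incident E (near (\<epsilon> u)) - {\<epsilon> u}) \<union> (incident E (far (\<epsilon> u)) - {\<epsilon> u})) \<le> 2 + 2"
      using card_Un_le[of "incident E (near (\<epsilon> u)) - {\<epsilon> u}" "incident E (far (\<epsilon> u)) - {\<epsilon> u}"]
        eq[OF True] deg3[of "near (\<epsilon> u)"] deg3[of "far (\<epsilon> u)"] by linarith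
    then show ?thesis using degree_G[OF that] neighbours_G[OF that True] by simp
  next
    case False
    then have "{v. {u, v} \<in> edges G} = {}" unfolding G_edge by auto
    then show ?thesis using degree_G[OF that] by simp
  qed
  obtain u where u: "u < n" "\<epsilon> u = e" using e(1) sub by auto
  have "(incident E (near e) - {e}) \<inter> (incident E (far e) - {e}) = {}"
    using share_unique[of _ e "near e" "far e"] near_neq_far[of e] by (auto simp: incident_def ends_def)
  then have "card ((incident E (near e) - {e}) \<union> (incident E (far e) - {e})) = 4"
    using eq[OF e(1)] e by (simp add: card_Un_disjoint)
  then have "degree_of G u = 4" using degree_G[OF u(1)] neighbours_G[OF u(1)] u e by simp
  then have "4 \<in> degree_of G ` verts G" using u by (metis imageI lessThan_iff verts_G)
  then show ?thesis unfolding max_degree_def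
    by (intro Max_eqI) (use le in auto)
qed

end

subsection \<open>Planarity\<close>

text \<open>Every vertex of the line graph is drawn at the midpoint of the lattice edge it stands for.
  All segments at a lattice point stay inside a small square around it; two of these squares meet
  in a midpoint at most.\<close>

definition mx :: "ledge \<Rightarrow> real" where
  "mx e = 2 * real (fst e) + (if snd (snd e) then 0 else 1)"
definition my :: "ledge \<Rightarrow> real" where
  "my e = 2 * real (fst (snd e)) + (if snd (snd e) then 1 else 0)"

text \<open>The corners of the square \<open>\<bar>a\<bar> + \<bar>b\<bar> \<le> 1\<close>: the
  midpoints of the edges at a lattice point, relative to that point, when all coordinates are
  doubled.\<close>

definition corner :: "real \<Rightarrow> real \<Rightarrow> bool" where
  "corner a b \<longleftrightarrow> (a = 1 \<and> b = 0) \<or> (a = - 1 \<and> b = 0) \<or> (a = 0 \<and> b = 1) \<or> (a = 0 \<and> b = - 1)"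

lemma corner_ends: "p \<in> ends e \<Longrightarrow> corner (mx e - 2 * real (fst p)) (my e - 2 * real (snd p))"
  by (auto simp: ends_def near_def far_def mx_def my_def corner_def)

lemma mx_my_inject: "mx e = mx f \<Longrightarrow> my e = my f \<Longrightarrow> e = f"
proof -
  assume a: "mx e = mx f" "my e = my f"
  have d: "2 * real i + 1 \<noteq> 2 * real j" for i j :: nat
  proof
    assume "2 * real i + 1 = 2 * real j"
    then have "real (2 * i + 1) = real (2 * j)" by simp
    then have "2 * i + 1 = 2 * j" by (simp only: of_nat_eq_iff)
    then show False by presburger
  qed
  show "e = f"
    using a d[of "fst e" "fst f"] d[of "fst f" "fst e"]
    by (cases e; cases f) (auto simp: mx_def my_def split: if_splits)
qed

text \<open>One coordinate of a midpoint is odd and so differs from the even coordinate of a lattice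
  point by at least 1, which exhausts the radius of the square.\<close>

lemma midpoint_corner:
  assumes "\<bar>mx e - 2 * real a\<bar> + \<bar>my e - 2 * real b\<bar> \<le> 1"
  shows "corner (mx e - 2 * real a) (my e - 2 * real b)"
proof -
  have h: "2 * real i + 1 - 2 * real j \<ge> 1 \<or> 2 * real i + 1 - 2 * real j \<le> - 1" for i j :: nat
    by (cases "i < j") auto
  show ?thesis
  proof (cases "snd (snd e)")
    case True
    then have "my e - 2 * real b \<ge> 1 \<or> my e - 2 * real b \<le> - 1"
      using h[of "fst (snd e)" b] by (simp add: my_def)
    then have "mx e - 2 * real a = 0 \<and> (my e - 2 * real b = 1 \<or> my e - 2 * real b = - 1)"
      using assms by linarith
    then show ?thesis unfolding corner_def by blast
  next
    case False
    then have "mx e - 2 * real a \<ge> 1 \<or> mx e - 2 * real a \<le> - 1"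
      using h[of "fst e" a] by (simp add: mx_def)
    then have "my e - 2 * real b = 0 \<and> (mx e - 2 * real a = 1 \<or> mx e - 2 * real a = - 1)"
      using assms by linarith
    then show ?thesis unfolding corner_def by blast
  qed
qed

lemma segment_bound:
  assumes "corner a b" "corner c d" "0 \<le> t" "t \<le> 1"
  shows "\<bar>(1 - t) * a + t * c\<bar> + \<bar>(1 - t) * b + t * d\<bar> \<le> 1"
  using assms by (auto simp: corner_def abs_if)

text \<open>Corners are extreme points of the square, so a segment between corners contains a corner
  only as an endpoint.\<close>

lemma corner_extreme:
  assumes "corner a b" "corner c d" "0 \<le> t" "t \<le> 1"
    "corner ((1 - t) * a + t * c) ((1 - t) * b + t * d)"
  shows "((1 - t) * a + t * c = a \<and> (1 - t) * b + t * d = b) \<or>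
    ((1 - t) * a + t * c = c \<and> (1 - t) * b + t * d = d)"
  using assms(1,2,5) by (auto simp: corner_def)

text \<open>Segments from one corner to two different corners have different directions.\<close>

lemma corner_segments_meet:
  assumes "corner a b" "corner c d" "corner c' d'" "(a, b) \<noteq> (c, d)" "(a, b) \<noteq> (c', d')" "(c, d) \<noteq> (c', d')"
    "(1 - t) * a + t * c = (1 - s) * a + s * c'" "(1 - t) * b + t * d = (1 - s) * b + s * d'"
  shows "(1 - t) * a + t * c = a \<and> (1 - t) * b + t * d = b"
  using assms by (auto simp: corner_def)

text \<open>The centres have distance at least 2 in some coordinate and both squares have radius 1,
  so the bounds are attained.\<close>

lemma squares_meet:
  assumes "\<bar>x - 2 * real a\<bar> + \<bar>y - 2 * real b\<bar> \<le> 1" "\<bar>x - 2 * real a'\<bar> + \<bar>y - 2 * real b'\<bar> \<le> 1"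
    "(a, b) \<noteq> (a', b')"
  shows "corner (x - 2 * real a) (y - 2 * real b)"
proof -
  have z: "i = j \<or> real i - real j \<ge> 1 \<or> real j - real i \<ge> 1" for i j :: nat
    by (cases i j rule: linorder_cases) auto
  consider "a = a'" "real b - real b' \<ge> 1 \<or> real b' - real b \<ge> 1"
    | "real a - real a' \<ge> 1 \<or> real a' - real a \<ge> 1"
    using z[of a a'] z[of b b'] assms(3) by blast
  then show ?thesis
  proof cases
    case 1
    have "\<bar>y - 2 * real b\<bar> + \<bar>y - 2 * real b'\<bar> \<ge> 2" using 1(2) by linarith
    then have "\<bar>x - 2 * real a\<bar> = 0" "\<bar>y - 2 * real b\<bar> = 1" using assms 1(1) by linarith+
    then have "x - 2 * real a = 0 \<and> (y - 2 * real b = 1 \<or> y - 2 * real b = - 1)" by linarith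
    then show ?thesis unfolding corner_def by blast
  next
    case 2
    have "\<bar>x - 2 * real a\<bar> + \<bar>x - 2 * real a'\<bar> \<ge> 2" using 2 by linarith
    then have "\<bar>y - 2 * real b\<bar> = 0" "\<bar>x - 2 * real a\<bar> = 1" using assms by linarith+
    then have "y - 2 * real b = 0 \<and> (x - 2 * real a = 1 \<or> x - 2 * real a = - 1)" by linarith
    then show ?thesis unfolding corner_def by blast
  qed
qed

context lattice
begin

definition pos :: "nat \<Rightarrow> complex" where "pos u = Complex (mx (\<epsilon> u)) (my (\<epsilon> u))"

lemma pos_eq: "u < n \<Longrightarrow> v < n \<Longrightarrow> pos u = pos v \<longleftrightarrow> u = v"
  using mx_my_inject[of "\<epsilon> u" "\<epsilon> v"] eps_eq by (auto simp: pos_def)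

lemma in_segmentE:
  assumes "z \<in> closed_segment (pos u) (pos v)"
  obtains t where "0 \<le> t" "t \<le> 1"
    "\<And>a :: real. Re z - a = (1 - t) * (mx (\<epsilon> u) - a) + t * (mx (\<epsilon> v) - a)"
    "\<And>b :: real. Im z - b = (1 - t) * (my (\<epsilon> u) - b) + t * (my (\<epsilon> v) - b)"
proof -
  obtain t where t: "0 \<le> t" "t \<le> 1" and z: "z = (1 - t) *\<^sub>R pos u + t *\<^sub>R pos v"
    using assms by (auto simp: in_segment)
  have "Re z = (1 - t) * mx (\<epsilon> u) + t * mx (\<epsilon> v)" "Im z = (1 - t) * my (\<epsilon> u) + t * my (\<epsilon> v)"
    by (simp_all add: z pos_def)
  then show ?thesis by (intro that[of t] t) (simp_all add: algebra_simps)
qed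

lemma segment_square:
  assumes "p \<in> ends (\<epsilon> u)" "p \<in> ends (\<epsilon> v)" "z \<in> closed_segment (pos u) (pos v)"
  shows "\<bar>Re z - 2 * real (fst p)\<bar> + \<bar>Im z - 2 * real (snd p)\<bar> \<le> 1"
proof -
  obtain t where t: "0 \<le> t" "t \<le> 1"
    "\<And>a :: real. Re z - a = (1 - t) * (mx (\<epsilon> u) - a) + t * (mx (\<epsilon> v) - a)"
    "\<And>b :: real. Im z - b = (1 - t) * (my (\<epsilon> u) - b) + t * (my (\<epsilon> v) - b)"
    using in_segmentE[OF assms(3)] by blast
  show ?thesis unfolding t(3)[of "2 * real (fst p)"] t(4)[of "2 * real (snd p)"]
    by (rule segment_bound[OF corner_ends[OF assms(1)] corner_ends[OF assms(2)] t(1,2)])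
qed

lemma segment_corner:
  assumes "p \<in> ends (\<epsilon> u)" "p \<in> ends (\<epsilon> v)" "z \<in> closed_segment (pos u) (pos v)"
    "corner (Re z - 2 * real (fst p)) (Im z - 2 * real (snd p))"
  shows "z = pos u \<or> z = pos v"
proof -
  obtain t where t: "0 \<le> t" "t \<le> 1"
    "\<And>a :: real. Re z - a = (1 - t) * (mx (\<epsilon> u) - a) + t * (mx (\<epsilon> v) - a)"
    "\<And>b :: real. Im z - b = (1 - t) * (my (\<epsilon> u) - b) + t * (my (\<epsilon> v) - b)"
    using in_segmentE[OF assms(3)] by blast
  have "(Re z - 2 * real (fst p) = mx (\<epsilon> u) - 2 * real (fst p) \<and> Im z - 2 * real (snd p) = my (\<epsilon> u) - 2 * real (snd p)) \<or>
      (Re z - 2 * real (fst p) = mx (\<epsilon> v) - 2 * real (fst p) \<and> Im z - 2 * real (snd p) = my (\<epsilon> v) - 2 * real (snd p))"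
    using corner_extreme[OF corner_ends[OF assms(1)] corner_ends[OF assms(2)] t(1,2)] assms(4)
    unfolding t(3)[of "2 * real (fst p)"] t(4)[of "2 * real (snd p)"] by blast
  then show ?thesis by (auto simp: pos_def complex_eq_iff)
qed

lemma segments_meet:
  assumes lt: "u < n" "v < n" "v' < n" and ne: "u \<noteq> v" "u \<noteq> v'" "v \<noteq> v'"
    and p: "p \<in> ends (\<epsilon> u)" "p \<in> ends (\<epsilon> v)" "p \<in> ends (\<epsilon> v')"
    and z: "z \<in> closed_segment (pos u) (pos v)" "z \<in> closed_segment (pos u) (pos v')"
  shows "z = pos u"
proof -
  obtain t where t: "0 \<le> t" "t \<le> 1"
    "\<And>a :: real. Re z - a = (1 - t) * (mx (\<epsilon> u) - a) + t * (mx (\<epsilon> v) - a)"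
    "\<And>b :: real. Im z - b = (1 - t) * (my (\<epsilon> u) - b) + t * (my (\<epsilon> v) - b)"
    using in_segmentE[OF z(1)] by blast
  obtain s where s: "0 \<le> s" "s \<le> 1"
    "\<And>a :: real. Re z - a = (1 - s) * (mx (\<epsilon> u) - a) + s * (mx (\<epsilon> v') - a)"
    "\<And>b :: real. Im z - b = (1 - s) * (my (\<epsilon> u) - b) + s * (my (\<epsilon> v') - b)"
    using in_segmentE[OF z(2)] by blast
  have "(mx (\<epsilon> x) - 2 * real (fst p), my (\<epsilon> x) - 2 * real (snd p)) \<noteq> (mx (\<epsilon> y) - 2 * real (fst p), my (\<epsilon> y) - 2 * real (snd p))"
    if "x < n" "y < n" "x \<noteq> y" for x y
    using mx_my_inject[of "\<epsilon> x" "\<epsilon> y"] eps_eq[OF that(1,2)] that(3) by auto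
  from corner_segments_meet[OF corner_ends[OF p(1)] corner_ends[OF p(2)] corner_ends[OF p(3)]
    this[OF lt(1,2) ne(1)] this[OF lt(1,3) ne(2)] this[OF lt(2,3) ne(3)], of t s]
  have "Re z - 2 * real (fst p) = mx (\<epsilon> u) - 2 * real (fst p) \<and> Im z - 2 * real (snd p) = my (\<epsilon> u) - 2 * real (snd p)"
    using t(3)[of "2 * real (fst p)"] t(4)[of "2 * real (snd p)"] s(3)[of "2 * real (fst p)"] s(4)[of "2 * real (snd p)"]
    by metis
  then show ?thesis by (auto simp: pos_def complex_eq_iff)
qed

lemma planar_G: "planar G"
proof -
  define \<gamma> where "\<gamma> a = linepath (pos (Min a)) (pos (Max a))" for a
  have gamma: "\<exists>u v. a = {u, v} \<and> {u, v} \<in> edges G \<and> \<gamma> a = linepath (pos u) (pos v)"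
    if a: "a \<in> edges G" for a
  proof -
    obtain u v where uv: "a = {u, v}" "{u, v} \<in> edges G" using G_edgeE[OF a] by blast
    show ?thesis
    proof (cases "u \<le> v")
      case True
      then show ?thesis using uv by (intro exI[of _ u] exI[of _ v]) (simp add: \<gamma>_def min_def max_def)
    next
      case False
      then show ?thesis using uv
        by (intro exI[of _ v] exI[of _ u]) (simp add: \<gamma>_def insert_commute min_def max_def)
    qed
  qed
  \<comment> \<open>With at most three edges at \<open>p\<close>, two pairs of them have a member in
    common. This excludes the two diagonals of a square, the only segments between corners that
    cross in their interior.\<close>
  have three: "a = b \<or> c = a \<or> c = b \<or> d = a \<or> d = b \<or> c = d"
    if "p \<in> ends (\<epsilon> a)" "p \<in> ends (\<epsilon> b)" "p \<in> ends (\<epsilon> c)" "p \<in> ends (\<epsilon> d)"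
      "\<epsilon> a \<in> E" "\<epsilon> b \<in> E" "\<epsilon> c \<in> E" "\<epsilon> d \<in> E" "a < n" "b < n" "c < n" "d < n" for a b c d p
  proof (rule ccontr)
    assume "\<not> ?thesis"
    then have "card {\<epsilon> a, \<epsilon> b, \<epsilon> c, \<epsilon> d} = 4" using that(9-12) by (auto simp: eps_eq card_insert_if)
    moreover have "{\<epsilon> a, \<epsilon> b, \<epsilon> c, \<epsilon> d} \<subseteq> incident E p" using that by (auto simp: incident_def)
    ultimately show False using card_mono[OF finite_inc, of "{\<epsilon> a, \<epsilon> b, \<epsilon> c, \<epsilon> d}" p] deg3[of p] by simp
  qed
  have "inj_on pos (verts G)" using pos_eq by (auto simp: inj_on_def)
  moreover have "arc (\<gamma> a) \<and> {pathstart (\<gamma> a), pathfinish (\<gamma> a)} = pos ` a \<and>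
      path_image (\<gamma> a) \<inter> pos ` verts G = pos ` a" if ae: "a \<in> edges G" for a
  proof -
    obtain u v where a: "a = {u, v}" "{u, v} \<in> edges G" "\<gamma> a = linepath (pos u) (pos v)"
      using gamma[OF ae] by blast
    then have uv: "u < n" "v < n" "u \<noteq> v" "ends (\<epsilon> u) \<inter> ends (\<epsilon> v) \<noteq> {}" unfolding G_edge by auto
    then obtain p where p: "p \<in> ends (\<epsilon> u)" "p \<in> ends (\<epsilon> v)" by blast
    have "x = u \<or> x = v" if "x < n" "pos x \<in> closed_segment (pos u) (pos v)" for x
    proof -
      have "corner (Re (pos x) - 2 * real (fst p)) (Im (pos x) - 2 * real (snd p))"
        using midpoint_corner[of "\<epsilon> x"] segment_square[OF p that(2)] by (simp add: pos_def)
      then show ?thesis using segment_corner[OF p that(2)] pos_eq that(1) uv by auto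
    qed
    then show ?thesis using a uv pos_eq by (auto simp: arc_linepath)
  qed
  moreover have "path_image (\<gamma> a) \<inter> path_image (\<gamma> b) \<subseteq> pos ` verts G"
    if ab: "a \<in> edges G" "b \<in> edges G" "a \<noteq> b" for a b
  proof
    fix z assume z: "z \<in> path_image (\<gamma> a) \<inter> path_image (\<gamma> b)"
    obtain u v where a: "a = {u, v}" "{u, v} \<in> edges G" "\<gamma> a = linepath (pos u) (pos v)"
      using gamma[OF ab(1)] by blast
    obtain x y where b: "b = {x, y}" "{x, y} \<in> edges G" "\<gamma> b = linepath (pos x) (pos y)"
      using gamma[OF ab(2)] by blast
    have uv: "u < n" "v < n" "u \<noteq> v" "\<epsilon> u \<in> E" "\<epsilon> v \<in> E" "ends (\<epsilon> u) \<inter> ends (\<epsilon> v) \<noteq> {}"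
      using a(2) unfolding G_edge by auto
    have xy: "x < n" "y < n" "x \<noteq> y" "\<epsilon> x \<in> E" "\<epsilon> y \<in> E" "ends (\<epsilon> x) \<inter> ends (\<epsilon> y) \<noteq> {}"
      using b(2) unfolding G_edge by auto
    obtain p where p: "p \<in> ends (\<epsilon> u)" "p \<in> ends (\<epsilon> v)" using uv by blast
    obtain q where q: "q \<in> ends (\<epsilon> x)" "q \<in> ends (\<epsilon> y)" using xy by blast
    have zs: "z \<in> closed_segment (pos u) (pos v)" "z \<in> closed_segment (pos x) (pos y)"
      using z a b by auto
    show "z \<in> pos ` verts G"
    proof (cases "p = q")
      case False
      then have "(fst p, snd p) \<noteq> (fst q, snd q)" by simp
      from squares_meet[OF segment_square[OF p zs(1)] segment_square[OF q zs(2)] this]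
      show ?thesis using segment_corner[OF p zs(1)] uv by auto
    next
      case True
      have zs': "z \<in> closed_segment (pos v) (pos u)" "z \<in> closed_segment (pos y) (pos x)"
        using zs by (simp_all add: closed_segment_commute)
      have q': "p \<in> ends (\<epsilon> x)" "p \<in> ends (\<epsilon> y)" using True q by simp_all
      have ne: "{u, v} \<noteq> {x, y}" using ab a b by simp
      consider "u = x" | "u = y" | "v = x" | "v = y"
        using three[OF p q' uv(4,5) xy(4,5) uv(1,2) xy(1,2)] uv(3) xy(3) by blast
      then show ?thesis
      proof cases
        case 1
        have ne': "v \<noteq> y" using ne 1 by auto
        have "z = pos u"
          using segments_meet[OF uv(1) uv(2) xy(2) uv(3) _ ne' p(1) p(2) q'(2) zs(1)] xy(3) zs(2) 1 by simp
        then show ?thesis using uv by simp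
      next
        case 2
        have ne': "v \<noteq> x" using ne 2 by auto
        have "z = pos u"
          using segments_meet[OF uv(1) uv(2) xy(1) uv(3) _ ne' p(1) p(2) q'(1) zs(1)] xy(3) zs'(2) 2 by simp
        then show ?thesis using uv by simp
      next
        case 3
        have ne': "u \<noteq> y" using ne 3 by auto
        have "z = pos v"
          using segments_meet[OF uv(2) uv(1) xy(2) uv(3)[symmetric] _ ne' p(2) p(1) q'(2) zs'(1)] xy(3) zs(2) 3 by simp
        then show ?thesis using uv by simp
      next
        case 4
        have ne': "u \<noteq> x" using ne 4 by auto
        have "z = pos v"
          using segments_meet[OF uv(2) uv(1) xy(1) uv(3)[symmetric] _ ne' p(2) p(1) q'(1) zs'(1)] xy(3) zs'(2) 4 by simp
        then show ?thesis using uv by simp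
      qed
    qed
  qed
  ultimately show ?thesis unfolding planar_def
    by (intro exI[of _ pos] exI[of _ \<gamma>]) blast
qed

end

subsection \<open>Acyclic matchings and labellings\<close>

text \<open>An acyclic matching is a set of paths with an even number of edges each, and all pairs of a
  path are centred at points of the same colour. A nonzero label is the colour of these points
  plus one.\<close>

definition labelling :: "ledge set \<Rightarrow> (ledge \<Rightarrow> nat) \<Rightarrow> bool" where
  "labelling E l \<longleftrightarrow> (\<forall>e. l e \<le> 2) \<and> (\<forall>e. l e \<noteq> 0 \<longrightarrow> e \<in> E) \<and>
     (\<forall>p. card (incident E p) = 1 \<longrightarrow> (\<forall>e\<in>incident E p. l e = 2 - lat_colour p)) \<and>
     (\<forall>p. 2 \<le> card (incident E p) \<longrightarrow>
        (\<exists>e f. e \<noteq> f \<and> {e \<in> incident E p. l e \<noteq> 0} = {e, f} \<and> l e = l f))"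

text \<open>A certificate against closed labelled paths: the lowest point of such a path would need
  a lower neighbour on it.\<close>

definition descending :: "ledge set \<Rightarrow> (ledge \<Rightarrow> nat) \<Rightarrow> (point \<Rightarrow> nat) \<Rightarrow> bool" where
  "descending E l h \<longleftrightarrow> (\<forall>p. 2 \<le> card (incident E p) \<longrightarrow>
     (\<exists>e\<in>incident E p. l e \<noteq> 0 \<and> (\<exists>q\<in>ends e. h q < h p)))"

context lattice
begin

definition points :: "point set" where "points = (\<Union>e\<in>E. ends e)"

lemma finite_points: "finite points"
  using finite_E by (simp add: points_def)

lemma card_M:
  assumes "matching G M"
  shows "card (\<Union>M) = 2 * card M"
proof -
  have M: "M \<subseteq> edges G" and dj: "\<And>a b. a \<in> M \<Longrightarrow> b \<in> M \<Longrightarrow> a \<noteq> b \<Longrightarrow> a \<inter> b = {}"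
    using assms by (auto simp: matching_def)
  have two: "card a = 2" "finite a" if "a \<in> M" for a
    using that M simple_graph_G card_ge_0_finite[of a] by (auto simp: simple_graph_def)
  have "card (\<Union>M) = (\<Sum>a\<in>M. card a)"
    by (rule card_Union_disjoint) (use dj two in \<open>auto simp: pairwise_def disjnt_def\<close>)
  also have "\<dots> = (\<Sum>a\<in>M. 2)" using two by (intro sum.cong) auto
  finally show ?thesis by simp
qed

text \<open>Equality in the degree count forces two matched edges at every point of degree at least
  2 and one at every point of degree 1. If two matched edges meet at \<open>p\<close>, then either
  they form a pair centred at \<open>p\<close>, or each is centred at its other end, which has the
  other colour; in both cases the labels agree. An edge at a point of degree 1 is centred at its
  other end.\<close>

lemma labelling_of_matching:
  assumes "acyclic_matching G M" and total: "(\<Sum>p\<in>points. min 2 (card (incident E p))) = 4 * card M"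
  shows "\<exists>l. labelling E l"
proof -
  have mat: "matching G M" and acy: "acyclic_graph (induced_subgraph G (\<Union>M))"
    using assms(1) by (auto simp: acyclic_matching_def)
  have M: "M \<subseteq> edges G" and dj: "\<And>a b. a \<in> M \<Longrightarrow> b \<in> M \<Longrightarrow> a \<noteq> b \<Longrightarrow> a \<inter> b = {}"
    using mat by (auto simp: matching_def)
  define F where "F = \<epsilon> ` \<Union>M"
  have Mn: "\<Union>M \<subseteq> {..<n}" using M simple_graph_G by (auto simp: simple_graph_def)
  have FE: "F \<subseteq> E"
  proof
    fix e assume "e \<in> F"
    then obtain u a where u: "e = \<epsilon> u" "u \<in> a" "a \<in> M" by (auto simp: F_def)
    then obtain x y where "a = {x, y}" "{x, y} \<in> edges G" using M G_edgeE[of a] by blast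
    then show "e \<in> E" using u unfolding G_edge by auto
  qed
  have finF: "finite F" using FE finite_E finite_subset by blast
  have cF: "card F = 2 * card M"
    unfolding F_def using card_M[OF mat] card_image[OF inj_on_subset[OF inj Mn]] by simp
  \<comment> \<open>Three edges at one point are pairwise adjacent in the line graph, a cycle of
    length 3.\<close>
  have le2: "card (incident F p) \<le> 2" for p
  proof (rule ccontr)
    assume "\<not> card (incident F p) \<le> 2"
    then have "3 \<le> card (incident F p)" by simp
    from obtain_subset_with_card_n[OF this] obtain T where T: "T \<subseteq> incident F p" "card T = 3" by blast
    then obtain a b c where abc: "T = {a, b, c}" "a \<noteq> b" "b \<noteq> c" "a \<noteq> c"
      unfolding card_3_iff by blast
    have in_F: "a \<in> F" "b \<in> F" "c \<in> F" and in_p: "p \<in> ends a" "p \<in> ends b" "p \<in> ends c"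
      using T(1) unfolding abc(1) by (auto simp: incident_def)
    obtain u v w where uvw: "a = \<epsilon> u" "b = \<epsilon> v" "c = \<epsilon> w" "u \<in> \<Union>M" "v \<in> \<Union>M" "w \<in> \<Union>M"
      using in_F unfolding F_def by blast
    have lt: "u < n" "v < n" "w < n" using uvw(4-6) Mn by auto
    have ed: "{u, v} \<in> edges G" "{v, w} \<in> edges G" "{w, u} \<in> edges G"
      unfolding G_edge using lt in_F FE in_p abc uvw by auto
    have "is_cycle (induced_subgraph G (\<Union>M)) [u, v, w]"
      unfolding is_cycle_def
    proof (intro conjI allI impI)
      show "distinct [u, v, w]" using abc uvw by auto
      show "set [u, v, w] \<subseteq> verts (induced_subgraph G (\<Union> M))"
        using lt uvw(4-6) by (simp add: induced_subgraph_def)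
      fix i assume "i < length [u, v, w]"
      then consider "i = 0" | "i = 1" | "i = 2" by fastforce
      then show "{[u, v, w] ! i, [u, v, w] ! (Suc i mod length [u, v, w])} \<in> edges (induced_subgraph G (\<Union> M))"
        by cases (use ed uvw(4-6) in \<open>simp_all add: induced_subgraph_def\<close>)
    qed simp
    then show False using acy by (auto simp: acyclic_graph_def)
  qed
  have le: "card (incident F p) \<le> min 2 (card (incident E p))" for p
    using le2[of p] card_mono[OF finite_inc, of "incident F p" p] FE by (auto simp: incident_def)
  have "(\<Sum>p\<in>points. card (incident F p)) = 2 * card F"
    by (rule sum_degrees[OF finF finite_points]) (use FE in \<open>auto simp: points_def\<close>)
  then have "(\<Sum>p\<in>points. card (incident F p)) = (\<Sum>p\<in>points. min 2 (card (incident E p)))"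
    using total cF by simp
  \<comment> \<open>A termwise inequality between equal sums is an equality in every term.\<close>
  then have eqp: "card (incident F p) = min 2 (card (incident E p))" if "p \<in> points" for p
    using sum_mono_inv[of "\<lambda>p. card (incident F p)" points "\<lambda>p. min 2 (card (incident E p))"] le that finite_points
    by blast
  have eq: "card (incident F p) = min 2 (card (incident E p))" for p
  proof (cases "p \<in> points")
    case False
    then have "incident E p = {}" by (auto simp: points_def incident_def)
    then show ?thesis using le[of p] by simp
  qed (rule eqp)
  define N where "N e f \<longleftrightarrow> e \<noteq> f \<and> (\<exists>u v. {u, v} \<in> M \<and> e = \<epsilon> u \<and> f = \<epsilon> v)" for e f
  have N_sym: "N e f \<Longrightarrow> N f e" for e f unfolding N_def by (metis insert_commute)
  have N_F: "f \<in> F" if "N e f" for e f using that unfolding N_def F_def by blast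
  have N_unique: "f = g" if "N e f" "N e g" for e f g
  proof -
    from that(1) obtain u v where uv: "{u, v} \<in> M" "e = \<epsilon> u" "f = \<epsilon> v" by (auto simp: N_def)
    from that(2) obtain x y where xy: "{x, y} \<in> M" "e = \<epsilon> x" "g = \<epsilon> y" by (auto simp: N_def)
    have lt: "u < n" "v < n" "x < n" "y < n" using uv(1) xy(1) Mn by auto
    then have "u = x" using uv(2) xy(2) eps_eq by blast
    then have "{u, v} = {x, y}" using dj[OF uv(1) xy(1)] by blast
    then show ?thesis using \<open>u = x\<close> uv(3) xy(3) by (auto simp: doubleton_eq_iff)
  qed
  have N_ex: "\<exists>f p. N e f \<and> p \<in> ends e \<and> p \<in> ends f" if eF: "e \<in> F" for e
  proof -
    obtain u a where u: "e = \<epsilon> u" "u \<in> a" "a \<in> M" using eF by (auto simp: F_def)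
    obtain x y where xy: "a = {x, y}" "{x, y} \<in> edges G" using M u(3) G_edgeE[of a] by blast
    obtain v where v: "a = {u, v}" "{u, v} \<in> edges G"
      using xy u(2) by (auto simp: insert_commute)
    then have "N e (\<epsilon> v)" "ends e \<inter> ends (\<epsilon> v) \<noteq> {}"
      using u eps_eq unfolding N_def G_edge by auto
    then show ?thesis by blast
  qed
  \<comment> \<open>The centre of the pair that contains \<open>e\<close>.\<close>
  define s where "s e = (SOME p. \<exists>f. N e f \<and> p \<in> ends e \<and> p \<in> ends f)" for e
  have s: "\<exists>f. N e f \<and> s e \<in> ends e \<and> s e \<in> ends f" if "e \<in> F" for e
    unfolding s_def by (rule someI_ex) (use N_ex[OF that] in blast)
  have s_eq: "s e = p" if "N e f" "e \<in> F" "p \<in> ends e" "p \<in> ends f" for e f p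
  proof -
    from s[OF that(2)] obtain g where g: "N e g" "s e \<in> ends e" "s e \<in> ends g" by blast
    then have "g = f" using N_unique that(1) by blast
    moreover have "e \<noteq> f" using that(1) by (simp add: N_def)
    ultimately show ?thesis using share_unique[of e f "s e" p] g that(3,4) by blast
  qed
  define l where "l e = (if e \<in> F then 1 + lat_colour (s e) else 0)" for e
  have inc_F: "{e \<in> incident E p. l e \<noteq> 0} = incident F p" for p using FE by (auto simp: incident_def l_def)
  have off: "l e = 2 - lat_colour p" if "e \<in> F" "p \<in> ends e" "s e \<noteq> p" for e p
  proof -
    have "s e \<in> ends e" using s[OF that(1)] by blast
    then have "lat_colour (s e) = 1 - lat_colour p" using colour_other[of p e "s e"] that by metis
    then show ?thesis using that(1) colour_cases[of p] by (auto simp: l_def)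
  qed
  have "labelling E l"
    unfolding labelling_def
  proof (intro conjI allI impI ballI)
    fix e show "l e \<le> 2" using colour_le[of "s e"] by (simp add: l_def)
    show "l e \<noteq> 0 \<Longrightarrow> e \<in> E" using FE by (auto simp: l_def split: if_splits)
  next
    fix p e assume c1: "card (incident E p) = 1" and e: "e \<in> incident E p"
    have single: "incident E p = {e}" using c1 e by (metis card_1_singletonE singletonD)
    have "card (incident F p) = 1" using eq[of p] c1 by simp
    then have "incident F p \<noteq> {}" by auto
    then have eF: "e \<in> F" using single FE by (auto simp: incident_def)
    have "s e \<noteq> p"
    proof
      assume sp: "s e = p"
      obtain f where f: "N e f" "s e \<in> ends f" using s[OF eF] by blast
      then have "f \<in> incident E p" using N_F[OF f(1)] FE sp by (auto simp: incident_def)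
      then show False using single f(1) by (auto simp: N_def)
    qed
    then show "l e = 2 - lat_colour p" using off[OF eF] e by (simp add: incident_def)
  next
    fix p assume "2 \<le> card (incident E p)"
    then have "card (incident F p) = 2" using eq[of p] by simp
    then obtain e f where ef: "incident F p = {e, f}" "e \<noteq> f" by (meson card_2_iff)
    have eF: "e \<in> F" "p \<in> ends e" and fF: "f \<in> F" "p \<in> ends f" using ef(1) by (auto simp: incident_def)
    \<comment> \<open>If \<open>x\<close> is centred at \<open>p\<close>, its partner is the only
      other matched edge there.\<close>
    have key: "s y = p" if "s x = p" "x \<in> F" "y \<in> F" "x \<noteq> y" "p \<in> ends x" "p \<in> ends y" "incident F p = {x, y}" for x y
    proof -
      from s[OF that(2)] obtain g where g: "N x g" "s x \<in> ends g" by blast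
      then have "g \<in> incident F p" using N_F that(1) by (auto simp: incident_def)
      then have "g = y" using that(7) g(1) by (auto simp: N_def)
      then show ?thesis using s_eq[OF N_sym[OF g(1)]] that by blast
    qed
    have "l e = l f"
    proof (cases "s e = p")
      case True
      then have "s f = p" using key[of e f] eF fF ef by blast
      then show ?thesis using True eF fF by (simp add: l_def)
    next
      case False
      then have "s f \<noteq> p" using key[of f e] eF fF ef by (auto simp: insert_commute)
      then show ?thesis using off[OF eF False] off[OF fF] by simp
    qed
    then show "\<exists>e f. e \<noteq> f \<and> {e \<in> incident E p. l e \<noteq> 0} = {e, f} \<and> l e = l f"
      using ef inc_F by blast
  qed
  then show ?thesis by blast
qed

text \<open>The label of an edge names the colour of one of its ends, and the edge is paired with
  the other labelled edge at that end. Equal labels make the choice mutual. A cycle of the line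
  graph would be a closed path of labelled edges, which the potential excludes.\<close>

lemma matching_of_labelling:
  assumes lab: "labelling E l" and desc: "descending E l h"
    and total: "(\<Sum>p\<in>points. min 2 (card (incident E p))) = 4 * k"
  shows "\<exists>M. acyclic_matching G M \<and> card M = k"
proof -
  have l2: "l e \<le> 2" and lE: "l e \<noteq> 0 \<Longrightarrow> e \<in> E" for e
    using lab unfolding labelling_def by blast+
  have l_1: "l e = 2 - lat_colour p" if "card (incident E p) = 1" "e \<in> incident E p" for e p
    using lab that unfolding labelling_def by blast
  have l_2: "\<exists>e f. e \<noteq> f \<and> {e \<in> incident E p. l e \<noteq> 0} = {e, f} \<and> l e = l f" if "2 \<le> card (incident E p)" for p
    using lab that unfolding labelling_def by blast
  define F where "F = {e \<in> E. l e \<noteq> 0}"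
  have finF: "finite F" using finite_E by (simp add: F_def)
  have inc_F: "incident F p = {e \<in> incident E p. l e \<noteq> 0}" for p by (auto simp: incident_def F_def)
  have pos_inc: "1 \<le> card (incident E p)" if "e \<in> incident E p" for e p
    using that finite_inc[of p] by (metis One_nat_def Suc_leI card_gt_0_iff empty_iff)
  have F_pair: "\<exists>f. incident F p = {e, f} \<and> e \<noteq> f \<and> l e = l f" if "2 \<le> card (incident E p)" "e \<in> incident F p" for e p
  proof -
    from l_2[OF that(1)] obtain a b where ab: "a \<noteq> b" "incident F p = {a, b}" "l a = l b"
      unfolding inc_F by blast
    have "e = a \<or> e = b" using that(2) ab(2) by simp
    then show ?thesis
    proof
      assume "e = a"
      then show ?thesis using ab by (intro exI[of _ b]) simp
    next
      assume "e = b"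
      then show ?thesis using ab by (intro exI[of _ a]) (simp add: insert_commute)
    qed
  qed
  have degF: "card (incident F p) = min 2 (card (incident E p))" if "p \<in> points" for p
  proof -
    from that obtain e where "e \<in> incident E p" by (auto simp: points_def incident_def)
    then consider "card (incident E p) = 1" | "2 \<le> card (incident E p)" using pos_inc[of e p] by linarith
    then show ?thesis
    proof cases
      case 1
      then have "l e = 2 - lat_colour p" using l_1 \<open>e \<in> incident E p\<close> by blast
      then have "l e \<noteq> 0" using colour_le[of p] by auto
      moreover have "incident E p = {e}" using 1 \<open>e \<in> incident E p\<close> by (metis card_1_singletonE singletonD)
      ultimately have "incident F p = {e}" by (auto simp: inc_F)
      then show ?thesis using 1 by simp
    next
      case 2
      then show ?thesis using l_2[OF 2] inc_F by auto
    qed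
  qed
  have "2 * card F = (\<Sum>p\<in>points. card (incident F p))"
    by (rule sum_degrees[OF finF finite_points, symmetric]) (auto simp: points_def F_def)
  also have "\<dots> = 4 * k" using total degF by simp
  finally have cF: "card F = 2 * k" by simp
  define c where "c e = (SOME p. p \<in> ends e \<and> lat_colour p = l e - 1)" for e
  have c: "c e \<in> ends e" "lat_colour (c e) = l e - 1" if "e \<in> F" for e
  proof -
    have "l e - 1 \<le> 1" using l2[of e] by simp
    then have "\<exists>p. p \<in> ends e \<and> lat_colour p = l e - 1" using ends_colour by blast
    from someI_ex[OF this] show "c e \<in> ends e" "lat_colour (c e) = l e - 1" by (simp_all add: c_def)
  qed
  have c_unique: "c e = p" if "e \<in> F" "p \<in> ends e" "lat_colour p = l e - 1" for e p
    using colour_other[of p e "c e"] c[OF that(1)] that colour_cases[of p] by fastforce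
  \<comment> \<open>At a point of degree 1 the label is one plus the opposite colour, so such a
    point is never the centre.\<close>
  have c_deg: "2 \<le> card (incident E (c e))" if "e \<in> F" for e
  proof (rule ccontr)
    assume "\<not> ?thesis"
    moreover have e: "e \<in> incident E (c e)" using c[OF that] that by (auto simp: incident_def F_def)
    ultimately have "card (incident E (c e)) = 1" using pos_inc[OF e] by simp
    then have "l e = 2 - lat_colour (c e)" using l_1 e by blast
    moreover have "l e \<noteq> 0" using that by (simp add: F_def)
    ultimately show False using c(2)[OF that] colour_le[of "c e"] by arith
  qed
  have partner: "\<exists>f. incident F (c e) = {e, f} \<and> e \<noteq> f \<and> f \<in> F \<and> c f = c e" if "e \<in> F" for e
  proof -
    have "e \<in> incident F (c e)" using c[OF that] that by (simp add: incident_def)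
    from F_pair[OF c_deg[OF that] this] obtain f where f: "incident F (c e) = {e, f}" "e \<noteq> f" "l e = l f" by blast
    then have "f \<in> F" "c e \<in> ends f" by (auto simp: incident_def)
    moreover have "c f = c e" using c_unique[of f "c e"] calculation c(2)[OF that] f(3) by simp
    ultimately show ?thesis using f by blast
  qed
  define M where "M = {{u, v} | u v. u < n \<and> v < n \<and> u \<noteq> v \<and> \<epsilon> u \<in> F \<and> \<epsilon> v \<in> F \<and> c (\<epsilon> u) = c (\<epsilon> v)}"
  have cover: "\<Union>M = {u. u < n \<and> \<epsilon> u \<in> F}"
  proof (intro equalityI subsetI)
    fix u assume u: "u \<in> {u. u < n \<and> \<epsilon> u \<in> F}"
    then obtain f where f: "\<epsilon> u \<noteq> f" "f \<in> F" "c f = c (\<epsilon> u)" using partner[of "\<epsilon> u"] by auto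
    then have "f \<in> E" by (simp add: F_def)
    then obtain v where "v < n" "f = \<epsilon> v" using sub by auto
    then have "{u, v} \<in> M" using u f unfolding M_def by auto
    then show "u \<in> \<Union>M" by blast
  qed (auto simp: M_def)
  have pair_unique: "v = w" if "u < n" "v < n" "w < n" "\<epsilon> u \<in> F" "\<epsilon> v \<in> F" "\<epsilon> w \<in> F" "u \<noteq> v" "u \<noteq> w"
    "c (\<epsilon> v) = c (\<epsilon> u)" "c (\<epsilon> w) = c (\<epsilon> u)" for u v w
  proof -
    from partner[OF that(4)] obtain f where f: "incident F (c (\<epsilon> u)) = {\<epsilon> u, f}" by blast
    have "\<epsilon> v \<in> {\<epsilon> u, f}" "\<epsilon> w \<in> {\<epsilon> u, f}"
      unfolding f[symmetric] incident_def
      using that(5,6) c(1)[OF that(5)] c(1)[OF that(6)] unfolding that(9,10) by simp_all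
    then have "\<epsilon> v = f" "\<epsilon> w = f"
      using eps_eq[OF that(1,2)] eps_eq[OF that(1,3)] that(7,8) by auto
    then show ?thesis using eps_eq[OF that(2,3)] by simp
  qed
  have "matching G M"
    unfolding matching_def
  proof (intro conjI ballI impI)
    show "M \<subseteq> edges G"
    proof
      fix a assume "a \<in> M"
      then obtain u v where uv: "a = {u, v}" "u < n" "v < n" "u \<noteq> v" "\<epsilon> u \<in> F" "\<epsilon> v \<in> F" "c (\<epsilon> u) = c (\<epsilon> v)"
        unfolding M_def by blast
      have "c (\<epsilon> u) \<in> ends (\<epsilon> u) \<inter> ends (\<epsilon> v)" using c(1)[OF uv(5)] c(1)[OF uv(6)] uv(7) by simp
      then show "a \<in> edges G" unfolding uv(1) G_edge using uv by (auto simp: F_def)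
    qed
    fix a b assume ab: "a \<in> M" "b \<in> M" "a \<noteq> b"
    have other: "\<exists>w. a = {z, w} \<and> z < n \<and> w < n \<and> z \<noteq> w \<and> \<epsilon> z \<in> F \<and> \<epsilon> w \<in> F \<and> c (\<epsilon> w) = c (\<epsilon> z)"
      if aM: "a \<in> M" and za: "z \<in> a" for a z
    proof -
      obtain u v where uv: "a = {u, v}" "u < n" "v < n" "u \<noteq> v" "\<epsilon> u \<in> F" "\<epsilon> v \<in> F" "c (\<epsilon> u) = c (\<epsilon> v)"
        using aM unfolding M_def by blast
      have "z = u \<or> z = v" using za uv(1) by simp
      then show ?thesis
      proof
        assume "z = u"
        then show ?thesis using uv by (intro exI[of _ v] conjI) simp_all
      next
        assume "z = v"
        then show ?thesis using uv by (intro exI[of _ u] conjI) (simp_all add: insert_commute)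
      qed
    qed
    show "a \<inter> b = {}"
    proof (rule ccontr)
      assume "a \<inter> b \<noteq> {}"
      then obtain z where z: "z \<in> a" "z \<in> b" by blast
      obtain w where w: "a = {z, w}" "z < n" "w < n" "z \<noteq> w" "\<epsilon> z \<in> F" "\<epsilon> w \<in> F" "c (\<epsilon> w) = c (\<epsilon> z)"
        using other[OF ab(1) z(1)] by blast
      obtain w' where w': "b = {z, w'}" "w' < n" "z \<noteq> w'" "\<epsilon> w' \<in> F" "c (\<epsilon> w') = c (\<epsilon> z)"
        using other[OF ab(2) z(2)] by blast
      have "w = w'" by (rule pair_unique[OF w(2,3) w'(2) w(5,6) w'(4) w(4) w'(3) w(7) w'(5)])
      then show False using ab(3) w(1) w'(1) by simp
    qed
  qed
  moreover have "card M = k"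
  proof -
    have "\<epsilon> ` {u. u < n \<and> \<epsilon> u \<in> F} = F" using sub by (auto simp: F_def)
    moreover have "inj_on \<epsilon> {u. u < n \<and> \<epsilon> u \<in> F}" by (rule inj_on_subset[OF inj]) auto
    ultimately have "card {u. u < n \<and> \<epsilon> u \<in> F} = card F" by (metis card_image)
    then show ?thesis using card_M[OF \<open>matching G M\<close>] cover cF by simp
  qed
  moreover have "acyclic_graph (induced_subgraph G (\<Union>M))"
    unfolding acyclic_graph_def
  proof
    assume "\<exists>vs. is_cycle (induced_subgraph G (\<Union>M)) vs"
    then obtain vs where vs: "is_cycle (induced_subgraph G (\<Union>M)) vs" ..
    define m where "m = length vs"
    define e where "e i = \<epsilon> (vs ! (i mod m))" for i
    have m3: "3 \<le> m" and dist: "distinct vs" and set: "set vs \<subseteq> \<Union>M"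
      and edge: "\<And>i. i < m \<Longrightarrow> {vs ! i, vs ! (Suc i mod m)} \<in> edges G"
      using vs unfolding is_cycle_def m_def induced_subgraph_def by auto
    have in_set: "vs ! (i mod m) \<in> \<Union>M" for i
      using set m3 by (metis gr_zeroI m_def mod_less_divisor not_numeral_le_zero nth_mem subsetD)
    have eF: "e i \<in> F" for i using in_set[of i] unfolding cover e_def by simp
    have e_neq: "e i \<noteq> e j" if "i mod m \<noteq> j mod m" for i j
    proof -
      have "vs ! (i mod m) \<noteq> vs ! (j mod m)"
        using that nth_eq_iff_index_eq[OF dist, of "i mod m" "j mod m"] m3 unfolding m_def[symmetric]
        by (metis gr_zeroI mod_less_divisor not_numeral_le_zero)
      then show ?thesis using in_set[of i] in_set[of j] eps_eq unfolding cover e_def by simp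
    qed
    have "\<exists>p. p \<in> ends (e i) \<and> p \<in> ends (e (Suc i))" for i
    proof -
      have "i mod m < m" using m3 by simp
      from edge[OF this] have "ends (\<epsilon> (vs ! (i mod m))) \<inter> ends (\<epsilon> (vs ! (Suc (i mod m) mod m))) \<noteq> {}"
        unfolding G_edge by blast
      then show ?thesis unfolding e_def by (auto simp: mod_Suc_eq)
    qed
    \<comment> \<open>The lattice points that a cycle of the line graph passes through:
      \<open>p i\<close> is shared by consecutive edges. Since no point has three labelled edges,
      consecutive points differ and the lattice edges form a closed path.\<close>
    then obtain p where p: "\<And>i. p i \<in> ends (e i)" "\<And>i. p i \<in> ends (e (Suc i))" by metis
    have sucne: "i mod m \<noteq> Suc i mod m" for i
    proof
      assume "i mod m = Suc i mod m"
      then have "m dvd Suc i - i" by (metis le_SucI le_refl mod_eq_dvd_iff_nat)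
      then show False using m3 by (auto dest: dvd_imp_le)
    qed
    have sucne2: "i mod m \<noteq> Suc (Suc i) mod m" for i
    proof
      assume "i mod m = Suc (Suc i) mod m"
      then have "m dvd Suc (Suc i) - i" by (metis le_SucI le_refl mod_eq_dvd_iff_nat)
      then show False using m3 by (auto dest: dvd_imp_le)
    qed
    have incp: "incident F (p i) = {e i, e (Suc i)}" for i
    proof -
      have sub2: "{e i, e (Suc i)} \<subseteq> incident F (p i)" using eF p by (auto simp: incident_def)
      have "card {e i, e (Suc i)} = 2" using e_neq[OF sucne[of i]] by simp
      moreover have "p i \<in> points" using eF[of i] p(1)[of i] by (auto simp: points_def F_def)
      then have "card (incident F (p i)) \<le> 2" using degF by simp
      moreover have "finite (incident F (p i))" using finF by (simp add: incident_def)
      ultimately show ?thesis using card_subset_eq[OF _ sub2] card_mono[OF _ sub2] by simp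
    qed
    have deg2: "2 \<le> card (incident E (p i))" for i
    proof -
      have "{e i, e (Suc i)} \<subseteq> incident E (p i)" using incp[of i] by (auto simp: inc_F)
      then have "card {e i, e (Suc i)} \<le> card (incident E (p i))" by (intro card_mono) simp_all
      then show ?thesis using e_neq[OF sucne[of i]] by simp
    qed
    have p_neq: "p i \<noteq> p (Suc i)" for i
    proof
      assume "p i = p (Suc i)"
      then have "e (Suc (Suc i)) \<in> {e i, e (Suc i)}" using incp[of i] incp[of "Suc i"] by auto
      then show False using e_neq[OF sucne2[of i]] e_neq[OF sucne[of "Suc i"]] by auto
    qed
    have ends_e: "ends (e (Suc i)) = {p i, p (Suc i)}" for i
      using p(2)[of i] p(1)[of "Suc i"] p_neq[of i] by (auto simp: ends_def)
    have per: "p (i + m) = p i" for i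
    proof -
      have "e (i + m) = e i" "e (Suc (i + m)) = e (Suc i)"
        unfolding e_def add_Suc[symmetric] by (simp_all only: mod_add_self2)
      then show ?thesis
        using share_unique[OF e_neq[OF sucne[of i]], of "p (i + m)" "p i"] p[of i] p[of "i + m"] by simp
    qed
    \<comment> \<open>A lowest point of the closed path. Both labelled edges at it belong to the
      path, so their other ends are not lower.\<close>
    obtain j where j: "\<And>i. h (p j) \<le> h (p i)"
    proof -
      have "\<exists>j. \<forall>i. h (p j) \<le> h (p i)" using ex_has_least_nat[of "\<lambda>_. True" 0 "h \<circ> p"] by auto
      then show ?thesis using that by blast
    qed
    have desc': "\<exists>e\<in>incident E (p j). l e \<noteq> 0 \<and> (\<exists>q\<in>ends e. h q < h (p j))"
      using desc deg2[of j] unfolding descending_def by blast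
    then obtain f q where fq: "f \<in> incident F (p j)" "q \<in> ends f" "h q < h (p j)"
      unfolding inc_F by blast
    \<comment> \<open>The predecessor of \<open>j\<close> modulo \<open>m\<close>, shifted by a
      period to stay in the natural numbers.\<close>
    define j' where "j' = j + m - 1"
    have j': "Suc j' = j + m" using m3 by (simp add: j'_def)
    have "e (Suc j') = e j" unfolding j' e_def by simp
    then have "ends (e j) = {p j', p (Suc j')}" using ends_e[of j'] by simp
    then have "q = p j' \<or> q = p (Suc j') \<or> q = p j \<or> q = p (Suc j)"
      using fq(1,2) incp[of j] ends_e[of j] by auto
    then show False using fq(3) j[of j'] j[of "Suc j'"] j[of j] j[of "Suc j"] by auto
  qed
  ultimately show ?thesis by (auto simp: acyclic_matching_def)
qed

end

section \<open>The cells of the crossbar\<close>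

text \<open>A cell is a block of 6 times 18 lattice points, listed row by row. A mask tells which edges
  leave a point: 1 for the edge to the right, 2 for the edge downwards. In a cell of type \<open>Pass\<close> a row wire and a column wire cross; in a cell of
  type \<open>Add\<close> the bit of the column is added to the bit of the row, and both bits must not be 1.
  A row wire consists of two lines, which enter a cell at its first two points on the left and carry
  a bit and its complement; a column wire enters a cell at its third point on the top. The cells at
  the top and bottom of the crossbar join the wires of two neighbouring columns.\<close>

text \<open>The labels of the edges that leave a point to the right and downwards, and a potential of the
  point.\<close>

type_synonym code = "nat \<times> nat \<times> nat"

datatype ctype = Empty | Pass | Add | CupL | CupR | CapL | CapR | Term

definition pass_mask :: "nat list" where
  "pass_mask =
     [1, 2, 2, 0, 3, 1, 2, 2, 2, 0, 2, 3, 2, 3, 2, 0, 2, 2, 2, 3, 1, 2, 2, 2, 3, 2, 2, 2, 2,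
     2, 3, 2, 2, 2, 2, 2, 2, 3, 1, 2, 2, 2, 2, 3, 3, 2, 2, 2, 2, 2, 0, 2, 2, 2, 2, 2, 2, 2,
     2, 2, 2, 3, 1, 2, 2, 2, 2, 3, 1, 2, 2, 2, 2, 3, 3, 2, 2, 2, 2, 2, 0, 2, 2, 2, 2, 2, 0,
     1, 0, 2, 2, 1, 1, 1, 1, 0, 1, 1, 2, 0, 0, 0, 0, 0, 2, 0, 0, 0]"

definition add_mask :: "nat list" where
  "add_mask =
     [1, 2, 2, 0, 3, 1, 2, 2, 2, 0, 2, 3, 2, 2, 2, 2, 2, 2, 2, 3, 1, 2, 2, 2, 3, 1, 1, 2, 2,
     2, 3, 1, 3, 2, 2, 2, 3, 0, 3, 2, 2, 2, 3, 3, 1, 2, 2, 2, 2, 2, 2, 2, 2, 2, 2, 3, 1, 2,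
     2, 2, 2, 3, 3, 2, 2, 2, 2, 2, 2, 2, 2, 2, 2, 2, 0, 2, 2, 2, 2, 2, 0, 2, 2, 2, 2, 2, 0,
     1, 0, 2, 2, 1, 1, 1, 1, 0, 1, 1, 2, 0, 0, 0, 0, 0, 2, 0, 0, 0]"

text \<open>The two digits in the names of these tables are the bit entering with the row and the
  bit of the column.\<close>

definition pass_labels00 :: "code list" where
  "pass_labels00 =
     [(2,0,0), (0,2,1), (0,1,13), (0,0,0), (2,2,26), (2,0,27), (0,1,0), (0,2,2), (0,1,12), (0,0,0),
     (0,2,25), (1,1,23), (0,1,1), (0,2,3), (0,1,11), (0,0,0), (0,2,24), (0,1,22), (0,1,2), (0,2,4),
     (1,0,10), (0,1,9), (0,2,23), (0,1,21), (0,1,3), (0,2,5), (0,2,0), (0,1,8), (0,2,22), (0,1,20),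
     (0,1,4), (0,2,4), (0,2,1), (0,1,7), (0,2,21), (0,1,19), (0,1,5), (2,0,3), (0,0,2), (0,1,6),
     (0,2,20), (0,1,18), (0,1,6), (2,2,2), (0,2,1), (0,1,5), (0,2,19), (0,1,17), (0,1,7), (0,2,3),
     (0,0,0), (0,1,4), (0,2,18), (0,1,16), (0,1,8), (0,2,4), (0,1,0), (0,1,3), (0,2,17), (0,1,15),
     (0,1,9), (0,2,5), (1,0,1), (0,0,2), (0,2,16), (0,1,14), (0,1,10), (2,0,6), (2,0,7), (0,2,8),
     (0,2,15), (0,1,13), (0,1,11), (1,1,2), (0,1,1), (0,2,9), (0,2,14), (0,1,12), (0,1,12), (0,1,3),
     (0,0,0), (0,2,10), (0,2,13), (0,1,11), (0,1,13), (0,1,4), (0,0,0), (2,0,11), (0,0,12), (0,1,10),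
     (0,1,14), (1,0,5), (1,0,6), (1,0,7), (1,0,8), (0,0,9), (1,0,15), (1,0,16), (0,1,17), (0,0,0),
     (0,0,0), (0,0,0), (0,0,0), (0,0,0), (0,1,18), (0,0,0), (0,0,0), (0,0,0)]"

definition pass_labels01 :: "code list" where
  "pass_labels01 =
     [(2,0,0), (0,2,1), (0,2,6), (0,0,0), (2,2,26), (2,0,27), (0,1,0), (0,2,2), (0,2,5), (0,0,0),
     (0,2,25), (1,1,23), (0,1,1), (2,0,3), (0,0,4), (0,0,0), (0,2,24), (0,1,22), (0,1,2), (1,1,5),
     (1,0,6), (0,1,7), (0,2,23), (0,1,21), (1,0,3), (0,0,4), (0,2,0), (0,1,8), (0,2,22), (0,1,20),
     (2,2,5), (0,2,4), (0,2,1), (0,1,7), (0,2,21), (0,1,19), (0,2,6), (2,0,3), (0,0,2), (0,1,6),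
     (0,2,20), (0,1,18), (0,2,7), (2,2,2), (0,2,1), (0,1,5), (0,2,19), (0,1,17), (0,2,8), (0,2,3),
     (0,0,0), (0,1,4), (0,2,18), (0,1,16), (0,2,9), (0,2,4), (0,1,0), (0,1,3), (0,2,17), (0,1,15),
     (0,2,10), (0,2,5), (1,0,1), (0,0,2), (0,2,16), (0,1,14), (0,2,11), (2,0,6), (2,0,7), (0,2,8),
     (0,2,15), (0,1,13), (0,2,12), (1,1,2), (0,1,1), (0,2,9), (0,2,14), (0,1,12), (0,2,13), (0,1,3),
     (0,0,0), (0,2,10), (0,2,13), (0,1,11), (0,2,14), (0,1,4), (0,0,0), (2,0,11), (0,0,12), (0,1,10),
     (0,2,15), (1,0,5), (1,0,6), (1,0,7), (1,0,8), (0,0,9), (2,0,16), (2,0,17), (0,2,18), (0,0,0),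
     (0,0,0), (0,0,0), (0,0,0), (0,0,0), (0,2,19), (0,0,0), (0,0,0), (0,0,0)]"

definition pass_labels10 :: "code list" where
  "pass_labels10 =
     [(1,0,0), (0,1,1), (0,1,6), (0,0,0), (1,1,19), (1,0,20), (0,2,0), (0,1,2), (0,1,5), (0,0,0),
     (0,1,18), (2,2,30), (0,2,1), (1,0,3), (0,0,4), (0,0,0), (0,1,17), (0,2,29), (0,2,2), (2,2,5),
     (2,0,6), (0,2,6), (0,1,16), (0,2,28), (2,0,3), (0,0,4), (0,2,0), (0,2,5), (0,1,15), (0,2,27),
     (1,1,8), (0,1,7), (0,2,1), (0,2,4), (0,1,14), (0,2,26), (0,1,9), (0,1,6), (2,0,2), (0,0,3),
     (0,1,13), (0,2,25), (0,1,10), (0,1,5), (2,2,1), (0,2,2), (0,1,12), (0,2,24), (0,1,11), (0,1,4),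
     (0,0,0), (0,2,3), (0,1,11), (0,2,23), (0,1,12), (0,1,3), (0,1,0), (0,2,4), (0,1,10), (0,2,22),
     (0,1,13), (1,0,2), (0,0,1), (0,2,5), (0,1,9), (0,2,21), (0,1,14), (2,2,8), (2,0,7), (0,0,6),
     (0,1,8), (0,2,20), (0,1,15), (0,2,9), (1,1,1), (0,1,2), (0,1,7), (0,2,19), (0,1,16), (0,2,10),
     (0,0,0), (0,1,3), (0,1,6), (0,2,18), (0,1,17), (0,2,11), (0,0,0), (1,0,4), (0,0,5), (0,2,17),
     (0,1,18), (2,0,12), (2,0,13), (2,0,14), (2,0,15), (0,0,16), (1,0,19), (1,0,20), (0,1,21), (0,0,0),
     (0,0,0), (0,0,0), (0,0,0), (0,0,0), (0,1,22), (0,0,0), (0,0,0), (0,0,0)]"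

definition pass_labels11 :: "code list" where
  "pass_labels11 =
     [(1,0,0), (0,1,1), (0,2,10), (0,0,0), (1,1,19), (1,0,20), (0,2,0), (0,1,2), (0,2,9), (0,0,0),
     (0,1,18), (2,2,30), (0,2,1), (0,1,3), (0,2,8), (0,0,0), (0,1,17), (0,2,29), (0,2,2), (0,1,4),
     (2,0,7), (0,2,6), (0,1,16), (0,2,28), (0,2,3), (0,1,5), (0,2,0), (0,2,5), (0,1,15), (0,2,27),
     (0,2,4), (0,1,6), (0,2,1), (0,2,4), (0,1,14), (0,2,26), (0,2,5), (0,1,6), (2,0,2), (0,0,3),
     (0,1,13), (0,2,25), (0,2,6), (0,1,5), (2,2,1), (0,2,2), (0,1,12), (0,2,24), (0,2,7), (0,1,4),
     (0,0,0), (0,2,3), (0,1,11), (0,2,23), (0,2,8), (0,1,3), (0,1,0), (0,2,4), (0,1,10), (0,2,22),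
     (0,2,9), (1,0,2), (0,0,1), (0,2,5), (0,1,9), (0,2,21), (0,2,10), (2,2,8), (2,0,7), (0,0,6), (0,1,8),
     (0,2,20), (0,2,11), (0,2,9), (1,1,1), (0,1,2), (0,1,7), (0,2,19), (0,2,12), (0,2,10), (0,0,0),
     (0,1,3), (0,1,6), (0,2,18), (0,2,13), (0,2,11), (0,0,0), (1,0,4), (0,0,5), (0,2,17), (0,2,14),
     (2,0,12), (2,0,13), (2,0,14), (2,0,15), (0,0,16), (2,0,15), (2,0,16), (0,2,17), (0,0,0), (0,0,0),
     (0,0,0), (0,0,0), (0,0,0), (0,2,18), (0,0,0), (0,0,0), (0,0,0)]"

text \<open>There are only three tables of this kind, as two bits 1 must not meet in such a
  cell.\<close>

definition add_labels00 :: "code list" where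
  "add_labels00 =
     [(2,0,0), (0,2,1), (0,1,5), (0,0,0), (2,2,22), (2,0,23), (0,1,0), (0,2,2), (0,1,4), (0,0,0),
     (0,2,21), (1,1,35), (0,1,1), (0,2,3), (0,1,3), (0,1,0), (0,2,20), (0,1,34), (0,1,2), (0,2,4),
     (1,0,2), (0,0,1), (0,2,19), (0,1,33), (0,1,3), (2,0,5), (2,0,6), (0,2,7), (0,2,18), (0,1,32),
     (1,0,4), (1,0,5), (0,1,6), (0,2,6), (0,2,17), (0,1,31), (1,1,1), (0,0,0), (0,1,7), (0,2,5),
     (0,2,16), (0,1,30), (0,1,2), (1,1,9), (0,0,8), (0,2,4), (0,2,15), (0,1,29), (0,1,3), (0,1,10),
     (0,2,0), (0,2,3), (0,2,14), (0,1,28), (0,1,4), (0,1,11), (2,0,1), (0,0,2), (0,2,13), (0,1,27),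
     (0,1,5), (0,1,12), (2,2,2), (0,2,3), (0,2,12), (0,1,26), (0,1,6), (0,1,13), (0,2,1), (0,2,4),
     (0,2,11), (0,1,25), (0,1,7), (0,1,14), (0,0,0), (0,2,5), (0,2,10), (0,1,24), (0,1,8), (0,1,15),
     (0,0,0), (0,2,6), (0,2,9), (0,1,23), (0,1,9), (0,1,16), (0,0,0), (2,0,7), (0,0,8), (0,1,22),
     (0,1,10), (1,0,17), (1,0,18), (1,0,19), (1,0,20), (0,0,21), (1,0,11), (1,0,12), (0,1,13), (0,0,0),
     (0,0,0), (0,0,0), (0,0,0), (0,0,0), (0,1,14), (0,0,0), (0,0,0), (0,0,0)]"

definition add_labels01 :: "code list" where
  "add_labels01 =
     [(2,0,0), (0,2,1), (0,2,8), (0,0,0), (1,1,31), (1,0,32), (0,1,0), (0,2,2), (0,2,7), (0,0,0),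
     (0,1,30), (2,2,26), (0,1,1), (0,2,3), (0,2,6), (0,1,0), (0,1,29), (0,2,25), (0,1,2), (2,0,4),
     (0,0,5), (0,1,1), (0,1,28), (0,2,24), (1,0,3), (1,0,4), (1,0,3), (0,0,2), (0,1,27), (0,2,23),
     (1,1,2), (1,0,3), (1,0,4), (0,1,5), (0,1,26), (0,2,22), (1,0,1), (0,0,0), (1,1,7), (0,0,6),
     (0,1,25), (0,2,21), (2,2,5), (0,2,4), (1,0,8), (0,1,9), (0,1,24), (0,2,20), (0,2,6), (0,2,3),
     (0,2,0), (0,1,10), (0,1,23), (0,2,19), (0,2,7), (2,0,2), (0,0,1), (0,1,11), (0,1,22), (0,2,18),
     (0,2,8), (2,2,3), (0,2,2), (0,1,12), (0,1,21), (0,2,17), (0,2,9), (0,2,4), (0,2,1), (0,1,13),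
     (0,1,20), (0,2,16), (0,2,10), (0,2,5), (0,0,0), (0,1,14), (0,1,19), (0,2,15), (0,2,11), (0,2,6),
     (0,0,0), (0,1,15), (0,1,18), (0,2,14), (0,2,12), (0,2,7), (0,0,0), (1,0,16), (0,0,17), (0,2,13),
     (0,2,13), (2,0,8), (2,0,9), (2,0,10), (2,0,11), (0,0,12), (2,0,14), (2,0,15), (0,2,16), (0,0,0),
     (0,0,0), (0,0,0), (0,0,0), (0,0,0), (0,2,17), (0,0,0), (0,0,0), (0,0,0)]"

definition add_labels10 :: "code list" where
  "add_labels10 =
     [(1,0,0), (0,1,1), (0,1,5), (0,0,0), (1,1,32), (1,0,33), (0,2,0), (0,1,2), (0,1,4), (0,0,0),
     (0,1,31), (2,2,26), (0,2,1), (0,1,3), (0,1,3), (0,1,0), (0,1,30), (0,2,25), (0,2,2), (0,1,4),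
     (1,0,2), (0,0,1), (0,1,29), (0,2,24), (0,2,3), (1,0,5), (1,0,6), (0,1,7), (0,1,28), (0,2,23),
     (2,0,4), (2,0,5), (0,2,6), (0,1,8), (0,1,27), (0,2,22), (1,1,1), (0,0,0), (0,2,6), (0,1,9),
     (0,1,26), (0,2,21), (0,1,2), (2,2,4), (0,0,5), (0,1,10), (0,1,25), (0,2,20), (0,1,3), (0,2,3),
     (0,2,0), (0,1,11), (0,1,24), (0,2,19), (0,1,4), (2,0,2), (0,0,1), (0,1,12), (0,1,23), (0,2,18),
     (0,1,5), (2,2,3), (0,2,2), (0,1,13), (0,1,22), (0,2,17), (0,1,6), (0,2,4), (0,2,1), (0,1,14),
     (0,1,21), (0,2,16), (0,1,7), (0,2,5), (0,0,0), (0,1,15), (0,1,20), (0,2,15), (0,1,8), (0,2,6),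
     (0,0,0), (0,1,16), (0,1,19), (0,2,14), (0,1,9), (0,2,7), (0,0,0), (1,0,17), (0,0,18), (0,2,13),
     (0,1,10), (2,0,8), (2,0,9), (2,0,10), (2,0,11), (0,0,12), (1,0,11), (1,0,12), (0,1,13), (0,0,0),
     (0,0,0), (0,0,0), (0,0,0), (0,0,0), (0,1,14), (0,0,0), (0,0,0), (0,0,0)]"

text \<open>Point \<open>j\<close> has local coordinates \<open>j mod 6\<close> and
  \<open>j div 6\<close>. A cup runs along row 16 from the third point of the left cell to the third
  point of the right one and then down on both sides; a cap runs along row 0. In \<open>Term\<close>
  the two lines stop at the local points (1, 0) and (0, 2), which have different colours.\<close>

definition cell_mask :: "ctype \<Rightarrow> nat list" where
  "cell_mask t = (case t of Empty \<Rightarrow> replicate 108 0 | Pass \<Rightarrow> pass_mask | Add \<Rightarrow> add_mask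
   | CupL \<Rightarrow> (replicate 108 0)[98 := 3, 99 := 1, 100 := 1, 101 := 1, 104 := 2]
   | CupR \<Rightarrow> (replicate 108 0)[96 := 1, 97 := 1, 98 := 2, 104 := 2]
   | CapL \<Rightarrow> (replicate 108 0)[2 := 1, 3 := 1, 4 := 1, 5 := 1]
   | CapR \<Rightarrow> (replicate 108 0)[0 := 1, 1 := 1]
   | Term \<Rightarrow> (replicate 108 0)[0 := 1, 6 := 2])"

section \<open>Boundaries and degrees of cells\<close>

definition edge_on :: "ctype \<Rightarrow> nat \<Rightarrow> bool \<Rightarrow> bool" where
  "edge_on t j d \<longleftrightarrow> (if d then 2 \<le> cell_mask t ! j else odd (cell_mask t ! j))"

definition east :: "ctype \<Rightarrow> bool list" where
  "east t = map (\<lambda>y. edge_on t (6 * y + 5) False) [0..<18]"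
definition south :: "ctype \<Rightarrow> bool list" where
  "south t = map (\<lambda>x. edge_on t (102 + x) True) [0..<6]"

definition no_west :: "bool list" where "no_west = replicate 18 False"
definition no_north :: "bool list" where "no_north = replicate 6 False"

text \<open>The edges that a cell expects from its left neighbour. With this information all degrees
  in a cell are a finite computation, independent of its position except for the flag of the first
  column.\<close>

definition west_of :: "ctype \<Rightarrow> bool \<Rightarrow> bool list" where
  "west_of t first = (case t of Pass \<Rightarrow> if first then no_west else no_west[0 := True, 1 := True]
     | Add \<Rightarrow> if first then no_west else no_west[0 := True, 1 := True]
     | Term \<Rightarrow> no_west[0 := True, 1 := True]
     | CupR \<Rightarrow> no_west[16 := True] | CapR \<Rightarrow> no_west[0 := True] | _ \<Rightarrow> no_west)"

definition north_of :: "ctype \<Rightarrow> bool list" where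
  "north_of t = (if t \<in> {Pass, Add, CapL, CapR} then no_north[2 := True] else no_north)"

definition cell_deg :: "bool list \<Rightarrow> bool list \<Rightarrow> nat list \<Rightarrow> nat \<Rightarrow> nat" where
  "cell_deg wm nm mt j =
     (if (if j mod 6 = 0 then wm ! (j div 6) else odd (mt ! (j - 1))) then 1 else 0) +
     (if (if j < 6 then nm ! j else 2 \<le> mt ! (j - 6)) then 1 else 0) +
     (if odd (mt ! j) then 1 else 0) + (if 2 \<le> mt ! j then 1 else 0)"

text \<open>The same data as a list that is built without random access, for fast evaluation.\<close>

definition point_list :: "bool list \<Rightarrow> bool list \<Rightarrow> nat list \<Rightarrow> (nat \<times> nat \<times> bool \<times> bool \<times> bool) list" where
  "point_list wm nm mt = zip [0..<108] (zip mt (zip (nm @ map (\<lambda>m. 2 \<le> m) mt) (zip (False # map odd mt)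
     (concat (map (\<lambda>b. [b, False, False, False, False, False]) wm)))))"

fun list_deg :: "nat \<times> nat \<times> bool \<times> bool \<times> bool \<Rightarrow> nat" where
  "list_deg (j, m, u, lp, lw) = (if (if j mod 6 = 0 then lw else lp) then 1 else 0) + (if u then 1 else 0) +
     (if odd m then 1 else 0) + (if 2 \<le> m then 1 else 0)"

lemma nth_spread:
  "j < 6 * length ws \<Longrightarrow> concat (map (\<lambda>b. [b, z, z, z, z, z]) ws) ! j = (if j mod 6 = 0 then ws ! (j div 6) else z)"
proof (induction ws arbitrary: j)
  case (Cons a ws)
  show ?case
  proof (cases "j < 6")
    case True
    then have "j = 0 \<or> j = 1 \<or> j = 2 \<or> j = 3 \<or> j = 4 \<or> j = 5" by arith
    then show ?thesis by auto
  next
    case False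
    then have lt: "j - 6 < 6 * length ws" using Cons.prems by simp
    have m: "(j - 6) mod 6 = j mod 6" "j div 6 = Suc ((j - 6) div 6)"
      using False by (simp_all add: le_mod_geq le_div_geq)
    have l6: "length [a, z, z, z, z, z] = 6" by simp
    have "concat (map (\<lambda>b. [b, z, z, z, z, z]) (a # ws)) =
        [a, z, z, z, z, z] @ concat (map (\<lambda>b. [b, z, z, z, z, z]) ws)" by simp
    then have "concat (map (\<lambda>b. [b, z, z, z, z, z]) (a # ws)) ! j =
        concat (map (\<lambda>b. [b, z, z, z, z, z]) ws) ! (j - 6)"
      using False by (simp only: nth_append l6 if_False)
    then show ?thesis using Cons.IH[OF lt] m by simp
  qed
qed simp

lemma length_spread: "length (concat (map (\<lambda>b. [b, z, z, z, z, z]) ws)) = 6 * length ws"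
  by (induction ws) auto

lemma length_point_list:
  "length wm = 18 \<Longrightarrow> length nm = 6 \<Longrightarrow> length mt = 108 \<Longrightarrow> length (point_list wm nm mt) = 108"
  by (simp add: point_list_def length_spread)

lemma nth_point_list:
  assumes "length wm = 18" "length nm = 6" "length mt = 108" "j < 108"
  shows "point_list wm nm mt ! j = (j, mt ! j, (if j < 6 then nm ! j else 2 \<le> mt ! (j - 6)),
      (if j = 0 then False else odd (mt ! (j - 1))), if j mod 6 = 0 then wm ! (j div 6) else False)"
  using assms nth_spread[of j wm False]
  by (simp add: point_list_def length_spread nth_append nth_Cons')

lemma list_deg_nth:
  assumes "length wm = 18" "length nm = 6" "length mt = 108" "j < 108"
  shows "list_deg (point_list wm nm mt ! j) = cell_deg wm nm mt j"
  unfolding nth_point_list[OF assms] by (auto simp: cell_deg_def)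

lemma map_list_deg:
  assumes "length wm = 18" "length nm = 6" "length mt = 108"
  shows "map (\<lambda>p. g (fst p) (list_deg p) (fst (snd p))) (point_list wm nm mt) =
    map (\<lambda>j. g j (cell_deg wm nm mt j) (mt ! j)) [0..<108]"
proof (rule nth_equalityI)
  fix j assume "j < length (map (\<lambda>p. g (fst p) (list_deg p) (fst (snd p))) (point_list wm nm mt))"
  then have j: "j < 108" by (simp add: length_point_list[OF assms])
  have "fst (point_list wm nm mt ! j) = j" "fst (snd (point_list wm nm mt ! j)) = mt ! j"
    by (simp_all add: nth_point_list[OF assms j])
  then show "map (\<lambda>p. g (fst p) (list_deg p) (fst (snd p))) (point_list wm nm mt) ! j =
      map (\<lambda>j. g j (cell_deg wm nm mt j) (mt ! j)) [0..<108] ! j"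
    using j list_deg_nth[OF assms j] length_point_list[OF assms] by simp
qed (simp add: length_point_list[OF assms])

lemma length_west_of [simp]: "length (west_of t b) = 18"
  by (cases t) (simp_all add: west_of_def no_west_def)

lemma length_north_of [simp]: "length (north_of t) = 6"
  by (simp add: north_of_def no_north_def)

lemma length_cell_mask [simp]: "length (cell_mask t) = 108"
  by (cases t) (simp_all add: cell_mask_def pass_mask_def add_mask_def)

text \<open>The conditions of \<open>labelling\<close> at a single point of degree \<open>d\<close>
  and colour \<open>q\<close>, in terms of the labels of the up to four edges around it.\<close>

definition vrule :: "nat \<Rightarrow> nat \<Rightarrow> nat list \<Rightarrow> bool" where
  "vrule d q ls = (case filter (\<lambda>a. a \<noteq> 0) ls of [] \<Rightarrow> d = 0 | [a] \<Rightarrow> d = 1 \<and> a = 2 - q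
     | [a, b] \<Rightarrow> 2 \<le> d \<and> a = b | _ \<Rightarrow> False)"

section \<open>Search through the labellings of a cell\<close>

definition choices :: "bool \<Rightarrow> nat list" where "choices b = (if b then [0, 1, 2] else [0])"

type_synonym pinfo = "nat \<times> nat \<times> nat \<times> bool \<times> bool"
type_synonym frontier = "nat list \<times> nat list \<times> nat list"

text \<open>Points are scanned row by row. A frontier consists of the labels of the edge to the left of
  the current point and of the edges entering the later rows from the left, of the edges entering
  the next six points from above, and of the edges that leave the completed rows to the right.\<close>

definition scan_point :: "pinfo \<Rightarrow> frontier \<Rightarrow> frontier list" where
  "scan_point i s = (case i of (x, d, q, mr, md) \<Rightarrow> case s of (ws, us, es) \<Rightarrow>
     [(if x = 5 then tl ws else r # tl ws, tl us @ [dn], if x = 5 then es @ [r] else es).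
        r \<leftarrow> choices mr, dn \<leftarrow> choices md, vrule d q [hd ws, hd us, r, dn]])"

fun scan :: "pinfo list \<Rightarrow> frontier list \<Rightarrow> frontier list" where
  "scan [] S = S"
| "scan (i # is) S = scan is (remdups (concat (map (scan_point i) S)))"

definition pinfos :: "bool list \<Rightarrow> bool list \<Rightarrow> nat list \<Rightarrow> pinfo list" where
  "pinfos wm nm mt = map (\<lambda>j. (j mod 6, cell_deg wm nm mt j, (j mod 6 + j div 6) mod 2,
     odd (mt ! j), 2 \<le> mt ! j)) [0..<108]"

text \<open>Label 0 marks an edge off the paths, so a bit is stored plus one: the second line
  carries the bit and the first one its complement.\<close>

definition row_labels :: "nat \<Rightarrow> nat list" where "row_labels c = [2 - c, 1 + c] @ replicate 16 0"
definition no_row :: "nat list" where "no_row = replicate 18 0"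
definition column_label :: "nat \<Rightarrow> nat list" where "column_label x = [0, 0, 1 + x, 0, 0, 0]"
definition no_column :: "nat list" where "no_column = replicate 6 0"

definition cell_scan :: "ctype \<Rightarrow> bool \<Rightarrow> nat list \<Rightarrow> nat list \<Rightarrow> frontier list" where
  "cell_scan t first ws us = scan (pinfos (west_of t first) (north_of t) (cell_mask t)) [(ws, us, [])]"

lemma cell_scan_eq: "cell_scan t first ws us =
    scan (map (\<lambda>p. (\<lambda>j d m. (j mod 6, d, (j mod 6 + j div 6) mod 2, odd m, 2 \<le> m)) (fst p) (list_deg p) (fst (snd p)))
      (point_list (west_of t first) (north_of t) (cell_mask t))) [(ws, us, [])]"
  unfolding cell_scan_def pinfos_def by (subst map_list_deg) simp_all

text \<open>In every labelling both bits leave as they entered. In a first cell the two lines of the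
  row begin at points of degree 1, whose colours force the bit 0.\<close>

lemma scan_Pass:
  "set (cell_scan Pass False (row_labels 0) (column_label 0)) \<subseteq> {([], column_label 0, row_labels 0)}"
  "set (cell_scan Pass False (row_labels 0) (column_label 1)) \<subseteq> {([], column_label 1, row_labels 0)}"
  "set (cell_scan Pass False (row_labels 1) (column_label 0)) \<subseteq> {([], column_label 0, row_labels 1)}"
  "set (cell_scan Pass False (row_labels 1) (column_label 1)) \<subseteq> {([], column_label 1, row_labels 1)}"
  "set (cell_scan Pass True no_row (column_label 0)) \<subseteq> {([], column_label 0, row_labels 0)}"
  "set (cell_scan Pass True no_row (column_label 1)) \<subseteq> {([], column_label 1, row_labels 0)}"
  unfolding cell_scan_eq by code_simp+

text \<open>The outgoing row bit is the sum of the incoming bits. The impossible case, two bits 1,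
  is what keeps the sum along a row at most 1.\<close>

lemma scan_Add:
  "set (cell_scan Add False (row_labels 0) (column_label 0)) \<subseteq> {([], column_label 0, row_labels 0)}"
  "set (cell_scan Add False (row_labels 0) (column_label 1)) \<subseteq> {([], column_label 1, row_labels 1)}"
  "set (cell_scan Add False (row_labels 1) (column_label 0)) \<subseteq> {([], column_label 0, row_labels 1)}"
  "cell_scan Add False (row_labels 1) (column_label 1) = []"
  "set (cell_scan Add True no_row (column_label 0)) \<subseteq> {([], column_label 0, row_labels 0)}"
  "set (cell_scan Add True no_row (column_label 1)) \<subseteq> {([], column_label 1, row_labels 1)}"
  unfolding cell_scan_eq by code_simp+

text \<open>The dead ends of the two lines have colours 1 and 0 and force the labels 1 and 2, which
  is the row bit 1. This makes the sum along a row at least 1.\<close>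

lemma scan_Term: "cell_scan Term False (row_labels 0) no_column = []"
  unfolding cell_scan_eq by code_simp

text \<open>Both bits are possible here: the path of a cup has no end in the cell, so no colour
  fixes its label.\<close>

lemma scan_CupL:
  "set (cell_scan CupL False no_row no_column) \<subseteq>
     {([], column_label 0, no_row[16 := 1]), ([], column_label 1, no_row[16 := 2])}"
  unfolding cell_scan_eq by code_simp

lemma scan_CupR:
  "set (cell_scan CupR False (no_row[16 := 1]) no_column) \<subseteq> {([], column_label 0, no_row)}"
  "set (cell_scan CupR False (no_row[16 := 2]) no_column) \<subseteq> {([], column_label 1, no_row)}"
  unfolding cell_scan_eq by code_simp+

text \<open>Along the paths inside a cell the potential has no local minimum except at the ends of the paths and on the
  left boundary of the cell; this excludes cycles.\<close>

definition cell_codes :: "ctype \<Rightarrow> nat \<Rightarrow> nat \<Rightarrow> code list" where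
  "cell_codes t c x = (case t of Empty \<Rightarrow> replicate 108 (0, 0, 0)
   | Pass \<Rightarrow> if c = 0 then (if x = 0 then pass_labels00 else pass_labels01)
       else (if x = 0 then pass_labels10 else pass_labels11)
   | Add \<Rightarrow> if c = 0 then (if x = 0 then add_labels00 else add_labels01) else add_labels10
   | CupL \<Rightarrow> (replicate 108 (0, 0, 0))[98 := (1 + x, 1 + x, 101), 99 := (1 + x, 0, 102), 100 := (1 + x, 0, 103),
       101 := (1 + x, 0, 104), 104 := (0, 1 + x, 100)]
   | CupR \<Rightarrow> (replicate 108 (0, 0, 0))[96 := (1 + x, 0, 100), 97 := (1 + x, 0, 101), 98 := (0, 1 + x, 102),
       104 := (0, 1 + x, 103)]
   | CapL \<Rightarrow> (replicate 108 (0, 0, 0))[2 := (1 + x, 0, 100), 3 := (1 + x, 0, 101), 4 := (1 + x, 0, 102),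
       5 := (1 + x, 0, 103)]
   | CapR \<Rightarrow> (replicate 108 (0, 0, 0))[0 := (1 + x, 0, 100), 1 := (1 + x, 0, 101), 2 := (0, 0, 102)]
   | Term \<Rightarrow> (replicate 108 (0, 0, 0))[0 := (1, 0, 0), 6 := (0, 2, 0)])"

section \<open>Verification of explicit labels and potentials\<close>

definition code_right :: "code \<Rightarrow> nat" where "code_right a = fst a"
definition code_down :: "code \<Rightarrow> nat" where "code_down a = fst (snd a)"
definition code_pot :: "code \<Rightarrow> nat" where "code_pot a = snd (snd a)"

definition point_ok :: "nat \<Rightarrow> nat \<Rightarrow> nat \<Rightarrow> nat \<Rightarrow> nat \<Rightarrow> nat \<Rightarrow> nat \<Rightarrow> code \<Rightarrow> code \<Rightarrow> code \<Rightarrow> bool" where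
  "point_ok j d m lw pw lu pn a aright adown \<longleftrightarrow>
     d \<le> 3 \<and> vrule d ((j mod 6 + j div 6) mod 2) [lw, lu, code_right a, code_down a] \<and>
     (odd m \<or> code_right a = 0) \<and> (2 \<le> m \<or> code_down a = 0) \<and>
     (2 \<le> d \<longrightarrow>
        lw \<noteq> 0 \<and> (j mod 6 = 0 \<or> pw < code_pot a) \<or>
        lu \<noteq> 0 \<and> (if j < 6 then 100 \<le> code_pot a else pn < code_pot a) \<or>
        code_right a \<noteq> 0 \<and> j mod 6 \<noteq> 5 \<and> code_pot aright < code_pot a \<or>
        code_down a \<noteq> 0 \<and> (if 102 \<le> j then 100 \<le> code_pot a else code_pot adown < code_pot a))"

definition code_list :: "nat list \<Rightarrow> nat list \<Rightarrow> code list \<Rightarrow> (code \<times> code \<times> nat \<times> nat \<times> code \<times> code \<times> code) list" where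
  "code_list ws us cs = zip cs (zip ((0, 0, 0) # cs) (zip (concat (map (\<lambda>b. [b, 0, 0, 0, 0, 0]) ws))
     (zip (us @ map code_down cs) (zip (replicate 6 (0, 0, 0) @ cs) (zip (tl cs @ [(0, 0, 0)]) (drop 6 cs @ replicate 6 (0, 0, 0)))))))"

fun list_point_ok :: "(nat \<times> nat \<times> bool \<times> bool \<times> bool) \<times> code \<times> code \<times> nat \<times> nat \<times> code \<times> code \<times> code \<Rightarrow> bool" where
  "list_point_ok (p, a, ap, lw, lu, an, ar, ad) = point_ok (fst p) (list_deg p) (fst (snd p))
     (if fst p mod 6 = 0 then lw else code_right ap) (code_pot ap) lu (code_pot an) a ar ad"

definition cell_ok :: "ctype \<Rightarrow> bool \<Rightarrow> nat list \<Rightarrow> nat list \<Rightarrow> nat list \<Rightarrow> nat list \<Rightarrow> nat \<Rightarrow> nat \<Rightarrow> bool" where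
  "cell_ok t first ws us es ds c x \<longleftrightarrow> length ws = 18 \<and> length us = 6 \<and>
     (let cs = cell_codes t c x in
       list_all list_point_ok (zip (point_list (west_of t first) (north_of t) (cell_mask t)) (code_list ws us cs)) \<and>
       map (\<lambda>y. code_right (cs ! (6 * y + 5))) [0..<18] = es \<and>
       map (\<lambda>i. code_down (cs ! (102 + i))) [0..<6] = ds)"

lemma length_cell_codes [simp]: "length (cell_codes t c x) = 108"
  by (cases t) (simp_all add: cell_codes_def pass_labels00_def pass_labels01_def pass_labels10_def
    pass_labels11_def add_labels00_def add_labels01_def add_labels10_def)

text \<open>The translation from the zipped lists, which evaluate fast, to indexed access. The
  triples of zeros are padding for neighbours beyond the ends of the list.\<close>

lemma cell_okD:
  assumes ok: "cell_ok t first ws us es ds c x" and j: "j < 108"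
  defines "cs \<equiv> cell_codes t c x"
  shows "point_ok j (cell_deg (west_of t first) (north_of t) (cell_mask t) j) (cell_mask t ! j)
    (if j mod 6 = 0 then ws ! (j div 6) else code_right (cs ! (j - 1))) (code_pot (if j = 0 then (0, 0, 0) else cs ! (j - 1)))
    (if j < 6 then us ! j else code_down (cs ! (j - 6))) (code_pot (if j < 6 then (0, 0, 0) else cs ! (j - 6)))
    (cs ! j) (if j < 107 then cs ! (j + 1) else (0, 0, 0)) (if j < 102 then cs ! (j + 6) else (0, 0, 0))"
proof -
  have len: "length ws = 18" "length us = 6" "length cs = 108" using ok by (simp_all add: cell_ok_def cs_def)
  let ?pl = "point_list (west_of t first) (north_of t) (cell_mask t)"
  have lp: "length ?pl = 108" by (simp add: length_point_list)
  have lc: "length (code_list ws us cs) = 108" using len by (simp add: code_list_def length_spread)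
  have cl: "code_list ws us cs ! j = (cs ! j, (if j = 0 then (0, 0, 0) else cs ! (j - 1)),
      (if j mod 6 = 0 then ws ! (j div 6) else 0), (if j < 6 then us ! j else code_down (cs ! (j - 6))),
      (if j < 6 then (0, 0, 0) else cs ! (j - 6)), (if j < 107 then cs ! (j + 1) else (0, 0, 0)),
      if j < 102 then cs ! (j + 6) else (0, 0, 0))"
    using len j nth_spread[of j ws 0]
    by (auto simp: code_list_def length_spread nth_append nth_Cons' nth_tl add.commute)
  have "list_all list_point_ok (zip ?pl (code_list ws us cs))" using ok by (simp add: cell_ok_def cs_def Let_def)
  then have "list_point_ok (?pl ! j, code_list ws us cs ! j)"
    using j lp lc by (simp add: list_all_length)
  moreover have "fst (?pl ! j) = j" "fst (snd (?pl ! j)) = cell_mask t ! j"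
    using nth_point_list[of "west_of t first" "north_of t" "cell_mask t" j] j by simp_all
  moreover have "list_deg (?pl ! j) = cell_deg (west_of t first) (north_of t) (cell_mask t) j"
    using list_deg_nth[of "west_of t first" "north_of t" "cell_mask t" j] j by simp
  ultimately show ?thesis unfolding cl by (cases "j = 0"; cases "j mod 6 = 0"; simp)
qed

lemma ok_Pass:
  "cell_ok Pass False (row_labels 0) (column_label 0) (row_labels 0) (column_label 0) 0 0"
  "cell_ok Pass False (row_labels 0) (column_label 1) (row_labels 0) (column_label 1) 0 1"
  "cell_ok Pass False (row_labels 1) (column_label 0) (row_labels 1) (column_label 0) 1 0"
  "cell_ok Pass False (row_labels 1) (column_label 1) (row_labels 1) (column_label 1) 1 1"
  "cell_ok Pass True no_row (column_label 0) (row_labels 0) (column_label 0) 0 0"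
  "cell_ok Pass True no_row (column_label 1) (row_labels 0) (column_label 1) 0 1"
  by code_simp+

lemma ok_Add:
  "cell_ok Add False (row_labels 0) (column_label 0) (row_labels 0) (column_label 0) 0 0"
  "cell_ok Add False (row_labels 0) (column_label 1) (row_labels 1) (column_label 1) 0 1"
  "cell_ok Add False (row_labels 1) (column_label 0) (row_labels 1) (column_label 0) 1 0"
  "cell_ok Add True no_row (column_label 0) (row_labels 0) (column_label 0) 0 0"
  "cell_ok Add True no_row (column_label 1) (row_labels 1) (column_label 1) 0 1"
  by code_simp+

lemma ok_Term: "cell_ok Term False (row_labels 1) no_column no_row no_column 0 0"
  by code_simp

lemma ok_Empty: "cell_ok Empty False no_row no_column no_row no_column 0 0"
  "cell_ok Empty True no_row no_column no_row no_column 0 0"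
  by code_simp+

lemma ok_Cup:
  "cell_ok CupL False no_row no_column (no_row[16 := 1]) (column_label 0) 0 0"
  "cell_ok CupL False no_row no_column (no_row[16 := 2]) (column_label 1) 0 1"
  "cell_ok CupL True no_row no_column (no_row[16 := 1]) (column_label 0) 0 0"
  "cell_ok CupL True no_row no_column (no_row[16 := 2]) (column_label 1) 0 1"
  "cell_ok CupR False (no_row[16 := 1]) no_column no_row (column_label 0) 0 0"
  "cell_ok CupR False (no_row[16 := 2]) no_column no_row (column_label 1) 0 1"
  by code_simp+

lemma ok_Cap:
  "cell_ok CapL False no_row (column_label 0) (no_row[0 := 1]) no_column 0 0"
  "cell_ok CapL False no_row (column_label 1) (no_row[0 := 2]) no_column 0 1"
  "cell_ok CapL True no_row (column_label 0) (no_row[0 := 1]) no_column 0 0"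
  "cell_ok CapL True no_row (column_label 1) (no_row[0 := 2]) no_column 0 1"
  "cell_ok CapR False (no_row[0 := 1]) (column_label 0) no_row no_column 0 0"
  "cell_ok CapR False (no_row[0 := 2]) (column_label 1) no_row no_column 0 1"
  by code_simp+

definition cell_total :: "ctype \<Rightarrow> bool \<Rightarrow> nat" where
  "cell_total t first =
     sum_list (map (\<lambda>j. min 2 (cell_deg (west_of t first) (north_of t) (cell_mask t) j)) [0..<108])"

lemma cell_total_eq: "cell_total t first = sum_list (map (\<lambda>p. (\<lambda>j d m. min 2 d) (fst p) (list_deg p) (fst (snd p)))
    (point_list (west_of t first) (north_of t) (cell_mask t)))"
  unfolding cell_total_def by (subst map_list_deg) simp_all

text \<open>The shares of the cells in the size of the matching. A first cell has 2 less than other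
  cells of its type, since the points where its two row lines begin have degree 1 instead of
  2.\<close>

lemma cell_total:
  "cell_total Pass False = 188" "cell_total Pass True = 186" "cell_total Add False = 188"
  "cell_total Add True = 186" "cell_total Term False = 6" "cell_total Empty False = 0"
  "cell_total CupL False = 10" "cell_total CupR False = 8" "cell_total CapL False = 8"
  "cell_total CapR False = 6" "cell_total CupL True = 10" "cell_total CapL True = 8"
  "cell_total Empty True = 0"
  unfolding cell_total_eq by code_simp+

text \<open>The gap to the potentials of cups and caps, which start at 100, makes every step from a
  cup or cap into the crossbar a descent.\<close>

lemma low_potentials:
  "list_all (\<lambda>a. code_pot a < 100) (cell_codes Pass c x)"
  "list_all (\<lambda>a. code_pot a < 100) (cell_codes Add c x)"
proof -
  have "list_all (\<lambda>a. code_pot a < 100) pass_labels00" "list_all (\<lambda>a. code_pot a < 100) pass_labels01"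
    "list_all (\<lambda>a. code_pot a < 100) pass_labels10" "list_all (\<lambda>a. code_pot a < 100) pass_labels11"
    "list_all (\<lambda>a. code_pot a < 100) add_labels00" "list_all (\<lambda>a. code_pot a < 100) add_labels01"
    "list_all (\<lambda>a. code_pot a < 100) add_labels10" by code_simp+
  then show "list_all (\<lambda>a. code_pot a < 100) (cell_codes Pass c x)"
    "list_all (\<lambda>a. code_pot a < 100) (cell_codes Add c x)" by (simp_all add: cell_codes_def)
qed

text \<open>Points 19 and 20 are neighbours in the fourth row of the cell. The edge between them
  shows that the maximum degree is exactly 4.\<close>

lemma high_degrees:
  assumes "t = Pass \<or> t = Add"
  shows "edge_on t 19 False" "cell_deg (west_of t b) (north_of t) (cell_mask t) 19 = 3"
    "cell_deg (west_of t b) (north_of t) (cell_mask t) 20 = 3"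
  using assms by (auto simp: cell_deg_def edge_on_def cell_mask_def pass_mask_def add_mask_def)

lemma east_eqs: "east Empty = no_west" "east Pass = no_west[0 := True, 1 := True]"
  "east Add = no_west[0 := True, 1 := True]" "east CupL = no_west[16 := True]" "east CupR = no_west"
  "east CapL = no_west[0 := True]" "east CapR = no_west" "east Term = no_west"
  by code_simp+

lemma south_eqs: "south Empty = no_north" "south Pass = no_north[2 := True]"
  "south Add = no_north[2 := True]" "south CupL = no_north[2 := True]" "south CupR = no_north[2 := True]"
  "south CapL = no_north" "south CapR = no_north" "south Term = no_north"
  by code_simp+

section \<open>Grids of cells\<close>

text \<open>Left, up, right, down, the order that the labels have in \<open>plabels\<close> and in
  the scan.\<close>

definition incl :: "nat \<Rightarrow> nat \<Rightarrow> ledge list" where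
  "incl X Y = (if X = 0 then [] else [(X - 1, Y, False)]) @ (if Y = 0 then [] else [(X, Y - 1, True)]) @
     [(X, Y, False), (X, Y, True)]"

lemma distinct_incl: "distinct (incl X Y)"
  by (auto simp: incl_def)

lemma set_incl: "e \<in> set (incl X Y) \<longleftrightarrow> (X, Y) \<in> ends e"
  by (cases e) (auto simp: incl_def ends_def near_def far_def split: if_splits)

lemma inc_incl: "incident E (X, Y) = set (filter (\<lambda>e. e \<in> E) (incl X Y))"
  by (simp add: incident_def set_incl) auto

lemma card_inc: "card (incident E (X, Y)) = length (filter (\<lambda>e. e \<in> E) (incl X Y))"
  unfolding inc_incl by (rule distinct_card) (simp add: distinct_incl)

definition plabels :: "(ledge \<Rightarrow> nat) \<Rightarrow> nat \<Rightarrow> nat \<Rightarrow> nat list" where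
  "plabels l X Y = [if X = 0 then 0 else l (X - 1, Y, False), if Y = 0 then 0 else l (X, Y - 1, True),
     l (X, Y, False), l (X, Y, True)]"

lemma filter_plabels:
  "filter (\<lambda>a. a \<noteq> 0) (plabels l X Y) = map l (filter (\<lambda>e. l e \<noteq> 0) (incl X Y))"
  by (simp add: plabels_def incl_def)

text \<open>The rule sees a list of labels while \<open>labelling\<close> speaks of sets of edges.
  As \<open>incl\<close> has no repetitions, two nonzero entries belong to two different
  edges.\<close>

lemma labelling_vrule:
  assumes lE: "\<And>e. l e \<noteq> 0 \<Longrightarrow> e \<in> E"
  shows "labelling E l \<longleftrightarrow> (\<forall>e. l e \<le> 2) \<and>
    (\<forall>X Y. vrule (card (incident E (X, Y))) ((X + Y) mod 2) (plabels l X Y))"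
proof -
  define xs where "xs X Y = filter (\<lambda>e. l e \<noteq> 0) (incl X Y)" for X Y
  have set_xs: "set (xs X Y) = {e \<in> incident E (X, Y). l e \<noteq> 0}" for X Y
    using lE by (auto simp: xs_def inc_incl)
  have dist: "distinct (xs X Y)" for X Y by (simp add: xs_def distinct_incl)
  have vr: "vrule d q (plabels l X Y) \<longleftrightarrow> (case map l (xs X Y) of [] \<Rightarrow> d = 0 | [a] \<Rightarrow> d = 1 \<and> a = 2 - q
     | [a, b] \<Rightarrow> 2 \<le> d \<and> a = b | _ \<Rightarrow> False)" for d q X Y
    unfolding vrule_def filter_plabels xs_def ..
  have fin: "finite (incident E (X, Y))" for X Y by (simp add: inc_incl)
  have 1: "vrule (card (incident E (X, Y))) ((X + Y) mod 2) (plabels l X Y)" if L: "labelling E l" for X Y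
  proof -
    have L1: "card (incident E p) = 1 \<Longrightarrow> e \<in> incident E p \<Longrightarrow> l e = 2 - lat_colour p" for p e
      using L unfolding labelling_def by blast
    have L2: "2 \<le> card (incident E p) \<Longrightarrow> \<exists>e f. e \<noteq> f \<and> {e \<in> incident E p. l e \<noteq> 0} = {e, f} \<and> l e = l f" for p
      using L unfolding labelling_def by blast
    consider "card (incident E (X, Y)) = 0" | "card (incident E (X, Y)) = 1" | "2 \<le> card (incident E (X, Y))" by linarith
    then show ?thesis
    proof cases
      case 1
      then have "incident E (X, Y) = {}" using fin by simp
      then have "set (xs X Y) = {}" unfolding set_xs by blast
      then have "xs X Y = []" by simp
      then show ?thesis using 1 unfolding vr by simp
    next
      case 2
      then obtain e where e: "incident E (X, Y) = {e}" by (auto simp: card_1_singleton_iff)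
      then have le: "l e = 2 - lat_colour (X, Y)" using L1[OF 2] by simp
      then have "l e \<noteq> 0" using colour_le[of "(X, Y)"] by simp
      then have "set (xs X Y) = {e}" unfolding set_xs e by auto
      moreover from this have "length (xs X Y) = 1" using distinct_card[OF dist, of X Y] by simp
      ultimately have "xs X Y = [e]" by (cases "xs X Y") auto
      then show ?thesis using 2 le unfolding vr by (simp add: lat_colour_def)
    next
      case 3
      from L2[OF this] obtain e f where ef: "e \<noteq> f" "set (xs X Y) = {e, f}" "l e = l f"
        unfolding set_xs by blast
      then have "length (xs X Y) = 2" using distinct_card[OF dist, of X Y] by simp
      then obtain a b where ab: "xs X Y = [a, b]" by (auto simp: length_Suc_conv numeral_2_eq_2)
      then have "l a = l b" using ef by (auto simp: doubleton_eq_iff)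
      then show ?thesis using 3 unfolding vr ab by simp
    qed
  qed
  have 2: "labelling E l" if l2: "\<forall>e. l e \<le> 2"
    and V: "\<And>X Y. vrule (card (incident E (X, Y))) ((X + Y) mod 2) (plabels l X Y)"
    unfolding labelling_def
  proof (intro conjI allI impI ballI)
    fix e show "l e \<le> 2" using l2 by blast
    show "l e \<noteq> 0 \<Longrightarrow> e \<in> E" by (rule lE)
  next
    fix p e assume c: "card (incident E p) = 1" and e: "e \<in> incident E p"
    obtain X Y where p: "p = (X, Y)" by (cases p)
    obtain a where a: "map l (xs X Y) = [a]" "a = 2 - (X + Y) mod 2"
      using V[of X Y] c unfolding vr p by (auto split: list.splits)
    then obtain f where f: "xs X Y = [f]" "l f = a" by auto
    then have "f \<in> incident E p" using set_xs[of X Y] p by auto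
    then have "f = e" using c e by (auto simp: card_1_singleton_iff)
    then show "l e = 2 - lat_colour p" using a f p by (simp add: lat_colour_def)
  next
    fix p assume c: "2 \<le> card (incident E p)"
    obtain X Y where p: "p = (X, Y)" by (cases p)
    obtain a where a: "map l (xs X Y) = [a, a]"
      using V[of X Y] c unfolding vr p by (auto split: list.splits)
    then obtain e f where ef: "xs X Y = [e, f]" "l e = a" "l f = a" by auto
    then have "e \<noteq> f" using dist[of X Y] by simp
    then show "\<exists>e f. e \<noteq> f \<and> {e \<in> incident E p. l e \<noteq> 0} = {e, f} \<and> l e = l f"
      using ef set_xs[of X Y] p by (intro exI[of _ e] exI[of _ f]) simp
  qed
  show ?thesis
  proof
    assume L: "labelling E l"
    then show "(\<forall>e. l e \<le> 2) \<and> (\<forall>X Y. vrule (card (incident E (X, Y))) ((X + Y) mod 2) (plabels l X Y))"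
      using 1 by (simp add: labelling_def)
  next
    assume "(\<forall>e. l e \<le> 2) \<and> (\<forall>X Y. vrule (card (incident E (X, Y))) ((X + Y) mod 2) (plabels l X Y))"
    then show "labelling E l" using 2 by blast
  qed
qed

text \<open>Induction along the scan: the frontier that a given labelling shows before point
  \<open>j\<close> stays among the candidates, because the choices made by the labelling are among
  those tried.\<close>

lemma scan_sound:
  fixes W N Rr Dn :: "nat \<Rightarrow> nat"
  defines "U \<equiv> \<lambda>j. if j < 6 then N j else Dn (j - 6)"
    and "L \<equiv> \<lambda>j. if j mod 6 = 0 then W (j div 6) else Rr (j - 1)"
  assumes ok: "\<And>j. j < 108 \<Longrightarrow> vrule (dg j) (q j) [L j, U j, Rr j, Dn j] \<and>
     Rr j \<in> set (choices (mr j)) \<and> Dn j \<in> set (choices (md j))"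
  shows "([], map (\<lambda>x. Dn (102 + x)) [0..<6], map (\<lambda>y. Rr (6 * y + 5)) [0..<18]) \<in>
    set (scan (map (\<lambda>j. (j mod 6, dg j, q j, mr j, md j)) [0..<108]) [(map W [0..<18], map N [0..<6], [])])"
proof -
  define f where "f j = (j mod 6, dg j, q j, mr j, md j)" for j :: nat
  \<comment> \<open>The frontier before point \<open>j\<close>. At the start of a row the label to
    the left comes from the neighbouring cell, otherwise from the previous point.\<close>
  define st where "st j = ((if j mod 6 = 0 then map W [j div 6..<18] else L j # map W [Suc (j div 6)..<18]),
    map U [j..<j + 6], map (\<lambda>y. Rr (6 * y + 5)) [0..<j div 6])" for j
  have step: "st (Suc k) \<in> set (scan_point (f k) (st k))" if k: "k < 108" for k
  proof -
    define T where "T = map W [Suc (k div 6)..<18]"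
    have k18: "k div 6 < 18" using k by simp
    have ws: "(if k mod 6 = 0 then map W [k div 6..<18] else L k # map W [Suc (k div 6)..<18]) = L k # T"
      using k18 by (simp add: T_def L_def upt_conv_Cons)
    have us: "map U [k..<k + 6] = U k # map U [Suc k..<k + 6]" by (simp add: upt_conv_Cons)
    have us': "map U [Suc k..<Suc k + 6] = map U [Suc k..<k + 6] @ [Dn k]"
    proof -
      have "[Suc k..<Suc k + 6] = [Suc k..<k + 6] @ [k + 6]" using upt_Suc_append[of "Suc k" "k + 6"] by (simp add: add.commute)
      then show ?thesis by (simp add: U_def)
    qed
    have eq: "st (Suc k) = (if k mod 6 = 5 then T else Rr k # T, map U [Suc k..<k + 6] @ [Dn k],
        if k mod 6 = 5 then map (\<lambda>y. Rr (6 * y + 5)) [0..<k div 6] @ [Rr k]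
        else map (\<lambda>y. Rr (6 * y + 5)) [0..<k div 6])"
    proof (cases "k mod 6 = 5")
      case True
      then have m: "Suc k mod 6 = 0" "Suc k div 6 = Suc (k div 6)" by presburger+
      have "6 * (k div 6) + 5 = k" using True mult_div_mod_eq[of 6 k] by linarith
      then show ?thesis unfolding st_def us' m T_def using True by simp
    next
      case False
      then have m: "Suc k mod 6 \<noteq> 0" "Suc k div 6 = k div 6" by presburger+
      then show ?thesis unfolding st_def us' m(2) T_def using False by (simp add: L_def)
    qed
    show ?thesis
      unfolding eq unfolding st_def ws us f_def scan_point_def using ok[OF k] by auto
  qed
  have "st 108 \<in> set (scan (map f [k..<108]) S)" if "k \<le> 108" "st k \<in> set S" for k S
    using that
  proof (induction "108 - k" arbitrary: k S)
    case 0
    then show ?case by simp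
  next
    case (Suc m)
    then have k: "k < 108" by simp
    have "st (Suc k) \<in> set (remdups (concat (map (scan_point (f k)) S)))"
      using step[OF k] Suc.prems by auto
    then have "st 108 \<in> set (scan (map f [Suc k..<108]) (remdups (concat (map (scan_point (f k)) S))))"
      using Suc.hyps k by (intro Suc.hyps(1)) auto
    then show ?case using k by (simp add: upt_conv_Cons)
  qed
  from this[of 0 "[st 0]"] have "st 108 \<in> set (scan (map f [0..<108]) [st 0])" by simp
  moreover have "st 0 = (map W [0..<18], map N [0..<6], [])" by (simp add: st_def U_def)
  moreover have "map U [108..<108 + 6] = map (\<lambda>x. Dn (102 + x)) [0..<6]"
    by (simp add: U_def upt_rec)
  then have "st 108 = ([], map (\<lambda>x. Dn (102 + x)) [0..<6], map (\<lambda>y. Rr (6 * y + 5)) [0..<18])"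
    by (simp add: st_def)
  ultimately show ?thesis unfolding f_def by metis
qed

text \<open>A field of \<open>R\<close> times \<open>V\<close> cells. Row \<open>r0\<close> holds
  the cups and row \<open>r1\<close> the caps; each row strictly between them is a constraint on the
  \<open>C2\<close> columns, closed by a terminator in column \<open>C2\<close>. The predicate
  \<open>A\<close> tells which columns take part in a row.\<close>

locale grid =
  fixes R V r0 r1 C2 :: nat and A :: "nat \<Rightarrow> nat \<Rightarrow> bool"
  assumes rows: "Suc r0 < r1" "r1 < R" and cols: "0 < C2" "even C2" "C2 < V"
begin

definition ty :: "nat \<Rightarrow> nat \<Rightarrow> ctype" where
  "ty r v = (if r0 < r \<and> r < r1 then if v < C2 then if A r v then Add else Pass else if v = C2 then Term else Empty
     else if v < C2 \<and> r = r0 then if even v then CupL else CupR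
     else if v < C2 \<and> r = r1 then if even v then CapL else CapR else Empty)"

definition E :: "ledge set" where
  "E = {(X, Y, d). X < 6 * V \<and> Y < 18 * R \<and>
     edge_on (ty (Y div 18) (X div 6)) (6 * (Y mod 18) + X mod 6) d}"

text \<open>Decodes a number with the digits cell row, cell column, point and direction; a cell owns
  216 numbers, two for each of its 108 points.\<close>

definition eps :: "nat \<Rightarrow> ledge" where
  "eps u = (6 * (u div 216 mod V) + u mod 216 div 2 mod 6, 18 * (u div 216 div V) + u mod 216 div 2 div 6, odd u)"

lemma eps_index:
  assumes "r < R" "v < V" "y < 18" "x < 6"
  shows "eps (((r * V + v) * 108 + 6 * y + x) * 2 + (if d then 1 else 0)) = (6 * v + x, 18 * r + y, d)"
    and "((r * V + v) * 108 + 6 * y + x) * 2 + (if d then 1 else 0) < R * V * 216"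
proof -
  define a where "a = (6 * y + x) * 2 + (if d then 1 else 0)"
  have a: "a < 216" "a div 2 = 6 * y + x" "odd a = d" using assms by (auto simp: a_def)
  have u: "((r * V + v) * 108 + 6 * y + x) * 2 + (if d then 1 else 0) = (r * V + v) * 216 + a"
    by (simp add: a_def algebra_simps)
  have q: "((r * V + v) * 216 + a) div 216 = r * V + v" "((r * V + v) * 216 + a) mod 216 = a"
    using a(1) by (simp, simp only: mod_mult_self3 mod_less)
  have "(r * V + v) div V = r" "(r * V + v) mod V = v" using assms by simp_all
  moreover have "odd ((r * V + v) * 216 + a) = d" using a(3) by simp
  ultimately show "eps (((r * V + v) * 108 + 6 * y + x) * 2 + (if d then 1 else 0)) = (6 * v + x, 18 * r + y, d)"
    unfolding u eps_def q a(2) using assms by simp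
  have "r * V + v + 1 \<le> (r + 1) * V" using assms by simp
  also have "\<dots> \<le> R * V" using assms by (intro mult_le_mono1) simp
  finally have "(r * V + v + 1) * 216 \<le> R * V * 216" by (rule mult_le_mono1)
  then show "((r * V + v) * 108 + 6 * y + x) * 2 + (if d then 1 else 0) < R * V * 216"
    unfolding u using a(1) by simp
qed

lemma box_image: "{..<6 * V} \<times> {..<18 * R} \<times> (UNIV :: bool set) \<subseteq> eps ` {..<R * V * 216}"
proof
  fix e :: ledge assume "e \<in> {..<6 * V} \<times> {..<18 * R} \<times> UNIV"
  then obtain X Y d where e: "e = (X, Y, d)" "X < 6 * V" "Y < 18 * R" by auto
  have lt: "Y div 18 < R" "X div 6 < V" using e by (simp_all add: div_less_iff_less_mult mult.commute)
  have "eps (((Y div 18 * V + X div 6) * 108 + 6 * (Y mod 18) + X mod 6) * 2 + (if d then 1 else 0)) =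
      (6 * (X div 6) + X mod 6, 18 * (Y div 18) + Y mod 18, d)"
    by (rule eps_index) (use lt in simp_all)
  also have "\<dots> = e" using e by simp
  finally show "e \<in> eps ` {..<R * V * 216}"
    using eps_index(2)[OF lt, of "Y mod 18" "X mod 6" d] by (metis imageI lessThan_iff mod_less_divisor zero_less_numeral)
qed

text \<open>The image covers a box that has as many elements as the domain.\<close>

lemma inj_eps: "inj_on eps {..<R * V * 216}"
proof (rule eq_card_imp_inj_on)
  have "card ({..<6 * V} \<times> {..<18 * R} \<times> (UNIV :: bool set)) \<le> card (eps ` {..<R * V * 216})"
    by (rule card_mono[OF _ box_image]) simp
  moreover have "card ({..<6 * V} \<times> {..<18 * R} \<times> (UNIV :: bool set)) = R * V * 216"
    by (simp add: card_cartesian_product)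
  moreover have "card (eps ` {..<R * V * 216}) \<le> R * V * 216" using card_image_le[of "{..<R * V * 216}" eps] by simp
  ultimately show "card (eps ` {..<R * V * 216}) = card {..<R * V * 216}" by simp
qed simp

lemma E_cell:
  assumes "r < R" "v < V" "y < 18" "x < 6"
  shows "(6 * v + x, 18 * r + y, d) \<in> E \<longleftrightarrow> edge_on (ty r v) (6 * y + x) d"
proof -
  have "6 * v + x < 6 * V" "18 * r + y < 18 * R" using assms by simp_all
  moreover have "(6 * v + x) div 6 = v" "(6 * v + x) mod 6 = x" "(18 * r + y) div 18 = r" "(18 * r + y) mod 18 = y"
    using assms by simp_all
  ultimately show ?thesis by (simp add: E_def)
qed

text \<open>The boundary that a cell expects on its left is the one its neighbour provides; with the
  analogous fact for the upper boundary, degrees can be computed cell by cell.\<close>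

lemma west_mask:
  assumes "r < R" "v < V" "y < 18"
  shows "(0 < v \<and> (6 * v - 1, 18 * r + y, False) \<in> E) \<longleftrightarrow> west_of (ty r v) (v = 0) ! y"
proof (cases v)
  case 0
  have "west_of (ty r 0) True = no_west" using cols by (simp add: ty_def west_of_def)
  then show ?thesis using 0 assms by (simp add: no_west_def)
next
  case (Suc v')
  have "(6 * v - 1, 18 * r + y, False) = (6 * v' + 5, 18 * r + y, False)" using Suc by simp
  then have "(6 * v - 1, 18 * r + y, False) \<in> E \<longleftrightarrow> edge_on (ty r v') (6 * y + 5) False"
    using E_cell[of r v' y 5 False] assms Suc by (simp add: add.commute)
  also have "\<dots> \<longleftrightarrow> east (ty r v') ! y" using assms by (simp add: east_def)
  also have "east (ty r v') = west_of (ty r v) (v = 0)"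
    unfolding Suc using cols by (auto simp: ty_def west_of_def east_eqs)
  finally show ?thesis using Suc by simp
qed

lemma north_mask:
  assumes "r < R" "v < V" "x < 6"
  shows "(0 < r \<and> (6 * v + x, 18 * r - 1, True) \<in> E) \<longleftrightarrow> north_of (ty r v) ! x"
proof (cases r)
  case 0
  have "north_of (ty 0 v) = no_north" using rows by (simp add: ty_def north_of_def)
  then show ?thesis using 0 assms by (simp add: no_north_def)
next
  case (Suc r')
  have "(6 * v + x, 18 * r - 1, True) = (6 * v + x, 18 * r' + 17, True)" using Suc by simp
  then have "(6 * v + x, 18 * r - 1, True) \<in> E \<longleftrightarrow> edge_on (ty r' v) (102 + x) True"
    using E_cell[of r' v 17 x True] assms Suc by (simp add: add.commute)
  also have "\<dots> \<longleftrightarrow> south (ty r' v) ! x" using assms by (simp add: south_def)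
  also have "south (ty r' v) = north_of (ty r v)"
    unfolding Suc using rows by (auto simp: ty_def north_of_def south_eqs less_Suc_eq)
  finally show ?thesis using Suc by simp
qed

lemma degree_cell:
  assumes "r < R" "v < V" "j < 108"
  shows "card (incident E (6 * v + j mod 6, 18 * r + j div 6)) =
    cell_deg (west_of (ty r v) (v = 0)) (north_of (ty r v)) (cell_mask (ty r v)) j"
proof -
  define x y where "x = j mod 6" and "y = j div 6"
  have xy: "x < 6" "y < 18" and j: "j = 6 * y + x" using assms by (auto simp: x_def y_def)
  have self: "(6 * v + x, 18 * r + y, d) \<in> E \<longleftrightarrow> edge_on (ty r v) j d" for d
    using E_cell[OF assms(1,2) xy(2,1)] j by simp
  have left: "(6 * v + x \<noteq> 0 \<and> (6 * v + x - 1, 18 * r + y, False) \<in> E) \<longleftrightarrow>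
      (if x = 0 then west_of (ty r v) (v = 0) ! y else odd (cell_mask (ty r v) ! (j - 1)))"
  proof (cases "x = 0")
    case True
    then show ?thesis using west_mask[OF assms(1,2) xy(2)] by simp
  next
    case False
    have "6 * v + x - 1 = 6 * v + (x - 1)" "j - 1 = 6 * y + (x - 1)" using False j by simp_all
    then show ?thesis using E_cell[OF assms(1,2) xy(2), of "x - 1" False] xy False by (simp add: edge_on_def)
  qed
  have up: "(18 * r + y \<noteq> 0 \<and> (6 * v + x, 18 * r + y - 1, True) \<in> E) \<longleftrightarrow>
      (if y = 0 then north_of (ty r v) ! x else 2 \<le> cell_mask (ty r v) ! (j - 6))"
  proof (cases "y = 0")
    case True
    then show ?thesis using north_mask[OF assms(1,2) xy(1)] by simp
  next
    case False
    have "18 * r + y - 1 = 18 * r + (y - 1)" "j - 6 = 6 * (y - 1) + x" using False j by (simp_all add: algebra_simps)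
    then show ?thesis using E_cell[OF assms(1,2) _ xy(1), of "y - 1" True] xy False by (simp add: edge_on_def)
  qed
  have j6: "j < 6 \<longleftrightarrow> y = 0" "y = 0 \<Longrightarrow> j = x" using j xy by auto
  have "card (incident E (6 * v + x, 18 * r + y)) =
      (if 6 * v + x \<noteq> 0 \<and> (6 * v + x - 1, 18 * r + y, False) \<in> E then 1 else 0) +
      (if 18 * r + y \<noteq> 0 \<and> (6 * v + x, 18 * r + y - 1, True) \<in> E then 1 else 0) +
      (if (6 * v + x, 18 * r + y, False) \<in> E then 1 else 0) +
      (if (6 * v + x, 18 * r + y, True) \<in> E then 1 else 0)"
    unfolding card_inc incl_def by auto
  then show ?thesis
    unfolding left up self cell_deg_def x_def[symmetric] y_def[symmetric] j6(1)
    using j6(2) by (auto simp: edge_on_def)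
qed

text \<open>No edge leaves the field, because the last column lies at or beyond the terminators and
  the last row at or beyond the caps, and these cells are closed on the outside.\<close>

lemma E_far:
  assumes "e \<in> E" "(X, Y) \<in> ends e" shows "X < 6 * V \<and> Y < 18 * R"
proof -
  obtain a b d where e: "e = (a, b, d)" by (cases e)
  define r v where "r = b div 18" and "v = a div 6"
  have ab: "a < 6 * V" "b < 18 * R" and on: "edge_on (ty r v) (6 * (b mod 18) + a mod 6) d"
    using assms(1) by (simp_all add: e E_def r_def v_def)
  have rv: "r < R" "v < V" using ab by (simp_all add: r_def v_def div_less_iff_less_mult mult.commute)
  have "a + 1 < 6 * V" if "\<not> d"
  proof (rule ccontr)
    assume "\<not> ?thesis"
    then have a: "a = 6 * (V - 1) + 5" using ab by linarith
    then have "v = V - 1" "a mod 6 = 5" by (simp_all add: v_def)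
    then have "east (ty r (V - 1)) ! (b mod 18)" using on that by (simp add: east_def)
    moreover have "east (ty r (V - 1)) = no_west" using cols by (auto simp: ty_def east_eqs)
    ultimately show False by (simp add: no_west_def)
  qed
  moreover have "b + 1 < 18 * R" if "d"
  proof (rule ccontr)
    assume "\<not> ?thesis"
    then have b: "b = 18 * (R - 1) + 17" using ab by linarith
    then have "r = R - 1" "b mod 18 = 17" by (simp_all add: r_def)
    then have "south (ty (R - 1) v) ! (a mod 6)" using on that by (simp add: south_def)
    moreover have "south (ty (R - 1) v) = no_north" using rows by (auto simp: ty_def south_eqs)
    ultimately show False by (simp add: no_north_def)
  qed
  ultimately show ?thesis using assms(2) ab by (auto simp: e ends_def near_def far_def split: if_splits)
qed

lemma inc_outside: "\<not> (X < 6 * V \<and> Y < 18 * R) \<Longrightarrow> incident E (X, Y) = {}"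
  using E_far by (auto simp: incident_def)

end

text \<open>The bound 1000 is the difference in height between neighbouring columns of
  cells.\<close>

lemma code_bounds:
  assumes "x \<le> 1" "a \<in> set (cell_codes t c x)"
  shows "code_right a \<le> 2 \<and> code_down a \<le> 2 \<and> code_pot a < 1000"
proof -
  let ?P = "\<lambda>a. code_right a \<le> 2 \<and> code_down a \<le> 2 \<and> code_pot a < 1000"
  have T: "list_all ?P pass_labels00" "list_all ?P pass_labels01" "list_all ?P pass_labels10"
    "list_all ?P pass_labels11" "list_all ?P add_labels00" "list_all ?P add_labels01" "list_all ?P add_labels10"
    by code_simp+
  have U: "list_all ?P (xs[i := b])" if "list_all ?P xs" "?P b" for xs i b
    using that set_update_subset_insert[of xs i b] unfolding list_all_iff by blast
  have Z: "list_all ?P (replicate 108 (0, 0, 0))"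
    by (simp add: list_all_iff code_right_def code_down_def code_pot_def)
  have "list_all ?P (cell_codes t c x)"
  proof (cases t)
    case Pass
    then show ?thesis using T by (simp add: cell_codes_def)
  next
    case Add
    then show ?thesis using T by (simp add: cell_codes_def)
  qed (use assms(1) in \<open>simp_all only: cell_codes_def ctype.case\<close>,
       (intro U Z; simp add: code_right_def code_down_def code_pot_def)+)
  then show ?thesis using assms(2) by (simp add: list_all_iff)
qed

text \<open>The degree bound is one of the conditions of \<open>point_ok\<close>, so one verified
  labelling for each type of cell suffices.\<close>

lemma cell_deg_le:
  assumes j: "j < 108" and t: "first \<Longrightarrow> t \<notin> {CupR, CapR, Term}"
  shows "cell_deg (west_of t first) (north_of t) (cell_mask t) j \<le> 3"
proof -
  have D: "cell_deg (west_of t first) (north_of t) (cell_mask t) j \<le> 3"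
    if "cell_ok t first ws us es ds c x" for ws us es ds c x
    using cell_okD[OF that j] unfolding point_ok_def by blast
  show ?thesis
  proof (cases first)
    case True
    then show ?thesis
      using t by (cases t) (use D[of no_row] ok_Pass(5) ok_Add(4) ok_Empty(2) ok_Cup(3) ok_Cap(3) in \<open>(simp; fail) | metis\<close>)+
  next
    case False
    then show ?thesis
      by (cases t) (use D ok_Pass(1) ok_Add(1) ok_Empty(1) ok_Cup(1,5) ok_Cap(1,5) ok_Term in metis)+
  qed
qed

lemma div_mod_6I:
  fixes j :: nat assumes "c < 6" "j = 6 * q + c" shows "j mod 6 = c" "j div 6 = q"
  using assms by simp_all

lemma steps_6:
  fixes j :: nat
  shows "j mod 6 = 0 \<Longrightarrow> (j + 5) mod 6 = 5" "j mod 6 = 0 \<Longrightarrow> (j + 5) div 6 = j div 6"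
    "j mod 6 \<noteq> 0 \<Longrightarrow> (j - 1) mod 6 = j mod 6 - 1" "j mod 6 \<noteq> 0 \<Longrightarrow> (j - 1) div 6 = j div 6"
    "6 \<le> j \<Longrightarrow> (j - 6) mod 6 = j mod 6" "6 \<le> j \<Longrightarrow> (j - 6) div 6 = j div 6 - 1" "6 \<le> j \<Longrightarrow> 1 \<le> j div 6"
    "j < 6 \<Longrightarrow> (102 + j) mod 6 = j" "j < 6 \<Longrightarrow> (102 + j) div 6 = 17"
    "j mod 6 \<noteq> 5 \<Longrightarrow> (j + 1) mod 6 = j mod 6 + 1" "j mod 6 \<noteq> 5 \<Longrightarrow> (j + 1) div 6 = j div 6"
    "102 \<le> j \<Longrightarrow> j < 108 \<Longrightarrow> j mod 6 = j - 102" "102 \<le> j \<Longrightarrow> j < 108 \<Longrightarrow> j div 6 = 17"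
proof -
  have j: "j = 6 * (j div 6) + j mod 6" "j mod 6 < 6" by simp_all
  show "(j + 5) mod 6 = 5" "(j + 5) div 6 = j div 6" if "j mod 6 = 0"
    by (rule div_mod_6I[where q = "j div 6"], simp, use j that in linarith)
      (rule div_mod_6I[where c = 5], simp, use j that in linarith)
  show "(j - 1) mod 6 = j mod 6 - 1" "(j - 1) div 6 = j div 6" if "j mod 6 \<noteq> 0"
    by (rule div_mod_6I[where q = "j div 6"], use j that in linarith, use j that in linarith)
      (rule div_mod_6I[where c = "j mod 6 - 1"], use j that in linarith, use j that in linarith)
  show q: "1 \<le> j div 6" if "6 \<le> j" using div_le_mono[OF that, of 6] by simp
  show "(j - 6) mod 6 = j mod 6" "(j - 6) div 6 = j div 6 - 1" if "6 \<le> j"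
    by (rule div_mod_6I[where q = "j div 6 - 1"], use j in linarith, use j q[OF that] in linarith)
      (rule div_mod_6I[where c = "j mod 6"], use j in linarith, use j q[OF that] in linarith)
  show "(102 + j) mod 6 = j" "(102 + j) div 6 = 17" if "j < 6"
    using that by (intro div_mod_6I[where q = 17 and c = j]; simp)+
  show "(j + 1) mod 6 = j mod 6 + 1" "(j + 1) div 6 = j div 6" if "j mod 6 \<noteq> 5"
    by (rule div_mod_6I[where q = "j div 6"], use j that in linarith, use j that in linarith)
      (rule div_mod_6I[where c = "j mod 6 + 1"], use j that in linarith, use j that in linarith)
  show "j mod 6 = j - 102" "j div 6 = 17" if "102 \<le> j" "j < 108"
    using that by (intro div_mod_6I[where q = 17 and c = "j - 102"]; simp)+
qed

context grid
begin

lemma ty_first: "ty r 0 \<notin> {CupR, CapR, Term}"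
  using cols by (simp add: ty_def)

lemma point_coordinates:
  assumes "X < 6 * V" "Y < 18 * R"
  obtains r v j where "r < R" "v < V" "j < 108" "X = 6 * v + j mod 6" "Y = 18 * r + j div 6"
proof
  show "Y div 18 < R" "X div 6 < V" using assms by (simp_all add: div_less_iff_less_mult mult.commute)
  have "X mod 6 < 6" "Y mod 18 < 18" by simp_all
  then show "6 * (Y mod 18) + X mod 6 < 108" by linarith
  have "(6 * (Y mod 18) + X mod 6) mod 6 = X mod 6" "(6 * (Y mod 18) + X mod 6) div 6 = Y mod 18" by simp_all
  then show "X = 6 * (X div 6) + (6 * (Y mod 18) + X mod 6) mod 6"
    "Y = 18 * (Y div 18) + (6 * (Y mod 18) + X mod 6) div 6" by simp_all
qed

lemma degree_le: "card (incident E p) \<le> 3"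
proof (cases "fst p < 6 * V \<and> snd p < 18 * R")
  case True
  then obtain r v j where rvj: "r < R" "v < V" "j < 108" "fst p = 6 * v + j mod 6" "snd p = 18 * r + j div 6"
    using point_coordinates by metis
  then have "p = (6 * v + j mod 6, 18 * r + j div 6)" by (simp add: prod_eq_iff)
  then show ?thesis using degree_cell[OF rvj(1-3)] cell_deg_le[OF rvj(3), of "v = 0" "ty r v"] ty_first[of r] by auto
next
  case False
  then show ?thesis using inc_outside[of "fst p" "snd p"] by simp
qed

lemma E_eps: "E \<subseteq> eps ` {..<R * V * 216}"
  using box_image by (force simp: E_def)

sublocale lattice "R * V * 216" eps E
  by unfold_locales (rule inj_eps, rule E_eps, rule degree_le)

section \<open>From labellings of the crossbar to solutions\<close>

definition west :: "(ledge \<Rightarrow> nat) \<Rightarrow> nat \<Rightarrow> nat \<Rightarrow> nat list" where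
  "west l r v = map (\<lambda>y. if v = 0 then 0 else l (6 * v - 1, 18 * r + y, False)) [0..<18]"
definition north :: "(ledge \<Rightarrow> nat) \<Rightarrow> nat \<Rightarrow> nat \<Rightarrow> nat list" where
  "north l r v = map (\<lambda>x. if r = 0 then 0 else l (6 * v + x, 18 * r - 1, True)) [0..<6]"

lemma plabels_cell:
  assumes j: "j < 108"
  shows "plabels l (6 * v + j mod 6) (18 * r + j div 6) =
    [if j mod 6 = 0 then west l r v ! (j div 6) else l (6 * v + (j - 1) mod 6, 18 * r + (j - 1) div 6, False),
     if j < 6 then north l r v ! j else l (6 * v + (j - 6) mod 6, 18 * r + (j - 6) div 6, True),
     l (6 * v + j mod 6, 18 * r + j div 6, False), l (6 * v + j mod 6, 18 * r + j div 6, True)]"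
proof -
  have y: "j div 6 < 18" using j by simp
  have 1: "(if 6 * v + j mod 6 = 0 then 0 else l (6 * v + j mod 6 - 1, 18 * r + j div 6, False)) =
    (if j mod 6 = 0 then west l r v ! (j div 6) else l (6 * v + (j - 1) mod 6, 18 * r + (j - 1) div 6, False))"
  proof (cases "j mod 6 = 0")
    case True
    then show ?thesis using y by (simp add: west_def)
  next
    case False
    have e: "6 * v + j mod 6 - 1 = 6 * v + (j mod 6 - 1)" and nz: "6 * v + j mod 6 \<noteq> 0"
      using False by linarith+
    show ?thesis unfolding if_not_P[OF nz] if_not_P[OF False] steps_6(3,4)[OF False] e by (rule refl)
  qed
  have 2: "(if 18 * r + j div 6 = 0 then 0 else l (6 * v + j mod 6, 18 * r + j div 6 - 1, True)) =
    (if j < 6 then north l r v ! j else l (6 * v + (j - 6) mod 6, 18 * r + (j - 6) div 6, True))"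
  proof (cases "j < 6")
    case True
    then show ?thesis by (simp add: north_def)
  next
    case False
    then have j6: "6 \<le> j" by simp
    have e: "18 * r + j div 6 - 1 = 18 * r + (j div 6 - 1)" and nz: "18 * r + j div 6 \<noteq> 0"
      using steps_6(7)[OF j6] by linarith+
    show ?thesis unfolding if_not_P[OF nz] if_not_P[OF False] steps_6(5,6)[OF j6] e by (rule refl)
  qed
  show ?thesis unfolding plabels_def 1 2 ..
qed

text \<open>Width and height of a cell are even, so the colour of a point depends on its local
  coordinates only and one check serves all copies of a cell.\<close>

lemma colour_cell: "(6 * v + j mod 6 + (18 * r + j div 6)) mod 2 = (j mod 6 + j div 6) mod (2 :: nat)"
proof -
  have "6 * v + j mod 6 + (18 * r + j div 6) = (j mod 6 + j div 6) + (3 * v + 9 * r) * 2" by simp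
  then show ?thesis by (simp only: mod_mult_self1)
qed

lemma cell_scan_labelling:
  assumes lab: "labelling E l" and rv: "r < R" "v < V"
  shows "([], north l (Suc r) v, west l r (Suc v)) \<in>
    set (cell_scan (ty r v) (v = 0) (west l r v) (north l r v))"
proof -
  have l2: "l e \<le> 2" and lE: "l e \<noteq> 0 \<Longrightarrow> e \<in> E" for e
    using lab unfolding labelling_def by blast+
  have vr: "vrule (card (incident E (X, Y))) ((X + Y) mod 2) (plabels l X Y)" for X Y
    using labelling_vrule[of l E] lE lab by blast
  define W where "W = (\<lambda>y. if v = 0 then 0 else l (6 * v - 1, 18 * r + y, False))"
  define N where "N = (\<lambda>x. if r = 0 then 0 else l (6 * v + x, 18 * r - 1, True))"
  define Rr where "Rr = (\<lambda>j. l (6 * v + j mod 6, 18 * r + j div 6, False))"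
  define Dn where "Dn = (\<lambda>j. l (6 * v + j mod 6, 18 * r + j div 6, True))"
  let ?m = "cell_mask (ty r v)"
  have ch: "l (6 * v + j mod 6, 18 * r + j div 6, d) \<in> set (choices (edge_on (ty r v) j d))" if "j < 108" for j d
  proof -
    have "(6 * v + j mod 6, 18 * r + j div 6, d) \<in> E \<longleftrightarrow> edge_on (ty r v) j d"
      using E_cell[OF rv, of "j div 6" "j mod 6" d] that by simp
    moreover have "l (6 * v + j mod 6, 18 * r + j div 6, d) \<in> {0, 1, 2}"
      using l2[of "(6 * v + j mod 6, 18 * r + j div 6, d)"] by auto
    ultimately show ?thesis using lE[of "(6 * v + j mod 6, 18 * r + j div 6, d)"] by (auto simp: choices_def)
  qed
  have "([], map (\<lambda>x. Dn (102 + x)) [0..<6], map (\<lambda>y. Rr (6 * y + 5)) [0..<18]) \<in>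
    set (scan (map (\<lambda>j. (j mod 6, cell_deg (west_of (ty r v) (v = 0)) (north_of (ty r v)) ?m j,
      (j mod 6 + j div 6) mod 2, odd (?m ! j), 2 \<le> ?m ! j)) [0..<108]) [(map W [0..<18], map N [0..<6], [])])"
  proof (rule scan_sound)
    fix j :: nat assume j: "j < 108"
    have "j div 6 < 18" using j by simp
    then have "[if j mod 6 = 0 then W (j div 6) else Rr (j - 1), if j < 6 then N j else Dn (j - 6), Rr j, Dn j] =
        plabels l (6 * v + j mod 6) (18 * r + j div 6)"
      unfolding plabels_cell[OF j] by (simp add: W_def N_def Rr_def Dn_def west_def north_def)
    then show "vrule (cell_deg (west_of (ty r v) (v = 0)) (north_of (ty r v)) ?m j) ((j mod 6 + j div 6) mod 2)
       [if j mod 6 = 0 then W (j div 6) else Rr (j - 1), if j < 6 then N j else Dn (j - 6), Rr j, Dn j] \<and>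
       Rr j \<in> set (choices (odd (?m ! j))) \<and> Dn j \<in> set (choices (2 \<le> ?m ! j))"
      using vr[of "6 * v + j mod 6" "18 * r + j div 6"] degree_cell[OF rv j] colour_cell[of v j r] ch[OF j, of False]
        ch[OF j, of True] by (simp add: Rr_def Dn_def edge_on_def)
  qed
  moreover have "map (\<lambda>x. Dn (102 + x)) [0..<6] = north l (Suc r) v"
    unfolding north_def
  proof (rule map_cong[OF refl])
    fix x :: nat assume "x \<in> set [0..<6]"
    then have "(102 + x) mod 6 = x" "(102 + x) div 6 = 17" by (auto intro: steps_6)
    moreover have "18 * Suc r - 1 = 18 * r + 17" by simp
    ultimately show "Dn (102 + x) = (if Suc r = 0 then 0 else l (6 * v + x, 18 * Suc r - 1, True))"
      by (simp only: Dn_def) simp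
  qed
  moreover have "map (\<lambda>y. Rr (6 * y + 5)) [0..<18] = west l r (Suc v)"
    unfolding west_def by (rule map_cong) (auto simp: Rr_def add.commute)
  moreover have "map W [0..<18] = west l r v" "map N [0..<6] = north l r v"
    by (simp_all only: W_def N_def west_def north_def)
  ultimately show ?thesis unfolding cell_scan_def pinfos_def by simp
qed

lemma west_zero:
  assumes "labelling E l" "r < R" "v < V" "west_of (ty r v) (v = 0) = no_west"
  shows "west l r v = no_row"
proof -
  have lE: "l e = 0" if "e \<notin> E" for e using assms(1) that unfolding labelling_def by blast
  have "(if v = 0 then 0 else l (6 * v - 1, 18 * r + y, False)) = 0" if "y < 18" for y
    using west_mask[OF assms(2,3) that] assms(4) that lE by (auto simp: no_west_def)
  then show ?thesis unfolding west_def no_row_def by (intro nth_equalityI) auto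
qed

lemma north_zero:
  assumes "labelling E l" "r < R" "v < V" "north_of (ty r v) = no_north"
  shows "north l r v = no_column"
proof -
  have lE: "l e = 0" if "e \<notin> E" for e using assms(1) that unfolding labelling_def by blast
  have "(if r = 0 then 0 else l (6 * v + x, 18 * r - 1, True)) = 0" if "x < 6" for x
    using north_mask[OF assms(2,3) that] assms(4) that lE by (auto simp: no_north_def)
  then show ?thesis unfolding north_def no_column_def by (intro nth_equalityI) auto
qed

definition row_sum :: "(nat \<Rightarrow> nat) \<Rightarrow> nat \<Rightarrow> nat \<Rightarrow> nat" where
  "row_sum x r v = (\<Sum>u<v. if A r u then x u else 0)"

lemma row_sum_simps [simp]: "row_sum x r 0 = 0"
  "row_sum x r (Suc v) = row_sum x r v + (if A r v then x v else 0)"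
  by (simp_all add: row_sum_def)

lemma row_sum_mono: "u \<le> v \<Longrightarrow> row_sum x r u \<le> row_sum x r v"
  unfolding row_sum_def by (intro sum_mono2) auto

lemma scan_unique: "set S \<subseteq> {([], n, m)} \<Longrightarrow> ([], n', m') \<in> set S \<Longrightarrow> n' = n \<and> m' = m"
  by blast

text \<open>The bits are read off below the cups. Going down row by row, the scans show that columns
  keep their bits and that the row wire carries the partial sums, until the terminator demands
  1.\<close>

lemma solution_of_labelling:
  assumes lab: "labelling E l"
  shows "\<exists>x. (\<forall>v<C2. x v \<le> 1) \<and> (\<forall>i. 2 * i < C2 \<longrightarrow> x (2 * i) = x (2 * i + 1)) \<and>
    (\<forall>r. r0 < r \<longrightarrow> r < r1 \<longrightarrow> row_sum x r C2 = 1)"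
proof -
  note S = cell_scan_labelling[OF lab]
  \<comment> \<open>A cup gives both columns of a pair the same label, by matching the two halves at
    their common boundary.\<close>
  have pair: "\<exists>a\<le>1. north l (Suc r0) (2 * i) = column_label a \<and> north l (Suc r0) (2 * i + 1) = column_label a"
    if i: "2 * i < C2" for i
  proof -
    have i': "2 * i + 1 < C2" using i cols by presburger
    have R0: "r0 < R" and V: "2 * i < V" "2 * i + 1 < V" using rows cols i' by simp_all
    have tL: "ty r0 (2 * i) = CupL" and tR: "ty r0 (2 * i + 1) = CupR" using i i' by (simp_all add: ty_def)
    have w: "west l r0 (2 * i) = no_row" by (rule west_zero[OF lab R0 V(1)]) (simp only: tL west_of_def ctype.case)
    have n: "north l r0 (2 * i) = no_column" by (rule north_zero[OF lab R0 V(1)]) (unfold tL, simp add: north_of_def)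
    have n': "north l r0 (2 * i + 1) = no_column" by (rule north_zero[OF lab R0 V(2)]) (unfold tR, simp add: north_of_def)
    have f: "cell_scan CupL (2 * i = 0) ws us = cell_scan CupL False ws us" for ws us
      unfolding cell_scan_def west_of_def ctype.case by (rule refl)
    have "([], north l (Suc r0) (2 * i), west l r0 (Suc (2 * i))) \<in> set (cell_scan CupL False no_row no_column)"
      using S[OF R0 V(1)] unfolding tL w n f .
    from subsetD[OF scan_CupL this]
    have "north l (Suc r0) (2 * i) = column_label 0 \<and> west l r0 (Suc (2 * i)) = no_row[16 := 1] \<or>
        north l (Suc r0) (2 * i) = column_label 1 \<and> west l r0 (Suc (2 * i)) = no_row[16 := 2]"
      by (simp only: insert_iff empty_iff prod.inject simp_thms)
    then have "\<exists>a\<le>1. north l (Suc r0) (2 * i) = column_label a \<and> west l r0 (Suc (2 * i)) = no_row[16 := 1 + a]"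
    proof
      assume "north l (Suc r0) (2 * i) = column_label 0 \<and> west l r0 (Suc (2 * i)) = no_row[16 := 1]"
      then show ?thesis by (intro exI[of _ 0]) simp
    next
      assume "north l (Suc r0) (2 * i) = column_label 1 \<and> west l r0 (Suc (2 * i)) = no_row[16 := 2]"
      then show ?thesis by (intro exI[of _ 1]) (simp add: numeral_2_eq_2)
    qed
    then obtain a where a: "a \<le> 1" "north l (Suc r0) (2 * i) = column_label a" "west l r0 (2 * i + 1) = no_row[16 := 1 + a]"
      by (auto simp only: Suc_eq_plus1)
    have "([], north l (Suc r0) (2 * i + 1), west l r0 (Suc (2 * i + 1))) \<in> set (cell_scan CupR False (no_row[16 := 1 + a]) no_column)"
      using S[OF R0 V(2)] unfolding tR n' a(3) by (simp only: add_is_0 one_neq_zero simp_thms)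
    moreover have "a = 0 \<or> a = 1" using a(1) by linarith
    ultimately have "north l (Suc r0) (2 * i + 1) = column_label a"
    proof (elim disjE)
      assume m: "([], north l (Suc r0) (2 * i + 1), west l r0 (Suc (2 * i + 1))) \<in> set (cell_scan CupR False (no_row[16 := 1 + a]) no_column)"
      show "north l (Suc r0) (2 * i + 1) = column_label a" if a: "a = 0"
        using m scan_unique[OF scan_CupR(1)] unfolding a add_0_right by blast
      show "north l (Suc r0) (2 * i + 1) = column_label a" if a: "a = 1"
        using m scan_unique[OF scan_CupR(2)] unfolding a one_add_one by blast
    qed
    then show ?thesis using a by blast
  qed
  have "\<exists>a. a \<le> 1 \<and> north l (Suc r0) v = column_label a" if v: "v < C2" for v
  proof (cases "even v")
    case True
    then obtain i where "v = 2 * i" by (rule evenE)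
    then show ?thesis using pair[of i] v by blast
  next
    case False
    then obtain i where "v = 2 * i + 1" by (rule oddE)
    then show ?thesis using pair[of i] v by auto
  qed
  then have "\<forall>v. \<exists>a. v < C2 \<longrightarrow> a \<le> 1 \<and> north l (Suc r0) v = column_label a" by blast
  from choice[OF this] obtain x where x: "\<And>v. v < C2 \<Longrightarrow> x v \<le> 1"
    "\<And>v. v < C2 \<Longrightarrow> north l (Suc r0) v = column_label (x v)" by blast
  have twin: "x (2 * i) = x (2 * i + 1)" if i: "2 * i < C2" for i
  proof -
    have "2 * i + 1 < C2" using i cols by presburger
    moreover obtain a where "north l (Suc r0) (2 * i) = column_label a" "north l (Suc r0) (2 * i + 1) = column_label a"
      using pair[OF i] by blast
    ultimately have "column_label (x (2 * i)) = column_label (x (2 * i + 1))" using x(2)[OF i] x(2)[of "2 * i + 1"] by simp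
    then show ?thesis by (simp add: column_label_def)
  qed
  \<comment> \<open>One row of the crossbar: if the column bits enter from above, the row sum is 1
    and the bits leave unchanged below.\<close>
  have row: "row_sum x r C2 = 1 \<and> (\<forall>v<C2. north l (Suc r) v = column_label (x v))"
    if r: "r0 < r" "r < r1" and nr: "\<And>v. v < C2 \<Longrightarrow> north l r v = column_label (x v)" for r
  proof -
    have R: "r < R" using r rows by simp
    have step: "row_sum x r (Suc v) \<le> 1 \<and> west l r (Suc v) = row_labels (row_sum x r (Suc v)) \<and>
        north l (Suc r) v = column_label (x v)"
      if v: "v < C2" and s: "row_sum x r v \<le> 1" and w: "v \<noteq> 0 \<Longrightarrow> west l r v = row_labels (row_sum x r v)" for v
    proof -
      have V: "v < V" using v cols by simp
      have t: "ty r v = (if A r v then Add else Pass)" using r v by (simp add: ty_def)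
      have mem: "([], north l (Suc r) v, west l r (Suc v)) \<in>
          set (cell_scan (if A r v then Add else Pass) (v = 0) (west l r v) (column_label (x v)))"
        using S[OF R V] unfolding t nr[OF v] .
      have x01: "x v = 0 \<or> x v = 1" and s01: "row_sum x r v = 0 \<or> row_sum x r v = 1"
        using x(1)[OF v] s by linarith+
      show ?thesis
      proof (cases "v = 0")
        case True
        have w0: "west l r v = no_row" using True by (simp add: west_def no_row_def map_replicate_const)
        have ve: "(v = 0) = True" and s0: "row_sum x r v = 0" using True by simp_all
        from x01 show ?thesis
        proof
          assume x0: "x v = 0"
          show ?thesis
          proof (cases "A r v")
            case tt: True
            have "([], north l (Suc r) v, west l r (Suc v)) \<in> set (cell_scan Add True no_row (column_label 0))"
              using mem unfolding w0 by (simp only: tt if_True if_False x0 ve s0)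
            from scan_unique[OF scan_Add(5) this] show ?thesis unfolding row_sum_simps by (simp add: tt x0 s0)
          next
            case tt: False
            have "([], north l (Suc r) v, west l r (Suc v)) \<in> set (cell_scan Pass True no_row (column_label 0))"
              using mem unfolding w0 by (simp only: tt if_True if_False x0 ve s0)
            from scan_unique[OF scan_Pass(5) this] show ?thesis unfolding row_sum_simps by (simp add: tt x0 s0)
          qed
        next
          assume x0: "x v = 1"
          show ?thesis
          proof (cases "A r v")
            case tt: True
            have "([], north l (Suc r) v, west l r (Suc v)) \<in> set (cell_scan Add True no_row (column_label 1))"
              using mem unfolding w0 by (simp only: tt if_True if_False x0 ve s0)
            from scan_unique[OF scan_Add(6) this] show ?thesis unfolding row_sum_simps by (simp add: tt x0 s0)
          next
            case tt: False
            have "([], north l (Suc r) v, west l r (Suc v)) \<in> set (cell_scan Pass True no_row (column_label 1))"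
              using mem unfolding w0 by (simp only: tt if_True if_False x0 ve s0)
            from scan_unique[OF scan_Pass(6) this] show ?thesis unfolding row_sum_simps by (simp add: tt x0 s0)
          qed
        qed
      next
        case False
        have ve: "(v = 0) = False" using False by simp
        from s01 show ?thesis
        proof
          assume s0: "row_sum x r v = 0"
          from x01 show ?thesis
          proof
            assume x0: "x v = 0"
            show ?thesis
            proof (cases "A r v")
              case tt: True
              have "([], north l (Suc r) v, west l r (Suc v)) \<in> set (cell_scan Add False (row_labels 0) (column_label 0))"
                using mem unfolding w[OF False] by (simp only: tt if_True if_False x0 ve s0)
              from scan_unique[OF scan_Add(1) this] show ?thesis unfolding row_sum_simps by (simp add: tt x0 s0)
            next
              case tt: False
              have "([], north l (Suc r) v, west l r (Suc v)) \<in> set (cell_scan Pass False (row_labels 0) (column_label 0))"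
                using mem unfolding w[OF False] by (simp only: tt if_True if_False x0 ve s0)
              from scan_unique[OF scan_Pass(1) this] show ?thesis unfolding row_sum_simps by (simp add: tt x0 s0)
            qed
          next
            assume x0: "x v = 1"
            show ?thesis
            proof (cases "A r v")
              case tt: True
              have "([], north l (Suc r) v, west l r (Suc v)) \<in> set (cell_scan Add False (row_labels 0) (column_label 1))"
                using mem unfolding w[OF False] by (simp only: tt if_True if_False x0 ve s0)
              from scan_unique[OF scan_Add(2) this] show ?thesis unfolding row_sum_simps by (simp add: tt x0 s0)
            next
              case tt: False
              have "([], north l (Suc r) v, west l r (Suc v)) \<in> set (cell_scan Pass False (row_labels 0) (column_label 1))"
                using mem unfolding w[OF False] by (simp only: tt if_True if_False x0 ve s0)
              from scan_unique[OF scan_Pass(2) this] show ?thesis unfolding row_sum_simps by (simp add: tt x0 s0)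
            qed
          qed
        next
          assume s0: "row_sum x r v = 1"
          from x01 show ?thesis
          proof
            assume x0: "x v = 0"
            show ?thesis
            proof (cases "A r v")
              case tt: True
              have "([], north l (Suc r) v, west l r (Suc v)) \<in> set (cell_scan Add False (row_labels 1) (column_label 0))"
                using mem unfolding w[OF False] by (simp only: tt if_True if_False x0 ve s0)
              from scan_unique[OF scan_Add(3) this] show ?thesis unfolding row_sum_simps by (simp add: tt x0 s0)
            next
              case tt: False
              have "([], north l (Suc r) v, west l r (Suc v)) \<in> set (cell_scan Pass False (row_labels 1) (column_label 0))"
                using mem unfolding w[OF False] by (simp only: tt if_True if_False x0 ve s0)
              from scan_unique[OF scan_Pass(3) this] show ?thesis unfolding row_sum_simps by (simp add: tt x0 s0)
            qed
          next
            assume x0: "x v = 1"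
            show ?thesis
            proof (cases "A r v")
              case tt: True
              have "([], north l (Suc r) v, west l r (Suc v)) \<in> set (cell_scan Add False (row_labels 1) (column_label 1))"
                using mem unfolding w[OF False] by (simp only: tt if_True if_False x0 ve s0)
              then show ?thesis unfolding scan_Add(4) by simp
            next
              case tt: False
              have "([], north l (Suc r) v, west l r (Suc v)) \<in> set (cell_scan Pass False (row_labels 1) (column_label 1))"
                using mem unfolding w[OF False] by (simp only: tt if_True if_False x0 ve s0)
              from scan_unique[OF scan_Pass(4) this] show ?thesis unfolding row_sum_simps by (simp add: tt x0 s0)
            qed
          qed
        qed
      qed
    qed
    have all: "row_sum x r v \<le> 1 \<and> (v \<noteq> 0 \<longrightarrow> west l r v = row_labels (row_sum x r v)) \<and>
        (\<forall>u<v. north l (Suc r) u = column_label (x u))" if "v \<le> C2" for v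
      using that
    proof (induction v)
      case (Suc v)
      then have IH: "row_sum x r v \<le> 1" "v \<noteq> 0 \<Longrightarrow> west l r v = row_labels (row_sum x r v)"
        "\<And>u. u < v \<Longrightarrow> north l (Suc r) u = column_label (x u)" and v: "v < C2" by simp_all
      note st = step[OF v IH(1,2)]
      have "north l (Suc r) u = column_label (x u)" if "u < Suc v" for u
        using that IH(3)[of u] st by (cases "u = v") simp_all
      then show ?case using st by blast
    qed simp
    have V: "C2 < V" and C: "C2 \<noteq> 0" using cols by simp_all
    have t: "ty r C2 = Term" using r by (simp add: ty_def)
    have n: "north l r C2 = no_column" by (rule north_zero[OF lab R V]) (simp add: t north_of_def)
    have w: "west l r C2 = row_labels (row_sum x r C2)" and le: "row_sum x r C2 \<le> 1" using all[of C2] C by blast+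
    have "([], north l (Suc r) C2, west l r (Suc C2)) \<in> set (cell_scan Term False (row_labels (row_sum x r C2)) no_column)"
      using S[OF R V] C unfolding t n w by simp
    then have "row_sum x r C2 \<noteq> 0" using scan_Term by (intro notI) simp
    then have "row_sum x r C2 = 1" using le by linarith
    then show ?thesis using all[of C2] by blast
  qed
  have "\<forall>v<C2. north l r v = column_label (x v)" if "Suc r0 \<le> r" "r \<le> r1" for r
    using that
  proof (induction r rule: dec_induct)
    case base
    then show ?case using x(2) by blast
  next
    case (step r)
    then show ?case using row[of r] by simp
  qed
  then have "row_sum x r C2 = 1" if "r0 < r" "r < r1" for r using row[OF that] that by simp
  then show ?thesis using x(1) twin by blast
qed

lemma max_degree_grid: "max_degree G = 4"
proof (rule max_degree_G)
  define r where "r = Suc r0"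
  have rv: "r < R" "0 < V" using rows cols by (simp_all add: r_def)
  have t: "ty r 0 = Pass \<or> ty r 0 = Add" using rows cols by (simp add: ty_def r_def)
  show "(6 * 0 + 1, 18 * r + 3, False) \<in> E"
    using E_cell[OF rv, of 3 1 False] high_degrees(1)[OF t] by simp
  have "near (6 * 0 + 1, 18 * r + 3, False) = (6 * 0 + 19 mod 6, 18 * r + 19 div 6)" by (simp add: near_def)
  then show "card (incident E (near (6 * 0 + 1, 18 * r + 3, False))) = 3"
    using degree_cell[OF rv, of 19] high_degrees(2)[OF t] by simp
  have "far (6 * 0 + 1, 18 * r + 3, False) = (6 * 0 + 20 mod 6, 18 * r + 20 div 6)" by (simp add: far_def)
  then show "card (incident E (far (6 * 0 + 1, 18 * r + 3, False))) = 3"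
    using degree_cell[OF rv, of 20] high_degrees(3)[OF t] by simp
qed

lemma sum_pairs: "(\<Sum>v<2 * m. if even v then a else b) = m * (a + b :: nat)"
  by (induction m) (simp_all add: algebra_simps)

text \<open>Summation over cells, using that points outside the cells have no edges. One quarter of
  the result is the size that a matching has to reach.\<close>

lemma total: "(\<Sum>p\<in>points. min 2 (card (incident E p))) = 4 * ((r1 - r0 - 1) * (47 * C2 + 1) + 4 * C2)"
proof -
  let ?f = "\<lambda>p. min 2 (card (incident E p))"
  have "(\<Sum>p\<in>points. ?f p) = (\<Sum>p\<in>{..<6 * V} \<times> {..<18 * R}. ?f p)"
  proof (rule sum.mono_neutral_left)
    show "points \<subseteq> {..<6 * V} \<times> {..<18 * R}" using E_far by (fastforce simp: points_def)
    show "\<forall>p\<in>{..<6 * V} \<times> {..<18 * R} - points. ?f p = 0"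
    proof
      fix p assume "p \<in> {..<6 * V} \<times> {..<18 * R} - points"
      then have "incident E p = {}" by (auto simp: points_def incident_def)
      then show "?f p = 0" by simp
    qed
  qed simp
  also have "\<dots> = (\<Sum>(r, v, j)\<in>{..<R} \<times> {..<V} \<times> {..<108}. ?f (6 * v + j mod 6, 18 * r + j div 6))"
  proof (rule sum.reindex_bij_witness[where i = "\<lambda>(r, v, j). (6 * v + j mod 6, 18 * r + j div 6)"
        and j = "\<lambda>(X, Y). (Y div 18, X div 6, 6 * (Y mod 18) + X mod 6)"])
    fix p assume "p \<in> {..<6 * V} \<times> {..<18 * R}"
    then obtain X Y where p: "p = (X, Y)" "X < 6 * V" "Y < 18 * R" by auto
    have "X mod 6 < 6" "Y mod 18 < 18" by simp_all
    then have "6 * (Y mod 18) + X mod 6 < 108" by linarith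
    then show "(case p of (X, Y) \<Rightarrow> (Y div 18, X div 6, 6 * (Y mod 18) + X mod 6)) \<in> {..<R} \<times> {..<V} \<times> {..<108}"
      using p by (simp add: div_less_iff_less_mult mult.commute)
    show "(case case p of (X, Y) \<Rightarrow> (Y div 18, X div 6, 6 * (Y mod 18) + X mod 6) of
        (r, v, j) \<Rightarrow> (6 * v + j mod 6, 18 * r + j div 6)) = p" by (simp add: p)
    show "(case case p of (X, Y) \<Rightarrow> (Y div 18, X div 6, 6 * (Y mod 18) + X mod 6) of
        (r, v, j) \<Rightarrow> ?f (6 * v + j mod 6, 18 * r + j div 6)) = ?f p" by (simp add: p)
  next
    fix q :: "nat \<times> nat \<times> nat" assume "q \<in> {..<R} \<times> {..<V} \<times> {..<108}"
    then obtain r v j where q: "q = (r, v, j)" "r < R" "v < V" "j < 108" by auto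
    have "j div 6 < 18" using q by simp
    then show "(case case q of (r, v, j) \<Rightarrow> (6 * v + j mod 6, 18 * r + j div 6) of
        (X, Y) \<Rightarrow> (Y div 18, X div 6, 6 * (Y mod 18) + X mod 6)) = q" by (simp add: q)
    have "j mod 6 < 6" by simp
    then have "6 * v + j mod 6 < 6 * V" "18 * r + j div 6 < 18 * R" using q \<open>j div 6 < 18\<close> by linarith+
    then show "(case q of (r, v, j) \<Rightarrow> (6 * v + j mod 6, 18 * r + j div 6)) \<in> {..<6 * V} \<times> {..<18 * R}"
      by (simp add: q)
  qed
  also have "\<dots> = (\<Sum>r<R. \<Sum>v<V. \<Sum>j<108. ?f (6 * v + j mod 6, 18 * r + j div 6))"
    by (simp add: sum.cartesian_product)
  also have "\<dots> = (\<Sum>r<R. \<Sum>v<V. cell_total (ty r v) (v = 0))"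
  proof (intro sum.cong refl)
    fix r v assume rv: "r \<in> {..<R}" "v \<in> {..<V}"
    show "(\<Sum>j<108. ?f (6 * v + j mod 6, 18 * r + j div 6)) = cell_total (ty r v) (v = 0)"
      unfolding cell_total_def interv_sum_list_conv_sum_set_nat set_upt lessThan_atLeast0
      by (rule sum.cong[OF refl]) (use rv degree_cell in simp)
  qed
  \<comment> \<open>Cups contribute 10 and 8 in alternation, caps 8 and 6, hence the averages 9 and
    7 per column. A constraint row contributes 188 per column, less 2 for the first cell, plus 6 for
    the terminator.\<close>
  also have "\<dots> = (\<Sum>r<R. (if r = r0 then 9 * C2 else 0) + (if r = r1 then 7 * C2 else 0) +
      (if r0 < r \<and> r < r1 then 188 * C2 + 4 else 0))"
  proof (rule sum.cong[OF refl])
    fix r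
    have cb: "cell_total CupL b = 10" "cell_total CapL b = 8" "cell_total Pass b = (if b then 186 else 188)"
      "cell_total Add b = (if b then 186 else 188)" for b by (cases b; simp add: cell_total)+
    have od: "(v = 0) = False" if "odd v" for v :: nat using that by (cases v) auto
    obtain m where m: "C2 = 2 * m" using cols by (auto elim: evenE)
    have split: "(\<Sum>v<V. cell_total (ty r v) (v = 0)) = (\<Sum>v<C2. cell_total (ty r v) (v = 0)) + cell_total (ty r C2) False"
    proof -
      have "(\<Sum>v<V. cell_total (ty r v) (v = 0)) = (\<Sum>v<Suc C2. cell_total (ty r v) (v = 0))"
        by (rule sum.mono_neutral_right) (use cols in \<open>auto simp: ty_def cell_total\<close>)
      then show ?thesis using cols by simp
    qed
    consider "r = r0" | "r = r1" | "r0 < r" "r < r1" | "r < r0 \<or> r1 < r" by linarith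
    then show "(\<Sum>v<V. cell_total (ty r v) (v = 0)) = (if r = r0 then 9 * C2 else 0) +
        (if r = r1 then 7 * C2 else 0) + (if r0 < r \<and> r < r1 then 188 * C2 + 4 else 0)"
    proof cases
      case 1
      have "(\<Sum>v<C2. cell_total (ty r v) (v = 0)) = (\<Sum>v<C2. if even v then 10 else 8)"
        using 1 by (intro sum.cong refl) (auto simp: ty_def cell_total cb od)
      moreover have "cell_total (ty r C2) False = 0" using 1 by (simp add: ty_def cell_total)
      ultimately show ?thesis unfolding split using 1 rows sum_pairs[of 10 8 m] m by simp
    next
      case 2
      have "(\<Sum>v<C2. cell_total (ty r v) (v = 0)) = (\<Sum>v<C2. if even v then 8 else 6)"
        using 2 rows by (intro sum.cong refl) (auto simp: ty_def cell_total cb od)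
      moreover have "cell_total (ty r C2) False = 0" using 2 by (simp add: ty_def cell_total)
      ultimately show ?thesis unfolding split using 2 rows sum_pairs[of 8 6 m] m by simp
    next
      case 3
      have "(\<Sum>v<C2. cell_total (ty r v) (v = 0)) = (\<Sum>v<C2. if v = 0 then 186 else 188)"
        using 3 by (intro sum.cong refl) (auto simp: ty_def cell_total cb od)
      also have "\<dots> + 2 = (\<Sum>v<C2. 188)"
      proof -
        obtain c where c: "C2 = Suc c" using cols by (cases C2) auto
        show ?thesis unfolding c by (simp only: sum.lessThan_Suc_shift) simp
      qed
      finally show ?thesis unfolding split using 3 by (simp add: ty_def cell_total)
    next
      case 4
      then have "ty r v = Empty" for v using rows by (auto simp: ty_def)
      moreover have "cell_total Empty b = 0" for b by (cases b) (simp_all add: cell_total)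
      ultimately show ?thesis using 4 rows by auto
    qed
  qed
  also have "\<dots> = 9 * C2 + 7 * C2 + (r1 - r0 - 1) * (188 * C2 + 4)"
  proof -
    have "(\<Sum>r<R. if r0 < r \<and> r < r1 then 188 * C2 + 4 else 0) = (\<Sum>r\<in>{r0<..<r1}. 188 * C2 + 4)"
      by (rule sum.mono_neutral_cong_right) (use rows in auto)
    also have "\<dots> = (r1 - r0 - 1) * (188 * C2 + 4)" by simp
    finally show ?thesis using rows by (simp add: sum.distrib)
  qed
  also have "\<dots> = 4 * ((r1 - r0 - 1) * (47 * C2 + 1) + 4 * C2)" by (simp add: algebra_simps)
  finally show ?thesis .
qed

end

section \<open>From solutions to labellings with a potential\<close>

locale solved_grid = grid +
  fixes x :: "nat \<Rightarrow> nat"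
  assumes x_le: "v < C2 \<Longrightarrow> x v \<le> 1" and x_twin: "2 * i < C2 \<Longrightarrow> x (2 * i) = x (2 * i + 1)"
    and x_sum: "r0 < r \<Longrightarrow> r < r1 \<Longrightarrow> row_sum x r C2 = 1"
begin

definition bit :: "nat \<Rightarrow> nat" where "bit v = (if v < C2 then x v else 0)"
text \<open>The bit that enters a cell with the row wire; together with the column bit it selects
  the table of labels.\<close>

definition carry :: "nat \<Rightarrow> nat \<Rightarrow> nat" where
  "carry r v = (if r0 < r \<and> r < r1 \<and> v < C2 then row_sum x r v else 0)"
definition cells :: "nat \<Rightarrow> nat \<Rightarrow> code list" where "cells r v = cell_codes (ty r v) (carry r v) (bit v)"

text \<open>The labels intended at the left boundaries, and in \<open>ni\<close> those at the upper
  boundaries. They serve as an interface: each cell is verified against them separately, and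
  \<open>west_lab\<close> and \<open>north_lab\<close> show that the glued labelling has
  them.\<close>

definition wi :: "nat \<Rightarrow> nat \<Rightarrow> nat list" where
  "wi r v = (if v = 0 then no_row else if r0 < r \<and> r < r1 then if v \<le> C2 then row_labels (row_sum x r v) else no_row
     else if r = r0 \<and> odd v \<and> v < C2 then no_row[16 := 1 + x v]
     else if r = r1 \<and> odd v \<and> v < C2 then no_row[0 := 1 + x v] else no_row)"
definition ni :: "nat \<Rightarrow> nat \<Rightarrow> nat list" where
  "ni r v = (if r0 < r \<and> r \<le> r1 \<and> v < C2 then column_label (x v) else no_column)"

lemma bit_le: "bit v \<le> 1"
  using x_le by (simp add: bit_def)

lemma cell_ok_cells: "cell_ok (ty r v) (v = 0) (wi r v) (ni r v) (wi r (Suc v)) (ni (Suc r) v) (carry r v) (bit v)"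
proof -
  have x01: "x v = 0 \<or> x v = 1" if "v < C2" using x_le[OF that] by linarith
  consider (mid) "r0 < r" "r < r1" "v < C2" | (final) "r0 < r" "r < r1" "v = C2" | (rest) "r0 < r" "r < r1" "C2 < v"
    | (top) "r = r0" "v < C2" | (bottom) "r = r1" "v < C2"
    | (outer) "r < r0 \<or> r1 < r \<or> (r = r0 \<or> r = r1) \<and> C2 \<le> v" by linarith
  then show ?thesis
  proof cases
    case mid
    \<comment> \<open>Partial sums are bounded by the full sum 1, which excludes the forbidden
      combination in an \<open>Add\<close> cell.\<close>
    have s: "row_sum x r (Suc v) \<le> 1" using row_sum_mono[of "Suc v" C2 x r] x_sum mid by simp
    then have s01: "row_sum x r v = 0 \<or> row_sum x r v = 1" by auto
    have n: "ni r v = column_label (x v)" "ni (Suc r) v = column_label (x v)" using mid by (simp_all add: ni_def)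
    have w: "wi r (Suc v) = row_labels (row_sum x r (Suc v))" using mid by (simp add: wi_def)
    have cb: "carry r v = row_sum x r v" "bit v = x v" using mid by (simp_all add: carry_def bit_def)
    have t: "ty r v = (if A r v then Add else Pass)" using mid by (simp add: ty_def)
    show ?thesis
    proof (cases "v = 0")
      case True
      have "wi r v = no_row" using True by (simp add: wi_def)
      then show ?thesis unfolding n w cb t using x01[OF mid(3)] True ok_Pass(5,6) ok_Add(4,5)
        by (cases "A r 0"; elim disjE; simp)
    next
      case False
      have "wi r v = row_labels (row_sum x r v)" using False mid by (simp add: wi_def)
      then show ?thesis unfolding n w cb t using x01[OF mid(3)] s01 s False ok_Pass(1-4) ok_Add(1-3)
        by (cases "A r v"; elim disjE; simp)
    qed
  next
    case final
    have "wi r v = row_labels 1" "wi r (Suc v) = no_row" "ni r v = no_column" "ni (Suc r) v = no_column"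
      using final x_sum[of r] cols by (simp_all add: wi_def ni_def)
    moreover have "carry r v = 0" "bit v = 0" "ty r v = Term" "(v = 0) = False"
      using final cols by (simp_all add: carry_def bit_def ty_def)
    ultimately show ?thesis using ok_Term by (simp only:)
  next
    case rest
    have "wi r v = no_row" "wi r (Suc v) = no_row" "ni r v = no_column" "ni (Suc r) v = no_column"
      using rest cols by (simp_all add: wi_def ni_def)
    moreover have "carry r v = 0" "bit v = 0" "ty r v = Empty" "(v = 0) = False"
      using rest cols by (simp_all add: carry_def bit_def ty_def)
    ultimately show ?thesis using ok_Empty(1) by (simp only:)
  next
    case top
    have n: "ni r v = no_column" "ni (Suc r) v = column_label (x v)" using top rows by (simp_all add: ni_def)
    have cb: "carry r v = 0" "bit v = x v" using top by (simp_all add: carry_def bit_def)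
    show ?thesis
    proof (cases "even v")
      case True
      then obtain i where i: "v = 2 * i" by (rule evenE)
      have "Suc v < C2" using top True cols by presburger
      moreover have "x (Suc v) = x v" using x_twin[of i] top i by simp
      ultimately have w: "wi r v = no_row" "wi r (Suc v) = no_row[16 := 1 + x v]"
        using top True rows by (simp_all add: wi_def)
      have t: "ty r v = CupL" using top True by (simp add: ty_def)
      show ?thesis unfolding n cb w t using x01[OF top(2)] ok_Cup(1-4)
        by (cases "v = 0"; elim disjE; simp add: numeral_2_eq_2)
    next
      case False
      have w: "wi r v = no_row[16 := 1 + x v]" "wi r (Suc v) = no_row"
        using top False rows odd_pos[OF False] by (auto simp: wi_def)
      have t: "ty r v = CupR" "(v = 0) = False" using top False odd_pos[OF False] by (auto simp: ty_def)
      show ?thesis unfolding n cb w t using x01[OF top(2)] ok_Cup(5,6) by (elim disjE; simp add: numeral_2_eq_2)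
    qed
  next
    case bottom
    have n: "ni r v = column_label (x v)" "ni (Suc r) v = no_column" using bottom rows by (simp_all add: ni_def)
    have cb: "carry r v = 0" "bit v = x v" using bottom by (simp_all add: carry_def bit_def)
    show ?thesis
    proof (cases "even v")
      case True
      then obtain i where i: "v = 2 * i" by (rule evenE)
      have "Suc v < C2" using bottom True cols by presburger
      moreover have "x (Suc v) = x v" using x_twin[of i] bottom i by simp
      ultimately have w: "wi r v = no_row" "wi r (Suc v) = no_row[0 := 1 + x v]"
        using bottom True rows by (simp_all add: wi_def)
      have t: "ty r v = CapL" using bottom True rows by (simp add: ty_def)
      show ?thesis unfolding n cb w t using x01[OF bottom(2)] ok_Cap(1-4)
        by (cases "v = 0"; elim disjE; simp add: numeral_2_eq_2)
    next
      case False
      have w: "wi r v = no_row[0 := 1 + x v]" "wi r (Suc v) = no_row"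
        using bottom False rows odd_pos[OF False] by (auto simp: wi_def)
      have t: "ty r v = CapR" "(v = 0) = False" using bottom False rows odd_pos[OF False] by (auto simp: ty_def)
      show ?thesis unfolding n cb w t using x01[OF bottom(2)] ok_Cap(5,6) by (elim disjE; simp add: numeral_2_eq_2)
    qed
  next
    case outer
    have "wi r v = no_row" "wi r (Suc v) = no_row" "ni r v = no_column" "ni (Suc r) v = no_column"
      using outer rows by (auto simp: wi_def ni_def)
    moreover have "carry r v = 0" "ty r v = Empty"
      using outer rows by (auto simp: carry_def ty_def)
    moreover have "cell_codes Empty 0 (bit v) = cell_codes Empty 0 0" by (simp add: cell_codes_def)
    then have "cell_ok Empty f ws us es ds 0 (bit v) = cell_ok Empty f ws us es ds 0 0" for f ws us es ds
      by (simp only: cell_ok_def)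
    ultimately show ?thesis using ok_Empty by (cases "v = 0") (simp_all only: refl simp_thms)
  qed
qed

definition lab :: "ledge \<Rightarrow> nat" where
  "lab e = (case e of (X, Y, d) \<Rightarrow> if X < 6 * V \<and> Y < 18 * R then
     (if d then code_down else code_right) (cells (Y div 18) (X div 6) ! (6 * (Y mod 18) + X mod 6)) else 0)"

text \<open>The summand 1000 per column of cells exceeds every potential, so a step across a left
  boundary always descends.\<close>

definition height :: "point \<Rightarrow> nat" where
  "height p = (case p of (X, Y) \<Rightarrow> X div 6 * 1000 + code_pot (cells (Y div 18) (X div 6) ! (6 * (Y mod 18) + X mod 6)))"

lemma lab_cell:
  assumes "r < R" "v < V" "j < 108"
  shows "lab (6 * v + j mod 6, 18 * r + j div 6, d) = (if d then code_down else code_right) (cells r v ! j)"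
    "height (6 * v + j mod 6, 18 * r + j div 6) = v * 1000 + code_pot (cells r v ! j)"
proof -
  have m: "j mod 6 < 6" "j div 6 < 18" using assms by simp_all
  have "6 * v + j mod 6 < 6 * V" "18 * r + j div 6 < 18 * R" using assms m by linarith+
  moreover have "(6 * v + j mod 6) div 6 = v" "(18 * r + j div 6) div 18 = r"
    "6 * ((18 * r + j div 6) mod 18) + (6 * v + j mod 6) mod 6 = j" using m by simp_all
  ultimately show "lab (6 * v + j mod 6, 18 * r + j div 6, d) = (if d then code_down else code_right) (cells r v ! j)"
    "height (6 * v + j mod 6, 18 * r + j div 6) = v * 1000 + code_pot (cells r v ! j)"
    by (simp_all only: lab_def height_def case_prod_conv simp_thms if_True)
qed

lemma west_lab:
  assumes "r < R" "v < V" shows "west lab r v = wi r v"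
proof (cases v)
  case 0
  then show ?thesis by (simp add: west_def wi_def no_row_def map_replicate_const)
next
  case (Suc u)
  have "wi r (Suc u) = map (\<lambda>y. code_right (cells r u ! (6 * y + 5))) [0..<18]"
    using cell_ok_cells[of r u] by (simp add: cell_ok_def Let_def cells_def)
  moreover have "lab (6 * v - 1, 18 * r + y, False) = code_right (cells r u ! (6 * y + 5))" if "y < 18" for y
  proof -
    have e: "6 * v - 1 = 6 * u + 5" and m: "(6 * y + 5) mod 6 = 5" "(6 * y + 5) div 6 = y" using Suc by simp_all
    have "r < R" "u < V" "6 * y + 5 < 108" using assms Suc that by simp_all
    from lab_cell(1)[OF this, of False] show ?thesis unfolding e m if_False .
  qed
  ultimately show ?thesis unfolding west_def Suc by simp
qed

lemma north_lab:
  assumes "r < R" "v < V" shows "north lab r v = ni r v"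
proof (cases r)
  case 0
  then show ?thesis by (simp add: north_def ni_def no_column_def map_replicate_const)
next
  case (Suc q)
  have "ni (Suc q) v = map (\<lambda>i. code_down (cells q v ! (102 + i))) [0..<6]"
    using cell_ok_cells[of q v] by (simp add: cell_ok_def Let_def cells_def)
  moreover have "lab (6 * v + i, 18 * r - 1, True) = code_down (cells q v ! (102 + i))" if "i < 6" for i
  proof -
    have e: "18 * r - 1 = 18 * q + 17" using Suc by simp
    note m = steps_6(8,9)[OF that]
    have "q < R" "v < V" "102 + i < 108" using assms Suc that by simp_all
    from lab_cell(1)[OF this, of True] show ?thesis unfolding e m if_True .
  qed
  ultimately show ?thesis unfolding north_def Suc by simp
qed

lemma plabels_nth:
  assumes "r < R" "v < V" "j < 108"
  shows "plabels lab (6 * v + j mod 6) (18 * r + j div 6) ! 0 =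
      (if j mod 6 = 0 then wi r v ! (j div 6) else code_right (cells r v ! (j - 1)))"
    "plabels lab (6 * v + j mod 6) (18 * r + j div 6) ! 1 =
      (if j < 6 then ni r v ! j else code_down (cells r v ! (j - 6)))"
proof -
  have j: "j - 1 < 108" "j - 6 < 108" using assms(3) by simp_all
  have nth1: "[a, b, c, d] ! 1 = b" for a b c d :: nat by simp
  show "plabels lab (6 * v + j mod 6) (18 * r + j div 6) ! 0 =
      (if j mod 6 = 0 then wi r v ! (j div 6) else code_right (cells r v ! (j - 1)))"
    unfolding plabels_cell[OF assms(3)] west_lab[OF assms(1,2)] nth_Cons_0 lab_cell(1)[OF assms(1,2) j(1)] if_False
    by (rule refl)
  show "plabels lab (6 * v + j mod 6) (18 * r + j div 6) ! 1 =
      (if j < 6 then ni r v ! j else code_down (cells r v ! (j - 6)))"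
    unfolding plabels_cell[OF assms(3)] north_lab[OF assms(1,2)] nth1 lab_cell(1)[OF assms(1,2) j(2)] if_True
    by (rule refl)
qed

lemma point_ok_cell:
  assumes "r < R" "v < V" "j < 108"
  shows "point_ok j (card (incident E (6 * v + j mod 6, 18 * r + j div 6))) (cell_mask (ty r v) ! j)
    (plabels lab (6 * v + j mod 6) (18 * r + j div 6) ! 0) (code_pot (if j = 0 then (0, 0, 0) else cells r v ! (j - 1)))
    (plabels lab (6 * v + j mod 6) (18 * r + j div 6) ! 1) (code_pot (if j < 6 then (0, 0, 0) else cells r v ! (j - 6)))
    (cells r v ! j) (if j < 107 then cells r v ! (j + 1) else (0, 0, 0)) (if j < 102 then cells r v ! (j + 6) else (0, 0, 0))"
  unfolding plabels_nth[OF assms] degree_cell[OF assms] unfolding cells_def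
  by (rule cell_okD[OF cell_ok_cells assms(3)])

lemma code_bounds_cell:
  assumes "j < 108"
  shows "code_right (cells r v ! j) \<le> 2" "code_down (cells r v ! j) \<le> 2" "code_pot (cells r v ! j) < 1000"
proof -
  have "cells r v ! j \<in> set (cell_codes (ty r v) (carry r v) (bit v))"
    unfolding cells_def using assms by (intro nth_mem) simp
  from code_bounds[OF bit_le this] show "code_right (cells r v ! j) \<le> 2" "code_down (cells r v ! j) \<le> 2"
    "code_pot (cells r v ! j) < 1000" by blast+
qed

lemma pot_low:
  assumes "ty r v = Pass \<or> ty r v = Add" "j < 108"
  shows "code_pot (cells r v ! j) < 100"
proof -
  have "list_all (\<lambda>a. code_pot a < 100) (cells r v)"
    using assms(1) low_potentials unfolding cells_def by (elim disjE) (simp_all only:)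
  moreover have "length (cells r v) = 108" by (simp add: cells_def)
  ultimately show ?thesis using assms(2) unfolding list_all_length by (simp only:)
qed

lemma lab_in_E: "lab e \<noteq> 0 \<Longrightarrow> e \<in> E"
proof -
  assume nz: "lab e \<noteq> 0"
  obtain X Y d where e: "e = (X, Y, d)" by (cases e)
  have "X < 6 * V" "Y < 18 * R" using nz by (simp_all add: e lab_def split: if_splits)
  then obtain r v j where rvj: "r < R" "v < V" "j < 108" "X = 6 * v + j mod 6" "Y = 18 * r + j div 6"
    by (rule point_coordinates)
  have "odd (cell_mask (ty r v) ! j) \<or> code_right (cells r v ! j) = 0"
    using point_ok_cell[OF rvj(1-3)] unfolding point_ok_def by (elim conjE)
  moreover have "2 \<le> cell_mask (ty r v) ! j \<or> code_down (cells r v ! j) = 0"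
    using point_ok_cell[OF rvj(1-3)] unfolding point_ok_def by (elim conjE)
  ultimately have "edge_on (ty r v) j d"
    using nz lab_cell(1)[OF rvj(1-3), of d] unfolding e rvj(4,5) by (cases d) (auto simp: edge_on_def)
  then show "e \<in> E" using E_cell[OF rvj(1,2), of "j div 6" "j mod 6" d] rvj(3) unfolding e rvj(4,5) by simp
qed

lemma labelling_lab: "labelling E lab"
proof (rule iffD2[OF labelling_vrule])
  show "lab e \<noteq> 0 \<Longrightarrow> e \<in> E" for e by (rule lab_in_E)
  show "(\<forall>e. lab e \<le> 2) \<and> (\<forall>X Y. vrule (card (incident E (X, Y))) ((X + Y) mod 2) (plabels lab X Y))"
  proof (intro conjI allI)
  fix e :: ledge
  obtain X Y d where e: "e = (X, Y, d)" by (cases e)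
  have "6 * (Y mod 18) + X mod 6 < 108" using mod_less_divisor[of 18 Y] mod_less_divisor[of 6 X] by linarith
  then show "lab e \<le> 2" using code_bounds_cell(1,2) by (simp add: e lab_def)
next
  fix X Y
  show "vrule (card (incident E (X, Y))) ((X + Y) mod 2) (plabels lab X Y)"
  proof (cases "X < 6 * V \<and> Y < 18 * R")
    case True
    then obtain r v j where rvj: "r < R" "v < V" "j < 108" "X = 6 * v + j mod 6" "Y = 18 * r + j div 6"
      using point_coordinates by metis
    have p: "plabels lab X Y = [plabels lab X Y ! 0, plabels lab X Y ! 1, code_right (cells r v ! j), code_down (cells r v ! j)]"
      using lab_cell(1)[OF rvj(1-3)] by (simp add: plabels_def rvj(4,5))
    show ?thesis
      using point_ok_cell[OF rvj(1-3)] colour_cell[of v j r] p unfolding point_ok_def rvj(4,5) by metis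
  next
    case False
    then have out: "incident E (X, Y) = {}" by (intro inc_outside) auto
    have "lab e = 0" if "e \<in> set (incl X Y)" for e
    proof (rule ccontr)
      assume "lab e \<noteq> 0"
      from lab_in_E[OF this] have "e \<in> incident E (X, Y)" using that unfolding incident_def set_incl by simp
      then show False unfolding out by simp
    qed
    then have "filter (\<lambda>e. lab e \<noteq> 0) (incl X Y) = []" by (simp add: filter_empty_conv)
    then have "filter (\<lambda>a. a \<noteq> 0) (plabels lab X Y) = []" unfolding filter_plabels by simp
    then show ?thesis unfolding vrule_def out by simp
  qed
  qed
qed

text \<open>The four alternatives of \<open>point_ok\<close> give the edge to follow. Inside a cell
  the potentials decide, at the left boundary the column of cells, and at the upper and lower
  boundary the gap between cups or caps and the crossbar.\<close>

lemma descending_lab: "descending E lab height"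
  unfolding descending_def
proof (intro allI impI)
  fix p assume c: "2 \<le> card (incident E p)"
  obtain X Y where p: "p = (X, Y)" by (cases p)
  have "X < 6 * V \<and> Y < 18 * R" using c inc_outside[of X Y] unfolding p by fastforce
  then obtain r v j where rvj: "r < R" "v < V" "j < 108" "X = 6 * v + j mod 6" "Y = 18 * r + j div 6"
    using point_coordinates by metis
  let ?c = "cells r v"
  have hp: "height p = v * 1000 + code_pot (?c ! j)" using lab_cell(2)[OF rvj(1-3)] by (simp add: p rvj)
  have edge: "\<exists>e\<in>incident E p. lab e \<noteq> 0 \<and> (\<exists>q\<in>ends e. height q < height p)"
    if "lab e \<noteq> 0" "p \<in> ends e" "q \<in> ends e" "height q < height p" for e q
    using that lab_in_E[OF that(1)] unfolding incident_def by blast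
  have nip: "ty r v \<in> {Pass, Add} \<Longrightarrow> code_pot (?c ! j) < 100" using pot_low[OF _ rvj(3)] by auto
  have "plabels lab X Y ! 0 \<noteq> 0 \<and> (j mod 6 = 0 \<or> code_pot (if j = 0 then (0, 0, 0) else ?c ! (j - 1)) < code_pot (?c ! j)) \<or>
     plabels lab X Y ! 1 \<noteq> 0 \<and> (if j < 6 then 100 \<le> code_pot (?c ! j)
       else code_pot (if j < 6 then (0, 0, 0) else ?c ! (j - 6)) < code_pot (?c ! j)) \<or>
     code_right (?c ! j) \<noteq> 0 \<and> j mod 6 \<noteq> 5 \<and> code_pot (if j < 107 then ?c ! (j + 1) else (0, 0, 0)) < code_pot (?c ! j) \<or>
     code_down (?c ! j) \<noteq> 0 \<and> (if 102 \<le> j then 100 \<le> code_pot (?c ! j)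
       else code_pot (if j < 102 then ?c ! (j + 6) else (0, 0, 0)) < code_pot (?c ! j))"
  proof -
    have c': "2 \<le> card (incident E (6 * v + j mod 6, 18 * r + j div 6))" using c unfolding p rvj(4,5) .
    note conjunct2[OF conjunct2[OF conjunct2[OF conjunct2[OF point_ok_cell[OF rvj(1-3), unfolded point_ok_def]]]]]
    from mp[OF this c'] show ?thesis unfolding rvj(4,5) .
  qed
  then show "\<exists>e\<in>incident E p. lab e \<noteq> 0 \<and> (\<exists>q\<in>ends e. height q < height p)"
  proof (elim disjE)
    assume a: "plabels lab X Y ! 0 \<noteq> 0 \<and> (j mod 6 = 0 \<or> code_pot (if j = 0 then (0, 0, 0) else ?c ! (j - 1)) < code_pot (?c ! j))"
    then have X: "X \<noteq> 0" "lab (X - 1, Y, False) \<noteq> 0" by (auto simp: plabels_def split: if_splits)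
    have "height (X - 1, Y) < height p"
    proof (cases "j mod 6 = 0")
      case True
      then have v: "v \<noteq> 0" using X rvj(4) by simp
      have "j = 6 * (j div 6)" "j div 6 < 18" using True rvj(3) mult_div_mod_eq[of 6 j] by simp_all
      then have "X - 1 = 6 * (v - 1) + (j + 5) mod 6" "Y = 18 * r + (j + 5) div 6" "j + 5 < 108"
        unfolding steps_6(1,2)[OF True] using True v rvj(4,5) by linarith+
      then have "height (X - 1, Y) = (v - 1) * 1000 + code_pot (cells r (v - 1) ! (j + 5))"
        using lab_cell(2)[of r "v - 1" "j + 5"] rvj(1,2) by simp
      moreover have "code_pot (cells r (v - 1) ! (j + 5)) < 1000" by (rule code_bounds_cell) fact
      ultimately show ?thesis using hp v by (cases v) auto
    next
      case False
      have "X - 1 = 6 * v + (j - 1) mod 6" "Y = 18 * r + (j - 1) div 6"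
        unfolding steps_6(3,4)[OF False] using False rvj(4,5) by linarith+
      moreover have "j \<noteq> 0" using False by (cases j) simp_all
      ultimately have "height (X - 1, Y) = v * 1000 + code_pot (?c ! (j - 1))"
        using lab_cell(2)[OF rvj(1,2), of "j - 1"] rvj(3) by simp
      then show ?thesis using hp a False \<open>j \<noteq> 0\<close> by auto
    qed
    moreover have "p \<in> ends (X - 1, Y, False)" "(X - 1, Y) \<in> ends (X - 1, Y, False)"
      using X by (simp_all add: p ends_def near_def far_def)
    ultimately show ?thesis using edge X(2) by blast
  next
    assume a: "plabels lab X Y ! 1 \<noteq> 0 \<and> (if j < 6 then 100 \<le> code_pot (?c ! j)
       else code_pot (if j < 6 then (0, 0, 0) else ?c ! (j - 6)) < code_pot (?c ! j))"
    then have Y: "Y \<noteq> 0" "lab (X, Y - 1, True) \<noteq> 0" by (auto simp: plabels_def split: if_splits)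
    have "height (X, Y - 1) < height p"
    proof (cases "j < 6")
      case True
      have jx: "j mod 6 = j" "j div 6 = 0" using True by simp_all
      then have r: "r \<noteq> 0" using Y(1) rvj(5) by simp
      have "plabels lab X Y ! 1 = ni r v ! j"
        unfolding rvj(4,5) plabels_nth[OF rvj(1-3)] using True by (simp only: if_True)
      then have "ni r v ! j \<noteq> 0" using a by simp
      then have in_rows: "r0 < r" "r \<le> r1" "v < C2"
        using True by (auto simp: ni_def no_column_def split: if_splits)
      have pot: "100 \<le> code_pot (?c ! j)" using a True by simp
      \<comment> \<open>A potential of at least 100 does not occur in \<open>Pass\<close> and
        \<open>Add\<close> cells, so the cell is a cap, and the cell above it lies in the
        crossbar.\<close>
      have "\<not> r < r1"
      proof
        assume "r < r1"
        then have "ty r v \<in> {Pass, Add}" using in_rows by (simp add: ty_def)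
        then show False using nip pot by simp
      qed
      then have "ty (r - 1) v = Pass \<or> ty (r - 1) v = Add" using in_rows rows by (auto simp: ty_def)
      then have low: "code_pot (cells (r - 1) v ! (j + 102)) < 100" by (rule pot_low) (use True in simp)
      have "X = 6 * v + (j + 102) mod 6" "Y - 1 = 18 * (r - 1) + (j + 102) div 6"
        unfolding add.commute[of j 102] steps_6(8,9)[OF True] using jx r rvj(4,5) by linarith+
      then have "height (X, Y - 1) = v * 1000 + code_pot (cells (r - 1) v ! (j + 102))"
        using lab_cell(2)[of "r - 1" v "j + 102"] rvj(1,2) True by simp
      then show ?thesis using hp low pot by simp
    next
      case False
      have j6: "6 \<le> j" using False by simp
      have "X = 6 * v + (j - 6) mod 6" "Y - 1 = 18 * r + (j - 6) div 6"
        unfolding steps_6(5,6)[OF j6] using steps_6(7)[OF j6] rvj(4,5) by linarith+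
      then have "height (X, Y - 1) = v * 1000 + code_pot (?c ! (j - 6))"
        using lab_cell(2)[OF rvj(1,2), of "j - 6"] rvj(3) by simp
      then show ?thesis using hp a False by simp
    qed
    moreover have "p \<in> ends (X, Y - 1, True)" "(X, Y - 1) \<in> ends (X, Y - 1, True)"
      using Y by (simp_all add: p ends_def near_def far_def)
    ultimately show ?thesis using edge Y(2) by blast
  next
    assume a: "code_right (?c ! j) \<noteq> 0 \<and> j mod 6 \<noteq> 5 \<and> code_pot (if j < 107 then ?c ! (j + 1) else (0, 0, 0)) < code_pot (?c ! j)"
    have "j \<noteq> 107"
    proof
      assume "j = 107"
      then show False using a by simp
    qed
    then have j: "j + 1 < 108" using rvj(3) by simp
    have j5: "j mod 6 \<noteq> 5" using a by blast
    have "Suc X = 6 * v + (j + 1) mod 6" "Y = 18 * r + (j + 1) div 6"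
      unfolding steps_6(10,11)[OF j5] using rvj(4,5) by linarith+
    then have "height (Suc X, Y) = v * 1000 + code_pot (?c ! (j + 1))"
      using lab_cell(2)[OF rvj(1,2) j] by simp
    then have "height (Suc X, Y) < height p" using hp a j by simp
    moreover have "p \<in> ends (X, Y, False)" "(Suc X, Y) \<in> ends (X, Y, False)"
      by (simp_all add: p ends_def near_def far_def)
    moreover have "lab (X, Y, False) \<noteq> 0" using lab_cell(1)[OF rvj(1-3), of False] a by (simp add: rvj(4,5))
    ultimately show ?thesis using edge by blast
  next
    assume a: "code_down (?c ! j) \<noteq> 0 \<and> (if 102 \<le> j then 100 \<le> code_pot (?c ! j)
       else code_pot (if j < 102 then ?c ! (j + 6) else (0, 0, 0)) < code_pot (?c ! j))"
    have "height (X, Suc Y) < height p"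
    proof (cases "102 \<le> j")
      case True
      have "ni (Suc r) v = map (\<lambda>i. code_down (?c ! (102 + i))) [0..<6]"
        using cell_ok_cells[of r v] by (simp add: cell_ok_def Let_def cells_def)
      moreover have "j - 102 < 6" and j102: "102 + (j - 102) = j" using True rvj(3) by linarith+
      then have "map (\<lambda>i. code_down (?c ! (102 + i))) [0..<6] ! (j - 102) = code_down (?c ! (102 + (j - 102)))"
        using nth_map_upt[of "j - 102" 6 0 "\<lambda>i. code_down (?c ! (102 + i))"] by (simp only: diff_zero add_0)
      ultimately have "ni (Suc r) v ! (j - 102) = code_down (?c ! j)" by (simp only: j102)
      then have "ni (Suc r) v ! (j - 102) \<noteq> 0" using a by simp
      then have in_rows: "r0 \<le> r" "r < r1" "v < C2"
        using True rvj(3) by (auto simp: ni_def no_column_def split: if_splits)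
      have pot: "100 \<le> code_pot (?c ! j)" using a True by simp
      have "\<not> r0 < r"
      proof
        assume "r0 < r"
        then have "ty r v \<in> {Pass, Add}" using in_rows by (simp add: ty_def)
        then show False using nip pot by simp
      qed
      then have rr: "r = r0" using in_rows by linarith
      have "ty (Suc r) v = Pass \<or> ty (Suc r) v = Add" unfolding rr ty_def using in_rows(3) rows by simp
      then have low: "code_pot (cells (Suc r) v ! (j - 102)) < 100" by (rule pot_low) (use rvj(3) in simp)
      have j6: "(j - 102) mod 6 = j - 102" "(j - 102) div 6 = 0" using True rvj(3) by simp_all
      have "X = 6 * v + (j - 102) mod 6" "Suc Y = 18 * Suc r + (j - 102) div 6"
        unfolding rvj(4,5) j6 steps_6(12,13)[OF True rvj(3)] by simp_all
      then have "height (X, Suc Y) = v * 1000 + code_pot (cells (Suc r) v ! (j - 102))"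
        using lab_cell(2)[of "Suc r" v "j - 102"] rvj(2,3) in_rows rows by simp
      then show ?thesis using hp low pot by simp
    next
      case False
      have "X = 6 * v + (j + 6) mod 6" "Suc Y = 18 * r + (j + 6) div 6" using rvj(4,5) by simp_all
      then have "height (X, Suc Y) = v * 1000 + code_pot (?c ! (j + 6))"
        using lab_cell(2)[OF rvj(1,2), of "j + 6"] False by simp
      then show ?thesis using hp a False by simp
    qed
    moreover have "p \<in> ends (X, Y, True)" "(X, Suc Y) \<in> ends (X, Y, True)"
      by (simp_all add: p ends_def near_def far_def)
    moreover have "lab (X, Y, True) \<noteq> 0" using lab_cell(1)[OF rvj(1-3), of True] a by (simp add: rvj(4,5))
    ultimately show ?thesis using edge by blast
  qed
qed

end

text \<open>The labelling obtained from a matching may contain closed paths, which does no harm as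
  the scans hold for all labellings. The labelling built from a solution is free of them by its
  potential.\<close>

theorem (in grid) matching_iff_solution:
  "(\<exists>M. acyclic_matching G M \<and> card M = (r1 - r0 - 1) * (47 * C2 + 1) + 4 * C2) \<longleftrightarrow>
   (\<exists>x. (\<forall>v<C2. x v \<le> 1) \<and> (\<forall>i. 2 * i < C2 \<longrightarrow> x (2 * i) = x (2 * i + 1)) \<and>
     (\<forall>r. r0 < r \<longrightarrow> r < r1 \<longrightarrow> row_sum x r C2 = 1))"
  (is "?L \<longleftrightarrow> ?R")
proof
  assume ?L
  then obtain M where M: "acyclic_matching G M" "card M = (r1 - r0 - 1) * (47 * C2 + 1) + 4 * C2" by blast
  obtain l where "labelling E l" using labelling_of_matching[OF M(1)] total M(2) by auto
  then show ?R by (rule solution_of_labelling)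
next
  assume ?R
  then obtain x where x: "\<forall>v<C2. x v \<le> 1" "\<forall>i. 2 * i < C2 \<longrightarrow> x (2 * i) = x (2 * i + 1)"
     "\<forall>r. r0 < r \<longrightarrow> r < r1 \<longrightarrow> row_sum x r C2 = 1" by blast
  interpret solved_grid R V r0 r1 C2 A x by unfold_locales (use x in blast)+
  show ?L by (rule matching_of_labelling[OF labelling_lab descending_lab total])
qed

section \<open>Programs with nested loops and decidable conditions\<close>

text \<open>The language has no truth values, only branching on zero. A condition counts as
  decidable if a program can branch on it between any two given programs; in this form the Boolean
  connectives are nested branchings.\<close>

definition decides :: "nat \<Rightarrow> (bool list \<Rightarrow> (nat \<Rightarrow> nat) \<Rightarrow> bool) \<Rightarrow> bool" where
  "decides f P \<longleftrightarrow> (\<forall>s t. wf_stm s f \<longrightarrow> wf_stm t f \<longrightarrow> (\<exists>u. wf_stm u f \<and>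
     (\<forall>w \<rho>. prog_out w u f \<rho> = (if P w \<rho> then prog_out w s f \<rho> else prog_out w t f \<rho>))))"

lemma decD:
  assumes "decides f P" "wf_stm s f" "wf_stm t f"
  obtains u where "wf_stm u f" "\<And>w \<rho>. prog_out w u f \<rho> = (if P w \<rho> then prog_out w s f \<rho> else prog_out w t f \<rho>)"
  using assms unfolding decides_def by blast

lemma dec_zero: "var_bound e \<le> f \<Longrightarrow> decides f (\<lambda>w \<rho>. val w \<rho> e = 0)"
  unfolding decides_def
proof (intro allI impI)
  fix s t assume "var_bound e \<le> f" "wf_stm s f" "wf_stm t f"
  then show "\<exists>u. wf_stm u f \<and> (\<forall>w \<rho>. prog_out w u f \<rho> = (if val w \<rho> e = 0 then prog_out w s f \<rho> else prog_out w t f \<rho>))"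
    by (intro exI[of _ "IfZ e s t"]) simp
qed

lemma dec_const: "decides f (\<lambda>w \<rho>. c)"
  unfolding decides_def by (cases c) auto

lemma dec_if:
  assumes P: "decides f P" and Q: "decides f Q" and Q': "decides f Q'"
  shows "decides f (\<lambda>w \<rho>. if P w \<rho> then Q w \<rho> else Q' w \<rho>)"
  unfolding decides_def
proof (intro allI impI)
  fix s t assume st: "wf_stm s f" "wf_stm t f"
  obtain a where a: "wf_stm a f" "\<And>w \<rho>. prog_out w a f \<rho> = (if Q w \<rho> then prog_out w s f \<rho> else prog_out w t f \<rho>)"
    using decD[OF Q st] by blast
  obtain b where b: "wf_stm b f" "\<And>w \<rho>. prog_out w b f \<rho> = (if Q' w \<rho> then prog_out w s f \<rho> else prog_out w t f \<rho>)"
    using decD[OF Q' st] by blast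
  obtain c where c: "wf_stm c f" "\<And>w \<rho>. prog_out w c f \<rho> = (if P w \<rho> then prog_out w a f \<rho> else prog_out w b f \<rho>)"
    using decD[OF P a(1) b(1)] by blast
  show "\<exists>u. wf_stm u f \<and> (\<forall>w \<rho>. prog_out w u f \<rho> =
      (if if P w \<rho> then Q w \<rho> else Q' w \<rho> then prog_out w s f \<rho> else prog_out w t f \<rho>))"
    by (intro exI[of _ c] conjI allI c(1)) (simp add: c(2) a(2) b(2))
qed

lemma dec_cong: "decides f P \<Longrightarrow> (\<And>w \<rho>. P w \<rho> = Q w \<rho>) \<Longrightarrow> decides f Q"
  unfolding decides_def by simp

lemma dec_not: "decides f P \<Longrightarrow> decides f (\<lambda>w \<rho>. \<not> P w \<rho>)"
  by (rule dec_cong[OF dec_if[where P = P, OF _ dec_const[of f False] dec_const[of f True]]]) auto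

lemma dec_conj: "decides f P \<Longrightarrow> decides f Q \<Longrightarrow> decides f (\<lambda>w \<rho>. P w \<rho> \<and> Q w \<rho>)"
  by (rule dec_cong[OF dec_if[where P = P and Q = Q, OF _ _ dec_const[of f False]]]) auto

lemma dec_disj: "decides f P \<Longrightarrow> decides f Q \<Longrightarrow> decides f (\<lambda>w \<rho>. P w \<rho> \<or> Q w \<rho>)"
  by (rule dec_cong[OF dec_if[where P = P and Q' = Q, OF _ dec_const[of f True]]]) auto

lemma dec_le: "var_bound a \<le> f \<Longrightarrow> var_bound b \<le> f \<Longrightarrow> decides f (\<lambda>w \<rho>. val w \<rho> a \<le> val w \<rho> b)"
  by (rule dec_cong[OF dec_zero[of "Minus a b"]]) auto

lemma dec_eq: "var_bound a \<le> f \<Longrightarrow> var_bound b \<le> f \<Longrightarrow> decides f (\<lambda>w \<rho>. val w \<rho> a = val w \<rho> b)"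
  by (rule dec_cong[OF dec_conj[OF dec_le[of a f b] dec_le[of b f a]]]) auto

lemma dec_bool:
  assumes "decides f P" "\<And>b. decides f (Q b)"
  shows "decides f (\<lambda>w \<rho>. Q (P w \<rho>) w \<rho>)"
  by (rule dec_cong[OF dec_if[OF assms(1) assms(2)[of True] assms(2)[of False]]]) auto

lemma dec_ex: "(\<And>c. decides f (Q c)) \<Longrightarrow> decides f (\<lambda>w \<rho>. \<exists>c<(n::nat). Q c w \<rho>)"
proof (induction n)
  case 0
  show ?case by (rule dec_cong[OF dec_const[of f False]]) simp
next
  case (Suc n)
  show ?case by (rule dec_cong[OF dec_disj[OF Suc.IH[OF Suc.prems] Suc.prems[of n]]]) (auto simp: less_Suc_eq)
qed

text \<open>A value below a constant is treated by cases, so an arbitrary predicate \<open>Q\<close>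
  may depend on it. This is how unspecified finite tables get into a program.\<close>

lemma dec_num:
  assumes "var_bound e \<le> f" "\<And>c. decides f (Q c)"
  shows "decides f (\<lambda>w \<rho>. val w \<rho> e < n \<and> Q (val w \<rho> e) w \<rho>)"
proof (rule dec_cong)
  show "decides f (\<lambda>w \<rho>. \<exists>c<n. val w \<rho> e = val w \<rho> (Num c) \<and> Q c w \<rho>)"
    by (intro dec_ex dec_conj dec_eq assms) simp
qed auto

section \<open>Nested loops as counting in mixed radix\<close>

primrec nest :: "expr list \<Rightarrow> stm \<Rightarrow> stm" where
  "nest [] s = s"
| "nest (e # es) s = For e (nest es s)"

text \<open>Horner evaluation of the loop indices, which occupy every second counter from
  \<open>f\<close> on; \<open>k\<close> is the value of the digits already read.\<close>

primrec digits :: "nat list \<Rightarrow> nat \<Rightarrow> (nat \<Rightarrow> nat) \<Rightarrow> nat \<Rightarrow> nat" where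
  "digits [] f \<rho> k = k"
| "digits (n # ns) f \<rho> k = digits ns (f + 2) \<rho> (k * n + \<rho> f)"

lemma wf_nest:
  "(\<And>e. e \<in> set es \<Longrightarrow> var_bound e = 0) \<Longrightarrow> wf_stm s (f + 2 * length es) \<Longrightarrow> wf_stm (nest es s) f"
  by (induction es arbitrary: f) (auto simp: add.assoc)

lemma upt_blocks: "concat (map (\<lambda>i. concat (map F [(a + i) * m..<(a + i + 1) * m])) [0..<n]) =
    concat (map F [a * m..<(a + n) * m])"
proof (induction n)
  case (Suc n)
  have "[a * m..<(a + Suc n) * m] = [a * m..<(a + n) * m] @ [(a + n) * m..<(a + n + 1) * m]"
  proof -
    have "(a + Suc n) * m = (a + n) * m + m" "(a + n + 1) * m = (a + n) * m + m" by (simp_all add: algebra_simps)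
    then show ?thesis by (simp only:) (rule upt_add_eq_append, simp)
  qed
  then show ?case using Suc by simp
qed simp

text \<open>Loops whose bounds are the radices run through all digit sequences in increasing order
  of the number represented. The start value \<open>k\<close> generalises the claim for the
  induction: outer loops fix the leading digits.\<close>

lemma out_nest:
  assumes "\<And>e. e \<in> set es \<Longrightarrow> var_bound e = 0"
    and "\<And>\<rho>'. (\<And>i. i < f \<Longrightarrow> \<rho>' i = \<rho> i) \<Longrightarrow>
      (\<And>i. i < length es \<Longrightarrow> \<rho>' (f + 2 * i) < val w (\<lambda>_. 0) (es ! i)) \<Longrightarrow>
      prog_out w s (f + 2 * length es) \<rho>' = F (digits (map (val w (\<lambda>_. 0)) es) f \<rho>' k)"
  shows "prog_out w (nest es s) f \<rho> = concat (map F [k * prod_list (map (val w (\<lambda>_. 0)) es)..<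
     (k + 1) * prod_list (map (val w (\<lambda>_. 0)) es)])"
  using assms
proof (induction es arbitrary: f \<rho> k)
  case Nil
  have "prog_out w s f \<rho> = F k" using Nil.prems(2)[of \<rho>] by simp
  moreover have "[k * 1..<(k + 1) * 1] = [k]" by simp
  ultimately show ?case by simp
next
  case (Cons e es)
  let ?z = "\<lambda>_ :: nat. 0 :: nat"
  let ?n = "val w ?z e" and ?m = "prod_list (map (val w ?z) es)"
  have vz: "val w \<rho> a = val w ?z a" if "var_bound a = 0" for a \<rho>
    using that by (induction a) auto
  have ve: "val w \<rho> e = ?n" by (rule vz) (simp add: Cons.prems(1))
  have body: "prog_out w (nest es s) (f + 2) (\<rho>(f := i, f + 1 := ?n - i)) = concat (map F [(k * ?n + i) * ?m..<(k * ?n + i + 1) * ?m])"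
    if i: "i < ?n" for i
  proof (rule Cons.IH)
    show "var_bound e = 0" if "e \<in> set es" for e using Cons.prems(1) that by simp
  next
    fix \<rho>'
    assume a: "\<And>j. j < f + 2 \<Longrightarrow> \<rho>' j = (\<rho>(f := i, f + 1 := ?n - i)) j"
      and b: "\<And>j. j < length es \<Longrightarrow> \<rho>' (f + 2 + 2 * j) < val w ?z (es ! j)"
    have fi: "\<rho>' f = i" using a[of f] by simp
    have "prog_out w s (f + 2 * length (e # es)) \<rho>' = F (digits (map (val w ?z) (e # es)) f \<rho>' k)"
    proof (rule Cons.prems(2))
      show "\<rho>' j = \<rho> j" if "j < f" for j using a[of j] that by simp
      show "\<rho>' (f + 2 * j) < val w ?z ((e # es) ! j)" if "j < length (e # es)" for j
      proof (cases j)
        case 0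
        then show ?thesis using fi i by simp
      next
        case (Suc l)
        then show ?thesis using that b[of l] by simp
      qed
    qed
    then show "prog_out w s (f + 2 + 2 * length es) \<rho>' = F (digits (map (val w ?z) es) (f + 2) \<rho>' (k * ?n + i))"
      using fi by simp
  qed
  have "prog_out w (nest (e # es) s) f \<rho> = concat (map (\<lambda>i. prog_out w (nest es s) (f + 2) (\<rho>(f := i, f + 1 := ?n - i))) [0..<?n])"
    by (simp add: ve)
  also have "\<dots> = concat (map (\<lambda>i. concat (map F [(k * ?n + i) * ?m..<(k * ?n + i + 1) * ?m])) [0..<?n])"
    by (intro arg_cong[of _ _ concat] map_cong refl body) simp
  also have "\<dots> = concat (map F [k * ?n * ?m..<(k * ?n + ?n) * ?m])" by (rule upt_blocks)
  finally have "prog_out w (nest (e # es) s) f \<rho> = concat (map F [k * ?n * ?m..<(k * ?n + ?n) * ?m])" .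
  moreover have "k * (?n * ?m) = k * ?n * ?m" "(k + 1) * (?n * ?m) = (k * ?n + ?n) * ?m"
    by (simp_all add: algebra_simps)
  ultimately show ?case by (simp only: list.map prod_list.Cons)
qed

lemma expr_of_poly: "\<exists>e. var_bound e = 0 \<and> (\<forall>w \<rho>. val w \<rho> e = poly p (length w))"
proof (induction p rule: pCons_induct)
  case 0
  show ?case by (intro exI[of _ "Num 0"]) simp
next
  case (pCons a p)
  then obtain e where "var_bound e = 0" "\<forall>w \<rho>. val w \<rho> e = poly p (length w)" by blast
  then show ?case by (intro exI[of _ "Plus (Num a) (Times Len e)"]) simp
qed

section \<open>The crossbar of a tiling problem\<close>

lemma sum_append_nat: "(\<Sum>v<a + n. f v) = (\<Sum>v<a. f v) + (\<Sum>j<n. f (a + j :: nat) :: nat)"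
  by (induction n) simp_all

lemma sum_mixed: "(\<Sum>v<m * n. f v) = (\<Sum>i<m. \<Sum>j<n. f (i * n + j :: nat) :: nat)"
  by (induction m) (simp_all add: sum_append_nat add.commute[of n])

locale tiling =
  fixes K C U :: nat and w :: "bool list"
    and A0 :: "nat \<times> bool \<times> bool \<times> bool \<times> bool \<Rightarrow> nat \<Rightarrow> nat \<Rightarrow> bool" and A1 A2 :: "nat \<Rightarrow> nat \<Rightarrow> bool"
  assumes K: "1 \<le> K" and C: "1 \<le> C" and U: "1 \<le> U"
begin

definition S :: nat where "S = 2 * U + 1"
definition P :: nat where "P = S * S"
text \<open>Block numbers run from 0 to \<open>P + S\<close>, since the constraints of block
  \<open>P\<close> mention block \<open>P + S\<close>.\<close>

definition blocks :: nat where "blocks = P + S + 1"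

definition entry :: "nat \<Rightarrow> nat \<Rightarrow> nat \<Rightarrow> nat \<Rightarrow> bool" where
  "entry b t p a \<longleftrightarrow> p = b \<and> A0 (input_class w U b) t a \<or> p = b + 1 \<and> A1 t a \<or> p = b + S \<and> A2 t a"

text \<open>Every variable owns a pair of columns, joined by a cup and a cap, and only the left one
  takes part in the constraints. Without the restriction to even columns each bit would be added
  twice.\<close>

definition used :: "nat \<Rightarrow> nat \<Rightarrow> bool" where
  "used r v \<longleftrightarrow> even v \<and> entry (r div C) (r mod C) (v div 2 div K) (v div 2 mod K)"

lemma used_digits:
  assumes "t < C" "a < K" "s < 2"
  shows "used (b * C + t) ((p * K + a) * 2 + s) \<longleftrightarrow> s = 0 \<and> entry b t p a"
proof -
  have "(b * C + t) div C = b" "(b * C + t) mod C = t" "(p * K + a) div K = p" "(p * K + a) mod K = a"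
    "((p * K + a) * 2 + s) div 2 = p * K + a" "even ((p * K + a) * 2 + s) \<longleftrightarrow> s = 0"
    using assms by (auto simp: less_2_cases_iff)
  then show ?thesis unfolding used_def by (simp only:)
qed

lemma P_pos: "1 \<le> P"
  by (simp add: P_def S_def)

text \<open>Crossbar row \<open>b * C + t\<close> is constraint \<open>t\<close> of block
  \<open>b\<close>. The cups occupy the last row of block 0, so the constraint rows are those of
  blocks 1 to \<open>P\<close>, and the caps follow. One further group of rows and of columns makes
  room for caps and terminators and keeps the dimensions products of radices.\<close>

sublocale grid "(P + 2) * C" "(blocks + 1) * K * 2" "C - 1" "(P + 1) * C" "blocks * K * 2" used
proof
  have "C * 1 \<le> P * C" using P_pos C by (simp add: mult.commute)
  then show "Suc (C - 1) < (P + 1) * C" using C by simp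
qed (use K C in \<open>simp_all add: blocks_def\<close>)

lemma row_sum_entries:
  assumes b: "b \<le> P" and t: "t < C"
  shows "row_sum x (b * C + t) (blocks * K * 2) =
    (\<Sum>a<K. if A0 (input_class w U b) t a then x ((b * K + a) * 2) else 0) +
    (\<Sum>a<K. if A1 t a then x (((b + 1) * K + a) * 2) else 0) +
    (\<Sum>a<K. if A2 t a then x (((b + S) * K + a) * 2) else 0)" (is "_ = ?s0 + ?s1 + ?s2")
proof -
  have "row_sum x (b * C + t) (blocks * K * 2) =
      (\<Sum>p<blocks. \<Sum>a<K. \<Sum>s<2. if used (b * C + t) ((p * K + a) * 2 + s) then x ((p * K + a) * 2 + s) else 0)"
    unfolding row_sum_def sum_mixed ..
  also have "\<dots> = (\<Sum>p<blocks. \<Sum>a<K. if entry b t p a then x ((p * K + a) * 2) else 0)"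
  proof (intro sum.cong refl)
    fix p a assume "a \<in> {..<K}"
    then have a: "a < K" by simp
    show "(\<Sum>s<2. if used (b * C + t) ((p * K + a) * 2 + s) then x ((p * K + a) * 2 + s) else 0) =
        (if entry b t p a then x ((p * K + a) * 2) else 0)"
      using used_digits[OF t a, of 0 b p] used_digits[OF t a, of 1 b p] by (simp add: numeral_2_eq_2)
  qed
  also have "\<dots> = (\<Sum>p<blocks. (if p = b then ?s0 else 0) + (if p = b + 1 then ?s1 else 0) + (if p = b + S then ?s2 else 0))"
  proof (intro sum.cong refl)
    fix p
    \<comment> \<open>This keeps the blocks \<open>b\<close>, \<open>b + 1\<close> and
      \<open>b + S\<close> apart, so that at most one of the three tables applies to a
      column.\<close>
    have S: "1 < S" using U by (simp add: S_def)
    consider "p = b" | "p = b + 1" | "p = b + S" | "p \<noteq> b" "p \<noteq> b + 1" "p \<noteq> b + S" by blast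
    then show "(\<Sum>a<K. if entry b t p a then x ((p * K + a) * 2) else 0) =
        (if p = b then ?s0 else 0) + (if p = b + 1 then ?s1 else 0) + (if p = b + S then ?s2 else 0)"
    proof cases
      case 1
      then have "entry b t p a \<longleftrightarrow> A0 (input_class w U b) t a" for a using S by (simp add: entry_def)
      then show ?thesis using S unfolding 1 by simp
    next
      case 2
      then have "entry b t p a \<longleftrightarrow> A1 t a" for a using S by (simp add: entry_def)
      then show ?thesis using S unfolding 2 by simp
    next
      case 3
      then have "entry b t p a \<longleftrightarrow> A2 t a" for a using S by (simp add: entry_def)
      then show ?thesis using S unfolding 3 by simp
    next
      case 4
      then show ?thesis by (simp add: entry_def)
    qed
  qed
  also have "\<dots> = ?s0 + ?s1 + ?s2"
  proof -
    have "b < blocks" "b + 1 < blocks" "b + S < blocks" using b U by (simp_all add: blocks_def S_def)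
    then show ?thesis unfolding sum.distrib sum.delta[OF finite_lessThan] lessThan_iff by (simp only: if_True)
  qed
  finally show ?thesis .
qed

text \<open>The column variable of tile \<open>a\<close> in block \<open>p\<close> is the left
  column of pair \<open>p * K + a\<close>. The row sum of a constraint row then splits into the
  three counts.\<close>

lemma solvable_iff:
  "(\<exists>x. (\<forall>v<blocks * K * 2. x v \<le> 1) \<and> (\<forall>i. 2 * i < blocks * K * 2 \<longrightarrow> x (2 * i) = x (2 * i + 1)) \<and>
      (\<forall>r. C - 1 < r \<longrightarrow> r < (P + 1) * C \<longrightarrow> row_sum x r (blocks * K * 2) = 1)) \<longleftrightarrow>
   (\<exists>x. \<forall>b t. 1 \<le> b \<longrightarrow> b \<le> S * S \<longrightarrow> t < C \<longrightarrow>
      count K (\<lambda>a. x b a \<and> A0 (input_class w U b) t a) + count K (\<lambda>a. x (b + 1) a \<and> A1 t a) +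
      count K (\<lambda>a. x (b + S) a \<and> A2 t a) = 1)" (is "?L \<longleftrightarrow> ?R")
proof
  assume ?L
  then obtain x where x: "\<And>v. v < blocks * K * 2 \<Longrightarrow> x v \<le> 1"
    and rs: "\<And>r. C - 1 < r \<Longrightarrow> r < (P + 1) * C \<Longrightarrow> row_sum x r (blocks * K * 2) = 1" by blast
  define z where "z b a \<longleftrightarrow> x ((b * K + a) * 2) = 1" for b a
  have cnt: "count K (\<lambda>a. z p a \<and> B a) = (\<Sum>a<K. if B a then x ((p * K + a) * 2) else 0)" if "p < blocks" for p B
    unfolding count_def
  proof (intro sum.cong refl)
    fix a assume a: "a \<in> {..<K}"
    have "p * K + a + 1 \<le> (p + 1) * K" using a by simp
    also have "\<dots> \<le> blocks * K" using that by (intro mult_le_mono1) simp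
    finally have "(p * K + a) * 2 < blocks * K * 2" by simp
    from x[OF this] show "(if z p a \<and> B a then 1 else 0) = (if B a then x ((p * K + a) * 2) else 0)"
      by (auto simp: z_def le_Suc_eq)
  qed
  show ?R
  proof (intro exI[of _ z] allI impI)
    fix b t assume bt: "1 \<le> b" "b \<le> S * S" "t < C"
    have bP: "b \<le> P" using bt by (simp add: P_def)
    have "C * 1 \<le> b * C" using bt(1) by (simp add: mult.commute)
    then have 1: "C - 1 < b * C + t" using C by linarith
    have "b * C \<le> P * C" by (rule mult_le_mono1[OF bP])
    then have 2: "b * C + t < (P + 1) * C" unfolding add_mult_distrib using bt(3) by linarith
    have "b < blocks" "b + 1 < blocks" "b + S < blocks" using bP U by (simp_all add: blocks_def S_def)
    then show "count K (\<lambda>a. z b a \<and> A0 (input_class w U b) t a) + count K (\<lambda>a. z (b + 1) a \<and> A1 t a) +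
        count K (\<lambda>a. z (b + S) a \<and> A2 t a) = 1"
      using rs[OF 1 2] row_sum_entries[OF bP bt(3), of x] by (simp only: cnt)
  qed
next
  assume ?R
  then obtain z where z: "\<And>b t. 1 \<le> b \<Longrightarrow> b \<le> S * S \<Longrightarrow> t < C \<Longrightarrow>
      count K (\<lambda>a. z b a \<and> A0 (input_class w U b) t a) + count K (\<lambda>a. z (b + 1) a \<and> A1 t a) +
      count K (\<lambda>a. z (b + S) a \<and> A2 t a) = 1" by blast
  define x :: "nat \<Rightarrow> nat" where "x v = (if z (v div 2 div K) (v div 2 mod K) then 1 else 0)" for v
  have cnt: "(\<Sum>a<K. if B a then x ((p * K + a) * 2) else 0) = count K (\<lambda>a. z p a \<and> B a)" for p B
    unfolding count_def by (intro sum.cong refl) (simp add: x_def)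
  have "row_sum x r (blocks * K * 2) = 1" if r: "C - 1 < r" "r < (P + 1) * C" for r
  proof -
    define b t where "b = r div C" and "t = r mod C"
    have rbt: "r = b * C + t" "t < C" using C by (simp_all add: b_def t_def)
    have "1 \<le> b" using r(1) C by (simp add: b_def Suc_le_eq div_greater_zero_iff)
    moreover have "b \<le> P" using less_mult_imp_div_less[OF r(2)] by (simp add: b_def)
    ultimately show ?thesis
      unfolding rbt(1) row_sum_entries[OF \<open>b \<le> P\<close> rbt(2)] cnt using z[of b t] rbt(2) by (simp add: P_def)
  qed
  moreover have "x v \<le> 1" "x (2 * i) = x (2 * i + 1)" for v i by (simp_all add: x_def)
  ultimately show ?L by blast
qed

definition target :: nat where "target = P * C * (47 * (blocks * K * 2) + 1) + 4 * (blocks * K * 2)"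

lemma matching_iff_tiling:
  "has_acyclic_matching (G, target) \<longleftrightarrow> (\<exists>x. \<forall>b t. 1 \<le> b \<longrightarrow> b \<le> S * S \<longrightarrow> t < C \<longrightarrow>
      count K (\<lambda>a. x b a \<and> A0 (input_class w U b) t a) + count K (\<lambda>a. x (b + 1) a \<and> A1 t a) +
      count K (\<lambda>a. x (b + S) a \<and> A2 t a) = 1)"
proof -
  have "(P + 1) * C - (C - 1) - 1 = P * C" using C by simp
  then show ?thesis
    using matching_iff_solution unfolding solvable_iff by (simp add: has_acyclic_matching_def target_def)
qed

lemma target_pos: "0 < target"
  using K by (simp add: target_def blocks_def)

text \<open>A vertex number split into eight digits. All digits except \<open>b\<close> and
  \<open>p\<close> are bounded by constants and may be looked up in tables; \<open>b\<close> and
  \<open>p\<close> enter through comparisons and the input symbol only.\<close>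

definition vertex :: "nat \<Rightarrow> nat \<Rightarrow> nat \<Rightarrow> nat \<Rightarrow> nat \<Rightarrow> nat \<Rightarrow> nat \<Rightarrow> nat \<Rightarrow> nat" where
  "vertex b t p a s y x d = ((((((b * C + t) * (blocks + 1) + p) * K + a) * 2 + s) * 18 + y) * 6 + x) * 2 + d"

lemma eps_vertex:
  assumes "b < P + 2" "t < C" "p < blocks + 1" "a < K" "s < 2" "y < 18" "x < 6" "d < 2"
  shows "eps (vertex b t p a s y x d) = (6 * ((p * K + a) * 2 + s) + x, 18 * (b * C + t) + y, d = 1)"
    and "vertex b t p a s y x d < (P + 2) * C * ((blocks + 1) * K * 2) * 216"
    and "eps (vertex b t p a s y x d) \<in> E \<longleftrightarrow> edge_on (ty (b * C + t) ((p * K + a) * 2 + s)) (6 * y + x) (d = 1)"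
proof -
  have "b * C + t + 1 \<le> (b + 1) * C" using assms by simp
  also have "\<dots> \<le> (P + 2) * C" using assms by (intro mult_le_mono1) simp
  finally have r: "b * C + t < (P + 2) * C" by simp
  have "p * K + a + 1 \<le> (p + 1) * K" using assms by simp
  also have "\<dots> \<le> (blocks + 1) * K" using assms by (intro mult_le_mono1) simp
  finally have v: "(p * K + a) * 2 + s < (blocks + 1) * K * 2" using assms(5) by simp
  have "d = (if d = 1 then 1 else 0)" using assms(8) by auto
  then have u: "vertex b t p a s y x d = (((b * C + t) * ((blocks + 1) * K * 2) + ((p * K + a) * 2 + s)) * 108 + 6 * y + x) * 2 +
      (if d = 1 then 1 else 0)" unfolding vertex_def by (simp add: algebra_simps)
  show e: "eps (vertex b t p a s y x d) = (6 * ((p * K + a) * 2 + s) + x, 18 * (b * C + t) + y, d = 1)"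
    unfolding u by (rule eps_index(1)[OF r v assms(6,7)])
  show "vertex b t p a s y x d < (P + 2) * C * ((blocks + 1) * K * 2) * 216"
    unfolding u by (rule eps_index(2)[OF r v assms(6,7)])
  show "eps (vertex b t p a s y x d) \<in> E \<longleftrightarrow> edge_on (ty (b * C + t) ((p * K + a) * 2 + s)) (6 * y + x) (d = 1)"
    unfolding e by (rule E_cell[OF r v assms(6,7)])
qed

end

section \<open>The program that writes the instance\<close>

lemma ends_meet:
  assumes "d < 2" "d' < 2"
  shows "ends (X, Y, d = 1) \<inter> ends (X', Y', d' = 1) \<noteq> {} \<longleftrightarrow> X = X' \<and> Y = Y' \<or>
    X = X' + (1 - d') \<and> Y = Y' + d' \<or> X + (1 - d) = X' \<and> Y + d = Y' \<or>
    X + (1 - d) = X' + (1 - d') \<and> Y + d = Y' + (d' :: nat)"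
proof -
  have f: "far (X, Y, d = 1) = (X + (1 - d), Y + d)" if "d < 2" for X Y d
    using that by (auto simp: far_def less_2_cases_iff)
  have "ends (X, Y, d = 1) = {(X, Y), (X + (1 - d), Y + d)}" "ends (X', Y', d' = 1) = {(X', Y'), (X' + (1 - d'), Y' + d')}"
    unfolding ends_def f[OF assms(1)] f[OF assms(2)] near_def by simp_all
  then show ?thesis by auto
qed

lemma dec_list:
  assumes "\<And>P. P \<in> set Ps \<Longrightarrow> decides f P"
  shows "decides f (\<lambda>w \<rho>. H (map (\<lambda>P. P w \<rho>) Ps))"
  using assms
proof (induction Ps arbitrary: H)
  case Nil
  show ?case using dec_const[of f "H []"] by simp
next
  case (Cons P Ps)
  have "decides f (\<lambda>w \<rho>. (\<lambda>b w \<rho>. H (b # map (\<lambda>P. P w \<rho>) Ps)) (P w \<rho>) w \<rho>)"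
    by (rule dec_bool[OF Cons.prems Cons.IH]) (use Cons.prems in auto)
  then show ?case by simp
qed

text \<open>Any function of finitely many bounded values and finitely many decidable conditions is
  decidable, by an exhaustive table.\<close>

lemma dec_finite:
  assumes "\<And>e n. (e, n) \<in> set es \<Longrightarrow> var_bound e \<le> f" "\<And>P. P \<in> set Ps \<Longrightarrow> decides f P"
  shows "decides f (\<lambda>w \<rho>. (\<forall>(e, n)\<in>set es. val w \<rho> e < n) \<and> H (map (\<lambda>(e, n). val w \<rho> e) es) (map (\<lambda>P. P w \<rho>) Ps))"
  using assms(1)
proof (induction es arbitrary: H)
  case Nil
  show ?case using dec_list[OF assms(2), where H = "H []"] by simp
next
  case (Cons en es)
  obtain e n where en: "en = (e, n)" by (cases en)
  have "decides f (\<lambda>w \<rho>. val w \<rho> e < n \<and> (\<lambda>c w \<rho>. (\<forall>(e, n)\<in>set es. val w \<rho> e < n) \<and>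
      H (c # map (\<lambda>(e, n). val w \<rho> e) es) (map (\<lambda>P. P w \<rho>) Ps)) (val w \<rho> e) w \<rho>)"
    by (rule dec_num[OF _ Cons.IH]) (use Cons.prems en in auto)
  then show ?case by (rule dec_cong) (auto simp: en)
qed

lemma word_contents_less: "word_contents w i < 3"
  by (simp add: word_contents_def)

definition row_expr :: "nat \<Rightarrow> nat \<Rightarrow> expr" where
  "row_expr C f = Plus (Times (Var f) (Num C)) (Var (f + 2))"
definition column_expr :: "nat \<Rightarrow> nat \<Rightarrow> expr" where
  "column_expr K f = Plus (Times (Plus (Times (Var (f + 4)) (Num K)) (Var (f + 6))) (Num 2)) (Var (f + 8))"

text \<open>The case distinction of the crossbar with its conditions replaced by truth values, so
  that it becomes a function on a finite domain.\<close>

definition type_of :: "bool \<Rightarrow> bool \<Rightarrow> bool \<Rightarrow> bool \<Rightarrow> bool \<Rightarrow> bool \<Rightarrow> bool \<Rightarrow> ctype" where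
  "type_of mid lft fin ad upp low evn = (if mid then if lft then if ad then Add else Pass else if fin then Term else Empty
     else if lft \<and> upp then if evn then CupL else CupR
     else if lft \<and> low then if evn then CapL else CapR else Empty)"

context
  fixes K C :: nat and A0 :: "nat \<times> bool \<times> bool \<times> bool \<times> bool \<Rightarrow> nat \<Rightarrow> nat \<Rightarrow> bool" and A1 A2 :: "nat \<Rightarrow> nat \<Rightarrow> bool"
    and p :: "nat poly" and eU :: expr
  assumes K: "1 \<le> K" and C: "1 \<le> C" and U: "\<And>n. 1 \<le> poly p n"
    and eU: "var_bound eU = 0" "\<And>w \<rho>. val w \<rho> eU = poly p (length w)"
begin

interpretation T: tiling K C "poly p (length w)" w A0 A1 A2 for w
  by unfold_locales (use K C U in auto)

abbreviation "eS \<equiv> Plus (Times (Num 2) eU) (Num 1)"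
abbreviation "eP \<equiv> Times eS eS"
abbreviation "eB \<equiv> Plus (Plus eP eS) (Num 1)"
abbreviation "radices \<equiv> [Plus eP (Num 2), Num C, Plus eB (Num 1), Num K, Num 2, Num 18, Num 6, Num 2]"
abbreviation "eC2 \<equiv> Times (Times eB (Num K)) (Num 2)"

definition in_range :: "nat \<Rightarrow> bool list \<Rightarrow> (nat \<Rightarrow> nat) \<Rightarrow> bool" where
  "in_range f w \<rho> \<longleftrightarrow> (\<forall>i<8. \<rho> (f + 2 * i) < val w (\<lambda>_. 0) (radices ! i))"

definition vert :: "nat \<Rightarrow> bool list \<Rightarrow> (nat \<Rightarrow> nat) \<Rightarrow> nat" where
  "vert f w \<rho> = T.vertex w (\<rho> f) (\<rho> (f + 2)) (\<rho> (f + 4)) (\<rho> (f + 6)) (\<rho> (f + 8)) (\<rho> (f + 10)) (\<rho> (f + 12)) (\<rho> (f + 14))"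

lemma in_rangeD:
  assumes "in_range f w \<rho>"
  shows "\<rho> f < T.P w + 2" "\<rho> (f + 2) < C" "\<rho> (f + 4) < T.blocks w + 1" "\<rho> (f + 6) < K" "\<rho> (f + 8) < 2"
    "\<rho> (f + 10) < 18" "\<rho> (f + 12) < 6" "\<rho> (f + 14) < 2"
proof -
  have i: "\<rho> (f + 2 * i) < val w (\<lambda>_. 0) (radices ! i)" if "i < 8" for i using assms that unfolding in_range_def by blast
  show "\<rho> f < T.P w + 2" "\<rho> (f + 2) < C" "\<rho> (f + 4) < T.blocks w + 1" "\<rho> (f + 6) < K" "\<rho> (f + 8) < 2"
    "\<rho> (f + 10) < 18" "\<rho> (f + 12) < 6" "\<rho> (f + 14) < 2"
    using i[of 0] i[of 1] i[of 2] i[of 3] i[of 4] i[of 5] i[of 6] i[of 7]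
    by (simp_all add: eU T.P_def T.S_def T.blocks_def)
qed

lemma digits_radices: "digits (map (val w (\<lambda>_. 0)) radices) f \<rho> 0 = vert f w \<rho>"
  by (simp add: vert_def T.vertex_def eU T.P_def T.S_def T.blocks_def add.assoc del: add_2_eq_Suc add_2_eq_Suc')

text \<open>Whether a lattice edge is present depends on six bounded values, among them the input
  symbol at the block, and on fourteen comparisons.\<close>

lemma dec_edge:
  assumes f: "f + 16 \<le> g"
  shows "\<exists>Q. decides g Q \<and> (\<forall>w \<rho>. in_range f w \<rho> \<longrightarrow> Q w \<rho> = (T.eps w (vert f w \<rho>) \<in> T.E w))"
proof -
  define es where "es = [(Sym (Var f) (Plus eU (Num 1)), 3), (Var (f + 2), C), (Var (f + 6), K),
    (Var (f + 10), 18), (Var (f + 12), 6), (Var (f + 14), 2 :: nat)]"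
  define eqs where "eqs = [(Var f, Plus eU (Num 1)), (Var f, Num 1), (Var f, eS), (Var (f + 4), Var f),
    (Var (f + 4), Plus (Var f) (Num 1)), (Var (f + 4), Plus (Var f) eS), (Var (f + 8), Num 0),
    (column_expr K f, eC2), (row_expr C f, Num (C - 1)), (row_expr C f, Times (Plus eP (Num 1)) (Num C))]"
  define les where "les = [(Var f, eS), (Num C, row_expr C f),
    (Plus (row_expr C f) (Num 1), Times (Plus eP (Num 1)) (Num C)), (Plus (column_expr K f) (Num 1), eC2)]"
  define Ps where "Ps = map (\<lambda>(a, b) w \<rho>. val w \<rho> a = val w \<rho> b) eqs @ map (\<lambda>(a, b) w \<rho>. val w \<rho> a \<le> val w \<rho> b) les"
  \<comment> \<open>Positions 0 to 9 of \<open>bs\<close> are the equations in the order of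
    \<open>eqs\<close>, positions 10 to 13 the inequalities of \<open>les\<close>; the first
    argument of \<open>A0\<close> reassembles \<open>input_class\<close>. The entries of
    \<open>ns\<close> are the symbol, the constraint, the tile, and the local coordinates and
    direction of the edge.\<close>
  define H where "H = (\<lambda>(ns :: nat list) (bs :: bool list). edge_on (type_of (bs ! 11 \<and> bs ! 12) (bs ! 13) (bs ! 7)
      (bs ! 6 \<and> (bs ! 3 \<and> A0 (ns ! 0, bs ! 0, bs ! 1, bs ! 2, bs ! 10) (ns ! 1) (ns ! 2) \<or>
        bs ! 4 \<and> A1 (ns ! 1) (ns ! 2) \<or> bs ! 5 \<and> A2 (ns ! 1) (ns ! 2))) (bs ! 8) (bs ! 9) (bs ! 6))
      (6 * ns ! 3 + ns ! 4) (ns ! 5 = 1))"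
  define Q where "Q = (\<lambda>w \<rho>. (\<forall>(e, n)\<in>set es. val w \<rho> e < n) \<and> H (map (\<lambda>(e, n). val w \<rho> e) es) (map (\<lambda>P. P w \<rho>) Ps))"
  have dQ: "decides g Q"
    unfolding Q_def
  proof (rule dec_finite)
    fix e n assume "(e, n) \<in> set es"
    then show "var_bound e \<le> g" using f eU(1) by (auto simp: es_def)
  next
    fix R assume "R \<in> set Ps"
    then have "R \<in> (\<lambda>(a, b) w \<rho>. val w \<rho> a = val w \<rho> b) ` set eqs \<or> R \<in> (\<lambda>(a, b) w \<rho>. val w \<rho> a \<le> val w \<rho> b) ` set les"
      unfolding Ps_def by (simp only: set_append set_map Un_iff)
    then show "decides g R"
    proof (elim disjE imageE)
      fix ab assume R: "R = (case ab of (a, b) \<Rightarrow> \<lambda>w \<rho>. val w \<rho> a = val w \<rho> b)" and ab: "ab \<in> set eqs"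
      obtain a b where e: "ab = (a, b)" by (cases ab)
      have "var_bound a \<le> g" "var_bound b \<le> g" using ab f eU(1) unfolding e by (auto simp: eqs_def row_expr_def column_expr_def)
      then show "decides g R" unfolding R e case_prod_conv by (rule dec_eq)
    next
      fix ab assume R: "R = (case ab of (a, b) \<Rightarrow> \<lambda>w \<rho>. val w \<rho> a \<le> val w \<rho> b)" and ab: "ab \<in> set les"
      obtain a b where e: "ab = (a, b)" by (cases ab)
      have "var_bound a \<le> g" "var_bound b \<le> g" using ab f eU(1) unfolding e by (auto simp: les_def row_expr_def column_expr_def)
      then show "decides g R" unfolding R e case_prod_conv by (rule dec_le)
    qed
  qed
  have "Q w \<rho> = (T.eps w (vert f w \<rho>) \<in> T.E w)" if ins: "in_range f w \<rho>" for w \<rho>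
  proof -
    note b = in_rangeD[OF ins]
    define r v where "r = \<rho> f * C + \<rho> (f + 2)" and "v = (\<rho> (f + 4) * K + \<rho> (f + 6)) * 2 + \<rho> (f + 8)"
    have vals: "val w \<rho> (row_expr C f) = r" "val w \<rho> (column_expr K f) = v"
      by (simp_all add: r_def v_def row_expr_def column_expr_def)
    have ge: "(C - 1 < r) = (C \<le> r)" "(r < (T.P w + 1) * C) = (r + 1 \<le> (T.P w + 1) * C)"
      "(v < T.blocks w * K * 2) = (v + 1 \<le> T.blocks w * K * 2)" using C by auto
    have ev: "even v = (\<rho> (f + 8) = 0)" using b(5) by (auto simp: v_def less_2_cases_iff)
    have us: "T.used w r v = (\<rho> (f + 8) = 0 \<and> T.entry w (\<rho> f) (\<rho> (f + 2)) (\<rho> (f + 4)) (\<rho> (f + 6)))"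
      unfolding r_def v_def by (rule T.used_digits[OF b(2,4,5)])
    have ty: "T.ty w r v = type_of (C \<le> r \<and> r + 1 \<le> (T.P w + 1) * C) (v + 1 \<le> T.blocks w * K * 2)
        (v = T.blocks w * K * 2) (T.used w r v) (r = C - 1) (r = (T.P w + 1) * C) (even v)"
      unfolding T.ty_def type_of_def ge by (rule refl)
    have bounds: "\<forall>(e, n)\<in>set es. val w \<rho> e < n" using b word_contents_less by (simp add: es_def)
    have ic: "input_class w (poly p (length w)) (\<rho> f) = (word_contents w (int (\<rho> f) - int (poly p (length w) + 1)),
        \<rho> f = poly p (length w) + 1, \<rho> f = 1, \<rho> f = T.S w, \<rho> f \<le> T.S w)"
      by (simp add: input_class_def T.S_def)
    have nss: "map (\<lambda>(e, n). val w \<rho> e) es = [word_contents w (int (\<rho> f) - int (poly p (length w) + 1)),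
        \<rho> (f + 2), \<rho> (f + 6), \<rho> (f + 10), \<rho> (f + 12), \<rho> (f + 14)]"
      by (simp add: es_def eU)
    have bss: "map (\<lambda>P. P w \<rho>) Ps = [\<rho> f = poly p (length w) + 1, \<rho> f = 1, \<rho> f = T.S w, \<rho> (f + 4) = \<rho> f,
        \<rho> (f + 4) = \<rho> f + 1, \<rho> (f + 4) = \<rho> f + T.S w, \<rho> (f + 8) = 0, v = T.blocks w * K * 2, r = C - 1,
        r = (T.P w + 1) * C, \<rho> f \<le> T.S w, C \<le> r, r + 1 \<le> (T.P w + 1) * C, v + 1 \<le> T.blocks w * K * 2]"
      by (simp add: Ps_def eqs_def les_def vals eU T.S_def T.P_def T.blocks_def)
    have "Q w \<rho> = H (map (\<lambda>(e, n). val w \<rho> e) es) (map (\<lambda>P. P w \<rho>) Ps)" unfolding Q_def using bounds by blast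
    also have "\<dots> = edge_on (T.ty w r v) (6 * \<rho> (f + 10) + \<rho> (f + 12)) (\<rho> (f + 14) = 1)"
      unfolding nss bss H_def ty us T.entry_def ic ev by simp
    also have "\<dots> = (T.eps w (vert f w \<rho>) \<in> T.E w)"
      unfolding vert_def r_def v_def by (rule T.eps_vertex(3)[OF b, symmetric])
    finally show ?thesis .
  qed
  then show ?thesis using dQ by blast
qed

text \<open>Four possible coincidences of ends. The far end is obtained arithmetically by adding the
  direction digit to one coordinate and its complement to the other.\<close>

lemma dec_meet:
  "\<exists>Q. decides 32 Q \<and> (\<forall>w \<rho>. in_range 0 w \<rho> \<longrightarrow> in_range 16 w \<rho> \<longrightarrow>
    Q w \<rho> = (ends (T.eps w (vert 0 w \<rho>)) \<inter> ends (T.eps w (vert 16 w \<rho>)) \<noteq> {}))"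
proof -
  define X where "X f = Plus (Times (Num 6) (column_expr K f)) (Var (f + 12))" for f
  define Y where "Y f = Plus (Times (Num 18) (row_expr C f)) (Var (f + 10))" for f
  define X' where "X' f = Plus (X f) (Minus (Num 1) (Var (f + 14)))" for f
  define Y' where "Y' f = Plus (Y f) (Var (f + 14))" for f
  have vb: "var_bound (X f) \<le> 32" "var_bound (Y f) \<le> 32" "var_bound (X' f) \<le> 32" "var_bound (Y' f) \<le> 32" if "f \<le> 16" for f
    using that by (simp_all add: X_def Y_def X'_def Y'_def row_expr_def column_expr_def)
  define Q where "Q = (\<lambda>w \<rho>. val w \<rho> (X 0) = val w \<rho> (X 16) \<and> val w \<rho> (Y 0) = val w \<rho> (Y 16) \<or>
    val w \<rho> (X 0) = val w \<rho> (X' 16) \<and> val w \<rho> (Y 0) = val w \<rho> (Y' 16) \<or>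
    val w \<rho> (X' 0) = val w \<rho> (X 16) \<and> val w \<rho> (Y' 0) = val w \<rho> (Y 16) \<or>
    val w \<rho> (X' 0) = val w \<rho> (X' 16) \<and> val w \<rho> (Y' 0) = val w \<rho> (Y' 16))"
  have "decides 32 Q" unfolding Q_def by (intro dec_disj dec_conj dec_eq vb) simp_all
  moreover have "Q w \<rho> = (ends (T.eps w (vert 0 w \<rho>)) \<inter> ends (T.eps w (vert 16 w \<rho>)) \<noteq> {})"
    if a: "in_range 0 w \<rho>" and b: "in_range 16 w \<rho>" for w \<rho>
  proof -
    have e: "T.eps w (vert f w \<rho>) = (val w \<rho> (X f), val w \<rho> (Y f), \<rho> (f + 14) = 1)" if "in_range f w \<rho>" for f
      unfolding vert_def T.eps_vertex(1)[OF in_rangeD[OF that]]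
      by (simp add: X_def Y_def row_expr_def column_expr_def)
    show ?thesis
      unfolding e[OF a] e[OF b] ends_meet[OF in_rangeD(8)[OF a] in_rangeD(8)[OF b]] Q_def X'_def Y'_def by simp
  qed
  ultimately show ?thesis by blast
qed

text \<open>Two nested groups of eight loops run through rows and columns of the adjacency matrix.
  Each loop takes two counters, so the digits of the row vertex start at counter 0, those of the
  column vertex at 16, and the innermost program has level 32.\<close>

lemma reduction:
  "\<exists>s. wf_stm s 0 \<and> (\<forall>w. prog_out w s 0 (\<lambda>_. 0) = encode_instance (T.G w, T.target w))"
proof -
  have "\<exists>Q. decides 32 Q \<and> (\<forall>w \<rho>. in_range 0 w \<rho> \<longrightarrow> Q w \<rho> = (T.eps w (vert 0 w \<rho>) \<in> T.E w))"
    by (rule dec_edge) simp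
  then obtain Q1 where Q1: "decides 32 Q1" "\<And>w \<rho>. in_range 0 w \<rho> \<Longrightarrow> Q1 w \<rho> = (T.eps w (vert 0 w \<rho>) \<in> T.E w)"
    by blast
  have "\<exists>Q. decides 32 Q \<and> (\<forall>w \<rho>. in_range 16 w \<rho> \<longrightarrow> Q w \<rho> = (T.eps w (vert 16 w \<rho>) \<in> T.E w))"
    by (rule dec_edge) simp
  then obtain Q2 where Q2: "decides 32 Q2" "\<And>w \<rho>. in_range 16 w \<rho> \<Longrightarrow> Q2 w \<rho> = (T.eps w (vert 16 w \<rho>) \<in> T.E w)"
    by blast
  obtain Q3 where Q3: "decides 32 Q3" "\<And>w \<rho>. in_range 0 w \<rho> \<Longrightarrow> in_range 16 w \<rho> \<Longrightarrow>
      Q3 w \<rho> = (ends (T.eps w (vert 0 w \<rho>)) \<inter> ends (T.eps w (vert 16 w \<rho>)) \<noteq> {})"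
    using dec_meet by blast
  \<comment> \<open>The vertex number as an expression in the loop indices, needed to write 0 on the
    diagonal of the matrix.\<close>
  define ix where "ix f = Plus (Times (Plus (Times (Plus (Times (Plus (Times (Plus (Times (Plus (Times (Plus
    (Times (Var f) (Num C)) (Var (f + 2))) (Plus eB (Num 1))) (Var (f + 4))) (Num K)) (Var (f + 6))) (Num 2)) (Var (f + 8)))
    (Num 18)) (Var (f + 10))) (Num 6)) (Var (f + 12))) (Num 2)) (Var (f + 14))" for f
  have vb: "var_bound (ix f) \<le> 32" if "f \<le> 16" for f
    using that eU(1) by (simp add: ix_def)
  have vx: "val w \<rho> (ix f) = vert f w \<rho>" for w \<rho> f
    by (simp add: ix_def vert_def T.vertex_def eU T.P_def T.S_def T.blocks_def)
  have Q4: "decides 32 (\<lambda>w \<rho>. \<not> val w \<rho> (ix 0) = val w \<rho> (ix 16))"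
    by (intro dec_not dec_eq vb) simp_all
  define Q where "Q = (\<lambda>w \<rho>. \<not> val w \<rho> (ix 0) = val w \<rho> (ix 16) \<and> Q1 w \<rho> \<and> Q2 w \<rho> \<and> Q3 w \<rho>)"
  have dQ: "decides 32 Q" unfolding Q_def by (intro dec_conj Q1(1) Q2(1) Q3(1) Q4)
  have "\<exists>u. wf_stm u 32 \<and> (\<forall>w \<rho>. prog_out w u 32 \<rho> = (if Q w \<rho> then prog_out w (Emit True) 32 \<rho> else prog_out w (Emit False) 32 \<rho>))"
    by (rule dQ[unfolded decides_def, rule_format, of "Emit True" "Emit False"]) simp_all
  then obtain u where u: "wf_stm u 32"
    "\<And>w \<rho>. prog_out w u 32 \<rho> = (if Q w \<rho> then prog_out w (Emit True) 32 \<rho> else prog_out w (Emit False) 32 \<rho>)" by blast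
  have u': "prog_out w u 32 \<rho> = [Q w \<rho>]" for w \<rho> using u(2)[of w \<rho>] by simp
  have rb: "\<And>e. e \<in> set radices \<Longrightarrow> var_bound e = 0" using eU(1) by auto
  define N where "N w = prod_list (map (val w (\<lambda>_. 0)) radices)" for w
  have N: "N w = (T.P w + 2) * C * ((T.blocks w + 1) * K * 2) * 216" for w
  proof -
    have va: "val w \<rho> (Plus eP (Num 2)) = T.P w + 2" "val w \<rho> (Plus eB (Num 1)) = T.blocks w + 1" for \<rho>
      by (simp_all add: eU T.P_def T.S_def T.blocks_def)
    have "a * (c * (b * (k * (2 * (18 * (6 * (2 * 1))))))) = a * c * (b * k * 2) * (216 :: nat)" for a b c k
      by simp
    then show ?thesis unfolding N_def list.map prod_list.Cons prod_list.Nil va val.simps(2) .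
  qed
  have adj: "Q w \<rho> = ({vert 0 w \<rho>, vert 16 w \<rho>} \<in> edges (T.G w))" if a: "in_range 0 w \<rho>" and b: "in_range 16 w \<rho>" for w \<rho>
    unfolding Q_def vx T.G_edge Q1(2)[OF a] Q2(2)[OF b] Q3(2)[OF a b]
    using T.eps_vertex(2)[OF in_rangeD[OF a]] T.eps_vertex(2)[OF in_rangeD[OF b]] unfolding vert_def by blast
  have inner: "prog_out w (nest radices u) 16 \<rho> = map (\<lambda>j. {vert 0 w \<rho>, j} \<in> edges (T.G w)) [0..<N w]"
    if a: "in_range 0 w \<rho>" for w \<rho>
  proof -
    have "prog_out w (nest radices u) 16 \<rho> = concat (map (\<lambda>j. [{vert 0 w \<rho>, j} \<in> edges (T.G w)])
        [0 * prod_list (map (val w (\<lambda>_. 0)) radices)..<(0 + 1) * prod_list (map (val w (\<lambda>_. 0)) radices)])"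
    proof (rule out_nest)
      show "var_bound e = 0" if "e \<in> set radices" for e by (rule rb[OF that])
    next
      fix \<sigma> :: "nat \<Rightarrow> nat"
      assume s: "\<And>i. i < 16 \<Longrightarrow> \<sigma> i = \<rho> i" and i: "\<And>i. i < length radices \<Longrightarrow> \<sigma> (16 + 2 * i) < val w (\<lambda>_. 0) (radices ! i)"
      have b: "in_range 16 w \<sigma>" unfolding in_range_def
      proof (intro allI impI)
        fix k :: nat assume "k < 8"
        then show "\<sigma> (16 + 2 * k) < val w (\<lambda>_. 0) (radices ! k)" by (intro i) simp
      qed
      have v0: "vert 0 w \<sigma> = vert 0 w \<rho>" by (simp add: vert_def s)
      have "in_range 0 w \<sigma>" unfolding in_range_def
      proof (intro allI impI)
        fix k :: nat assume k: "k < 8"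
        then have "\<sigma> (0 + 2 * k) = \<rho> (0 + 2 * k)" by (intro s) simp
        then show "\<sigma> (0 + 2 * k) < val w (\<lambda>_. 0) (radices ! k)" using a k unfolding in_range_def by simp
      qed
      from adj[OF this b] have "prog_out w u 32 \<sigma> = [{vert 0 w \<rho>, vert 16 w \<sigma>} \<in> edges (T.G w)]" unfolding u' v0 by simp
      moreover have "16 + 2 * length radices = 32" by simp
      ultimately show "prog_out w u (16 + 2 * length radices) \<sigma> =
          [{vert 0 w \<rho>, digits (map (val w (\<lambda>_. 0)) radices) 16 \<sigma> 0} \<in> edges (T.G w)]"
        unfolding digits_radices by (simp only:)
    qed
    then show ?thesis unfolding N_def[symmetric] mult_0 add_0 mult_1 concat_map_singleton .
  qed
  have outer: "prog_out w (nest radices (nest radices u)) 0 (\<lambda>_. 0) =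
      concat (map (\<lambda>i. map (\<lambda>j. {i, j} \<in> edges (T.G w)) [0..<N w]) [0..<N w])" for w
  proof -
    have "prog_out w (nest radices (nest radices u)) 0 (\<lambda>_. 0) = concat (map (\<lambda>i. map (\<lambda>j. {i, j} \<in> edges (T.G w)) [0..<N w])
        [0 * prod_list (map (val w (\<lambda>_. 0)) radices)..<(0 + 1) * prod_list (map (val w (\<lambda>_. 0)) radices)])"
    proof (rule out_nest)
      show "var_bound e = 0" if "e \<in> set radices" for e by (rule rb[OF that])
    next
      fix \<sigma> :: "nat \<Rightarrow> nat"
      assume i: "\<And>i. i < length radices \<Longrightarrow> \<sigma> (0 + 2 * i) < val w (\<lambda>_. 0) (radices ! i)"
      have a: "in_range 0 w \<sigma>" unfolding in_range_def
      proof (intro allI impI)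
        fix k :: nat assume "k < 8"
        then show "\<sigma> (0 + 2 * k) < val w (\<lambda>_. 0) (radices ! k)" by (intro i) simp
      qed
      have "0 + 2 * length radices = 16" by simp
      then show "prog_out w (nest radices u) (0 + 2 * length radices) \<sigma> =
          map (\<lambda>j. {digits (map (val w (\<lambda>_. 0)) radices) 0 \<sigma> 0, j} \<in> edges (T.G w)) [0..<N w]"
        unfolding digits_radices using inner[OF a] by (simp only:)
    qed
    then show ?thesis unfolding N_def[symmetric] mult_0 add_0 mult_1 .
  qed
  \<comment> \<open>The number of vertices and, in \<open>ek\<close>, the required size of the
    matching; both are polynomial in the input length.\<close>
  define eN where "eN = Times (Times (Times (Plus eP (Num 2)) (Num C)) (Times (Times (Plus eB (Num 1)) (Num K)) (Num 2))) (Num 216)"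
  define ek where "ek = Plus (Times (Times eP (Num C)) (Plus (Times (Num 47) eC2) (Num 1))) (Times (Num 4) eC2)"
  define s where "s = Then (For eN (Emit True)) (Then (Emit False) (Then (nest radices (nest radices u)) (EmitBin ek)))"
  have vbs: "var_bound eN = 0" "var_bound ek = 0" using eU(1) by (simp_all add: eN_def ek_def)
  have vN: "val w \<rho> eN = N w" for w \<rho> unfolding N by (simp add: eN_def eU T.P_def T.S_def T.blocks_def)
  have vk: "val w \<rho> ek = T.target w" for w \<rho>
    by (simp add: ek_def eU T.target_def T.P_def T.S_def T.blocks_def)
  have w16: "wf_stm (nest radices u) 16"
  proof (rule wf_nest)
    show "var_bound e = 0" if "e \<in> set radices" for e by (rule rb[OF that])
    show "wf_stm u (16 + 2 * length radices)" using u(1) by simp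
  qed
  have "wf_stm (nest radices (nest radices u)) 0"
  proof (rule wf_nest)
    show "var_bound e = 0" if "e \<in> set radices" for e by (rule rb[OF that])
    have "0 + 2 * length radices = 16" by simp
    then show "wf_stm (nest radices u) (0 + 2 * length radices)" using w16 by (simp only:)
  qed
  then have "wf_stm s 0" unfolding s_def using vbs by (simp del: nest.simps)
  moreover have "prog_out w s 0 (\<lambda>_. 0) = encode_instance (T.G w, T.target w)" for w
  proof -
    have c: "card (verts (T.G w)) = N w" by (simp only: T.verts_G card_lessThan N)
    have t: "prog_out w (For eN (Emit True)) 0 (\<lambda>_. 0) = replicate (N w) True"
      by (simp add: vN concat_map_singleton map_replicate_const)
    have "prog_out w s 0 (\<lambda>_. 0) = prog_out w (For eN (Emit True)) 0 (\<lambda>_. 0) @ [False] @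
        prog_out w (nest radices (nest radices u)) 0 (\<lambda>_. 0) @ binary (val w (\<lambda>_. 0) ek)"
      by (simp add: s_def del: nest.simps)
    also have "\<dots> = encode_instance (T.G w, T.target w)"
      unfolding encode_instance_def case_prod_conv Let_def c t outer vk by (rule refl)
    finally show ?thesis .
  qed
  ultimately show ?thesis by blast
qed

end

text \<open>One program, built from the tables of the language, writes the crossbar of the tableau
  for every word. The restrictions on the graph hold for all crossbars, whether or not the word is
  accepted, so every input yields an admissible instance.\<close>

theorem theorem6:
  "NP_hard encode_instance
     {(G, k) \<in> acyclic_matching_instances. planar G \<and> is_line_graph G \<and> max_degree G = 4}
     has_acyclic_matching"
  unfolding NP_hard_def
proof
  fix L :: "bool list set" assume "L \<in> NP"
  from cook_levin[OF this] obtain K C :: nat and A0 A1 A2 and p :: "nat poly" where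
    K: "1 \<le> K" "1 \<le> C" and p': "\<forall>n. 1 \<le> poly p n" and
    L: "\<forall>w. w \<in> L \<longleftrightarrow> (let U = poly p (length w) in \<exists>x. \<forall>b t. 1 \<le> b \<longrightarrow> b \<le> (2 * U + 1) * (2 * U + 1) \<longrightarrow>
      t < C \<longrightarrow> count K (\<lambda>a. x b a \<and> A0 (input_class w U b) t a) + count K (\<lambda>a. x (b + 1) a \<and> A1 t a) +
        count K (\<lambda>a. x (b + (2 * U + 1)) a \<and> A2 t a) = 1)"
    by (elim exE conjE) (rule that[rotated 3]; assumption)
  have p: "\<And>n. 1 \<le> poly p n" using p' by blast
  obtain eU where eU: "var_bound eU = 0" "\<And>w \<rho>. val w \<rho> eU = poly p (length w)"
    using expr_of_poly[of p] by blast
  interpret T: tiling K C "poly p (length w)" w A0 A1 A2 for w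
    by unfold_locales (use K p in auto)
  have "\<exists>s. wf_stm s 0 \<and> (\<forall>w. prog_out w s 0 (\<lambda>_. 0) = encode_instance (T.G w, T.target w))"
    by (rule reduction[OF K p eU])
  then obtain s where s: "wf_stm s 0" "\<And>w. prog_out w s 0 (\<lambda>_. 0) = encode_instance (T.G w, T.target w)" by blast
  show "\<exists>f. polytime_computable f \<and> (\<forall>w. \<exists>i\<in>{(G, k) \<in> acyclic_matching_instances. planar G \<and> is_line_graph G \<and> max_degree G = 4}.
      f w = encode_instance i \<and> (w \<in> L \<longleftrightarrow> has_acyclic_matching i))"
  proof (intro exI[of _ "\<lambda>w. prog_out w s 0 (\<lambda>_. 0)"] conjI allI)
    show "polytime_computable (\<lambda>w. prog_out w s 0 (\<lambda>_. 0))" by (rule polytime_out[OF s(1)])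
  next
    fix w
    have "w \<in> L \<longleftrightarrow> has_acyclic_matching (T.G w, T.target w)"
      unfolding T.matching_iff_tiling T.S_def spec[OF L, of w] Let_def by (rule refl)
    moreover have "(T.G w, T.target w) \<in> acyclic_matching_instances"
      unfolding acyclic_matching_instances_def mem_Collect_eq case_prod_conv
      using T.simple_graph_G[of w] T.verts_G[of w] T.target_pos[of w] by blast
    then have "(T.G w, T.target w) \<in> {(G, k) \<in> acyclic_matching_instances. planar G \<and> is_line_graph G \<and> max_degree G = 4}"
      unfolding mem_Collect_eq case_prod_conv by (intro conjI T.planar_G T.is_line_graph_G T.max_degree_grid)
    ultimately show "\<exists>i\<in>{(G, k) \<in> acyclic_matching_instances. planar G \<and> is_line_graph G \<and> max_degree G = 4}.
        prog_out w s 0 (\<lambda>_. 0) = encode_instance i \<and> (w \<in> L \<longleftrightarrow> has_acyclic_matching i)"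
      using s(2)[of w] by (intro bexI[of _ "(T.G w, T.target w)"] conjI)
  qed
qed

end
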